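(* For every cubical set $C$ and commutative monoid $\tau$, the unit $\eta_C:C\to\mathbf{S}C$ of the monad $\mathbf{S}=\mathrm{sing}\,\|-\|$ induces an isomorphism of commutative monoids $$H^1(\eta_C;\tau):H^1_{\mathrm{sing}}(\|C\|;\tau)\cong H^1(C;\tau),$$ natural in cubical sets $C$ and commutative monoids $\tau$.
   Context: Cubical sets. $[1]=\{0<1\}$; posets and monoids are regarded as categories. $\square$ is the subcategory of the category $\mathbf{Cat}$ of small categories with objects the product posets $[1]^n$ ($n\geq 0$) and morphisms all composites of cofaces $[1]^{n-1}\to[1]^n$ (inserting a constant $0$ or $1$ in one coordinate), codegeneracies $[1]^{n+1}\to[1]^n$ (projections omitting one coordinate) and coordinate permutations. Cubical sets are presheaves of sets on $\square$, forming $\hat\square$; $\square[1]^n$ is the presheaf represented by $[1]^n$; $\otimes$ is the Day convolution product with $\square[1]^m\otimes\square[1]^n=\square[1]^{m+n}$. The cubical nerve $\mathrm{ner}\,\tau$ has $(\mathrm{ner}\,\tau)_n=\mathbf{Cat}([1]^n,\tau)$. Streams. A circulation on a space $X$ assigns to each open $U\subset X$ a preorder $\leqslant_U$ on $U$ such that, for each collection $\mathcal{O}$ of open subsets, the preorder on $\bigcup\mathcal{O}$ is the one with smallest graph containing the graphs of all $\leqslant_U$, $U\in\mathcal{O}$. A stream is a space with a circulation; a stream map $f:X\to Y$ is a continuous function with $f(x)\leqslant_U f(y)$ whenever $U\subset Y$ is open and $x\leqslant_{f^{-1}U}y$. $\mathbf{DiTop}$ is the category of weak Hausdorff k-streams (k-stream: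 colimit of compact Hausdorff streams in all streams; weak Hausdorff: the underlying space is). $\vec{\mathbb{I}}^n$ is $[0,1]^n$ with the unique circulation whose value on the whole cube is the coordinatewise order. Directed realization $\|-\|:\hat\square\to\mathbf{DiTop}$ is the cocontinuous functor with $\|\square[1]^n\|=\vec{\mathbb{I}}^n$ (with the evident action on cofaces, codegeneracies, permutations); its right adjoint is $\mathrm{sing}$, $(\mathrm{sing}\,X)_n=\mathbf{DiTop}(\|\square[1]^n\|,X)$. Cohomology. For a cubical set $C$ and commutative monoid $\tau$, $H^1(C;\tau)$ is the set of cubical functions $C\to\mathrm{ner}\,\tau$ modulo the equivalence relation generated by $\alpha\sim\beta$ whenever there is a cubical function $C\otimes\square[1]\to\mathrm{ner}\,\tau$ restricting to $\alpha$ and $\beta$ at the vertices $0$ and $1$ of $\square[1]$; it is a commutative monoid under the operation induced by multiplication $\tau\times\tau\to\tau$, contravariant in $C$. For a stream $X$, $H^1_{\mathrm{sing}}(X;\tau)=H^1(\mathrm{sing}\,X;\tau)$. *)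

theory Defs
  imports "HOL-Analysis.Analysis" "HOL-Algebra.Group"
begin

section \<open>The box category\<close>

text \<open>
  An \<open>n\<close>-tuple over \<open>S\<close> is an extensional function on \<open>{..<n}\<close>.  The generating maps are
  polymorphic in the entries, so that the same formula describes the map \<open>[1]\<^sup>m \<rightarrow> [1]\<^sup>n\<close> of
  posets and the map of geometric cubes which realizes it.
\<close>

definition tuples :: "'a set \<Rightarrow> nat \<Rightarrow> (nat \<Rightarrow> 'a) set" where
  "tuples S n = {..<n} \<rightarrow>\<^sub>E S"

abbreviation verts :: "nat \<Rightarrow> (nat \<Rightarrow> bool) set" where
  "verts \<equiv> tuples UNIV"

abbreviation cube :: "nat \<Rightarrow> (nat \<Rightarrow> real) set" where
  "cube \<equiv> tuples {0..1}"

definition verts_le :: "nat \<Rightarrow> ((nat \<Rightarrow> bool) \<times> (nat \<Rightarrow> bool)) set" where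
  "verts_le n = {(v, w). v \<in> verts n \<and> w \<in> verts n \<and> (\<forall>i<n. v i \<le> w i)}"

definition coface :: "nat \<Rightarrow> nat \<Rightarrow> 'a \<Rightarrow> (nat \<Rightarrow> 'a) \<Rightarrow> (nat \<Rightarrow> 'a)" where
  "coface n i b x = (\<lambda>j\<in>{..<Suc n}. if j < i then x j else if j = i then b else x (j - 1))"

definition codegeneracy :: "nat \<Rightarrow> nat \<Rightarrow> (nat \<Rightarrow> 'a) \<Rightarrow> (nat \<Rightarrow> 'a)" where
  "codegeneracy n i x = (\<lambda>j\<in>{..<n}. if j < i then x j else x (Suc j))"

definition permute_coords :: "nat \<Rightarrow> (nat \<Rightarrow> nat) \<Rightarrow> (nat \<Rightarrow> 'a) \<Rightarrow> (nat \<Rightarrow> 'a)" where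
  "permute_coords n \<pi> x = (\<lambda>j\<in>{..<n}. x (\<pi> j))"

text \<open>\<open>box_mor m n \<phi>\<close>: the extensional function \<open>\<phi>\<close> is a morphism \<open>[1]\<^sup>m \<rightarrow> [1]\<^sup>n\<close> of the box category.\<close>

inductive box_mor :: "nat \<Rightarrow> nat \<Rightarrow> ((nat \<Rightarrow> bool) \<Rightarrow> (nat \<Rightarrow> bool)) \<Rightarrow> bool" where
  ident: "box_mor n n (restrict (\<lambda>x. x) (verts n))"
| coface: "i \<le> n \<Longrightarrow> box_mor n (Suc n) (restrict (coface n i b) (verts n))"
| codegeneracy: "i \<le> n \<Longrightarrow> box_mor (Suc n) n (restrict (codegeneracy n i) (verts (Suc n)))"
| permute: "\<pi> permutes {..<n} \<Longrightarrow> box_mor n n (restrict (permute_coords n \<pi>) (verts n))"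
| comp: "box_mor l m \<phi> \<Longrightarrow> box_mor m n \<psi> \<Longrightarrow> box_mor l n (compose (verts l) \<psi> \<phi>)"

text \<open>
  The functorial action of the box category on geometric cubes, given by the evident action
  on generators.
\<close>

inductive box_real ::
  "nat \<Rightarrow> nat \<Rightarrow> ((nat \<Rightarrow> bool) \<Rightarrow> (nat \<Rightarrow> bool)) \<Rightarrow> ((nat \<Rightarrow> real) \<Rightarrow> (nat \<Rightarrow> real)) \<Rightarrow> bool"
where
  ident: "box_real n n (restrict (\<lambda>x. x) (verts n)) (restrict (\<lambda>x. x) (cube n))"
| coface: "i \<le> n \<Longrightarrow> box_real n (Suc n)
    (restrict (coface n i b) (verts n)) (restrict (coface n i (of_bool b)) (cube n))"
| codegeneracy: "i \<le> n \<Longrightarrow> box_real (Suc n) n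
    (restrict (codegeneracy n i) (verts (Suc n))) (restrict (codegeneracy n i) (cube (Suc n)))"
| permute: "\<pi> permutes {..<n} \<Longrightarrow> box_real n n
    (restrict (permute_coords n \<pi>) (verts n)) (restrict (permute_coords n \<pi>) (cube n))"
| comp: "box_real l m \<phi> \<phi>' \<Longrightarrow> box_real m n \<psi> \<psi>' \<Longrightarrow>
    box_real l n (compose (verts l) \<psi> \<phi>) (compose (cube l) \<psi>' \<phi>')"

definition cube_map ::
  "nat \<Rightarrow> nat \<Rightarrow> ((nat \<Rightarrow> bool) \<Rightarrow> (nat \<Rightarrow> bool)) \<Rightarrow> (nat \<Rightarrow> real) \<Rightarrow> (nat \<Rightarrow> real)" where
  "cube_map m n \<phi> = (THE \<psi>. box_real m n \<phi> \<psi>)"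

lemma box_real_box: "box_real m n \<phi> \<psi> \<Longrightarrow> box_mor m n \<phi>"
  by (induction rule: box_real.induct) (assumption | rule box_mor.intros)+

lemma box_box_real: "box_mor m n \<phi> \<Longrightarrow> \<exists>\<psi>. box_real m n \<phi> \<psi>"
proof (induction rule: box_mor.induct)
  case (comp l m \<phi> n \<psi>)
  then show ?case using box_real.comp by blast
qed (rule exI, (rule box_real.intros, assumption | rule box_real.ident))+

lemma box_real_coords:
  assumes "box_real m n \<phi> \<psi>"
  shows "\<phi> \<in> verts m \<rightarrow>\<^sub>E verts n \<and> \<psi> \<in> cube m \<rightarrow>\<^sub>E cube n \<and>
    (\<forall>i<n. (\<exists>b. (\<forall>x\<in>verts m. \<phi> x i = b) \<and> (\<forall>t\<in>cube m. \<psi> t i = of_bool b)) \<or>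
           (\<exists>j<m. (\<forall>x\<in>verts m. \<phi> x i = x j) \<and> (\<forall>t\<in>cube m. \<psi> t i = t j)))"
  using assms
proof (induction rule: box_real.induct)
  case (ident n)
  have 1: "\<exists>j<n. (\<forall>x\<in>verts n. restrict (\<lambda>x. x) (verts n) x k = x j) \<and>
      (\<forall>t\<in>cube n. restrict (\<lambda>x. x) (cube n) t k = t j)" if "k < n" for k
    using that by (intro exI[of _ k]) simp
  show ?case
    by (intro conjI restrict_PiE_iff[THEN iffD2] ballI allI impI disjI2 1)
next
  case (coface i n b)
  have 1: "(\<exists>c. (\<forall>x\<in>verts n. restrict (coface n i b) (verts n) x k = c) \<and>
      (\<forall>t\<in>cube n. restrict (coface n i (of_bool b)) (cube n) t k = of_bool c)) \<or>
    (\<exists>j<n. (\<forall>x\<in>verts n. restrict (coface n i b) (verts n) x k = x j) \<and>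
      (\<forall>t\<in>cube n. restrict (coface n i (of_bool b)) (cube n) t k = t j))"
    if "k < Suc n" for k
  proof -
    consider "k < i" | "k = i" | "k > i" by linarith
    then show ?thesis
    proof cases
      case 1
      then show ?thesis using that coface by (intro disjI2 exI[of _ k]) (auto simp: coface_def)
    next
      case 2
      then show ?thesis using that by (intro disjI1 exI[of _ b]) (auto simp: coface_def)
    next
      case 3
      then show ?thesis using that by (intro disjI2 exI[of _ "k - 1"]) (auto simp: coface_def)
    qed
  qed
  have 2: "coface n i c t \<in> tuples S (Suc n)" if "t \<in> tuples S n" "c \<in> S" for c t and S :: "'z set"
    using that coface by (auto simp: tuples_def coface_def PiE_iff)
  have "restrict (coface n i b) (verts n) \<in> verts n \<rightarrow>\<^sub>E verts (Suc n)"
    "restrict (coface n i (of_bool b)) (cube n) \<in> cube n \<rightarrow>\<^sub>E cube (Suc n)"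
    by (intro restrict_PiE_iff[THEN iffD2] ballI 2; simp)+
  then show ?case by (intro conjI allI impI 1)
next
  case (codegeneracy i n)
  have 2: "codegeneracy n i t \<in> tuples S n" if "t \<in> tuples S (Suc n)" for t and S :: "'z set"
    using that codegeneracy by (auto simp: tuples_def codegeneracy_def PiE_iff)
  have 1: "\<exists>j<Suc n. (\<forall>x\<in>verts (Suc n). restrict (codegeneracy n i) (verts (Suc n)) x k = x j) \<and>
      (\<forall>t\<in>cube (Suc n). restrict (codegeneracy n i) (cube (Suc n)) t k = t j)"
    if "k < n" for k
    using that by (intro exI[of _ "if k < i then k else Suc k"]) (auto simp: codegeneracy_def)
  have "restrict (codegeneracy n i) (verts (Suc n)) \<in> verts (Suc n) \<rightarrow>\<^sub>E verts n"
    "restrict (codegeneracy n i) (cube (Suc n)) \<in> cube (Suc n) \<rightarrow>\<^sub>E cube n"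
    by (intro restrict_PiE_iff[THEN iffD2] ballI 2; simp)+
  then show ?case by (intro conjI allI impI disjI2 1)
next
  case (permute \<pi> n)
  have \<pi>: "\<pi> k < n" if "k < n" for k
    using permute that permutes_in_image[of \<pi> "{..<n}" k] by auto
  have 2: "permute_coords n \<pi> t \<in> tuples S n" if "t \<in> tuples S n" for t and S :: "'z set"
    using that \<pi> by (auto simp: tuples_def permute_coords_def PiE_iff)
  have 1: "\<exists>j<n. (\<forall>x\<in>verts n. restrict (permute_coords n \<pi>) (verts n) x k = x j) \<and>
      (\<forall>t\<in>cube n. restrict (permute_coords n \<pi>) (cube n) t k = t j)"
    if "k < n" for k
    using that \<pi> by (intro exI[of _ "\<pi> k"]) (auto simp: permute_coords_def)
  have "restrict (permute_coords n \<pi>) (verts n) \<in> verts n \<rightarrow>\<^sub>E verts n"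
    "restrict (permute_coords n \<pi>) (cube n) \<in> cube n \<rightarrow>\<^sub>E cube n"
    by (intro restrict_PiE_iff[THEN iffD2] ballI 2; simp)+
  then show ?case by (intro conjI allI impI disjI2 1)
next
  case (comp l m \<phi> \<phi>' n \<psi> \<psi>')
  have m: "\<phi> x \<in> verts m" if "x \<in> verts l" for x
    using conjunct1[OF comp.IH(1)] that by (rule PiE_mem)
  have m': "\<phi>' x \<in> cube m" if "x \<in> cube l" for x
    using conjunct1[OF conjunct2[OF comp.IH(1)]] that by (rule PiE_mem)
  have n: "\<psi> x \<in> verts n" if "x \<in> verts m" for x
    using conjunct1[OF comp.IH(2)] that by (rule PiE_mem)
  have n': "\<psi>' x \<in> cube n" if "x \<in> cube m" for x
    using conjunct1[OF conjunct2[OF comp.IH(2)]] that by (rule PiE_mem)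
  have *: "(\<exists>b. (\<forall>x\<in>verts l. compose (verts l) \<psi> \<phi> x k = b) \<and>
      (\<forall>t\<in>cube l. compose (cube l) \<psi>' \<phi>' t k = of_bool b)) \<or>
    (\<exists>j<l. (\<forall>x\<in>verts l. compose (verts l) \<psi> \<phi> x k = x j) \<and>
      (\<forall>t\<in>cube l. compose (cube l) \<psi>' \<phi>' t k = t j))" if "k < n" for k
  proof -
    have IH2: "(\<exists>b. (\<forall>x\<in>verts m. \<psi> x k = b) \<and> (\<forall>t\<in>cube m. \<psi>' t k = of_bool b)) \<or>
           (\<exists>j<m. (\<forall>x\<in>verts m. \<psi> x k = x j) \<and> (\<forall>t\<in>cube m. \<psi>' t k = t j))"
      by (rule conjunct2[OF conjunct2[OF comp.IH(2)], THEN spec, THEN mp, OF that])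
    have c: "compose (verts l) \<psi> \<phi> x k = \<psi> (\<phi> x) k" if "x \<in> verts l" for x
      using that by (simp add: compose_eq)
    have c': "compose (cube l) \<psi>' \<phi>' x k = \<psi>' (\<phi>' x) k" if "x \<in> cube l" for x
      using that by (simp add: compose_eq)
    from IH2 show ?thesis
    proof (elim disjE exE conjE)
      fix b assume b: "\<forall>x\<in>verts m. \<psi> x k = b" "\<forall>t\<in>cube m. \<psi>' t k = of_bool b"
      show ?thesis
      proof (intro disjI1 exI[of _ b] conjI ballI)
        show "compose (verts l) \<psi> \<phi> x k = b" if "x \<in> verts l" for x
          using c[OF that] b(1) m[OF that] by simp
        show "compose (cube l) \<psi>' \<phi>' x k = of_bool b" if "x \<in> cube l" for x
          using c'[OF that] b(2) m'[OF that] by simp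
      qed
    next
      fix j assume j: "j < m" "\<forall>x\<in>verts m. \<psi> x k = x j" "\<forall>t\<in>cube m. \<psi>' t k = t j"
      have d: "compose (verts l) \<psi> \<phi> x k = \<phi> x j" if "x \<in> verts l" for x
        using c[OF that] j(2) m[OF that] by simp
      have d': "compose (cube l) \<psi>' \<phi>' x k = \<phi>' x j" if "x \<in> cube l" for x
        using c'[OF that] j(3) m'[OF that] by simp
      have "(\<exists>b. (\<forall>x\<in>verts l. \<phi> x j = b) \<and> (\<forall>t\<in>cube l. \<phi>' t j = of_bool b)) \<or>
           (\<exists>i<l. (\<forall>x\<in>verts l. \<phi> x j = x i) \<and> (\<forall>t\<in>cube l. \<phi>' t j = t i))"
        by (rule conjunct2[OF conjunct2[OF comp.IH(1)], THEN spec, THEN mp, OF j(1)])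
      then show ?thesis using d d' by (elim disjE exE conjE; simp) (*X*)
    qed
  qed
  have "compose (verts l) \<psi> \<phi> \<in> verts l \<rightarrow>\<^sub>E verts n" "compose (cube l) \<psi>' \<phi>' \<in> cube l \<rightarrow>\<^sub>E cube n"
    unfolding compose_def restrict_PiE_iff
    by (intro ballI n m n' m'; assumption)+
  then show ?case by (intro conjI allI impI *)
qed

lemma box_real_coordsE [consumes 2, case_names const proj]:
  assumes "box_real m n \<phi> \<psi>" "i < n"
  obtains (const) b where "\<And>x. x \<in> verts m \<Longrightarrow> \<phi> x i = b" "\<And>t. t \<in> cube m \<Longrightarrow> \<psi> t i = of_bool b"
  | (proj) j where "j < m" "\<And>x. x \<in> verts m \<Longrightarrow> \<phi> x i = x j" "\<And>t. t \<in> cube m \<Longrightarrow> \<psi> t i = t j"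
  using conjunct2[OF conjunct2[OF box_real_coords[OF assms(1)]], THEN spec, THEN mp, OF assms(2)]
  by (elim disjE exE conjE; simp)

lemma box_real_maps:
  assumes "box_real m n \<phi> \<psi>"
  shows "\<phi> \<in> verts m \<rightarrow>\<^sub>E verts n" "\<psi> \<in> cube m \<rightarrow>\<^sub>E cube n"
  using box_real_coords[OF assms] by simp_all

lemma box_real_unique:
  assumes 1: "box_real m n \<phi> \<psi>" and 2: "box_real m n \<phi> \<psi>'"
  shows "\<psi> = \<psi>'"
proof (rule PiE_ext[OF box_real_maps(2)[OF 1] box_real_maps(2)[OF 2]])
  fix t assume t: "t \<in> cube m"
  have eq: "\<psi> t i = \<psi>' t i" if i: "i < n" for i
  proof -
    define e where "e k = (\<lambda>j\<in>{..<m}. j = k)" for k :: nat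
    define a where "a b = (\<lambda>j\<in>{..<m}. b)" for b :: bool
    have ea: "e k \<in> verts m" "a b \<in> verts m" for k b by (auto simp: tuples_def e_def a_def)
    have e: "e k j \<longleftrightarrow> j = k" if "j < m" for j k using that by (simp add: e_def)
    have a: "a b j = b" if "j < m" for j b using that by (simp add: a_def)
    show ?thesis
      using 1 i
    proof (cases rule: box_real_coordsE)
      case b: (const b)
      show ?thesis
        using 2 i
      proof (cases rule: box_real_coordsE)
        case (const b')
        then show ?thesis using b(1)[OF ea(1)] b(2)[OF t] const(1)[OF ea(1)] const(2)[OF t] by simp
      next
        case (proj j)
        then show ?thesis using b(1)[OF ea(2)[of "\<not> b"]] proj(2)[OF ea(2)[of "\<not> b"]] a[OF proj(1)] by simp
      qed
    next
      case j: (proj j)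
      show ?thesis
        using 2 i
      proof (cases rule: box_real_coordsE)
        case (const b)
        then show ?thesis using const(1)[OF ea(2)[of "\<not> b"]] j(2)[OF ea(2)[of "\<not> b"]] a[OF j(1)] by simp
      next
        case (proj k)
        have "e j k" using j(2)[OF ea(1)[of j]] proj(2)[OF ea(1)[of j]] e[OF j(1), of j] by simp
        then have "k = j" using e[OF proj(1)] by simp
        then show ?thesis using j(3)[OF t] proj(3)[OF t] by simp
      qed
    qed
  qed
  have "\<psi> t \<in> {..<n} \<rightarrow>\<^sub>E {0..1}" "\<psi>' t \<in> {..<n} \<rightarrow>\<^sub>E {0..1}"
    using PiE_mem[OF box_real_maps(2)[OF 1] t] PiE_mem[OF box_real_maps(2)[OF 2] t]
    by (simp_all add: tuples_def)
  then show "\<psi> t = \<psi>' t"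
    by (rule PiE_ext) (simp add: eq)
qed

lemma cube_map_eq: "box_real m n \<phi> \<psi> \<Longrightarrow> cube_map m n \<phi> = \<psi>"
  unfolding cube_map_def by (rule the_equality) (auto intro: box_real_unique)

lemma box_real_cube_map: "box_mor m n \<phi> \<Longrightarrow> box_real m n \<phi> (cube_map m n \<phi>)"
  using box_box_real cube_map_eq by metis

lemma cube_map_compose:
  "box_mor l m \<phi> \<Longrightarrow> box_mor m n \<psi> \<Longrightarrow>
    cube_map l n (compose (verts l) \<psi> \<phi>) = compose (cube l) (cube_map m n \<psi>) (cube_map l m \<phi>)"
  by (rule cube_map_eq, rule box_real.comp[of l m]) (rule box_real_cube_map, assumption)+

lemma cube_map_ident: "cube_map n n (restrict (\<lambda>x. x) (verts n)) = restrict (\<lambda>x. x) (cube n)"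
  by (intro cube_map_eq box_real.ident)

section \<open>Cubical sets\<close>

text \<open>\<open>act C m n \<phi>\<close> is the function \<open>C\<^sub>n \<rightarrow> C\<^sub>m\<close> induced by \<open>\<phi> : [1]\<^sup>m \<rightarrow> [1]\<^sup>n\<close>.\<close>

record 'c cubical =
  cells :: "nat \<Rightarrow> 'c set"
  act :: "nat \<Rightarrow> nat \<Rightarrow> ((nat \<Rightarrow> bool) \<Rightarrow> (nat \<Rightarrow> bool)) \<Rightarrow> 'c \<Rightarrow> 'c"

definition cubical_set :: "'c cubical \<Rightarrow> bool" where
  "cubical_set C \<longleftrightarrow>
     (\<forall>m n \<phi> c. box_mor m n \<phi> \<and> c \<in> cells C n \<longrightarrow> act C m n \<phi> c \<in> cells C m) \<and>
     (\<forall>n c. c \<in> cells C n \<longrightarrow> act C n n (restrict (\<lambda>x. x) (verts n)) c = c) \<and>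
     (\<forall>l m n \<phi> \<psi> c. box_mor l m \<phi> \<and> box_mor m n \<psi> \<and> c \<in> cells C n \<longrightarrow>
        act C l n (compose (verts l) \<psi> \<phi>) c = act C l m \<phi> (act C m n \<psi> c))"

definition cubical_hom :: "'c cubical \<Rightarrow> 'd cubical \<Rightarrow> (nat \<Rightarrow> 'c \<Rightarrow> 'd) set" where
  "cubical_hom C D = {f. (\<forall>n. f n \<in> cells C n \<rightarrow>\<^sub>E cells D n) \<and>
     (\<forall>m n \<phi> c. box_mor m n \<phi> \<and> c \<in> cells C n \<longrightarrow> f m (act C m n \<phi> c) = act D m n \<phi> (f n c))}"

definition cubical_comp ::
  "'c cubical \<Rightarrow> (nat \<Rightarrow> 'd \<Rightarrow> 'e) \<Rightarrow> (nat \<Rightarrow> 'c \<Rightarrow> 'd) \<Rightarrow> (nat \<Rightarrow> 'c \<Rightarrow> 'e)" where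
  "cubical_comp C g f = (\<lambda>n. compose (cells C n) (g n) (f n))"

definition representable :: "nat \<Rightarrow> ((nat \<Rightarrow> bool) \<Rightarrow> (nat \<Rightarrow> bool)) cubical" where
  "representable k = \<lparr>cells = (\<lambda>n. {\<psi>. box_mor n k \<psi>}), act = (\<lambda>m n \<phi> \<psi>. compose (verts m) \<psi> \<phi>)\<rparr>"

subsection \<open>Day convolution\<close>

definition box_tensor :: "nat \<Rightarrow> nat \<Rightarrow> ((nat \<Rightarrow> bool) \<Rightarrow> (nat \<Rightarrow> bool)) \<Rightarrow>
    nat \<Rightarrow> nat \<Rightarrow> ((nat \<Rightarrow> bool) \<Rightarrow> (nat \<Rightarrow> bool)) \<Rightarrow> (nat \<Rightarrow> bool) \<Rightarrow> (nat \<Rightarrow> bool)" where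
  "box_tensor p p' \<alpha> q q' \<beta> = (\<lambda>x\<in>verts (p + q). \<lambda>i\<in>{..<p' + q'}.
     if i < p' then \<alpha> (\<lambda>j\<in>{..<p}. x j) i else \<beta> (\<lambda>j\<in>{..<q}. x (p + j)) (i - p'))"

text \<open>
  \<open>(C \<otimes> D)\<^sub>n\<close> is the coend over \<open>p, q\<close> of \<open>C\<^sub>p \<times> D\<^sub>q \<times> \<box>([1]\<^sup>n, [1]\<^sup>p\<^sup>+\<^sup>q)\<close>, i.e. the quotient of
  \<open>day_pre\<close> by the equivalence relation generated by \<open>day_glue\<close>.
\<close>

type_synonym ('c, 'd) day = "nat \<times> nat \<times> 'c \<times> 'd \<times> ((nat \<Rightarrow> bool) \<Rightarrow> (nat \<Rightarrow> bool))"

definition day_pre :: "'c cubical \<Rightarrow> 'd cubical \<Rightarrow> nat \<Rightarrow> ('c, 'd) day set" where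
  "day_pre C D n = {(p, q, c, d, \<theta>). c \<in> cells C p \<and> d \<in> cells D q \<and> box_mor n (p + q) \<theta>}"

definition day_glue :: "'c cubical \<Rightarrow> 'd cubical \<Rightarrow> nat \<Rightarrow> ('c, 'd) day \<Rightarrow> ('c, 'd) day \<Rightarrow> bool" where
  "day_glue C D n x y \<longleftrightarrow> (\<exists>p p' q q' \<alpha> \<beta> c d \<theta>.
     box_mor p p' \<alpha> \<and> box_mor q q' \<beta> \<and> c \<in> cells C p' \<and> d \<in> cells D q' \<and> box_mor n (p + q) \<theta> \<and>
     x = (p, q, act C p p' \<alpha> c, act D q q' \<beta> d, \<theta>) \<and>
     y = (p', q', c, d, compose (verts n) (box_tensor p p' \<alpha> q q' \<beta>) \<theta>))"

definition day_eq :: "'c cubical \<Rightarrow> 'd cubical \<Rightarrow> nat \<Rightarrow> (('c, 'd) day \<times> ('c, 'd) day) set" where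
  "day_eq C D n = {(x, y). x \<in> day_pre C D n \<and> y \<in> day_pre C D n \<and> equivclp (day_glue C D n) x y}"

definition tensor :: "'c cubical \<Rightarrow> 'd cubical \<Rightarrow> ('c, 'd) day set cubical" where
  "tensor C D = \<lparr>cells = (\<lambda>n. day_pre C D n // day_eq C D n),
     act = (\<lambda>m n \<phi> A. day_eq C D m ``
       {(p, q, c, d, compose (verts m) \<theta> \<phi>) |p q c d \<theta>. (p, q, c, d, \<theta>) \<in> A})\<rparr>"

text \<open>
  The inclusion \<open>C \<cong> C \<otimes> \<box>[1]\<^sup>0 \<rightarrow> C \<otimes> \<box>[1]\<close> at the vertex \<open>b\<close> of \<open>\<box>[1]\<close>; the vertex is the
  map \<open>[1]\<^sup>0 \<rightarrow> [1]\<close> with value \<open>b\<close>.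
\<close>

definition cylinder_end :: "'c cubical \<Rightarrow> bool \<Rightarrow> nat \<Rightarrow> 'c \<Rightarrow>
    ('c, (nat \<Rightarrow> bool) \<Rightarrow> (nat \<Rightarrow> bool)) day set" where
  "cylinder_end C b = (\<lambda>n. \<lambda>c\<in>cells C n. day_eq C (representable 1) n ``
     {(n, 0, c, restrict (coface 0 0 b) (verts 0), restrict (\<lambda>x. x) (verts n))})"

section \<open>Cohomology with coefficients in a commutative monoid\<close>

text \<open>
  A functor from the poset \<open>[1]\<^sup>n\<close> to the one-object category \<open>\<tau>\<close>, as a function on the
  arrows \<open>v \<le> w\<close> of \<open>[1]\<^sup>n\<close>.
\<close>

definition ner :: "('t, 'm) monoid_scheme \<Rightarrow> ((nat \<Rightarrow> bool) \<times> (nat \<Rightarrow> bool) \<Rightarrow> 't) cubical" where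
  "ner \<tau> = \<lparr>cells = (\<lambda>n. {F \<in> verts_le n \<rightarrow>\<^sub>E carrier \<tau>.
       (\<forall>v\<in>verts n. F (v, v) = \<one>\<^bsub>\<tau>\<^esub>) \<and>
       (\<forall>u v w. (u, v) \<in> verts_le n \<and> (v, w) \<in> verts_le n \<longrightarrow> F (u, w) = F (v, w) \<otimes>\<^bsub>\<tau>\<^esub> F (u, v))}),
     act = (\<lambda>m n \<phi> F. \<lambda>(v, w)\<in>verts_le m. F (\<phi> v, \<phi> w))\<rparr>"

definition ner_map :: "nat \<Rightarrow> ('t \<Rightarrow> 's) \<Rightarrow>
    ((nat \<Rightarrow> bool) \<times> (nat \<Rightarrow> bool) \<Rightarrow> 't) \<Rightarrow> ((nat \<Rightarrow> bool) \<times> (nat \<Rightarrow> bool) \<Rightarrow> 's)" where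
  "ner_map n h F = (\<lambda>e\<in>verts_le n. h (F e))"

type_synonym ('c, 't) cochain = "nat \<Rightarrow> 'c \<Rightarrow> (nat \<Rightarrow> bool) \<times> (nat \<Rightarrow> bool) \<Rightarrow> 't"

definition cochain_mult :: "'c cubical \<Rightarrow> ('t, 'm) monoid_scheme \<Rightarrow>
    ('c, 't) cochain \<Rightarrow> ('c, 't) cochain \<Rightarrow> ('c, 't) cochain" where
  "cochain_mult C \<tau> \<alpha> \<beta> =
     (\<lambda>n. \<lambda>c\<in>cells C n. \<lambda>e\<in>verts_le n. \<alpha> n c e \<otimes>\<^bsub>\<tau>\<^esub> \<beta> n c e)"

definition cochain_one :: "'c cubical \<Rightarrow> ('t, 'm) monoid_scheme \<Rightarrow> ('c, 't) cochain" where
  "cochain_one C \<tau> = (\<lambda>n. \<lambda>c\<in>cells C n. \<lambda>e\<in>verts_le n. \<one>\<^bsub>\<tau>\<^esub>)"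

definition cochain_homotopic :: "'c cubical \<Rightarrow> ('t, 'm) monoid_scheme \<Rightarrow>
    ('c, 't) cochain \<Rightarrow> ('c, 't) cochain \<Rightarrow> bool" where
  "cochain_homotopic C \<tau> \<alpha> \<beta> \<longleftrightarrow> \<alpha> \<in> cubical_hom C (ner \<tau>) \<and> \<beta> \<in> cubical_hom C (ner \<tau>) \<and>
     (\<exists>H \<in> cubical_hom (tensor C (representable 1)) (ner \<tau>).
        cubical_comp C H (cylinder_end C False) = \<alpha> \<and>
        cubical_comp C H (cylinder_end C True) = \<beta>)"

definition cohomologous :: "'c cubical \<Rightarrow> ('t, 'm) monoid_scheme \<Rightarrow>
    (('c, 't) cochain \<times> ('c, 't) cochain) set" where
  "cohomologous C \<tau> = {(\<alpha>, \<beta>). \<alpha> \<in> cubical_hom C (ner \<tau>) \<and> \<beta> \<in> cubical_hom C (ner \<tau>) \<and>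
     equivclp (cochain_homotopic C \<tau>) \<alpha> \<beta>}"

definition H1 :: "'c cubical \<Rightarrow> ('t, 'm) monoid_scheme \<Rightarrow> ('c, 't) cochain set monoid" where
  "H1 C \<tau> = \<lparr>carrier = cubical_hom C (ner \<tau>) // cohomologous C \<tau>,
     monoid.mult = (\<lambda>A B. cohomologous C \<tau> `` {cochain_mult C \<tau> \<alpha> \<beta> |\<alpha> \<beta>. \<alpha> \<in> A \<and> \<beta> \<in> B}),
     one = cohomologous C \<tau> `` {cochain_one C \<tau>}\<rparr>"

text \<open>Contravariance in the cubical set (along \<open>f : C \<rightarrow> D\<close>) and covariance in the coefficients.\<close>

definition H1_pull :: "'c cubical \<Rightarrow> 'd cubical \<Rightarrow> ('t, 'm) monoid_scheme \<Rightarrow> (nat \<Rightarrow> 'c \<Rightarrow> 'd) \<Rightarrow>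
    ('d, 't) cochain set \<Rightarrow> ('c, 't) cochain set" where
  "H1_pull C D \<tau> f = (\<lambda>A\<in>carrier (H1 D \<tau>). cohomologous C \<tau> `` ((\<lambda>\<alpha>. cubical_comp C \<alpha> f) ` A))"

definition H1_push :: "'c cubical \<Rightarrow> ('t, 'm) monoid_scheme \<Rightarrow> ('s, 'k) monoid_scheme \<Rightarrow> ('t \<Rightarrow> 's) \<Rightarrow>
    ('c, 't) cochain set \<Rightarrow> ('c, 's) cochain set" where
  "H1_push C \<tau> \<sigma> h = (\<lambda>A\<in>carrier (H1 C \<tau>). cohomologous C \<sigma> ``
     ((\<lambda>\<alpha>. \<lambda>n. \<lambda>c\<in>cells C n. ner_map n h (\<alpha> n c)) ` A))"

section \<open>Streams\<close>

text \<open>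
  A circulation is a function on sets of points; the value at a set that is not open carries
  no information and is fixed to be empty, so that circulations are determined by their values
  at open sets.
\<close>

record 'a stream =
  stop :: "'a topology"
  circ :: "'a set \<Rightarrow> ('a \<times> 'a) set"

definition circulation :: "'a topology \<Rightarrow> ('a set \<Rightarrow> ('a \<times> 'a) set) \<Rightarrow> bool" where
  "circulation X L \<longleftrightarrow>
     (\<forall>U. openin X U \<longrightarrow> preorder_on U (L U)) \<and>
     (\<forall>\<O>. (\<forall>U\<in>\<O>. openin X U) \<longrightarrow>
        (\<forall>U\<in>\<O>. L U \<subseteq> L (\<Union>\<O>)) \<and>
        (\<forall>R. preorder_on (\<Union>\<O>) R \<and> (\<forall>U\<in>\<O>. L U \<subseteq> R) \<longrightarrow> L (\<Union>\<O>) \<subseteq> R)) \<and>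
     (\<forall>U. \<not> openin X U \<longrightarrow> L U = {})"

definition is_stream :: "'a stream \<Rightarrow> bool" where
  "is_stream X \<longleftrightarrow> circulation (stop X) (circ X)"

definition stream_maps :: "'a stream \<Rightarrow> 'b stream \<Rightarrow> ('a \<Rightarrow> 'b) set" where
  "stream_maps X Y = {f \<in> topspace (stop X) \<rightarrow>\<^sub>E topspace (stop Y).
     continuous_map (stop X) (stop Y) f \<and>
     (\<forall>U. openin (stop Y) U \<longrightarrow>
        (\<forall>(x, y)\<in>circ X {x \<in> topspace (stop X). f x \<in> U}. (f x, f y) \<in> circ Y U))}"

subsection \<open>The directed cubes\<close>

definition cube_topology :: "nat \<Rightarrow> (nat \<Rightarrow> real) topology" where
  "cube_topology n = product_topology (\<lambda>_. top_of_set {0..1}) {..<n}"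

definition cube_le :: "nat \<Rightarrow> ((nat \<Rightarrow> real) \<times> (nat \<Rightarrow> real)) set" where
  "cube_le n = {(s, t). s \<in> cube n \<and> t \<in> cube n \<and> (\<forall>i<n. s i \<le> t i)}"

definition directed_cube :: "nat \<Rightarrow> (nat \<Rightarrow> real) stream" where
  "directed_cube n = \<lparr>stop = cube_topology n,
     circ = (THE L. circulation (cube_topology n) L \<and> L (cube n) = cube_le n)\<rparr>"

lemma topspace_cube_topology [simp]: "topspace (cube_topology n) = cube n"
  by (simp add: cube_topology_def tuples_def)

lemma cube_le_trans: "trans (cube_le n)"
  unfolding trans_def cube_le_def by (auto intro: order_trans)

lemma circulationD:
  assumes "circulation X L"
  shows "openin X U \<Longrightarrow> preorder_on U (L U)"
    and "(\<And>U. U \<in> \<O> \<Longrightarrow> openin X U) \<Longrightarrow> U \<in> \<O> \<Longrightarrow> L U \<subseteq> L (\<Union>\<O>)"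
    and "(\<And>U. U \<in> \<O> \<Longrightarrow> openin X U) \<Longrightarrow> preorder_on (\<Union>\<O>) R \<Longrightarrow>
      (\<And>U. U \<in> \<O> \<Longrightarrow> L U \<subseteq> R) \<Longrightarrow> L (\<Union>\<O>) \<subseteq> R"
    and "\<not> openin X U \<Longrightarrow> L U = {}"
  using assms unfolding circulation_def by simp_all

lemma circulation_mono:
  assumes "circulation X L" "openin X U" "openin X V" "U \<subseteq> V"
  shows "L U \<subseteq> L V"
  using circulationD(2)[OF assms(1), of "{U, V}" U] assms(2-4) by (auto simp: Un_absorb1)

text \<open>The circulation of the directed cube, explicitly.\<close>

definition cube_interval :: "nat \<Rightarrow> (nat \<Rightarrow> real) \<Rightarrow> (nat \<Rightarrow> real) \<Rightarrow> (nat \<Rightarrow> real) set" where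
  "cube_interval n s t = {u \<in> cube n. \<forall>i<n. s i \<le> u i \<and> u i \<le> t i}"

definition cube_steps :: "nat \<Rightarrow> (nat \<Rightarrow> real) set \<Rightarrow> ((nat \<Rightarrow> real) \<times> (nat \<Rightarrow> real)) set" where
  "cube_steps n U = {(s, t) \<in> cube_le n. s \<in> U \<and> t \<in> U \<and> cube_interval n s t \<subseteq> U}"

definition cube_circulation :: "nat \<Rightarrow> (nat \<Rightarrow> real) set \<Rightarrow> ((nat \<Rightarrow> real) \<times> (nat \<Rightarrow> real)) set" where
  "cube_circulation n U = (if openin (cube_topology n) U then (cube_steps n U)\<^sup>+ else {})"

lemma cube_iff: "u \<in> cube n \<longleftrightarrow> u \<in> extensional {..<n} \<and> (\<forall>i<n. 0 \<le> u i \<and> u i \<le> 1)"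
  unfolding tuples_def PiE_iff by auto

lemma cube_interval_refl: "s \<in> cube n \<Longrightarrow> cube_interval n s s = {s}"
proof (intro equalityI subsetI)
  fix x assume "s \<in> cube n" and "x \<in> cube_interval n s s"
  then have "x \<in> extensional {..<n}" "s \<in> extensional {..<n}" "\<And>i. i \<in> {..<n} \<Longrightarrow> x i = s i"
    by (simp_all add: cube_interval_def cube_iff order.eq_iff)
  then have "x = s" by (rule extensionalityI)
  then show "x \<in> {s}" by simp
qed (simp add: cube_interval_def)

lemma closedin_cube_interval: "closedin (cube_topology n) (cube_interval n s t)"
proof -
  have "cube_interval n s t = (\<Pi>\<^sub>E i\<in>{..<n}. {0..1} \<inter> {s i..t i})"
    by (rule Set.set_eqI) (simp add: cube_interval_def cube_iff PiE_iff Ball_def; blast)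
  moreover have "closedin (top_of_set {0..1}) ({0..1} \<inter> {s i..t i})" for i
    using closedin_closed_Int[of "{s i..t i}"] closed_atLeastAtMost by blast
  ultimately show ?thesis
    unfolding cube_topology_def by (simp add: closedin_product_topology)
qed

lemma cube_box_neighbourhood:
  assumes "openin (cube_topology n) U" "x \<in> U"
  obtains e where "e > 0" "{u \<in> cube n. \<forall>i<n. \<bar>u i - x i\<bar> < e} \<subseteq> U"
proof -
  from assms(1)[unfolded cube_topology_def openin_product_topology_alt, rule_format, OF assms(2)]
  obtain B where B: "\<And>i. i < n \<Longrightarrow> openin (top_of_set {0..1::real}) (B i)" "x \<in> Pi\<^sub>E {..<n} B" "Pi\<^sub>E {..<n} B \<subseteq> U"
    unfolding topspace_euclidean_subtopology lessThan_iff Ball_def by (elim exE conjE) blast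
  have "\<exists>d>0. \<forall>y\<in>{0..1}. \<bar>y - x i\<bar> < d \<longrightarrow> y \<in> B i" if "i < n" for i
    using B(1)[OF that] PiE_mem[OF B(2), of i] that
    unfolding openin_euclidean_subtopology_iff dist_real_def by blast
  then obtain d where d: "\<And>i. i < n \<Longrightarrow> d i > (0::real)"
    "\<And>i y. i < n \<Longrightarrow> y \<in> {0..1} \<Longrightarrow> \<bar>y - x i\<bar> < d i \<Longrightarrow> y \<in> B i" by metis
  let ?e = "Min (insert 1 (d ` {..<n}))"
  have "?e > 0" using d(1) by (subst Min_gr_iff) auto
  moreover have "{u \<in> cube n. \<forall>i<n. \<bar>u i - x i\<bar> < ?e} \<subseteq> Pi\<^sub>E {..<n} B"
  proof
    fix u assume u: "u \<in> {u \<in> cube n. \<forall>i<n. \<bar>u i - x i\<bar> < ?e}"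
    have "u i \<in> B i" if "i < n" for i
    proof (rule d(2)[OF that])
      show "u i \<in> {0..1}" using u that by (auto simp: tuples_def)
      have "?e \<le> d i" using that by (intro Min_le) auto
      then show "\<bar>u i - x i\<bar> < d i" using u that by force
    qed
    with u show "u \<in> Pi\<^sub>E {..<n} B" by (auto simp: tuples_def PiE_iff)
  qed
  ultimately show ?thesis using B(3) that by (meson order_trans)
qed

lemma openin_cube_box: "openin (cube_topology n) {u \<in> cube n. \<forall>i<n. \<bar>u i - x i\<bar> < e}"
proof -
  have "{u \<in> cube n. \<forall>i<n. \<bar>u i - x i\<bar> < e} = (\<Pi>\<^sub>E i\<in>{..<n}. {0..1} \<inter> ball (x i) e)"
    by (rule Set.set_eqI) (simp add: cube_iff PiE_iff Ball_def dist_real_def abs_minus_commute; blast)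
  moreover have "openin (top_of_set {0..1}) ({0..1} \<inter> ball (x i) e)" for i
    by (simp add: openin_open_Int)
  ultimately show ?thesis
    unfolding cube_topology_def by (simp add: openin_PiE_gen)
qed

lemma cube_steps_refl: "U \<subseteq> cube n \<Longrightarrow> s \<in> U \<Longrightarrow> (s, s) \<in> cube_steps n U"
  unfolding cube_steps_def by (auto simp: cube_le_def cube_interval_refl)

lemma preorder_on_cube_circulation:
  assumes "openin (cube_topology n) U"
  shows "preorder_on U (cube_circulation n U)"
proof -
  have U: "U \<subseteq> cube n" using openin_subset[OF assms] by simp
  have "cube_steps n U \<subseteq> U \<times> U" by (auto simp: cube_steps_def)
  then have "(cube_steps n U)\<^sup>+ \<subseteq> U \<times> U" by (rule trancl_subset_Sigma)
  moreover have "refl_on U ((cube_steps n U)\<^sup>+)"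
    using cube_steps_refl[OF U] by (auto simp: refl_on_def)
  ultimately show ?thesis
    using assms by (simp add: preorder_on_def cube_circulation_def)
qed

lemma cube_line_step:
  assumes st: "(s, t) \<in> cube_le n" and \<O>: "\<And>U. U \<in> \<O> \<Longrightarrow> openin (cube_topology n) U"
    and sub: "cube_interval n s t \<subseteq> \<Union>\<O>" and R: "preorder_on (\<Union>\<O>) R"
    and LR: "\<And>U. U \<in> \<O> \<Longrightarrow> cube_steps n U \<subseteq> R"
  shows "(s, t) \<in> R"
proof -
  define g where "g r = (\<lambda>i\<in>{..<n}. s i + r * (t i - s i))" for r :: real
  have s: "s \<in> cube n" and t: "t \<in> cube n" and le: "\<And>i. i < n \<Longrightarrow> s i \<le> t i"
    using st by (auto simp: cube_le_def)
  have s01: "0 \<le> s i" "t i \<le> 1" if "i < n" for i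
    using s t that by (simp_all add: cube_iff)
  have gi: "g r i = s i + r * (t i - s i)" if "i < n" for r i using that by (simp add: g_def)
  have g_bounds: "s i \<le> g r i \<and> g r i \<le> t i" if "i < n" "0 \<le> r" "r \<le> 1" for r i
  proof -
    have "0 \<le> r * (t i - s i)" "r * (t i - s i) \<le> 1 * (t i - s i)"
      using le[OF that(1)] that by (simp, intro mult_right_mono) simp_all
    then show ?thesis using gi[OF that(1)] by (simp only: mult_1_left) linarith
  qed
  have g_cube: "g r \<in> cube n" if "0 \<le> r" "r \<le> 1" for r
    using g_bounds[OF _ that] s01 by (force simp: tuples_def g_def PiE_iff intro: order_trans)
  have g_int: "g r \<in> cube_interval n s t" if "0 \<le> r" "r \<le> 1" for r
    using g_cube g_bounds that by (simp add: cube_interval_def)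
  have g_mono: "g a i \<le> g b i" if "i < n" "a \<le> b" for a b i
    using le[OF that(1)] that by (simp add: gi mult_right_mono)
  have g0: "g 0 = s"
    using s by (auto simp: g_def tuples_def PiE_iff extensional_def fun_eq_iff)
  have g1: "g 1 = t"
    using t by (auto simp: g_def tuples_def PiE_iff extensional_def fun_eq_iff)
  have "0 \<le> (0::real) \<and> (1::real) \<le> 1 \<longrightarrow> (g 0, g 1) \<in> R"
  proof (rule Bolzano[where P = "\<lambda>a b. 0 \<le> a \<and> b \<le> 1 \<longrightarrow> (g a, g b) \<in> R"])
    fix a b c :: real
    assume "0 \<le> a \<and> b \<le> 1 \<longrightarrow> (g a, g b) \<in> R" "0 \<le> b \<and> c \<le> 1 \<longrightarrow> (g b, g c) \<in> R" "a \<le> b" "b \<le> c"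
    moreover have "trans R" using R by (simp add: preorder_on_def)
    ultimately show "0 \<le> a \<and> c \<le> 1 \<longrightarrow> (g a, g c) \<in> R" by (meson order_trans transD)
  next
    fix x :: real assume x: "0 \<le> x" "x \<le> 1"
    with g_int sub obtain U where U: "U \<in> \<O>" "g x \<in> U" by blast
    obtain e where e: "e > 0" "{u \<in> cube n. \<forall>i<n. \<bar>u i - g x i\<bar> < e} \<subseteq> U"
      using cube_box_neighbourhood[OF \<O>[OF U(1)] U(2)] by blast
    have near: "\<bar>g y i - g x i\<bar> \<le> \<bar>y - x\<bar>" if "i < n" for y i
    proof -
      have "g y i - g x i = (y - x) * (t i - s i)" by (simp add: gi that algebra_simps)
      moreover have "\<bar>t i - s i\<bar> \<le> 1" using s01[OF that] le[OF that] by simp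
      ultimately show ?thesis by (simp add: abs_mult mult_left_le)
    qed
    show "\<exists>d>0. \<forall>a b. a \<le> x \<and> x \<le> b \<and> b - a < d \<longrightarrow> 0 \<le> a \<and> b \<le> 1 \<longrightarrow> (g a, g b) \<in> R"
    proof (intro exI[of _ e] conjI allI impI e(1))
      fix a b assume ab: "a \<le> x \<and> x \<le> b \<and> b - a < e" "0 \<le> a \<and> b \<le> 1"
      have "cube_interval n (g a) (g b) \<subseteq> U"
      proof
        fix u assume u: "u \<in> cube_interval n (g a) (g b)"
        have "\<bar>u i - g x i\<bar> < e" if "i < n" for i
        proof -
          have "g a i \<le> u i" "u i \<le> g b i" using u that by (auto simp: cube_interval_def)
          moreover have "\<bar>g a i - g x i\<bar> \<le> \<bar>a - x\<bar>" "\<bar>g b i - g x i\<bar> \<le> \<bar>b - x\<bar>"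
            using near that by auto
          ultimately show ?thesis using ab by linarith
        qed
        with u e(2) show "u \<in> U" by (auto simp: cube_interval_def)
      qed
      moreover have "(g a, g b) \<in> cube_le n"
        using g_cube g_mono ab by (auto simp: cube_le_def)
      moreover have "g a \<in> cube_interval n (g a) (g b)" "g b \<in> cube_interval n (g a) (g b)"
        using g_cube g_mono ab by (auto simp: cube_interval_def)
      ultimately have "(g a, g b) \<in> cube_steps n U" by (auto simp: cube_steps_def)
      then show "(g a, g b) \<in> R" using LR[OF U(1)] by blast
    qed
  qed simp_all
  then show ?thesis by (simp add: g0 g1)
qed

lemma circulation_cube_circulation: "circulation (cube_topology n) (cube_circulation n)"
  unfolding circulation_def
proof (intro conjI allI impI ballI)
  show "preorder_on U (cube_circulation n U)" if "openin (cube_topology n) U" for U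
    using preorder_on_cube_circulation that .
  show "cube_circulation n U = {}" if "\<not> openin (cube_topology n) U" for U
    using that by (simp add: cube_circulation_def)
  fix \<O> assume \<O>: "\<forall>U\<in>\<O>. openin (cube_topology n) U"
  then have un: "openin (cube_topology n) (\<Union>\<O>)" by (simp add: openin_Union)
  show "cube_circulation n U \<subseteq> cube_circulation n (\<Union>\<O>)" if "U \<in> \<O>" for U
  proof -
    have "cube_steps n U \<subseteq> cube_steps n (\<Union>\<O>)" using that by (auto simp: cube_steps_def)
    then show ?thesis using un \<O> that by (auto simp: cube_circulation_def intro: trancl_mono)
  qed
  fix R assume R: "preorder_on (\<Union>\<O>) R \<and> (\<forall>U\<in>\<O>. cube_circulation n U \<subseteq> R)"
  have "cube_steps n (\<Union>\<O>) \<subseteq> R"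
  proof
    fix p assume "p \<in> cube_steps n (\<Union>\<O>)"
    then obtain s t where p: "p = (s, t)" "(s, t) \<in> cube_le n" "cube_interval n s t \<subseteq> \<Union>\<O>"
      by (auto simp: cube_steps_def)
    have "cube_steps n U \<subseteq> R" if "U \<in> \<O>" for U
    proof -
      have "cube_steps n U \<subseteq> cube_circulation n U"
        using that \<O> by (auto simp: cube_circulation_def)
      then show ?thesis using R that by blast
    qed
    then have "(s, t) \<in> R"
      using cube_line_step[OF p(2) _ p(3) conjunct1[OF R]] \<O> by blast
    then show "p \<in> R" by (simp add: p)
  qed
  then have "(cube_steps n (\<Union>\<O>))\<^sup>+ \<subseteq> R\<^sup>+" by (auto intro: trancl_mono)
  also have "R\<^sup>+ = R" using R by (simp add: preorder_on_def)
  finally show "cube_circulation n (\<Union>\<O>) \<subseteq> R" using un by (simp add: cube_circulation_def)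
qed

lemma openin_cube: "openin (cube_topology n) (cube n)"
  using openin_topspace[of "cube_topology n"] by simp

lemma cube_circulation_cube: "cube_circulation n (cube n) = cube_le n"
proof -
  have "cube_steps n (cube n) = cube_le n"
    by (auto simp: cube_steps_def cube_le_def cube_interval_def)
  then show ?thesis
    using openin_cube cube_le_trans by (simp add: cube_circulation_def)
qed

lemma cube_circulation_unique:
  assumes M: "circulation (cube_topology n) M" "M (cube n) = cube_le n"
  shows "M = cube_circulation n"
proof (rule ext)
  fix U
  show "M U = cube_circulation n U"
  proof (cases "openin (cube_topology n) U")
    case False
    then show ?thesis using circulationD(4)[OF M(1)] by (simp add: cube_circulation_def)
  next
    case U: True
    then have Uc: "U \<subseteq> cube n" using openin_subset by force
    have sub_le: "M V \<subseteq> cube_le n" if "openin (cube_topology n) V" for V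
      using circulation_mono[OF M(1) that openin_cube] openin_subset[OF that] M(2) by simp
    have "cube_steps n U \<subseteq> M U"
    proof
      fix p assume "p \<in> cube_steps n U"
      then obtain s t where p: "p = (s, t)" and st: "(s, t) \<in> cube_le n" "s \<in> U" "t \<in> U"
        and int: "cube_interval n s t \<subseteq> U" by (auto simp: cube_steps_def)
      define W where "W = cube n - cube_interval n s t"
      have W: "openin (cube_topology n) W"
        unfolding W_def using closedin_cube_interval[of n s t] openin_cube by (simp add: openin_diff)
      have UW: "\<Union>{U, W} = cube n" using Uc int by (auto simp: W_def)
      have pU: "preorder_on U (M U)" by (rule circulationD(1)[OF M(1) U])
      have pW: "preorder_on W (M W)" by (rule circulationD(1)[OF M(1) W])
      \<comment> \<open>within the order interval, only the steps in \<open>U\<close> matter\<close>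
      define R where "R = {(x, y). (x, y) \<in> cube_le n \<and>
        (x \<in> cube_interval n s t \<and> y \<in> cube_interval n s t \<longrightarrow> (x, y) \<in> M U)}"
      have "preorder_on (cube n) R"
        unfolding preorder_on_def
      proof (intro conjI)
        show "R \<subseteq> cube n \<times> cube n" by (auto simp: R_def cube_le_def)
        have "(x, x) \<in> M U" if "x \<in> cube_interval n s t" for x
          using pU int that by (auto simp: preorder_on_def refl_on_def)
        then show "refl_on (cube n) R" by (auto simp: R_def refl_on_def cube_le_def)
        show "trans R"
        proof (rule transI)
          fix x y z assume xy: "(x, y) \<in> R" and yz: "(y, z) \<in> R"
          have xz: "(x, z) \<in> cube_le n" using xy yz cube_le_trans by (auto simp: R_def dest: transD)
          have "(x, z) \<in> M U" if x: "x \<in> cube_interval n s t" and z: "z \<in> cube_interval n s t"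
          proof -
            have "y \<in> cube n" "\<And>i. i < n \<Longrightarrow> x i \<le> y i" "\<And>i. i < n \<Longrightarrow> y i \<le> z i"
              using xy yz by (auto simp: R_def cube_le_def)
            then have "y \<in> cube_interval n s t"
              using x z unfolding cube_interval_def mem_Collect_eq by (meson order_trans)
            then have "(x, y) \<in> M U" "(y, z) \<in> M U" using xy yz x z by (auto simp: R_def)
            then show ?thesis using pU unfolding preorder_on_def by (blast dest: transD)
          qed
          with xz show "(x, z) \<in> R" by (simp add: R_def)
        qed
      qed
      moreover have "M U \<subseteq> R" using sub_le[OF U] by (auto simp: R_def)
      moreover have "M W \<subseteq> R"
      proof -
        have "M W \<subseteq> W \<times> W" using pW by (simp add: preorder_on_def)
        then show ?thesis using sub_le[OF W] by (auto simp: R_def W_def)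
      qed
      ultimately have "M (\<Union>{U, W}) \<subseteq> R"
        using U W UW by (intro circulationD(3)[OF M(1)]) auto
      then have "(s, t) \<in> R" using UW M(2) st(1) by auto
      moreover have "s \<in> cube_interval n s t" "t \<in> cube_interval n s t"
        using st(1) by (auto simp: cube_interval_def cube_le_def)
      ultimately show "p \<in> M U" using p by (simp add: R_def)
    qed
    then have "(cube_steps n U)\<^sup>+ \<subseteq> (M U)\<^sup>+" by (auto intro: trancl_mono)
    also have "(M U)\<^sup>+ = M U"
      using circulationD(1)[OF M(1) U] by (simp add: preorder_on_def)
    finally have 1: "cube_circulation n U \<subseteq> M U" using U by (simp add: cube_circulation_def)
    define \<O> where "\<O> = {B. \<exists>x e. e > 0 \<and> B = {u \<in> cube n. \<forall>i<n. \<bar>u i - x i\<bar> < e} \<and> B \<subseteq> U}"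
    have \<O>: "openin (cube_topology n) B" if "B \<in> \<O>" for B
      using that openin_cube_box by (auto simp: \<O>_def)
    have un: "\<Union>\<O> = U"
    proof
      show "\<Union>\<O> \<subseteq> U" by (auto simp: \<O>_def)
      show "U \<subseteq> \<Union>\<O>"
      proof
        fix x assume x: "x \<in> U"
        obtain e where e: "e > 0" "{u \<in> cube n. \<forall>i<n. \<bar>u i - x i\<bar> < e} \<subseteq> U"
          using cube_box_neighbourhood[OF U x] by blast
        then have "{u \<in> cube n. \<forall>i<n. \<bar>u i - x i\<bar> < e} \<in> \<O>" unfolding \<O>_def by blast
        moreover have "x \<in> {u \<in> cube n. \<forall>i<n. \<bar>u i - x i\<bar> < e}" using x Uc e(1) by auto
        ultimately show "x \<in> \<Union>\<O>" by blast
      qed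
    qed
    have "M B \<subseteq> cube_circulation n U" if B: "B \<in> \<O>" for B
    proof
      fix p assume p: "p \<in> M B"
      obtain a b where ab: "p = (a, b)" by (cases p)
      from B obtain x e where B': "B = {u \<in> cube n. \<forall>i<n. \<bar>u i - x i\<bar> < e}" "B \<subseteq> U"
        by (auto simp: \<O>_def)
      have "(a, b) \<in> B \<times> B"
        using circulationD(1)[OF M(1) \<O>[OF B]] p ab by (auto simp: preorder_on_def)
      then have mem: "a \<in> B" "b \<in> B" by auto
      have "cube_interval n a b \<subseteq> B"
      proof
        fix u assume u: "u \<in> cube_interval n a b"
        have "\<bar>u i - x i\<bar> < e" if "i < n" for i
        proof -
          have "a i \<le> u i" "u i \<le> b i" "\<bar>a i - x i\<bar> < e" "\<bar>b i - x i\<bar> < e"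
            using u mem that by (auto simp: B' cube_interval_def)
          then show ?thesis by linarith
        qed
        with u show "u \<in> B" by (auto simp: B' cube_interval_def)
      qed
      then have "(a, b) \<in> cube_steps n U"
        using mem B'(2) sub_le[OF \<O>[OF B]] p ab by (auto simp: cube_steps_def)
      then show "p \<in> cube_circulation n U" using U ab by (auto simp: cube_circulation_def)
    qed
    then have "M (\<Union>\<O>) \<subseteq> cube_circulation n U"
      using preorder_on_cube_circulation[OF U] \<O> un by (intro circulationD(3)[OF M(1)]) auto
    with 1 un show ?thesis by auto
  qed
qed

lemma directed_cube_eq:
  "directed_cube n = \<lparr>stop = cube_topology n, circ = cube_circulation n\<rparr>"
proof -
  have "(THE L. circulation (cube_topology n) L \<and> L (cube n) = cube_le n) = cube_circulation n"
    using circulation_cube_circulation cube_circulation_cube cube_circulation_unique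
    by (intro the_equality) blast+
  then show ?thesis by (simp add: directed_cube_def)
qed

lemma ex1_cube_circulation: "\<exists>!L. circulation (cube_topology n) L \<and> L (cube n) = cube_le n"
  by (rule ex1I[of _ "cube_circulation n"])
    (simp_all add: circulation_cube_circulation cube_circulation_cube cube_circulation_unique)

lemma stop_directed_cube [simp]: "stop (directed_cube n) = cube_topology n"
  by (simp add: directed_cube_def)

lemma is_stream_directed_cube: "is_stream (directed_cube n)"
  using circulation_cube_circulation by (simp add: is_stream_def directed_cube_eq)

subsection \<open>Weak Hausdorff spaces\<close>

text \<open>
  Images of all compact Hausdorff spaces are closed.  HOL cannot quantify over the type of
  points of the compact Hausdorff space inside a definition; the type \<open>'a set set\<close> is large
  enough, see \<open>weak_Hausdorff_closed_image\<close> below.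
\<close>

definition weak_Hausdorff :: "'a topology \<Rightarrow> bool" where
  "weak_Hausdorff X \<longleftrightarrow> (\<forall>(K :: 'a set set topology) f.
     compact_space K \<and> Hausdorff_space K \<and> continuous_map K X f \<longrightarrow> closedin X (f ` topspace K))"

lemma weak_Hausdorff_closed_image:
  fixes X :: "'a topology" and K :: "'k topology"
  assumes X: "weak_Hausdorff X" and K: "compact_space K" "Hausdorff_space K"
    and f: "continuous_map K X f"
  shows "closedin X (f ` topspace K)"
proof -
  define S where "S = f ` topspace K"
  have "\<forall>y\<in>S. \<exists>x. x \<in> topspace K \<and> f x = y" by (auto simp: S_def)
  then obtain d where d: "\<And>y. y \<in> S \<Longrightarrow> d y \<in> topspace K" "\<And>y. y \<in> S \<Longrightarrow> f (d y) = y" by metis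
  define C where "C = K closure_of (d ` S)"
  have clC: "closedin K C" by (simp add: C_def)
  then have subC: "C \<subseteq> topspace K" by (rule closedin_subset)
  have dC: "d y \<in> C" if "y \<in> S" for y
    using closure_of_subset[of "d ` S" K] d(1) that by (auto simp: C_def)
  have fC: "f ` C = S"
  proof
    show "f ` C \<subseteq> S" using subC by (auto simp: S_def)
    show "S \<subseteq> f ` C" using dC d(2) by force
  qed
  define j :: "'k \<Rightarrow> 'a set set" where "j x = {{y \<in> S. d y \<in> U} |U. openin K U \<and> x \<in> U}" for x
  have inj: "inj_on j C"
  proof (rule inj_onI, rule ccontr)
    fix x x' assume x: "x \<in> C" "x' \<in> C" and jx: "j x = j x'" and ne: "x \<noteq> x'"
    then obtain U V where UV: "openin K U" "openin K V" "x \<in> U" "x' \<in> V" "disjnt U V"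
      using K(2) subC unfolding Hausdorff_space_def by (meson subsetD)
    have "{y \<in> S. d y \<in> U} \<in> j x" using UV by (auto simp: j_def)
    then obtain V' where V': "openin K V'" "x' \<in> V'" "{y \<in> S. d y \<in> U} = {y \<in> S. d y \<in> V'}"
      unfolding jx by (auto simp: j_def)
    have "openin K (V \<inter> V')" "x' \<in> V \<inter> V'" using UV V' by auto
    then obtain y where "y \<in> S" "d y \<in> V" "d y \<in> V'"
      using x(2) unfolding C_def in_closure_of by blast
    then show False using V'(3) UV(5) by (auto simp: disjnt_iff)
  qed
  define i where "i = inv_into C j"
  define L where "L = subtopology K C"
  have tL: "topspace L = C" using subC by (auto simp: L_def)
  define K' where "K' = pullback_topology (j ` C) i L"
  have ij: "i (j x) = x" if "x \<in> C" for x using inj that by (simp add: i_def)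
  have tK': "topspace K' = j ` C"
    using ij by (auto simp: K'_def topspace_pullback_topology tL)
  have ci: "continuous_map K' L i"
    unfolding K'_def using continuous_map_pullback[of L L id "j ` C" i] by simp
  have cj: "continuous_map L K' j"
    unfolding K'_def
  proof (rule continuous_map_pullback')
    show "continuous_map L L (i \<circ> j)"
      by (rule continuous_map_eq[of L L id]) (simp_all add: tL ij)
  qed (auto simp: tL)
  have "homeomorphic_maps L K' j i"
    unfolding homeomorphic_maps_def using ci cj ij by (auto simp: tL tK')
  then have hom: "L homeomorphic_space K'" by (auto simp: homeomorphic_space_def)
  have "compact_space L" "Hausdorff_space L"
    unfolding L_def using K clC
    by (auto intro: compact_space_subtopology closedin_compact_space Hausdorff_space_subtopology)
  then have "compact_space K'" "Hausdorff_space K'"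
    using hom homeomorphic_compact_space homeomorphic_Hausdorff_space by blast+
  moreover have "continuous_map K' X (f \<circ> i)"
    using ci f unfolding L_def by (intro continuous_map_compose[of _ L]) (auto simp: L_def continuous_map_from_subtopology)
  ultimately have "closedin X ((f \<circ> i) ` topspace K')"
    using X unfolding weak_Hausdorff_def by blast
  moreover have "(f \<circ> i) ` topspace K' = f ` C" using ij by (force simp: tK')
  ultimately show ?thesis using fC by (simp add: S_def)
qed

lemma weak_Hausdorff_injective:
  fixes X :: "'a topology"
  assumes Y: "weak_Hausdorff Y" and g: "continuous_map X Y g" and inj: "inj_on g (topspace X)"
  shows "weak_Hausdorff X"
  unfolding weak_Hausdorff_def
proof (intro allI impI, elim conjE)
  fix K :: "'a set set topology" and f
  assume K: "compact_space K" "Hausdorff_space K" "continuous_map K X f"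
  then have "closedin Y ((g \<circ> f) ` topspace K)"
    using weak_Hausdorff_closed_image[OF Y K(1,2)] continuous_map_compose[OF K(3) g] by blast
  then have "closedin X {x \<in> topspace X. g x \<in> (g \<circ> f) ` topspace K}"
    by (rule closedin_continuous_map_preimage[OF g])
  moreover have "{x \<in> topspace X. g x \<in> (g \<circ> f) ` topspace K} = f ` topspace K"
    using continuous_map_image_subset_topspace[OF K(3)] inj
    by (auto simp: inj_on_def image_subset_iff)
  ultimately show "closedin X (f ` topspace K)" by simp
qed

lemma weak_Hausdorff_image_Hausdorff:
  assumes X: "weak_Hausdorff X" and K: "compact_space K" "Hausdorff_space K"
    and f: "continuous_map K X f"
  shows "Hausdorff_space (subtopology X (f ` topspace K))"
proof (rule Hausdorff_normal_space_closed_continuous_map_image)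
  let ?L = "subtopology X (f ` topspace K)"
  have sub: "f ` topspace K \<subseteq> topspace X" using f by (rule continuous_map_image_subset_topspace)
  have closed: "closedin X (f ` C)" if "closedin K C" for C
  proof -
    have "compact_space (subtopology K C)" "Hausdorff_space (subtopology K C)"
      using that K by (auto intro: compact_space_subtopology closedin_compact_space Hausdorff_space_subtopology)
    then have "closedin X (f ` topspace (subtopology K C))"
      using X f by (intro weak_Hausdorff_closed_image continuous_map_from_subtopology)
    moreover have "topspace (subtopology K C) = C" using closedin_subset[OF that] by auto
    ultimately show ?thesis by simp
  qed
  have cl: "closedin X (f ` topspace K)" by (rule closed) simp
  show "normal_space K" using K by (simp add: compact_Hausdorff_or_regular_imp_normal_space)
  show "continuous_map K ?L f" using f by (auto simp: continuous_map_in_subtopology)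
  show cm: "closed_map K ?L f"
    unfolding closed_map_def closedin_closed_subtopology[OF cl]
    using closed by (intro allI impI conjI image_mono closedin_subset)
  show img: "f ` topspace K = topspace ?L" using sub by auto
  show "t1_space ?L"
    unfolding t1_space_closedin_singleton
  proof
    fix y assume "y \<in> topspace ?L"
    then have "y \<in> f ` topspace K" by simp
    then obtain x where x: "x \<in> topspace K" "y = f x" by blast
    then have "closedin K {x}" using K(2) by (simp add: closedin_Hausdorff_singleton)
    then have "closedin ?L (f ` {x})" using cm unfolding closed_map_def by blast
    then show "closedin ?L {y}" using x by simp
  qed
qed

subsection \<open>Coproducts and quotients of streams\<close>

definition coproduct_stream :: "('i \<Rightarrow> 'a stream) \<Rightarrow> 'i set \<Rightarrow> ('i \<times> 'a) stream" where
  "coproduct_stream X I = \<lparr>stop = sum_topology (\<lambda>i. stop (X i)) I,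
     circ = (\<lambda>U. if openin (sum_topology (\<lambda>i. stop (X i)) I) U
       then {((i, x), (i, y)) |i x y. i \<in> I \<and> (x, y) \<in> circ (X i) {x. (i, x) \<in> U}} else {})\<rparr>"

text \<open>The preimage of a set \<open>V\<close> of equivalence classes under the quotient map is \<open>\<Union>V\<close>.\<close>

definition quotient_topology :: "'a topology \<Rightarrow> ('a \<times> 'a) set \<Rightarrow> 'a set topology" where
  "quotient_topology X E = topology (\<lambda>V. V \<subseteq> topspace X // E \<and> openin X (\<Union>V))"

definition quotient_stream :: "'a stream \<Rightarrow> ('a \<times> 'a) set \<Rightarrow> 'a set stream" where
  "quotient_stream X E = \<lparr>stop = quotient_topology (stop X) E,
     circ = (\<lambda>V. if openin (quotient_topology (stop X) E) V
       then {(E `` {x}, E `` {y}) |x y. (x, y) \<in> circ X (\<Union>V)}\<^sup>+ else {})\<rparr>"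

lemma Union_in_quotient:
  assumes E: "equiv A E" and V: "V \<subseteq> A // E"
  shows "x \<in> \<Union>V \<longleftrightarrow> x \<in> A \<and> E `` {x} \<in> V"
proof
  assume "x \<in> \<Union>V"
  then obtain W where W: "x \<in> W" "W \<in> V" by blast
  with V have "W \<in> A // E" by blast
  then obtain y where y: "y \<in> A" "W = E `` {y}" by (rule quotientE)
  with W have "(y, x) \<in> E" by blast
  then have "W = E `` {x}" "x \<in> A"
    using y equiv_class_eq[OF E \<open>(y, x) \<in> E\<close>] equivE[OF E] by blast+
  with W show "x \<in> A \<and> E `` {x} \<in> V" by simp
next
  assume "x \<in> A \<and> E `` {x} \<in> V"
  then show "x \<in> \<Union>V" using equiv_class_self[OF E] by blast
qed

lemma openin_quotient_topology:
  assumes E: "equiv (topspace X) E"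
  shows "openin (quotient_topology X E) V \<longleftrightarrow> V \<subseteq> topspace X // E \<and> openin X (\<Union>V)"
proof -
  have "\<Union>(V \<inter> W) = \<Union>V \<inter> \<Union>W" if "V \<subseteq> topspace X // E" "W \<subseteq> topspace X // E" for V W
  proof -
    have "V \<inter> W \<subseteq> topspace X // E" using that by blast
    then show ?thesis
      using Union_in_quotient[OF E that(1)] Union_in_quotient[OF E that(2)] Union_in_quotient[OF E, of "V \<inter> W"]
      by blast
  qed
  moreover have "openin X (\<Union>(\<Union>\<K>))" if "\<forall>V\<in>\<K>. openin X (\<Union>V)" for \<K>
  proof -
    have "\<Union>(\<Union>\<K>) = \<Union>(Union ` \<K>)" by blast
    moreover have "openin X (\<Union>(Union ` \<K>))" using that by (intro openin_Union) blast
    ultimately show ?thesis by (simp only:)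
  qed
  ultimately have "istopology (\<lambda>V. V \<subseteq> topspace X // E \<and> openin X (\<Union>V))"
    unfolding istopology_def by (simp add: Sup_le_iff le_infI1 openin_Int)
  then show ?thesis by (simp add: quotient_topology_def topology_inverse')
qed

lemma topspace_quotient_topology:
  assumes E: "equiv (topspace X) E"
  shows "topspace (quotient_topology X E) = topspace X // E"
proof -
  have "openin (quotient_topology X E) (topspace X // E)"
    using E by (simp add: openin_quotient_topology Union_quotient)
  then show ?thesis
    using openin_quotient_topology[OF E] openin_subset openin_topspace by (metis subset_antisym)
qed

lemma closedin_quotient_topology:
  assumes E: "equiv (topspace X) E"
  shows "closedin (quotient_topology X E) V \<longleftrightarrow> V \<subseteq> topspace X // E \<and> closedin X (\<Union>V)"
proof (cases "V \<subseteq> topspace X // E")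
  case True
  have "\<Union>(topspace X // E - V) = topspace X - \<Union>V"
    using Union_in_quotient[OF E True] Union_in_quotient[OF E, of "topspace X // E - V"]
    by (auto simp: quotientI)
  moreover have "\<Union>V \<subseteq> topspace X" using Union_in_quotient[OF E True] by blast
  ultimately show ?thesis
    using True by (simp add: closedin_def openin_quotient_topology[OF E] topspace_quotient_topology[OF E])
next
  case False
  then show ?thesis by (simp add: closedin_def topspace_quotient_topology[OF E])
qed

lemma continuous_map_quotient_proj:
  assumes E: "equiv (topspace X) E"
  shows "continuous_map X (quotient_topology X E) (\<lambda>x. E `` {x})"
  unfolding continuous_map_def topspace_quotient_topology[OF E] openin_quotient_topology[OF E]
proof (intro conjI allI impI)
  fix V assume V: "V \<subseteq> topspace X // E \<and> openin X (\<Union>V)"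
  then have "{x \<in> topspace X. E `` {x} \<in> V} = \<Union>V"
    using Union_in_quotient[OF E, of V] by blast
  then show "openin X {x \<in> topspace X. E `` {x} \<in> V}" using V by simp
qed (auto intro: quotientI)

lemma continuous_map_from_quotient:
  assumes E: "equiv (topspace X) E" and g: "g \<in> topspace X // E \<rightarrow> topspace Y"
    and f: "continuous_map X Y (\<lambda>x. g (E `` {x}))"
  shows "continuous_map (quotient_topology X E) Y g"
  unfolding continuous_map_def topspace_quotient_topology[OF E] openin_quotient_topology[OF E]
proof (intro conjI allI impI g)
  fix U assume U: "openin Y U"
  have "x \<in> \<Union>{c \<in> topspace X // E. g c \<in> U} \<longleftrightarrow> x \<in> {x \<in> topspace X. g (E `` {x}) \<in> U}" for x
    by (subst Union_in_quotient[OF E]) (auto intro: quotientI)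
  then have "\<Union>{c \<in> topspace X // E. g c \<in> U} = {x \<in> topspace X. g (E `` {x}) \<in> U}" by blast
  moreover have "openin X {x \<in> topspace X. g (E `` {x}) \<in> U}"
    using f U by (simp add: continuous_map_def)
  ultimately show "openin X (\<Union>{c \<in> topspace X // E. g c \<in> U})" by simp
qed auto

lemma equiv_Inter:
  assumes "\<E> \<noteq> {}" "\<And>E. E \<in> \<E> \<Longrightarrow> equiv A E"
  shows "equiv A (\<Inter>\<E>)"
proof (rule equivI)
  have E: "E \<subseteq> A \<times> A" "refl_on A E" "sym E" "trans E" if "E \<in> \<E>" for E
    using assms(2)[OF that] by (auto elim: equivE)
  show "\<Inter>\<E> \<subseteq> A \<times> A" using E(1) assms(1) by blast
  show "refl_on A (\<Inter>\<E>)" using E(2) by (auto simp: refl_on_def)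
  show "sym (\<Inter>\<E>)" using E(3) by (auto simp: sym_def)
  show "trans (\<Inter>\<E>)" using E(4) unfolding trans_def by blast
qed

lemma weak_Hausdorff_quotient_Inter:
  fixes X :: "'a topology"
  assumes ne: "\<E> \<noteq> {}" and eq: "\<And>E. E \<in> \<E> \<Longrightarrow> equiv (topspace X) E"
    and wH: "\<And>E. E \<in> \<E> \<Longrightarrow> weak_Hausdorff (quotient_topology X E)"
  shows "weak_Hausdorff (quotient_topology X (\<Inter>\<E>))"
  unfolding weak_Hausdorff_def
proof (intro allI impI, elim conjE)
  fix K :: "'a set set set topology" and f
  define E0 where "E0 = \<Inter>\<E>"
  have E0: "equiv (topspace X) E0" unfolding E0_def using ne eq by (rule equiv_Inter)
  assume K: "compact_space K" "Hausdorff_space K"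
    and "continuous_map K (quotient_topology X (\<Inter>\<E>)) f"
  then have f: "continuous_map K (quotient_topology X E0) f" by (simp add: E0_def)
  have fmem: "f k \<in> topspace X // E0" if "k \<in> topspace K" for k
    using f that unfolding continuous_map_def topspace_quotient_topology[OF E0] by blast
  define p where "p E c = E `` c" for E :: "('a \<times> 'a) set" and c
  have p: "p E (E0 `` {x}) = E `` {x}" if E: "E \<in> \<E>" and x: "x \<in> topspace X" for E x
  proof -
    have "E0 \<subseteq> E" using E by (auto simp: E0_def)
    moreover have "x \<in> E0 `` {x}" using E0 x by (rule equiv_class_self)
    moreover have "trans E" "sym E" using eq[OF E] by (auto elim: equivE)
    ultimately show ?thesis unfolding p_def by (blast dest: transD symD)
  qed
  have pf: "continuous_map K (quotient_topology X E) (\<lambda>k. p E (f k))" if E: "E \<in> \<E>" for E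
  proof -
    have "continuous_map (quotient_topology X E0) (quotient_topology X E) (p E)"
    proof (rule continuous_map_from_quotient[OF E0])
      show "p E \<in> topspace X // E0 \<rightarrow> topspace (quotient_topology X E)"
        using p[OF E] by (auto simp: topspace_quotient_topology[OF eq[OF E]] elim!: quotientE intro: quotientI)
      show "continuous_map X (quotient_topology X E) (\<lambda>x. p E (E0 `` {x}))"
        by (rule continuous_map_eq[OF continuous_map_quotient_proj[OF eq[OF E]]]) (simp add: p[OF E])
    qed
    from continuous_map_compose[OF f this] show ?thesis by (simp add: o_def)
  qed
  define G where "G E = {(k, x). k \<in> topspace K \<and> x \<in> topspace X \<and> p E (f k) = E `` {x}}" for E
  have G: "closedin (prod_topology K X) (G E)" if E: "E \<in> \<E>" for E
  proof -
    let ?Q = "quotient_topology X E"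
    define l where "l = (\<lambda>k. p E (f k)) ` topspace K"
    have l: "closedin ?Q l"
      unfolding l_def by (rule weak_Hausdorff_closed_image[OF wH[OF E] K pf[OF E]])
    have H: "Hausdorff_space (subtopology ?Q l)"
      unfolding l_def by (rule weak_Hausdorff_image_Hausdorff[OF wH[OF E] K pf[OF E]])
    have c2: "continuous_map (prod_topology K X) ?Q (\<lambda>z. E `` {snd z})"
      using continuous_map_compose[OF continuous_map_snd continuous_map_quotient_proj[OF eq[OF E]]]
      by (simp add: o_def)
    have c1: "continuous_map (prod_topology K X) ?Q (\<lambda>z. p E (f (fst z)))"
      using continuous_map_compose[OF continuous_map_fst pf[OF E]] by (simp add: o_def)
    define T where "T = {z \<in> topspace (prod_topology K X). E `` {snd z} \<in> l}"
    have T: "closedin (prod_topology K X) T"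
      unfolding T_def using c2 l by (rule closedin_continuous_map_preimage)
    let ?T = "subtopology (prod_topology K X) T"
    have tT: "topspace ?T = T" unfolding T_def by auto
    have "continuous_map ?T (subtopology ?Q l) (\<lambda>z. p E (f (fst z)))"
      "continuous_map ?T (subtopology ?Q l) (\<lambda>z. E `` {snd z})"
      using c1 c2 tT
      by (auto simp: continuous_map_in_subtopology T_def l_def intro: continuous_map_from_subtopology)
    then have "closedin ?T {z \<in> topspace ?T. p E (f (fst z)) = E `` {snd z}}"
      by (rule closedin_continuous_maps_eq[OF H])
    moreover have "{z \<in> topspace ?T. p E (f (fst z)) = E `` {snd z}} = G E"
      unfolding tT T_def G_def l_def by (auto; metis image_eqI)
    ultimately show ?thesis by (simp add: closedin_closed_subtopology[OF T])
  qed
  have "closedin (prod_topology K X) (\<Inter>(G ` \<E>))"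
    using G ne by (intro closedin_Inter) auto
  then have "closedin X (snd ` \<Inter>(G ` \<E>))"
    using closed_map_snd[OF K(1)] unfolding closed_map_def by blast
  moreover have "snd ` \<Inter>(G ` \<E>) = \<Union>(f ` topspace K)"
  proof (intro equalityI subsetI)
    fix x assume "x \<in> snd ` \<Inter>(G ` \<E>)"
    then obtain k where "(k, x) \<in> \<Inter>(G ` \<E>)" by force
    then have kx: "\<And>E. E \<in> \<E> \<Longrightarrow> (k, x) \<in> G E" by blast
    with ne have k: "k \<in> topspace K" and x: "x \<in> topspace X" by (auto simp: G_def)
    from fmem[OF k] obtain y where y: "y \<in> topspace X" "f k = E0 `` {y}" by (rule quotientE)
    have "(y, x) \<in> E" if E: "E \<in> \<E>" for E
    proof -
      have "E `` {y} = E `` {x}" using kx[OF E] y p[OF E] by (simp add: G_def)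
      then show ?thesis using eq_equiv_class[OF _ eq[OF E] x] by blast
    qed
    then have "x \<in> f k" using y by (auto simp: E0_def)
    with k show "x \<in> \<Union>(f ` topspace K)" by blast
  next
    fix x assume "x \<in> \<Union>(f ` topspace K)"
    then obtain k where k: "k \<in> topspace K" and xk: "x \<in> f k" by blast
    from fmem[OF k] obtain y where y: "y \<in> topspace X" "f k = E0 `` {y}" by (rule quotientE)
    then have yx: "(y, x) \<in> E0" using xk by blast
    then have x: "x \<in> topspace X" using E0 by (auto elim: equivE)
    have "(k, x) \<in> G E" if E: "E \<in> \<E>" for E
    proof -
      have "(y, x) \<in> E" using yx E by (auto simp: E0_def)
      then have "E `` {y} = E `` {x}" by (rule equiv_class_eq[OF eq[OF E]])
      then show ?thesis using k x y p[OF E] by (simp add: G_def)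
    qed
    then show "x \<in> snd ` \<Inter>(G ` \<E>)" by (intro image_eqI[of _ _ "(k, x)"]) auto
  qed
  ultimately show "closedin (quotient_topology X (\<Inter>\<E>)) (f ` topspace K)"
    unfolding E0_def[symmetric] closedin_quotient_topology[OF E0] using fmem by auto
qed

lemma is_stream_quotient:
  assumes X: "is_stream X" and E: "equiv (topspace (stop X)) E"
  shows "is_stream (quotient_stream X E)"
proof -
  let ?Q = "quotient_topology (stop X) E"
  have X': "circulation (stop X) (circ X)" using X by (simp add: is_stream_def)
  define P where "P V = {(E `` {x}, E `` {y}) |x y. (x, y) \<in> circ X (\<Union>V)}" for V
  have cQ: "circ (quotient_stream X E) V = (if openin ?Q V then (P V)\<^sup>+ else {})" for V
    by (simp add: quotient_stream_def P_def)
  have pre: "preorder_on (\<Union>V) (circ X (\<Union>V))" if "openin ?Q V" for V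
    using that X' openin_quotient_topology[OF E] by (simp add: circulationD(1))
  have mem: "x \<in> \<Union>V \<longleftrightarrow> x \<in> topspace (stop X) \<and> E `` {x} \<in> V" if "openin ?Q V" for V x
  proof (rule Union_in_quotient[OF E])
    show "V \<subseteq> topspace (stop X) // E" using that openin_quotient_topology[OF E] by blast
  qed
  have P_sub: "P V \<subseteq> V \<times> V" if "openin ?Q V" for V
  proof
    fix z assume "z \<in> P V"
    then obtain x y where z: "z = (E `` {x}, E `` {y})" "(x, y) \<in> circ X (\<Union>V)" by (auto simp: P_def)
    then have "x \<in> \<Union>V" "y \<in> \<Union>V" using pre[OF that] unfolding preorder_on_def by blast+
    then show "z \<in> V \<times> V" using mem[OF that] z by blast
  qed
  have pre_P: "preorder_on V ((P V)\<^sup>+)" if V: "openin ?Q V" for V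
    unfolding preorder_on_def
  proof (intro conjI)
    show "(P V)\<^sup>+ \<subseteq> V \<times> V" using P_sub[OF V] by (rule trancl_subset_Sigma)
    show "refl_on V ((P V)\<^sup>+)"
      unfolding refl_on_def
    proof
      fix c assume c: "c \<in> V"
      then have "c \<in> topspace (stop X) // E" using V openin_quotient_topology[OF E] by blast
      then obtain x where x: "x \<in> topspace (stop X)" "c = E `` {x}" by (rule quotientE)
      then have "x \<in> \<Union>V" using mem[OF V] c by blast
      then have "(x, x) \<in> circ X (\<Union>V)" using pre[OF V] by (auto simp: preorder_on_def refl_on_def)
      then show "(c, c) \<in> (P V)\<^sup>+" using x by (auto simp: P_def)
    qed
  qed simp
  have "circulation ?Q (circ (quotient_stream X E))"
    unfolding circulation_def
  proof (intro conjI allI impI ballI)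
    show "preorder_on V (circ (quotient_stream X E) V)" if "openin ?Q V" for V
      using that pre_P by (simp add: cQ)
    show "circ (quotient_stream X E) V = {}" if "\<not> openin ?Q V" for V
      using that by (simp add: cQ)
    fix \<O> assume \<O>: "\<forall>V\<in>\<O>. openin ?Q V"
    then have un: "openin ?Q (\<Union>\<O>)" by (simp add: openin_Union)
    have op: "openin (stop X) (\<Union>V)" if "V \<in> \<O>" for V
      using \<O> that openin_quotient_topology[OF E] by blast
    have UU: "\<Union>(\<Union>\<O>) = \<Union>(Union ` \<O>)" by blast
    show "circ (quotient_stream X E) V \<subseteq> circ (quotient_stream X E) (\<Union>\<O>)" if V: "V \<in> \<O>" for V
    proof -
      have "circ X (\<Union>V) \<subseteq> circ X (\<Union>(\<Union>\<O>))"
        unfolding UU using op V by (intro circulationD(2)[OF X']) auto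
      then have "P V \<subseteq> P (\<Union>\<O>)" unfolding P_def by blast
      then show ?thesis using un \<O> V by (auto simp: cQ intro: trancl_mono)
    qed
    fix R assume R: "preorder_on (\<Union>\<O>) R \<and> (\<forall>V\<in>\<O>. circ (quotient_stream X E) V \<subseteq> R)"
    then have trR: "trans R" and reR: "refl_on (\<Union>\<O>) R" by (auto simp: preorder_on_def)
    define R' where "R' = {(x, y). x \<in> \<Union>(\<Union>\<O>) \<and> y \<in> \<Union>(\<Union>\<O>) \<and> (E `` {x}, E `` {y}) \<in> R}"
    have "preorder_on (\<Union>(Union ` \<O>)) R'"
      unfolding UU[symmetric] preorder_on_def
    proof (intro conjI)
      show "R' \<subseteq> \<Union>(\<Union>\<O>) \<times> \<Union>(\<Union>\<O>)" by (auto simp: R'_def)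
      show "refl_on (\<Union>(\<Union>\<O>)) R'"
        using reR mem[OF un] unfolding refl_on_def R'_def by blast
      show "trans R'" using trR unfolding R'_def trans_def by blast
    qed
    moreover have "circ X (\<Union>V) \<subseteq> R'" if V: "V \<in> \<O>" for V
    proof
      fix z assume z: "z \<in> circ X (\<Union>V)"
      obtain x y where xy: "z = (x, y)" by (cases z)
      have oV: "openin ?Q V" using \<O> V by blast
      have "(E `` {x}, E `` {y}) \<in> (P V)\<^sup>+" using z xy by (auto simp: P_def)
      moreover have "(P V)\<^sup>+ \<subseteq> R" using bspec[OF conjunct2[OF R] V] oV by (simp add: cQ)
      ultimately have "(E `` {x}, E `` {y}) \<in> R" by blast
      moreover have "x \<in> \<Union>V" "y \<in> \<Union>V" using pre[OF oV] z xy by (auto simp: preorder_on_def)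
      ultimately show "z \<in> R'" using V xy by (auto simp: R'_def)
    qed
    ultimately have "circ X (\<Union>(Union ` \<O>)) \<subseteq> R'"
      using op by (intro circulationD(3)[OF X']) auto
    then have "P (\<Union>\<O>) \<subseteq> R" unfolding UU[symmetric] P_def R'_def by blast
    then have "(P (\<Union>\<O>))\<^sup>+ \<subseteq> R\<^sup>+" by (auto intro: trancl_mono)
    also have "R\<^sup>+ = R" using trR by simp
    finally show "circ (quotient_stream X E) (\<Union>\<O>) \<subseteq> R" using un by (simp add: cQ)
  qed
  then show ?thesis by (simp add: is_stream_def quotient_stream_def)
qed

lemma is_stream_coproduct:
  assumes X: "\<And>i. i \<in> I \<Longrightarrow> is_stream (X i)"
  shows "is_stream (coproduct_stream X I)"
proof -
  let ?S = "sum_topology (\<lambda>i. stop (X i)) I"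
  define s where "s U i = {x. (i, x) \<in> U}" for U :: "('a \<times> 'b) set" and i
  define L where "L U = {((i, x), (i, y)) |i x y. i \<in> I \<and> (x, y) \<in> circ (X i) (s U i)}" for U
  have cS: "circ (coproduct_stream X I) U = (if openin ?S U then L U else {})" for U
    by (simp add: coproduct_stream_def L_def s_def)
  have X': "circulation (stop (X i)) (circ (X i))" if "i \<in> I" for i
    using X[OF that] by (simp add: is_stream_def)
  have op: "openin (stop (X i)) (s U i)" if "openin ?S U" "i \<in> I" for U i
    using that by (simp add: openin_sum_topology s_def)
  have pre: "preorder_on (s U i) (circ (X i) (s U i))" if "openin ?S U" "i \<in> I" for U i
    using circulationD(1)[OF X' op] that by blast
  have inI: "i \<in> I" if "openin ?S U" "(i, x) \<in> U" for U i x
    using that by (auto simp: openin_sum_topology)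
  have "circulation ?S (circ (coproduct_stream X I))"
    unfolding circulation_def
  proof (intro conjI allI impI ballI)
    show "circ (coproduct_stream X I) U = {}" if "\<not> openin ?S U" for U
      using that by (simp add: cS)
    show "preorder_on U (circ (coproduct_stream X I) U)" if U: "openin ?S U" for U
    proof -
      have p: "circ (X i) (s U i) \<subseteq> s U i \<times> s U i" "refl_on (s U i) (circ (X i) (s U i))"
        "trans (circ (X i) (s U i))" if "i \<in> I" for i
        using pre[OF U that] by (simp_all add: preorder_on_def)
      have "L U \<subseteq> U \<times> U" using p(1) by (fastforce simp: L_def s_def)
      moreover have "refl_on U (L U)"
        unfolding refl_on_def
      proof
        fix z assume z: "z \<in> U"
        obtain i x where ix: "z = (i, x)" by (cases z)
        then have "i \<in> I" "x \<in> s U i" using z inI[OF U] by (auto simp: s_def)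
        then show "(z, z) \<in> L U" using p(2) ix unfolding refl_on_def L_def by blast
      qed
      moreover have "trans (L U)"
        unfolding trans_def L_def using p(3) by (auto dest: transD)
      ultimately show ?thesis using U by (simp add: cS preorder_on_def)
    qed
    fix \<O> assume \<O>: "\<forall>U\<in>\<O>. openin ?S U"
    then have un: "openin ?S (\<Union>\<O>)" by (simp add: openin_Union)
    have sU: "s (\<Union>\<O>) i = \<Union>((\<lambda>U. s U i) ` \<O>)" for i by (auto simp: s_def)
    show "circ (coproduct_stream X I) U \<subseteq> circ (coproduct_stream X I) (\<Union>\<O>)" if U: "U \<in> \<O>" for U
    proof -
      have "circ (X i) (s U i) \<subseteq> circ (X i) (s (\<Union>\<O>) i)" if i: "i \<in> I" for i
        unfolding sU using U \<O> op i by (intro circulationD(2)[OF X'[OF i]]) auto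
      then have "L U \<subseteq> L (\<Union>\<O>)" unfolding L_def by blast
      then show ?thesis using un \<O> U by (simp add: cS)
    qed
    fix R assume R: "preorder_on (\<Union>\<O>) R \<and> (\<forall>U\<in>\<O>. circ (coproduct_stream X I) U \<subseteq> R)"
    then have trR: "trans R" and reR: "refl_on (\<Union>\<O>) R" by (auto simp: preorder_on_def)
    have "circ (X i) (s (\<Union>\<O>) i) \<subseteq> {(x, y). x \<in> s (\<Union>\<O>) i \<and> y \<in> s (\<Union>\<O>) i \<and> ((i, x), (i, y)) \<in> R}"
      (is "_ \<subseteq> ?R") if i: "i \<in> I" for i
    proof -
      have "circ (X i) (\<Union>((\<lambda>U. s U i) ` \<O>)) \<subseteq> ?R"
      proof (rule circulationD(3)[OF X'[OF i]])
        show "openin (stop (X i)) V" if "V \<in> (\<lambda>U. s U i) ` \<O>" for V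
          using that op[OF _ i] \<O> by auto
        show "preorder_on (\<Union>((\<lambda>U. s U i) ` \<O>)) ?R"
          unfolding sU[symmetric] preorder_on_def
        proof (intro conjI)
          show "?R \<subseteq> s (\<Union>\<O>) i \<times> s (\<Union>\<O>) i" by blast
          show "refl_on (s (\<Union>\<O>) i) ?R" using reR by (auto simp: refl_on_def s_def)
          show "trans ?R" using trR unfolding trans_def by blast
        qed
        fix V assume "V \<in> (\<lambda>U. s U i) ` \<O>"
        then obtain U where U: "U \<in> \<O>" "V = s U i" by blast
        have oU: "openin ?S U" using \<O> U by blast
        show "circ (X i) V \<subseteq> ?R"
        proof
          fix z assume z: "z \<in> circ (X i) V"
          obtain x y where xy: "z = (x, y)" by (cases z)
          have "((i, x), (i, y)) \<in> L U" using z xy U i by (auto simp: L_def)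
          moreover have "L U \<subseteq> R" using bspec[OF conjunct2[OF R] U(1)] oU by (simp add: cS)
          ultimately have "((i, x), (i, y)) \<in> R" by blast
          moreover have "x \<in> s U i" "y \<in> s U i"
            using pre[OF oU i] z xy U by (auto simp: preorder_on_def)
          ultimately show "z \<in> ?R" using U xy by (auto simp: s_def)
        qed
      qed
      then show ?thesis by (simp add: sU)
    qed
    then have "L (\<Union>\<O>) \<subseteq> R" unfolding L_def by blast
    then show "circ (coproduct_stream X I) (\<Union>\<O>) \<subseteq> R" using un by (simp add: cS)
  qed
  then show ?thesis by (simp add: is_stream_def coproduct_stream_def)
qed

lemma stop_quotient_stream [simp]: "stop (quotient_stream X E) = quotient_topology (stop X) E"
  by (simp add: quotient_stream_def)

lemma stop_coproduct_stream [simp]: "stop (coproduct_stream X I) = sum_topology (\<lambda>i. stop (X i)) I"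
  by (simp add: coproduct_stream_def)

lemma is_streamD:
  assumes "is_stream X" "openin (stop X) U"
  shows "circ X U \<subseteq> U \<times> U" "refl_on U (circ X U)" "trans (circ X U)"
  using circulationD(1)[of "stop X" "circ X" U] assms by (simp_all add: is_stream_def preorder_on_def)

lemma stream_mapsD:
  assumes "f \<in> stream_maps X Y"
  shows "f \<in> topspace (stop X) \<rightarrow>\<^sub>E topspace (stop Y)" "continuous_map (stop X) (stop Y) f"
    "openin (stop Y) U \<Longrightarrow> (x, y) \<in> circ X {x \<in> topspace (stop X). f x \<in> U} \<Longrightarrow> (f x, f y) \<in> circ Y U"
  using assms unfolding stream_maps_def by blast+

lemma stream_mapsI:
  assumes "f \<in> topspace (stop X) \<rightarrow>\<^sub>E topspace (stop Y)" "continuous_map (stop X) (stop Y) f"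
    "\<And>U x y. openin (stop Y) U \<Longrightarrow> (x, y) \<in> circ X {x \<in> topspace (stop X). f x \<in> U} \<Longrightarrow>
      (f x, f y) \<in> circ Y U"
  shows "f \<in> stream_maps X Y"
  using assms unfolding stream_maps_def by blast

lemma stream_maps_compose:
  assumes X: "is_stream X" and f: "f \<in> stream_maps X Y" and g: "g \<in> stream_maps Y Z"
  shows "compose (topspace (stop X)) g f \<in> stream_maps X Z"
proof (rule stream_mapsI)
  note f' = stream_mapsD[OF f] and g' = stream_mapsD[OF g]
  have fm: "f x \<in> topspace (stop Y)" if "x \<in> topspace (stop X)" for x using PiE_mem[OF f'(1) that] .
  show "compose (topspace (stop X)) g f \<in> topspace (stop X) \<rightarrow>\<^sub>E topspace (stop Z)"
    unfolding compose_def restrict_PiE_iff using fm PiE_mem[OF g'(1)] by blast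
  show "continuous_map (stop X) (stop Z) (compose (topspace (stop X)) g f)"
    by (rule continuous_map_eq[OF continuous_map_compose[OF f'(2) g'(2)]]) (simp add: compose_eq)
  fix U x y assume U: "openin (stop Z) U"
    and xy: "(x, y) \<in> circ X {x \<in> topspace (stop X). compose (topspace (stop X)) g f x \<in> U}"
  let ?V = "{y \<in> topspace (stop Y). g y \<in> U}"
  have V: "openin (stop Y) ?V" using g'(2) U by (simp add: continuous_map_def)
  have eq: "{x \<in> topspace (stop X). compose (topspace (stop X)) g f x \<in> U} = {x \<in> topspace (stop X). f x \<in> ?V}"
    using fm by (auto simp: compose_eq)
  from this xy have "(f x, f y) \<in> circ Y ?V" using f'(3)[OF V] by simp
  then have "(g (f x), g (f y)) \<in> circ Z U" using g'(3)[OF U] by blast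
  moreover have "x \<in> topspace (stop X)" "y \<in> topspace (stop X)"
  proof -
    have "openin (stop X) {x \<in> topspace (stop X). f x \<in> ?V}"
      using f'(2) V unfolding continuous_map_def by blast
    from is_streamD(1)[OF X this] show "x \<in> topspace (stop X)" "y \<in> topspace (stop X)"
      using xy eq by auto
  qed
  ultimately show "(compose (topspace (stop X)) g f x, compose (topspace (stop X)) g f y) \<in> circ Z U"
    by (simp add: compose_eq)
qed

lemma monotone_stream_map:
  assumes f: "f \<in> cube m \<rightarrow>\<^sub>E cube n" and cont: "continuous_map (cube_topology m) (cube_topology n) f"
    and mono: "\<And>s t. (s, t) \<in> cube_le m \<Longrightarrow> (f s, f t) \<in> cube_le n"
  shows "f \<in> stream_maps (directed_cube m) (directed_cube n)"
proof (rule stream_mapsI)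
  show "f \<in> topspace (stop (directed_cube m)) \<rightarrow>\<^sub>E topspace (stop (directed_cube n))" using f by simp
  show "continuous_map (stop (directed_cube m)) (stop (directed_cube n)) f" using cont by simp
  fix U x y assume "openin (stop (directed_cube n)) U"
    and xy: "(x, y) \<in> circ (directed_cube m) {x \<in> topspace (stop (directed_cube m)). f x \<in> U}"
  then have U: "openin (cube_topology n) U" by simp
  have Uc: "U \<subseteq> cube n" using openin_subset[OF U] by simp
  define pre where "pre B = {x \<in> cube m. f x \<in> B}" for B
  have pre: "openin (cube_topology m) (pre B)" if "openin (cube_topology n) B" for B
    using cont that by (simp add: continuous_map_def pre_def)
  define \<B> where "\<B> = {B. \<exists>z e. e > 0 \<and> B = {u \<in> cube n. \<forall>i<n. \<bar>u i - z i\<bar> < e} \<and> B \<subseteq> U}"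
  have un: "\<Union>(pre ` \<B>) = pre U"
  proof
    show "\<Union>(pre ` \<B>) \<subseteq> pre U" by (auto simp: pre_def \<B>_def)
    show "pre U \<subseteq> \<Union>(pre ` \<B>)"
    proof
      fix x assume x: "x \<in> pre U"
      then have fx: "f x \<in> U" "x \<in> cube m" by (auto simp: pre_def)
      obtain e where e: "e > 0" "{u \<in> cube n. \<forall>i<n. \<bar>u i - f x i\<bar> < e} \<subseteq> U"
        using cube_box_neighbourhood[OF U fx(1)] by blast
      then have "{u \<in> cube n. \<forall>i<n. \<bar>u i - f x i\<bar> < e} \<in> \<B>" unfolding \<B>_def by blast
      moreover have "f x \<in> {u \<in> cube n. \<forall>i<n. \<bar>u i - f x i\<bar> < e}" using fx Uc e(1) by auto
      ultimately show "x \<in> \<Union>(pre ` \<B>)" using fx(2) unfolding pre_def by blast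
    qed
  qed
  define R where "R = {(x, y). x \<in> pre U \<and> y \<in> pre U \<and> (f x, f y) \<in> cube_circulation n U}"
  have po: "preorder_on U (cube_circulation n U)" by (rule preorder_on_cube_circulation[OF U])
  have "preorder_on (\<Union>(pre ` \<B>)) R"
    unfolding un preorder_on_def
  proof (intro conjI)
    show "R \<subseteq> pre U \<times> pre U" by (auto simp: R_def)
    show "refl_on (pre U) R" using po by (auto simp: R_def refl_on_def preorder_on_def pre_def)
    have "trans (cube_circulation n U)" using po by (simp add: preorder_on_def)
    then show "trans R" unfolding trans_def R_def by blast
  qed
  moreover have "cube_circulation m (pre B) \<subseteq> R" if B: "B \<in> \<B>" for B
  proof
    fix p assume p: "p \<in> cube_circulation m (pre B)"
    obtain a b where ab: "p = (a, b)" by (cases p)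
    from B obtain z e where B': "B = {u \<in> cube n. \<forall>i<n. \<bar>u i - z i\<bar> < e}" "B \<subseteq> U"
      by (auto simp: \<B>_def)
    have oB: "openin (cube_topology n) B" unfolding B'(1) by (rule openin_cube_box)
    have "(a, b) \<in> pre B \<times> pre B"
      using preorder_on_cube_circulation[OF pre[OF oB]] p ab unfolding preorder_on_def by blast
    then have mem: "a \<in> pre B" "b \<in> pre B" "f a \<in> B" "f b \<in> B" by (auto simp: pre_def)
    have "cube_circulation m (pre B) \<subseteq> cube_le m"
      using circulation_mono[OF circulation_cube_circulation pre[OF oB] openin_cube] cube_circulation_cube
      by (auto simp: pre_def)
    then have le: "(f a, f b) \<in> cube_le n" using mono p ab by blast
    have "cube_interval n (f a) (f b) \<subseteq> B"
    proof
      fix u assume u: "u \<in> cube_interval n (f a) (f b)"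
      have "\<bar>u i - z i\<bar> < e" if "i < n" for i
      proof -
        have "f a i \<le> u i" "u i \<le> f b i" "\<bar>f a i - z i\<bar> < e" "\<bar>f b i - z i\<bar> < e"
          using u mem(3,4) that by (auto simp: B' cube_interval_def)
        then show ?thesis by linarith
      qed
      with u show "u \<in> B" by (auto simp: B' cube_interval_def)
    qed
    then have "(f a, f b) \<in> cube_steps n U"
      using mem B'(2) le by (auto simp: cube_steps_def)
    then show "p \<in> R" using U ab mem B'(2) by (auto simp: cube_circulation_def R_def pre_def)
  qed
  moreover have "openin (cube_topology m) (pre B)" if "B \<in> \<B>" for B
    using that openin_cube_box by (intro pre) (auto simp: \<B>_def)
  ultimately have "cube_circulation m (\<Union>(pre ` \<B>)) \<subseteq> R"
    by (intro circulationD(3)[OF circulation_cube_circulation]) auto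
  moreover have "(x, y) \<in> cube_circulation m (pre U)"
    using xy by (simp add: directed_cube_eq pre_def)
  ultimately show "(f x, f y) \<in> circ (directed_cube n) U"
    unfolding un by (auto simp: R_def directed_cube_eq)
qed

lemma cube_map_stream_map:
  assumes \<phi>: "box_mor m n \<phi>"
  shows "cube_map m n \<phi> \<in> stream_maps (directed_cube m) (directed_cube n)"
proof (rule monotone_stream_map)
  note r = box_real_cube_map[OF \<phi>]
  show f: "cube_map m n \<phi> \<in> cube m \<rightarrow>\<^sub>E cube n" by (rule box_real_maps(2)[OF r])
  show "(cube_map m n \<phi> s, cube_map m n \<phi> t) \<in> cube_le n" if st: "(s, t) \<in> cube_le m" for s t
  proof -
    have s: "s \<in> cube m" "t \<in> cube m" "\<And>i. i < m \<Longrightarrow> s i \<le> t i" using st by (auto simp: cube_le_def)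
    have "cube_map m n \<phi> s i \<le> cube_map m n \<phi> t i" if i: "i < n" for i
      using r i
    proof (cases rule: box_real_coordsE)
      case (const b)
      then show ?thesis using s by simp
    next
      case (proj j)
      then show ?thesis using s by simp
    qed
    then show ?thesis using s PiE_mem[OF f] by (simp add: cube_le_def)
  qed
  have "continuous_map (cube_topology m) (top_of_set {0..1}) (\<lambda>t. cube_map m n \<phi> t i)" if i: "i < n" for i
    using r i
  proof (cases rule: box_real_coordsE)
    case (const b)
    have "continuous_map (cube_topology m) (top_of_set {0..1::real}) (\<lambda>_. of_bool b)" by simp
    then show ?thesis by (rule continuous_map_eq) (simp add: const(2))
  next
    case (proj j)
    have "continuous_map (cube_topology m) (top_of_set {0..1::real}) (\<lambda>t. t j)"
      unfolding cube_topology_def using proj(1) by (intro continuous_map_product_projection) simp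
    then show ?thesis by (rule continuous_map_eq) (simp add: proj(3))
  qed
  moreover have "cube_map m n \<phi> ` cube m \<subseteq> extensional {..<n}"
    using PiE_mem[OF f] by (auto simp: tuples_def PiE_iff)
  ultimately show "continuous_map (cube_topology m) (cube_topology n) (cube_map m n \<phi>)"
    unfolding cube_topology_def[of n] by (subst continuous_map_componentwise) simp
qed

lemma quotient_stream_map_exists:
  assumes X: "is_stream X" and Y: "is_stream Y" and E: "equiv (topspace (stop X)) E"
    and f: "f \<in> stream_maps X Y" and ker: "\<And>x y. (x, y) \<in> E \<Longrightarrow> f x = f y"
  shows "\<exists>h \<in> stream_maps (quotient_stream X E) Y. \<forall>x\<in>topspace (stop X). h (E `` {x}) = f x"
proof -
  let ?A = "topspace (stop X)"
  note f' = stream_mapsD[OF f]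
  define h where "h = (\<lambda>c\<in>?A // E. f (SOME x. x \<in> c))"
  have h: "h (E `` {x}) = f x" if x: "x \<in> ?A" for x
  proof -
    have "x \<in> E `` {x}" using E x by (rule equiv_class_self)
    then have "(SOME y. y \<in> E `` {x}) \<in> E `` {x}" by (rule someI)
    then have "f x = f (SOME y. y \<in> E `` {x})" by (intro ker) simp
    then show ?thesis using x by (simp add: h_def quotientI)
  qed
  have "h \<in> stream_maps (quotient_stream X E) Y"
  proof (rule stream_mapsI)
    have hm: "h c \<in> topspace (stop Y)" if "c \<in> ?A // E" for c
      using that h PiE_mem[OF f'(1)] by (auto elim!: quotientE)
    then show "h \<in> topspace (stop (quotient_stream X E)) \<rightarrow>\<^sub>E topspace (stop Y)"
      by (simp add: topspace_quotient_topology[OF E] PiE_iff h_def)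
    have "continuous_map (stop X) (stop Y) (\<lambda>x. h (E `` {x}))"
      by (rule continuous_map_eq[OF f'(2)]) (simp add: h)
    then show "continuous_map (stop (quotient_stream X E)) (stop Y) h"
      using hm by (simp add: continuous_map_from_quotient[OF E])
    fix U c d assume U: "openin (stop Y) U"
      and cd: "(c, d) \<in> circ (quotient_stream X E) {x \<in> topspace (stop (quotient_stream X E)). h x \<in> U}"
    define V where "V = {c \<in> ?A // E. h c \<in> U}"
    have "\<Union>V = {x \<in> ?A. f x \<in> U}"
    proof (rule Set.set_eqI)
      fix x
      have "x \<in> \<Union>V \<longleftrightarrow> x \<in> ?A \<and> E `` {x} \<in> V" by (rule Union_in_quotient[OF E]) (auto simp: V_def)
      then show "x \<in> \<Union>V \<longleftrightarrow> x \<in> {x \<in> ?A. f x \<in> U}" using h by (auto simp: V_def quotientI)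
    qed
    then have P: "(h a, h b) \<in> circ Y U"
      if "(a, b) \<in> {(E `` {x}, E `` {y}) |x y. (x, y) \<in> circ X (\<Union>V)}" for a b
    proof -
      from that obtain x y where xy: "a = E `` {x}" "b = E `` {y}" "(x, y) \<in> circ X {x \<in> ?A. f x \<in> U}"
        using \<open>\<Union>V = _\<close> by auto
      moreover have "openin (stop X) {x \<in> ?A. f x \<in> U}" using f'(2) U by (simp add: continuous_map_def)
      ultimately have "x \<in> ?A" "y \<in> ?A" using is_streamD(1)[OF X] by blast+
      then show ?thesis using f'(3)[OF U xy(3)] xy h by simp
    qed
    have "(c, d) \<in> {(E `` {x}, E `` {y}) |x y. (x, y) \<in> circ X (\<Union>V)}\<^sup>+"
      using cd by (auto simp: quotient_stream_def V_def topspace_quotient_topology[OF E] split: if_splits)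
    then show "(h c, h d) \<in> circ Y U"
    proof (induction rule: trancl_induct)
      case (base b)
      then show ?case by (rule P)
    next
      case (step b b')
      then show ?case using P is_streamD(3)[OF Y U] by (meson transD)
    qed
  qed
  with h show ?thesis by blast
qed

lemma coproduct_stream_map:
  assumes X: "\<And>i. i \<in> I \<Longrightarrow> is_stream (X i)" and f: "\<And>i. i \<in> I \<Longrightarrow> f i \<in> stream_maps (X i) Y"
  shows "(\<lambda>(i, x)\<in>topspace (stop (coproduct_stream X I)). f i x) \<in> stream_maps (coproduct_stream X I) Y"
proof (rule stream_mapsI)
  let ?S = "coproduct_stream X I" and ?h = "\<lambda>(i, x)\<in>topspace (stop (coproduct_stream X I)). f i x"
  have f1: "f i x \<in> topspace (stop Y)" if "i \<in> I" "x \<in> topspace (stop (X i))" for i x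
    using PiE_mem[OF stream_mapsD(1)[OF f]] that by blast
  show "?h \<in> topspace (stop ?S) \<rightarrow>\<^sub>E topspace (stop Y)"
    unfolding restrict_PiE_iff using f1 by auto
  have pre: "{x. (i, x) \<in> {z \<in> topspace (stop ?S). ?h z \<in> U}} = {x \<in> topspace (stop (X i)). f i x \<in> U}"
    if "i \<in> I" for i U using that by auto
  have op: "openin (stop ?S) {z \<in> topspace (stop ?S). ?h z \<in> U}" if U: "openin (stop Y) U" for U
    unfolding stop_coproduct_stream openin_sum_topology
  proof (intro conjI ballI)
    fix i assume i: "i \<in> I"
    have "openin (stop (X i)) {x \<in> topspace (stop (X i)). f i x \<in> U}"
      using stream_mapsD(2)[OF f[OF i]] U by (simp add: continuous_map_def)
    then show "openin (stop (X i)) {x. (i, x) \<in> {z \<in> topspace (sum_topology (\<lambda>i. stop (X i)) I).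
        (\<lambda>(i, x)\<in>topspace (sum_topology (\<lambda>i. stop (X i)) I). f i x) z \<in> U}}"
      using pre[OF i, of U] by simp
  qed auto
  show "continuous_map (stop ?S) (stop Y) ?h"
    unfolding continuous_map_def using op f1 by auto
  fix U z w assume U: "openin (stop Y) U" and zw: "(z, w) \<in> circ ?S {z \<in> topspace (stop ?S). ?h z \<in> U}"
  then obtain i x y where *: "z = (i, x)" "w = (i, y)" "i \<in> I"
    "(x, y) \<in> circ (X i) {x. (i, x) \<in> {z \<in> topspace (stop ?S). ?h z \<in> U}}"
    using op[OF U] unfolding coproduct_stream_def by (auto simp del: topspace_sum_topology restrict_apply')
  then have xy: "(x, y) \<in> circ (X i) {x \<in> topspace (stop (X i)). f i x \<in> U}" using pre by simp
  have "openin (stop (X i)) {x \<in> topspace (stop (X i)). f i x \<in> U}"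
    using stream_mapsD(2)[OF f[OF *(3)]] U by (simp add: continuous_map_def)
  then have "x \<in> topspace (stop (X i))" "y \<in> topspace (stop (X i))"
    using is_streamD(1)[OF X[OF *(3)]] xy by blast+
  then show "(?h z, ?h w) \<in> circ Y U"
    using stream_mapsD(3)[OF f[OF *(3)] U xy] * by simp
qed

lemma coproduct_stream_inclusion:
  assumes "i \<in> I" and X: "is_stream (X i)"
  shows "(\<lambda>x\<in>topspace (stop (X i)). (i, x)) \<in> stream_maps (X i) (coproduct_stream X I)"
proof (rule stream_mapsI)
  let ?S = "coproduct_stream X I" and ?j = "\<lambda>x\<in>topspace (stop (X i)). (i, x)"
  show "?j \<in> topspace (stop (X i)) \<rightarrow>\<^sub>E topspace (stop ?S)" using assms by simp
  have pre: "{x \<in> topspace (stop (X i)). ?j x \<in> U} = {x. (i, x) \<in> U}" if "openin (stop ?S) U" for U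
    using that assms openin_subset[of "stop ?S" U] by auto
  show "continuous_map (stop (X i)) (stop ?S) ?j"
    unfolding continuous_map_def
  proof (intro conjI allI impI)
    fix U assume U: "openin (stop ?S) U"
    then show "openin (stop (X i)) {x \<in> topspace (stop (X i)). ?j x \<in> U}"
      unfolding pre[OF U] using assms by (simp add: openin_sum_topology)
  qed (use assms in auto)
  fix U x y assume U: "openin (stop ?S) U"
    and xy: "(x, y) \<in> circ (X i) {x \<in> topspace (stop (X i)). ?j x \<in> U}"
  then have xy': "(x, y) \<in> circ (X i) {x. (i, x) \<in> U}" unfolding pre[OF U] by simp
  have oi: "openin (stop (X i)) {x. (i, x) \<in> U}" using U assms by (simp add: openin_sum_topology)
  have "x \<in> topspace (stop (X i))" "y \<in> topspace (stop (X i))"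
    using is_streamD(1)[OF X oi] xy' openin_subset[OF oi] by blast+
  then show "(?j x, ?j y) \<in> circ ?S U"
    using xy' U assms by (simp add: coproduct_stream_def)
qed

section \<open>Directed realization and singular cubical sets\<close>

text \<open>
  The realization of \<open>C\<close> is the colimit in weak Hausdorff k-streams of the directed cubes
  indexed by the cells of \<open>C\<close>.  It is formed as the quotient of the coproduct of these cubes
  (a k-stream) by the smallest equivalence relation which contains the identifications along
  morphisms of the box category and has a weak Hausdorff quotient.  The universal property is
  \<open>realization_universal\<close> below.
\<close>

definition cells_stream :: "'c cubical \<Rightarrow> ((nat \<times> 'c) \<times> (nat \<Rightarrow> real)) stream" where
  "cells_stream C = coproduct_stream (\<lambda>(n, c). directed_cube n) {(n, c). c \<in> cells C n}"

definition realization_glue ::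
  "'c cubical \<Rightarrow> (((nat \<times> 'c) \<times> (nat \<Rightarrow> real)) \<times> ((nat \<times> 'c) \<times> (nat \<Rightarrow> real))) set" where
  "realization_glue C = {(((m, act C m n \<phi> c), t), ((n, c), cube_map m n \<phi> t)) |m n \<phi> c t.
     box_mor m n \<phi> \<and> c \<in> cells C n \<and> t \<in> cube m}"

definition realization_eq ::
  "'c cubical \<Rightarrow> (((nat \<times> 'c) \<times> (nat \<Rightarrow> real)) \<times> ((nat \<times> 'c) \<times> (nat \<Rightarrow> real))) set" where
  "realization_eq C = \<Inter>{E. equiv (topspace (stop (cells_stream C))) E \<and> realization_glue C \<subseteq> E \<and>
     weak_Hausdorff (quotient_topology (stop (cells_stream C)) E)}"

definition realization :: "'c cubical \<Rightarrow> ((nat \<times> 'c) \<times> (nat \<Rightarrow> real)) set stream" where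
  "realization C = quotient_stream (cells_stream C) (realization_eq C)"

definition realization_map :: "'c cubical \<Rightarrow> 'd cubical \<Rightarrow> (nat \<Rightarrow> 'c \<Rightarrow> 'd) \<Rightarrow>
    ((nat \<times> 'c) \<times> (nat \<Rightarrow> real)) set \<Rightarrow> ((nat \<times> 'd) \<times> (nat \<Rightarrow> real)) set" where
  "realization_map C D f = (\<lambda>P\<in>topspace (stop (realization C)).
     realization_eq D `` ((\<lambda>((n, c), t). ((n, f n c), t)) ` P))"

definition sing :: "'a stream \<Rightarrow> ((nat \<Rightarrow> real) \<Rightarrow> 'a) cubical" where
  "sing X = \<lparr>cells = (\<lambda>n. stream_maps (directed_cube n) X),
     act = (\<lambda>m n \<phi> s. compose (cube m) s (cube_map m n \<phi>))\<rparr>"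

definition sing_map :: "'a stream \<Rightarrow> ('a \<Rightarrow> 'b) \<Rightarrow>
    nat \<Rightarrow> ((nat \<Rightarrow> real) \<Rightarrow> 'a) \<Rightarrow> ((nat \<Rightarrow> real) \<Rightarrow> 'b)" where
  "sing_map X g = (\<lambda>n. \<lambda>s\<in>cells (sing X) n. compose (cube n) g s)"

lemma cubical_set_sing: "cubical_set (sing X)"
  unfolding cubical_set_def
proof (intro conjI allI impI; (elim conjE)?)
  show "act (sing X) m n \<phi> c \<in> cells (sing X) m" if "box_mor m n \<phi>" "c \<in> cells (sing X) n" for m n \<phi> c
    using stream_maps_compose[OF is_stream_directed_cube cube_map_stream_map[OF that(1)]] that(2)
    by (simp add: sing_def)
  have ext: "c \<in> extensional (cube n)" if "c \<in> cells (sing X) n" for n c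
    using that by (simp add: sing_def stream_maps_def PiE_iff)
  show "act (sing X) n n (restrict (\<lambda>x. x) (verts n)) c = c" if "c \<in> cells (sing X) n" for n c
  proof (rule extensionalityI)
    show "c \<in> extensional (cube n)" using ext[OF that] .
    show "act (sing X) n n (restrict (\<lambda>x. x) (verts n)) c \<in> extensional (cube n)"
      by (simp add: sing_def)
  qed (simp add: sing_def cube_map_ident compose_eq)
  fix l m n \<phi> \<psi> c
  assume \<phi>: "box_mor l m \<phi>" and \<psi>: "box_mor m n \<psi>" and c: "c \<in> cells (sing X) n"
  have "cube_map l m \<phi> t \<in> cube m" if "t \<in> cube l" for t
    using PiE_mem[OF stream_mapsD(1)[OF cube_map_stream_map[OF \<phi>]]] that by simp
  then show "act (sing X) l n (compose (verts l) \<psi> \<phi>) c = act (sing X) l m \<phi> (act (sing X) m n \<psi> c)"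
    by (simp add: sing_def cube_map_compose[OF \<phi> \<psi>] compose_eq restrict_def compose_def[of "cube l"]
        compose_def[of "cube m"] fun_eq_iff)
qed


text \<open>
  The unit sends a cell \<open>c\<close> of dimension \<open>n\<close> to the structure map of the colimit at \<open>c\<close>, the
  domain \<open>\<parallel>\<box>[1]\<^sup>n\<parallel>\<close> of which is the directed \<open>n\<close>-cube.
\<close>

definition realization_unit :: "'c cubical \<Rightarrow> nat \<Rightarrow> 'c \<Rightarrow>
    (nat \<Rightarrow> real) \<Rightarrow> ((nat \<times> 'c) \<times> (nat \<Rightarrow> real)) set" where
  "realization_unit C = (\<lambda>n. \<lambda>c\<in>cells C n. \<lambda>t\<in>cube n. realization_eq C `` {((n, c), t)})"

lemma topspace_cells_stream:
  "topspace (stop (cells_stream C)) = {((n, c), t). c \<in> cells C n \<and> t \<in> cube n}"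
  by (auto simp: cells_stream_def)

lemma is_stream_cells_stream: "is_stream (cells_stream C)"
  unfolding cells_stream_def
  by (intro is_stream_coproduct) (auto simp: is_stream_directed_cube)

lemma quotient_stream_proj:
  assumes X: "is_stream X" and E: "equiv (topspace (stop X)) E"
  shows "(\<lambda>x\<in>topspace (stop X). E `` {x}) \<in> stream_maps X (quotient_stream X E)"
proof (rule stream_mapsI)
  let ?A = "topspace (stop X)"
  show "(\<lambda>x\<in>?A. E `` {x}) \<in> ?A \<rightarrow>\<^sub>E topspace (stop (quotient_stream X E))"
    by (simp add: topspace_quotient_topology[OF E] quotientI)
  show "continuous_map (stop X) (stop (quotient_stream X E)) (\<lambda>x\<in>?A. E `` {x})"
    unfolding stop_quotient_stream
    by (rule continuous_map_eq[OF continuous_map_quotient_proj[OF E]]) simp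
  fix U x y assume "openin (stop (quotient_stream X E)) U"
    and xy: "(x, y) \<in> circ X {x \<in> ?A. (\<lambda>x\<in>?A. E `` {x}) x \<in> U}"
  then have U: "openin (quotient_topology (stop X) E) U" by simp
  then have U': "U \<subseteq> ?A // E" "openin (stop X) (\<Union>U)" by (simp_all add: openin_quotient_topology[OF E])
  have "{x \<in> ?A. (\<lambda>x\<in>?A. E `` {x}) x \<in> U} = \<Union>U"
    using Union_in_quotient[OF E U'(1)] by auto
  with xy have xy': "(x, y) \<in> circ X (\<Union>U)" by simp
  then have "x \<in> ?A" "y \<in> ?A" using is_streamD(1)[OF X U'(2)] openin_subset[OF U'(2)] by blast+
  moreover have "(E `` {x}, E `` {y}) \<in> circ (quotient_stream X E) U"
    using U xy' by (auto simp: quotient_stream_def)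
  ultimately show "((\<lambda>x\<in>?A. E `` {x}) x, (\<lambda>x\<in>?A. E `` {x}) y) \<in> circ (quotient_stream X E) U" by simp
qed

lemma weak_Hausdorff_total_quotient:
  fixes X :: "'a topology"
  shows "weak_Hausdorff (quotient_topology X (topspace X \<times> topspace X))"
  unfolding weak_Hausdorff_def
proof (intro allI impI, elim conjE)
  let ?E = "topspace X \<times> topspace X"
  have E: "equiv (topspace X) ?E" by (auto intro!: equivI simp: refl_on_def sym_def trans_def)
  fix K :: "'a set set set topology" and f
  assume "continuous_map K (quotient_topology X ?E) f"
  then have sub: "f ` topspace K \<subseteq> topspace X // ?E"
    using continuous_map_image_subset_topspace topspace_quotient_topology[OF E] by metis
  have "c = topspace X" if "c \<in> topspace X // ?E" for c
    using that by (auto elim!: quotientE)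
  then have "f ` topspace K = {} \<or> f ` topspace K = topspace (quotient_topology X ?E)"
    using sub unfolding topspace_quotient_topology[OF E] by blast
  then show "closedin (quotient_topology X ?E) (f ` topspace K)" by force
qed

context
  fixes C :: "'c cubical"
  assumes C: "cubical_set C"
begin

lemma realization_glue_subset:
  "realization_glue C \<subseteq> topspace (stop (cells_stream C)) \<times> topspace (stop (cells_stream C))"
proof -
  have "act C m n \<phi> c \<in> cells C m" "cube_map m n \<phi> t \<in> cube n"
    if "box_mor m n \<phi>" "c \<in> cells C n" "t \<in> cube m" for m n \<phi> c t
  proof -
    show "act C m n \<phi> c \<in> cells C m" using C that unfolding cubical_set_def by blast
    show "cube_map m n \<phi> t \<in> cube n"
      using PiE_mem[OF box_real_maps(2)[OF box_real_cube_map[OF that(1)]] that(3)] .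
  qed
  then show ?thesis unfolding topspace_cells_stream realization_glue_def by blast
qed

lemma realization_eq_props:
  shows "equiv (topspace (stop (cells_stream C))) (realization_eq C)"
    and "realization_glue C \<subseteq> realization_eq C"
    and "weak_Hausdorff (quotient_topology (stop (cells_stream C)) (realization_eq C))"
proof -
  let ?X = "stop (cells_stream C)"
  let ?\<E> = "{E. equiv (topspace ?X) E \<and> realization_glue C \<subseteq> E \<and> weak_Hausdorff (quotient_topology ?X E)}"
  have "equiv (topspace ?X) (topspace ?X \<times> topspace ?X)"
    by (auto intro!: equivI simp: refl_on_def sym_def trans_def)
  then have "topspace ?X \<times> topspace ?X \<in> ?\<E>"
    using realization_glue_subset weak_Hausdorff_total_quotient by blast
  then have ne: "?\<E> \<noteq> {}" by blast
  show "equiv (topspace ?X) (realization_eq C)"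
    unfolding realization_eq_def using ne by (rule equiv_Inter) blast
  show "realization_glue C \<subseteq> realization_eq C" unfolding realization_eq_def by blast
  show "weak_Hausdorff (quotient_topology ?X (realization_eq C))"
    unfolding realization_eq_def using ne by (rule weak_Hausdorff_quotient_Inter) blast+
qed

lemma is_stream_realization: "is_stream (realization C)"
  unfolding realization_def by (rule is_stream_quotient[OF is_stream_cells_stream realization_eq_props(1)])

lemma weak_Hausdorff_realization: "weak_Hausdorff (stop (realization C))"
  unfolding realization_def using realization_eq_props(3) by simp

lemma realization_unit_glue:
  assumes \<phi>: "box_mor m n \<phi>" and c: "c \<in> cells C n"
  shows "realization_unit C m (act C m n \<phi> c) = compose (cube m) (realization_unit C n c) (cube_map m n \<phi>)"
proof (rule extensionalityI[where A = "cube m"])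
  have c': "act C m n \<phi> c \<in> cells C m" using C assms unfolding cubical_set_def by blast
  show "realization_unit C m (act C m n \<phi> c) \<in> extensional (cube m)"
    using c' by (simp add: realization_unit_def)
  fix t assume t: "t \<in> cube m"
  then have t': "cube_map m n \<phi> t \<in> cube n"
    using PiE_mem[OF box_real_maps(2)[OF box_real_cube_map[OF \<phi>]]] by blast
  have "(((m, act C m n \<phi> c), t), ((n, c), cube_map m n \<phi> t)) \<in> realization_eq C"
    using realization_eq_props(2) \<phi> c t unfolding realization_glue_def by blast
  then have "realization_eq C `` {((m, act C m n \<phi> c), t)} = realization_eq C `` {((n, c), cube_map m n \<phi> t)}"
    by (rule equiv_class_eq[OF realization_eq_props(1)])
  then show "realization_unit C m (act C m n \<phi> c) t
      = compose (cube m) (realization_unit C n c) (cube_map m n \<phi>) t"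
    using c c' t t' by (simp add: realization_unit_def compose_eq)
qed simp

lemma realization_unit_stream_map:
  assumes c: "c \<in> cells C n"
  shows "realization_unit C n c \<in> stream_maps (directed_cube n) (realization C)"
proof -
  let ?X = "cells_stream C"
  let ?j = "\<lambda>t\<in>cube n. ((n, c), t)"
  have j: "?j \<in> stream_maps (directed_cube n) ?X"
    using coproduct_stream_inclusion[of "(n, c)" "{(n, c). c \<in> cells C n}" "\<lambda>(n, c). directed_cube n"]
      is_stream_directed_cube c by (simp add: cells_stream_def)
  have "(\<lambda>x\<in>topspace (stop ?X). realization_eq C `` {x}) \<in> stream_maps ?X (realization C)"
    unfolding realization_def
    by (rule quotient_stream_proj[OF is_stream_cells_stream realization_eq_props(1)])
  from stream_maps_compose[OF is_stream_directed_cube j this]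
  have "compose (cube n) (\<lambda>x\<in>topspace (stop ?X). realization_eq C `` {x}) ?j
      \<in> stream_maps (directed_cube n) (realization C)" by simp
  moreover have "compose (cube n) (\<lambda>x\<in>topspace (stop ?X). realization_eq C `` {x}) ?j = realization_unit C n c"
    using c by (auto simp: realization_unit_def compose_def topspace_cells_stream fun_eq_iff)
  ultimately show ?thesis by simp
qed

lemma realization_unit_hom: "realization_unit C \<in> cubical_hom C (sing (realization C))"
proof -
  have "realization_unit C n \<in> cells C n \<rightarrow>\<^sub>E cells (sing (realization C)) n" for n
    using realization_unit_stream_map by (simp add: PiE_iff sing_def realization_unit_def)
  then show ?thesis using realization_unit_glue by (simp add: cubical_hom_def sing_def)
qed

text \<open>
  The realization is the colimit of the directed cubes indexed by the cells of \<open>C\<close>, with the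
  components of the unit as structure maps.
\<close>

lemma realization_universal:
  fixes Y :: "'y stream" and g :: "nat \<Rightarrow> 'c \<Rightarrow> (nat \<Rightarrow> real) \<Rightarrow> 'y"
  assumes Y: "is_stream Y" "weak_Hausdorff (stop Y)"
    and g: "\<And>n c. c \<in> cells C n \<Longrightarrow> g n c \<in> stream_maps (directed_cube n) Y"
    and comp: "\<And>m n \<phi> c. box_mor m n \<phi> \<Longrightarrow> c \<in> cells C n \<Longrightarrow>
      g m (act C m n \<phi> c) = compose (cube m) (g n c) (cube_map m n \<phi>)"
  shows "\<exists>!h. h \<in> stream_maps (realization C) Y \<and>
    (\<forall>n. \<forall>c\<in>cells C n. compose (cube n) h (realization_unit C n c) = g n c)"
proof -
  let ?X = "cells_stream C"
  let ?T = "stop ?X"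
  define G where "G = (\<lambda>((n, c), t)\<in>topspace ?T. g n c t)"
  have G: "G \<in> stream_maps ?X Y"
  proof -
    have "(\<lambda>(i, x)\<in>topspace ?T. (\<lambda>(n, c). g n c) i x) \<in> stream_maps ?X Y"
      unfolding cells_stream_def
      using g by (intro coproduct_stream_map) (auto simp: is_stream_directed_cube)
    moreover have "(\<lambda>(i, x)\<in>topspace ?T. (\<lambda>(n, c). g n c) i x) = G"
      unfolding G_def by (intro restrict_ext) auto
    ultimately show ?thesis by simp
  qed
  define E where "E = {(x, y). x \<in> topspace ?T \<and> y \<in> topspace ?T \<and> G x = G y}"
  have E: "equiv (topspace ?T) E"
    by (auto intro!: equivI simp: E_def refl_on_def sym_def trans_def)
  have glueE: "realization_glue C \<subseteq> E"
  proof
    fix z assume z: "z \<in> realization_glue C"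
    then obtain m n \<phi> c t where *: "z = (((m, act C m n \<phi> c), t), ((n, c), cube_map m n \<phi> t))"
      "box_mor m n \<phi>" "c \<in> cells C n" "t \<in> cube m" unfolding realization_glue_def by blast
    have "fst z \<in> topspace ?T" "snd z \<in> topspace ?T" using z realization_glue_subset by auto
    moreover from this have "G (fst z) = G (snd z)"
      using * comp[OF *(2,3)] by (simp add: G_def compose_eq)
    ultimately show "z \<in> E" using *(1) by (simp add: E_def)
  qed
  have whE: "weak_Hausdorff (quotient_topology ?T E)"
  proof -
    obtain h where h: "h \<in> stream_maps (quotient_stream ?X E) Y" "\<And>x. x \<in> topspace ?T \<Longrightarrow> h (E `` {x}) = G x"
      using quotient_stream_map_exists[OF is_stream_cells_stream Y(1) E G] by (auto simp: E_def)
    have "inj_on h (topspace (quotient_topology ?T E))"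
      unfolding topspace_quotient_topology[OF E]
    proof (rule inj_onI)
      fix a b assume a: "a \<in> topspace ?T // E" and b: "b \<in> topspace ?T // E" and ab: "h a = h b"
      from a obtain x where x: "x \<in> topspace ?T" "a = E `` {x}" by (rule quotientE)
      from b obtain y where y: "y \<in> topspace ?T" "b = E `` {y}" by (rule quotientE)
      have "(x, y) \<in> E" using x y ab h(2) by (simp add: E_def)
      then show "a = b" using x y equiv_class_eq[OF E] by blast
    qed
    then show ?thesis using weak_Hausdorff_injective[OF Y(2)] stream_mapsD(2)[OF h(1)] by simp
  qed
  have sub: "realization_eq C \<subseteq> E"
    unfolding realization_eq_def using E glueE whE by blast
  obtain h where h: "h \<in> stream_maps (realization C) Y"
    "\<And>x. x \<in> topspace ?T \<Longrightarrow> h (realization_eq C `` {x}) = G x"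
  proof -
    have "\<exists>h \<in> stream_maps (quotient_stream ?X (realization_eq C)) Y.
        \<forall>x\<in>topspace ?T. h (realization_eq C `` {x}) = G x"
      using sub by (intro quotient_stream_map_exists[OF is_stream_cells_stream Y(1) realization_eq_props(1) G])
        (auto simp: E_def)
    then show thesis using that by (auto simp: realization_def)
  qed
  have comp_iff: "compose (cube n) k (realization_unit C n c) = g n c \<longleftrightarrow>
      (\<forall>t\<in>cube n. k (realization_eq C `` {((n, c), t)}) = g n c t)" if c: "c \<in> cells C n" for n c k
  proof -
    have "g n c \<in> extensional (cube n)" using stream_mapsD(1)[OF g[OF c]] by (simp add: PiE_iff)
    then show ?thesis using c
      by (auto simp: fun_eq_iff compose_def realization_unit_def extensional_def)
  qed
  show ?thesis
  proof (rule ex1I[of _ h])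
    show "h \<in> stream_maps (realization C) Y \<and>
        (\<forall>n. \<forall>c\<in>cells C n. compose (cube n) h (realization_unit C n c) = g n c)"
      using h comp_iff by (auto simp: topspace_cells_stream G_def)
    fix k assume k: "k \<in> stream_maps (realization C) Y \<and>
        (\<forall>n. \<forall>c\<in>cells C n. compose (cube n) k (realization_unit C n c) = g n c)"
    have tR: "topspace (stop (realization C)) = topspace ?T // realization_eq C"
      unfolding realization_def by (simp add: topspace_quotient_topology[OF realization_eq_props(1)])
    show "k = h"
    proof (rule extensionalityI)
      show "k \<in> extensional (topspace (stop (realization C)))" "h \<in> extensional (topspace (stop (realization C)))"
        using stream_mapsD(1)[of k "realization C" Y] k stream_mapsD(1)[OF h(1)] by (simp_all add: PiE_iff)
      fix a assume "a \<in> topspace (stop (realization C))"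
      then have "a \<in> topspace ?T // realization_eq C" by (simp add: tR)
      then obtain x where x: "x \<in> topspace ?T" "a = realization_eq C `` {x}" by (rule quotientE)
      then obtain n c t where nct: "x = ((n, c), t)" "c \<in> cells C n" "t \<in> cube n"
        by (auto simp: topspace_cells_stream)
      then have "k a = g n c t" using k x comp_iff[OF nct(2)] by blast
      also have "\<dots> = h a" using h(2)[OF x(1)] x nct by (simp add: G_def)
      finally show "k a = h a" .
    qed
  qed
qed

end

lemma realization_map_props:
  assumes C: "cubical_set C" and D: "cubical_set D" and f: "f \<in> cubical_hom C D"
  shows "realization_map C D f \<in> stream_maps (realization C) (realization D)"
    and "\<And>n c. c \<in> cells C n \<Longrightarrow>
      compose (cube n) (realization_map C D f) (realization_unit C n c) = realization_unit D n (f n c)"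
proof -
  have fD: "f n c \<in> cells D n" if "c \<in> cells C n" for n c
    using f that unfolding cubical_hom_def by blast
  have fact: "f m (act C m n \<phi> c) = act D m n \<phi> (f n c)" if "box_mor m n \<phi>" "c \<in> cells C n" for m n \<phi> c
    using f that unfolding cubical_hom_def by blast
  have "\<exists>!h. h \<in> stream_maps (realization C) (realization D) \<and>
      (\<forall>n. \<forall>c\<in>cells C n. compose (cube n) h (realization_unit C n c) = realization_unit D n (f n c))"
    using realization_unit_stream_map[OF D] realization_unit_glue[OF D] fD fact
    by (intro realization_universal[OF C is_stream_realization[OF D] weak_Hausdorff_realization[OF D]]) simp_all
  then obtain h where h: "h \<in> stream_maps (realization C) (realization D)"
    and hc: "\<And>n c. c \<in> cells C n \<Longrightarrow> compose (cube n) h (realization_unit C n c) = realization_unit D n (f n c)"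
    by blast
  let ?T = "topspace (stop (cells_stream C))"
  let ?F = "\<lambda>((n, c), t). ((n, f n c), t)"
  have E: "equiv ?T (realization_eq C)" by (rule realization_eq_props(1)[OF C])
  have tR: "topspace (stop (realization C)) = ?T // realization_eq C"
    unfolding realization_def by (simp add: topspace_quotient_topology[OF E])
  have hF: "h (realization_eq C `` {x}) = realization_eq D `` {?F x}" if x: "x \<in> ?T" for x
  proof -
    from x obtain n c t where x': "x = ((n, c), t)" "c \<in> cells C n" "t \<in> cube n"
      by (auto simp: topspace_cells_stream)
    have "compose (cube n) h (realization_unit C n c) t = realization_unit D n (f n c) t"
      using hc[OF x'(2)] by simp
    then show ?thesis using x' fD[OF x'(2)] by (simp add: compose_eq realization_unit_def)
  qed
  have "realization_map C D f = h"
  proof (rule extensionalityI)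
    show "realization_map C D f \<in> extensional (topspace (stop (realization C)))"
      by (simp add: realization_map_def)
    show "h \<in> extensional (topspace (stop (realization C)))"
      using stream_mapsD(1)[OF h] by (simp add: PiE_iff)
    fix P assume P: "P \<in> topspace (stop (realization C))"
    then have "P \<in> ?T // realization_eq C" by (simp add: tR)
    then obtain x where x: "x \<in> ?T" "P = realization_eq C `` {x}" by (rule quotientE)
    have one: "realization_eq D `` {?F y} = h P" if y: "y \<in> P" for y
    proof -
      have xy: "(x, y) \<in> realization_eq C" using x(2) y by blast
      then have "y \<in> ?T" using equivE[OF E] by blast
      then have "h (realization_eq C `` {y}) = realization_eq D `` {?F y}" by (rule hF)
      moreover have "realization_eq C `` {y} = P" using equiv_class_eq[OF E xy] x(2) by simp
      ultimately show ?thesis by (simp only:)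
    qed
    have "x \<in> P" using equiv_class_self[OF E x(1)] x(2) by simp
    have "realization_map C D f P = realization_eq D `` (?F ` P)"
      using P by (simp add: realization_map_def)
    also have "\<dots> = (\<Union>y\<in>P. realization_eq D `` {?F y})" by blast
    also have "\<dots> = (\<Union>y\<in>P. h P)" using one by (intro SUP_cong) simp_all
    also have "\<dots> = h P" using \<open>x \<in> P\<close> by blast
    finally show "realization_map C D f P = h P" .
  qed
  with h hc show "realization_map C D f \<in> stream_maps (realization C) (realization D)"
    "\<And>n c. c \<in> cells C n \<Longrightarrow>
      compose (cube n) (realization_map C D f) (realization_unit C n c) = realization_unit D n (f n c)"
    by simp_all
qed

definition H1_sing :: "'a stream \<Rightarrow> ('t, 'm) monoid_scheme \<Rightarrow>
    ((nat \<Rightarrow> real) \<Rightarrow> 'a, 't) cochain set monoid" where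
  "H1_sing X \<tau> = H1 (sing X) \<tau>"

end

theory Submission
  imports Defs
begin

text \<open>
  A cochain \<open>\<alpha>\<close> on \<open>C\<close> assigns a weight to each pair \<open>v \<le> w\<close> of vertices of a cell.  Let the mass of a point
  of \<open>\<parallel>C\<parallel>\<close> be the weight of its coordinates between \<open>1/2\<close> and a level slightly above \<open>1/2\<close> that
  no coordinate crosses near a given point \<open>P\<close>.  This is a potential on a neighbourhood of \<open>P\<close> whose
  increments along directed paths do not depend on \<open>P\<close>.  Continuing it along directed paths gives a function
  on directed paths that is compatible with directed squares, hence a cochain on \<open>sing \<parallel>C\<parallel>\<close> which
  restricts to \<open>\<alpha>\<close>: a path through the centre of a cube picks up the weight when it crosses \<open>1/2\<close>.

  Conversely let \<open>\<beta>\<close> be a cochain on \<open>sing \<parallel>C\<parallel>\<close>.  It is homotopic to its pullback along the self-maps of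
  \<open>\<parallel>C\<parallel>\<close> that apply \<open>t \<mapsto> max 0 (min 1 (k (t - 1/2)))\<close> to all coordinates.  For \<open>k \<rightarrow> \<infinity>\<close>, the
  traces of these homotopies are eventually constant at each point, and the value of the pullback on a given path is
  eventually that of the extension of \<open>\<beta>\<close> restricted to \<open>C\<close>; so the two are homotopic.
\<close>

text \<open>The monoid \<open>\<tau>\<close> may lack inverses and cancellation, so a value along a
  path cannot be read off as a difference of potentials. What replaces subtraction is the
  normalization of the mass to \<open>\<one>\<close> at its centre \<open>P\<close>: if a directed
  path in the neighbourhood leads from \<open>x\<close> to \<open>P\<close>, then its increment is
  an inverse of the mass of \<open>x\<close>, and an increment that starts at \<open>x\<close> is
  determined by its equation for the mass.

  A homotopy of cochains amounts to a function on the 0-cells that satisfies one equation for each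
  1-cell (\<open>natural_homotopy\<close>). Nothing continuous is asked of this function. The
  eventual values of the traces therefore still form a homotopy, although the self-maps converge to
  a step function.

  That the levels can be chosen depends on the absence of diagonals from the box category. A
  coordinate of a representative of \<open>P\<close> that is neither 0, 1 nor a coordinate of the
  chosen representative stems from a degeneracy, and moving it on its own does not change the
  point.\<close>

section \<open>Box morphisms and geometric cubes in coordinates\<close>

lemma box_mor_mem: "box_mor m n \<phi> \<Longrightarrow> x \<in> verts m \<Longrightarrow> \<phi> x \<in> verts n"
  using box_box_real box_real_maps(1) PiE_mem by metis

lemma cube_map_mem: "box_mor m n \<phi> \<Longrightarrow> t \<in> cube m \<Longrightarrow> cube_map m n \<phi> t \<in> cube n"
  using PiE_mem[OF box_real_maps(2)[OF box_real_cube_map]] by blast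

lemma box_mor_coords [consumes 2, case_names const proj]:
  assumes "box_mor m n \<phi>" "i < n"
  obtains (const) b where "\<And>x. x \<in> verts m \<Longrightarrow> \<phi> x i = b" "\<And>t. t \<in> cube m \<Longrightarrow> cube_map m n \<phi> t i = of_bool b"
  | (proj) j where "j < m" "\<And>x. x \<in> verts m \<Longrightarrow> \<phi> x i = x j" "\<And>t. t \<in> cube m \<Longrightarrow> cube_map m n \<phi> t i = t j"
  using box_real_cube_map[OF assms(1)] assms(2)
proof (cases rule: box_real_coordsE)
  case (const b)
  then show ?thesis by (rule that(1))
next
  case (proj j)
  then show ?thesis by (rule that(2))
qed

lemma tuples_eqI: "x \<in> tuples S n \<Longrightarrow> y \<in> tuples T n \<Longrightarrow> (\<And>i. i < n \<Longrightarrow> x i = y i) \<Longrightarrow> x = y"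
  by (rule extensionalityI[of _ "{..<n}"]) (auto simp: tuples_def PiE_iff)

lemma tuplesI: "(\<And>i. i < n \<Longrightarrow> f i \<in> S) \<Longrightarrow> restrict f {..<n} \<in> tuples S n"
  by (auto simp: tuples_def)

lemma verts_leI: "v \<in> verts n \<Longrightarrow> w \<in> verts n \<Longrightarrow> (\<And>i. i < n \<Longrightarrow> v i \<Longrightarrow> w i) \<Longrightarrow> (v, w) \<in> verts_le n"
  by (auto simp: verts_le_def)

lemma verts_leD:
  assumes "(v, w) \<in> verts_le n"
  shows "v \<in> verts n" "w \<in> verts n" "\<And>i. i < n \<Longrightarrow> v i \<Longrightarrow> w i"
  using assms by (auto simp: verts_le_def)

lemma verts_le_refl: "v \<in> verts n \<Longrightarrow> (v, v) \<in> verts_le n"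
  by (simp add: verts_le_def)

lemma verts_le_trans: "(u, v) \<in> verts_le n \<Longrightarrow> (v, w) \<in> verts_le n \<Longrightarrow> (u, w) \<in> verts_le n"
  by (simp add: verts_le_def)

lemma box_mor_verts_le:
  assumes "box_mor m n \<phi>" "(v, w) \<in> verts_le m"
  shows "(\<phi> v, \<phi> w) \<in> verts_le n"
proof (rule verts_leI)
  note vw = verts_leD[OF assms(2)]
  show "\<phi> v \<in> verts n" "\<phi> w \<in> verts n" using box_mor_mem[OF assms(1)] vw by blast+
  fix i assume i: "i < n" and v: "\<phi> v i"
  show "\<phi> w i" using assms(1) i
    by (cases rule: box_mor_coords) (use v vw in auto)
qed

text \<open>There are no diagonals in the box category.\<close>

lemma box_real_update:
  assumes "box_real m n \<phi> \<psi>" "j < m"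
  shows "(\<forall>s\<in>cube m. \<forall>r\<in>{0..1}. \<psi> (s(j := r)) = \<psi> s) \<or>
    (\<exists>i<n. \<forall>s\<in>cube m. \<forall>r\<in>{0..1}. \<psi> (s(j := r)) = (\<psi> s)(i := r) \<and> \<psi> s i = s j)"
  using assms
proof (induction arbitrary: j rule: box_real.induct)
  case (ident n)
  then show ?case
    by (intro disjI2 exI[of _ j]) (auto simp: tuples_def PiE_iff extensional_def)
next
  case (coface i n b)
  have upd: "s(j := r) \<in> cube n" if "s \<in> cube n" "r \<in> {0..1}" for s r
    using that coface by (auto simp: tuples_def PiE_iff extensional_def)
  show ?case
  proof (intro disjI2 exI[of _ "if j < i then j else Suc j"] conjI ballI)
    show "(if j < i then j else Suc j) < Suc n" using coface by auto
    fix s r assume sr: "s \<in> cube n" "r \<in> {0..1::real}"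
    show "restrict (coface n i (of_bool b)) (cube n) (s(j := r)) =
       (restrict (coface n i (of_bool b)) (cube n) s)(if j < i then j else Suc j := r)"
      using upd[OF sr] sr coface by (auto simp: coface_def fun_eq_iff restrict_def)
    show "restrict (coface n i (of_bool b)) (cube n) s (if j < i then j else Suc j) = s j"
      using sr coface by (auto simp: coface_def)
  qed
next
  case (codegeneracy i n)
  have upd: "s(j := r) \<in> cube (Suc n)" if "s \<in> cube (Suc n)" "r \<in> {0..1}" for s r
    using that codegeneracy by (auto simp: tuples_def PiE_iff extensional_def)
  show ?case
  proof (cases "j = i")
    case True
    show ?thesis
    proof (intro disjI1 ballI)
      fix s r assume sr: "s \<in> cube (Suc n)" "r \<in> {0..1::real}"
      show "restrict (codegeneracy n i) (cube (Suc n)) (s(j := r)) = restrict (codegeneracy n i) (cube (Suc n)) s"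
        using upd[OF sr] sr True by (auto simp: codegeneracy_def fun_eq_iff)
    qed
  next
    case False
    show ?thesis
    proof (intro disjI2 exI[of _ "if j < i then j else j - 1"] conjI ballI)
      show "(if j < i then j else j - 1) < n" using codegeneracy False by auto
      fix s r assume sr: "s \<in> cube (Suc n)" "r \<in> {0..1::real}"
      show "restrict (codegeneracy n i) (cube (Suc n)) (s(j := r)) =
         (restrict (codegeneracy n i) (cube (Suc n)) s)(if j < i then j else j - 1 := r)"
        using upd[OF sr] sr codegeneracy False by (auto simp: codegeneracy_def fun_eq_iff restrict_def)
      show "restrict (codegeneracy n i) (cube (Suc n)) s (if j < i then j else j - 1) = s j"
        using sr codegeneracy False by (auto simp: codegeneracy_def)
    qed
  qed
next
  case (permute \<pi> n)
  obtain i where i: "\<pi> i = j" using permutes_surj[OF permute(1)] by (metis surjD)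
  have i': "i < n" using permutes_in_image[OF permute(1), of i] i permute by auto
  have upd: "s(j := r) \<in> cube n" if "s \<in> cube n" "r \<in> {0..1}" for s r
    using that permute by (auto simp: tuples_def PiE_iff extensional_def)
  have iff: "\<pi> k = j \<longleftrightarrow> k = i" for k using i permutes_inj[OF permute(1)] by (auto dest: injD)
  show ?case
  proof (intro disjI2 exI[of _ i] conjI ballI i')
    fix s r assume sr: "s \<in> cube n" "r \<in> {0..1::real}"
    show "restrict (permute_coords n \<pi>) (cube n) (s(j := r)) = (restrict (permute_coords n \<pi>) (cube n) s)(i := r)"
      using upd[OF sr] sr i' by (auto simp: permute_coords_def fun_eq_iff iff)
    show "restrict (permute_coords n \<pi>) (cube n) s i = s j"
      using sr i i' by (simp add: permute_coords_def)
  qed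
next
  case (comp l m \<phi> \<phi>' n \<psi> \<psi>')
  have upd: "s(j := r) \<in> cube l" if "s \<in> cube l" "r \<in> {0..1}" for s r
    using that comp by (auto simp: tuples_def PiE_iff extensional_def)
  have mem: "\<phi>' s \<in> cube m" if "s \<in> cube l" for s
    using box_real_maps(2)[OF comp(1)] that by (rule PiE_mem)
  from comp.IH(1)[OF comp.prems] show ?case
  proof (elim disjE exE conjE)
    assume *: "\<forall>s\<in>cube l. \<forall>r\<in>{0..1}. \<phi>' (s(j := r)) = \<phi>' s"
    show ?thesis
    proof (intro disjI1 ballI)
      fix s r assume "s \<in> cube l" "r \<in> {0..1::real}"
      then show "compose (cube l) \<psi>' \<phi>' (s(j := r)) = compose (cube l) \<psi>' \<phi>' s"
        using upd[of s r] * by (simp add: compose_eq)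
    qed
  next
    fix i assume i: "i < m" and *: "\<forall>s\<in>cube l. \<forall>r\<in>{0..1}. \<phi>' (s(j := r)) = (\<phi>' s)(i := r) \<and> \<phi>' s i = s j"
    from comp.IH(2)[OF i] show ?thesis
    proof (elim disjE exE conjE)
      assume **: "\<forall>s\<in>cube m. \<forall>r\<in>{0..1}. \<psi>' (s(i := r)) = \<psi>' s"
      show ?thesis
      proof (intro disjI1 ballI)
        fix s r assume "s \<in> cube l" "r \<in> {0..1::real}"
        then show "compose (cube l) \<psi>' \<phi>' (s(j := r)) = compose (cube l) \<psi>' \<phi>' s"
          using upd[of s r] * ** mem by (simp add: compose_eq)
      qed
    next
      fix k assume k: "k < n" and **: "\<forall>s\<in>cube m. \<forall>r\<in>{0..1}. \<psi>' (s(i := r)) = (\<psi>' s)(k := r) \<and> \<psi>' s k = s i"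
      show ?thesis
      proof (intro disjI2 exI[of _ k] conjI ballI k)
        fix s r assume "s \<in> cube l" "r \<in> {0..1::real}"
        then show "compose (cube l) \<psi>' \<phi>' (s(j := r)) = (compose (cube l) \<psi>' \<phi>' s)(k := r)"
          "compose (cube l) \<psi>' \<phi>' s k = s j"
          using upd[of s r] * ** mem by (simp_all add: compose_eq)
      qed
    qed
  qed
qed

lemma cube_update: "s \<in> cube m \<Longrightarrow> j < m \<Longrightarrow> r \<in> {0..1} \<Longrightarrow> s(j := r) \<in> cube m"
  by (auto simp: tuples_def PiE_iff extensional_def)

lemma cube_map_update_source:
  assumes "box_mor m n \<phi>" "j < m"
  obtains "\<And>s r. s \<in> cube m \<Longrightarrow> r \<in> {0..1} \<Longrightarrow> cube_map m n \<phi> (s(j := r)) = cube_map m n \<phi> s"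
  | i where "i < n" "\<And>s r. s \<in> cube m \<Longrightarrow> r \<in> {0..1} \<Longrightarrow> cube_map m n \<phi> (s(j := r)) = (cube_map m n \<phi> s)(i := r)"
      "\<And>s. s \<in> cube m \<Longrightarrow> cube_map m n \<phi> s i = s j"
proof -
  \<comment> \<open>In \<open>box_real_update\<close> the clause on \<open>\<psi> s i = s j\<close>
    stands below the quantifier over \<open>r\<close>; a member of \<open>{0..1}\<close> releases
    it.\<close>
  have z: "0 \<in> {0..1::real}" by simp
  show thesis
    using box_real_update[OF box_real_cube_map[OF assms(1)] assms(2)] that z by metis
qed

text \<open>A target coordinate that equals \<open>s j\<close> changes with \<open>s j\<close>.
  Hence \<open>j\<close> is not forgotten by \<open>\<phi>\<close>, and the single target coordinate
  fed by \<open>j\<close> must be \<open>i\<close>.\<close>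

lemma cube_map_update_target:
  assumes \<phi>: "box_mor m n \<phi>" and i: "i < n"
  obtains "\<And>s. s \<in> cube m \<Longrightarrow> cube_map m n \<phi> s i \<in> {0, 1}"
  | j where "j < m" "\<And>s r. s \<in> cube m \<Longrightarrow> r \<in> {0..1} \<Longrightarrow> cube_map m n \<phi> (s(j := r)) = (cube_map m n \<phi> s)(i := r)"
      "\<And>s. s \<in> cube m \<Longrightarrow> cube_map m n \<phi> s i = s j"
  using \<phi> i
proof (cases rule: box_mor_coords)
  case (const b)
  then show ?thesis using that(1) by simp
next
  case (proj j)
  \<comment> \<open>The origin and its neighbour in direction \<open>j\<close> tell the alternatives
    apart.\<close>
  have z: "restrict (\<lambda>_. 0) {..<m} \<in> cube m" "(restrict (\<lambda>_. 0) {..<m})(j := 1) \<in> cube m"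
    using proj(1) by (auto intro!: tuplesI cube_update)
  have neq: "cube_map m n \<phi> ((restrict (\<lambda>_. 0) {..<m})(j := 1)) i \<noteq> cube_map m n \<phi> (restrict (\<lambda>_. 0) {..<m}) i"
    using proj z by simp
  from \<phi> proj(1) show ?thesis
  proof (cases rule: cube_map_update_source)
    case 1
    then show ?thesis using neq z(1) by simp
  next
    case (2 i')
    have "i' = i" using 2(2)[OF z(1), of 1] neq by (auto split: if_splits)
    then show ?thesis using that(2)[OF proj(1)] 2 by blast
  qed
qed

subsection \<open>Coordinatewise functions\<close>

definition cmap :: "(real \<Rightarrow> real) \<Rightarrow> nat \<Rightarrow> (nat \<Rightarrow> real) \<Rightarrow> (nat \<Rightarrow> real)" where
  "cmap k n t = (\<lambda>i\<in>{..<n}. k (t i))"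

text \<open>Cofaces insert the coordinates 0 and 1, so \<open>cmap k\<close> commutes with them only
  if \<open>k\<close> fixes both. Continuity and monotonicity are kept apart (see
  \<open>reparam\<close>), because the rounding function \<open>snap\<close> has jumps.\<close>

definition endpoint_fixing :: "(real \<Rightarrow> real) \<Rightarrow> bool" where
  "endpoint_fixing k \<longleftrightarrow> k \<in> {0..1} \<rightarrow> {0..1} \<and> k 0 = 0 \<and> k 1 = 1"

definition above :: "real \<Rightarrow> nat \<Rightarrow> (nat \<Rightarrow> real) \<Rightarrow> (nat \<Rightarrow> bool)" where
  "above r n t = (\<lambda>i\<in>{..<n}. r < t i)"

definition line :: "nat \<Rightarrow> (nat \<Rightarrow> bool) \<Rightarrow> (nat \<Rightarrow> bool) \<Rightarrow> real \<Rightarrow> (nat \<Rightarrow> real)" where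
  "line n v w r = (\<lambda>i\<in>{..<n}. (1 - r) * of_bool (v i) + r * of_bool (w i))"

lemma cmap_nth [simp]: "i < n \<Longrightarrow> cmap k n t i = k (t i)" by (simp add: cmap_def)
lemma above_nth [simp]: "i < n \<Longrightarrow> above r n t i \<longleftrightarrow> r < t i" by (simp add: above_def)
lemma line_nth [simp]: "i < n \<Longrightarrow> line n v w r i = (1 - r) * of_bool (v i) + r * of_bool (w i)" by (simp add: line_def)

lemma tuples_nth: "t \<in> tuples S n \<Longrightarrow> i < n \<Longrightarrow> t i \<in> S"
  using PiE_mem[of t "{..<n}" "\<lambda>_. S" i] by (simp add: tuples_def)

lemmas cube_nth = tuples_nth[where S = "{0..1::real}"]

lemma cmap_mem: "k \<in> {0..1} \<rightarrow> {0..1} \<Longrightarrow> t \<in> cube n \<Longrightarrow> cmap k n t \<in> cube n"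
  unfolding cmap_def by (rule tuplesI) (blast intro: funcset_mem cube_nth)

lemma above_mem: "above r n t \<in> verts n" by (simp add: above_def tuplesI)

lemma above_le: "r' \<le> r \<Longrightarrow> (above r n t, above r' n t) \<in> verts_le n"
  by (rule verts_leI) (auto simp: above_mem)

lemma above_mono: "(s, t) \<in> cube_le n \<Longrightarrow> (above r n s, above r n t) \<in> verts_le n"
  by (rule verts_leI) (auto simp: above_mem cube_le_def intro: less_le_trans)

lemma line_mem: "r \<in> {0..1} \<Longrightarrow> line n v w r \<in> cube n"
  unfolding line_def by (rule tuplesI) (auto simp: of_bool_def)

text \<open>Each coordinate of the image is 0, 1 or a source coordinate, and \<open>k\<close> fixes
  0 and 1.\<close>

lemma cube_map_cmap:
  assumes \<phi>: "box_mor m n \<phi>" and k: "endpoint_fixing k" and t: "t \<in> cube m"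
  shows "cube_map m n \<phi> (cmap k m t) = cmap k n (cube_map m n \<phi> t)"
proof (rule tuples_eqI[where S = "{0..1}" and T = "{0..1}"])
  have k': "k \<in> {0..1} \<rightarrow> {0..1}" using k by (simp add: endpoint_fixing_def)
  show "cube_map m n \<phi> (cmap k m t) \<in> cube n" "cmap k n (cube_map m n \<phi> t) \<in> cube n"
    by (intro cube_map_mem[OF \<phi>] cmap_mem[OF k'] t)+
  fix i assume i: "i < n"
  show "cube_map m n \<phi> (cmap k m t) i = cmap k n (cube_map m n \<phi> t) i"
    using \<phi> i
  proof (cases rule: box_mor_coords)
    case (const b)
    then show ?thesis using k i t cmap_mem[OF k' t] by (cases b) (simp_all add: endpoint_fixing_def)
  next
    case (proj j)
    then show ?thesis using k i t cmap_mem[OF k' t] by simp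
  qed
qed

text \<open>The bounds on \<open>r\<close> serve the constant coordinates: 0 is never above
  \<open>r\<close>, and 1 always is.\<close>

lemma above_cube_map:
  assumes \<phi>: "box_mor m n \<phi>" and r: "0 \<le> r" "r < 1" and t: "t \<in> cube m"
  shows "above r n (cube_map m n \<phi> t) = \<phi> (above r m t)"
proof (rule tuples_eqI[where S = UNIV and T = UNIV])
  show "above r n (cube_map m n \<phi> t) \<in> verts n" "\<phi> (above r m t) \<in> verts n"
    by (intro box_mor_mem[OF \<phi>] above_mem)+
  fix i assume i: "i < n"
  show "above r n (cube_map m n \<phi> t) i = \<phi> (above r m t) i"
    using \<phi> i
  proof (cases rule: box_mor_coords)
    case (const b)
    then show ?thesis using r i t above_mem by (cases b) simp_all
  next
    case (proj j)
    then show ?thesis using r i t above_mem by simp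
  qed
qed

lemma cube_map_line:
  assumes \<phi>: "box_mor m n \<phi>" and v: "v \<in> verts m" "w \<in> verts m" and r: "r \<in> {0..1}"
  shows "cube_map m n \<phi> (line m v w r) = line n (\<phi> v) (\<phi> w) r"
proof (rule tuples_eqI[where S = "{0..1}" and T = "{0..1}"])
  show "cube_map m n \<phi> (line m v w r) \<in> cube n" "line n (\<phi> v) (\<phi> w) r \<in> cube n"
    by (intro cube_map_mem[OF \<phi>] line_mem r)+
  fix i assume i: "i < n"
  show "cube_map m n \<phi> (line m v w r) i = line n (\<phi> v) (\<phi> w) r i"
    using \<phi> i
  proof (cases rule: box_mor_coords)
    case (const b)
    then show ?thesis using r i v line_mem[OF r] by simp
  next
    case (proj j)
    then show ?thesis using r i v line_mem[OF r] by simp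
  qed
qed

subsection \<open>Vertices and edges of cubes\<close>

definition vertex_map :: "(nat \<Rightarrow> bool) \<Rightarrow> (nat \<Rightarrow> bool) \<Rightarrow> (nat \<Rightarrow> bool)" where
  "vertex_map v = (\<lambda>x\<in>verts 0. v)"

definition edge_map :: "nat \<Rightarrow> (nat \<Rightarrow> bool) \<Rightarrow> nat \<Rightarrow> (nat \<Rightarrow> bool) \<Rightarrow> (nat \<Rightarrow> bool)" where
  "edge_map n v i = (\<lambda>x\<in>verts 1. \<lambda>j\<in>{..<n}. if j = i then x 0 else v j)"

definition const_vertex :: "nat \<Rightarrow> bool \<Rightarrow> (nat \<Rightarrow> bool)" where
  "const_vertex n b = (\<lambda>_\<in>{..<n}. b)"

lemma const_vertex_nth [simp]: "i < n \<Longrightarrow> const_vertex n b i = b" by (simp add: const_vertex_def)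
lemma const_vertex_mem [simp]: "const_vertex n b \<in> verts n" by (simp add: const_vertex_def tuplesI)
lemma const_vertex_le: "b \<le> b' \<Longrightarrow> (const_vertex n b, const_vertex n b') \<in> verts_le n"
  by (rule verts_leI) auto

lemma verts_0: "verts 0 = {const_vertex 0 b}"
  by (auto simp: tuples_def const_vertex_def)

text \<open>A coface inserts the last coordinate; the others are handled by induction.\<close>

lemma box_mor_vertex:
  assumes "v \<in> verts n"
  shows "box_mor 0 n (vertex_map v)"
  using assms
proof (induction n arbitrary: v)
  case 0
  have "vertex_map v = restrict (\<lambda>x. x) (verts 0)"
    using 0 unfolding vertex_map_def verts_0[of True] by (intro restrict_ext) auto
  then show ?case using box_mor.ident[of 0] by (simp only:)
next
  case (Suc n)
  define u where "u = (\<lambda>i\<in>{..<n}. v i)"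
  have u: "u \<in> verts n" by (simp add: u_def tuplesI)
  have "vertex_map v = compose (verts 0) (restrict (coface n n (v n)) (verts n)) (vertex_map u)"
    unfolding vertex_map_def compose_def
  proof (rule restrict_ext)
    fix x assume "x \<in> verts 0"
    have "v = coface n n (v n) u"
      by (rule tuples_eqI[OF Suc.prems, of _ UNIV]) (auto simp: coface_def u_def tuplesI less_Suc_eq)
    then show "v = restrict (coface n n (v n)) (verts n) ((\<lambda>x\<in>verts 0. u) x)"
      using \<open>x \<in> verts 0\<close> u by simp
  qed
  moreover have "box_mor n (Suc n) (restrict (coface n n (v n)) (verts n))"
    by (rule box_mor.coface) simp
  ultimately show ?case using box_mor.comp Suc.IH[OF u] by metis
qed

text \<open>Fixed coordinates are inserted by cofaces: the last one if it is fixed, otherwise the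
  first one, until only the free coordinate remains.\<close>

lemma box_mor_edge:
  assumes "i < n"
  shows "box_mor 1 n (edge_map n v i)"
  using assms
proof (induction n arbitrary: v i)
  case 0
  then show ?case by simp
next
  case (Suc n)
  consider "i < n" | "i = n" "n = 0" | "i = n" "0 < n" using Suc.prems by linarith
  then show ?case
  proof cases
    case 1
    have "edge_map (Suc n) v i = compose (verts 1) (restrict (coface n n (v n)) (verts n)) (edge_map n v i)"
      unfolding edge_map_def compose_def
    proof (rule restrict_ext)
      fix x assume "x \<in> verts 1"
      have "(\<lambda>j\<in>{..<n}. if j = i then x 0 else v j) \<in> verts n" by (simp add: tuplesI)
      then show "(\<lambda>j\<in>{..<Suc n}. if j = i then x 0 else v j) =
          restrict (coface n n (v n)) (verts n) ((\<lambda>x\<in>verts 1. \<lambda>j\<in>{..<n}. if j = i then x 0 else v j) x)"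
        using \<open>x \<in> verts 1\<close> 1 by (auto simp: coface_def restrict_def fun_eq_iff less_Suc_eq)
    qed
    moreover have "box_mor n (Suc n) (restrict (coface n n (v n)) (verts n))"
      by (rule box_mor.coface) simp
    ultimately show ?thesis using box_mor.comp Suc.IH[OF 1] by metis
  next
    case 2
    have "edge_map (Suc n) v i = restrict (\<lambda>x. x) (verts 1)"
      unfolding edge_map_def
    proof (rule restrict_ext)
      fix x :: "nat \<Rightarrow> bool" assume "x \<in> verts 1"
      then show "(\<lambda>j\<in>{..<Suc n}. if j = i then x 0 else v j) = x"
        using 2 by (intro tuples_eqI[of _ UNIV 1 _ UNIV]) (auto simp: tuplesI)
    qed
    moreover have "Suc n = 1" using 2 by simp
    ultimately show ?thesis using box_mor.ident[of 1] by (simp only:)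
  next
    case 3
    define u where "u = (\<lambda>j. v (Suc j))"
    have "edge_map (Suc n) v i = compose (verts 1) (restrict (coface n 0 (v 0)) (verts n)) (edge_map n u (i - 1))"
      unfolding edge_map_def compose_def
    proof (rule restrict_ext)
      fix x assume "x \<in> verts 1"
      have "(\<lambda>j\<in>{..<n}. if j = i - 1 then x 0 else u j) \<in> verts n" by (simp add: tuplesI)
      then show "(\<lambda>j\<in>{..<Suc n}. if j = i then x 0 else v j) =
          restrict (coface n 0 (v 0)) (verts n) ((\<lambda>x\<in>verts 1. \<lambda>j\<in>{..<n}. if j = i - 1 then x 0 else u j) x)"
        using \<open>x \<in> verts 1\<close> 3 by (auto simp: coface_def restrict_def fun_eq_iff u_def)
    qed
    moreover have "box_mor n (Suc n) (restrict (coface n 0 (v 0)) (verts n))"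
      by (rule box_mor.coface) simp
    moreover have "i - 1 < n" using 3 by simp
    ultimately show ?thesis using box_mor.comp Suc.IH by metis
  qed
qed

text \<open>Cochains are multiplicative, so identities for pairs \<open>v \<le> w\<close> need only
  be propagated across single edges. The induction raises one coordinate at a time and keeps
  \<open>v\<close> fixed.\<close>

lemma verts_le_induct [consumes 1, case_names refl edge]:
  assumes "(v, w) \<in> verts_le n"
    and "\<And>v. v \<in> verts n \<Longrightarrow> P v v"
    and "\<And>v u i. (v, u) \<in> verts_le n \<Longrightarrow> P v u \<Longrightarrow> i < n \<Longrightarrow> \<not> u i \<Longrightarrow> P v (u(i := True))"
  shows "P v w"
  using assms(1)
proof (induction "card {i. i < n \<and> w i \<and> \<not> v i}" arbitrary: w)
  case 0
  have "{i. i < n \<and> w i \<and> \<not> v i} = {}" using 0 by simp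
  then have "v = w" using 0(2) by (intro tuples_eqI[of v UNIV n w UNIV]) (auto simp: verts_le_def)
  then show ?case using 0(2) assms(2) by (auto simp: verts_le_def)
next
  case (Suc k)
  then obtain i where i: "i < n" "w i" "\<not> v i" by (metis (mono_tags, lifting) Collect_empty_eq card.empty nat.distinct(1))
  let ?u = "w(i := False)"
  have "{i. i < n \<and> w i \<and> \<not> v i} = insert i {j. j < n \<and> ?u j \<and> \<not> v j}" using i by auto
  then have "k = card {j. j < n \<and> ?u j \<and> \<not> v j}" using Suc(2) by simp
  moreover have u: "(v, ?u) \<in> verts_le n"
    using Suc(3) i by (auto simp: verts_le_def tuples_def PiE_iff extensional_def)
  ultimately have "P v ?u" using Suc(1) by blast
  then have "P v (?u(i := True))" using assms(3)[of v ?u i] u i by simp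
  moreover have "?u(i := True) = w" using i by (auto simp: fun_eq_iff)
  ultimately show ?case by simp
qed

subsection \<open>Cochains\<close>

lemma ner_cellD:
  assumes "F \<in> cells (ner \<tau>) n"
  shows "(v, w) \<in> verts_le n \<Longrightarrow> F (v, w) \<in> carrier \<tau>"
    and "v \<in> verts n \<Longrightarrow> F (v, v) = \<one>\<^bsub>\<tau>\<^esub>"
    and "(u, v) \<in> verts_le n \<Longrightarrow> (v, w) \<in> verts_le n \<Longrightarrow> F (u, w) = F (v, w) \<otimes>\<^bsub>\<tau>\<^esub> F (u, v)"
    and "F \<in> extensional (verts_le n)"
  using assms by (auto simp: ner_def PiE_iff)

lemma ner_cellI:
  assumes "F \<in> extensional (verts_le n)"
    and "\<And>v w. (v, w) \<in> verts_le n \<Longrightarrow> F (v, w) \<in> carrier \<tau>"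
    and "\<And>v. v \<in> verts n \<Longrightarrow> F (v, v) = \<one>\<^bsub>\<tau>\<^esub>"
    and "\<And>u v w. (u, v) \<in> verts_le n \<Longrightarrow> (v, w) \<in> verts_le n \<Longrightarrow> F (u, w) = F (v, w) \<otimes>\<^bsub>\<tau>\<^esub> F (u, v)"
  shows "F \<in> cells (ner \<tau>) n"
  using assms by (auto simp: ner_def PiE_iff)

lemma act_ner [simp]: "(v, w) \<in> verts_le m \<Longrightarrow> act (ner \<tau>) m n \<phi> F (v, w) = F (\<phi> v, \<phi> w)"
  by (simp add: ner_def)

lemma act_ner_extensional: "act (ner \<tau>) m n \<phi> F \<in> extensional (verts_le m)"
  by (simp add: ner_def)

lemma verts_le_eqI:
  assumes "F \<in> extensional (verts_le n)" "G \<in> extensional (verts_le n)"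
    and "\<And>v w. (v, w) \<in> verts_le n \<Longrightarrow> F (v, w) = G (v, w)"
  shows "F = G"
  using assms(1,2)
proof (rule extensionalityI)
  fix z assume "z \<in> verts_le n"
  then show "F z = G z" using assms(3)[of "fst z" "snd z"] by simp
qed

abbreviation cochains :: "'c cubical \<Rightarrow> ('t, 'm) monoid_scheme \<Rightarrow> ('c, 't) cochain set" where
  "cochains C \<tau> \<equiv> cubical_hom C (ner \<tau>)"

lemma cubical_homD:
  assumes "f \<in> cubical_hom C D"
  shows "c \<in> cells C n \<Longrightarrow> f n c \<in> cells D n"
    and "box_mor m n \<phi> \<Longrightarrow> c \<in> cells C n \<Longrightarrow> f m (act C m n \<phi> c) = act D m n \<phi> (f n c)"
    and "f n \<in> extensional (cells C n)"
  using assms unfolding cubical_hom_def by (blast, blast, simp add: PiE_iff)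

lemma cubical_homI:
  assumes "\<And>n. f n \<in> extensional (cells C n)"
    and "\<And>n c. c \<in> cells C n \<Longrightarrow> f n c \<in> cells D n"
    and "\<And>m n \<phi> c. box_mor m n \<phi> \<Longrightarrow> c \<in> cells C n \<Longrightarrow> f m (act C m n \<phi> c) = act D m n \<phi> (f n c)"
  shows "f \<in> cubical_hom C D"
  using assms unfolding cubical_hom_def by (simp add: PiE_iff)

lemma cubical_setD:
  assumes "cubical_set C"
  shows "box_mor m n \<phi> \<Longrightarrow> c \<in> cells C n \<Longrightarrow> act C m n \<phi> c \<in> cells C m"
    and "c \<in> cells C n \<Longrightarrow> act C n n (restrict (\<lambda>x. x) (verts n)) c = c"
    and "box_mor l m \<phi> \<Longrightarrow> box_mor m n \<psi> \<Longrightarrow> c \<in> cells C n \<Longrightarrow>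
        act C l n (compose (verts l) \<psi> \<phi>) c = act C l m \<phi> (act C m n \<psi> c)"
  using assms unfolding cubical_set_def by blast+

lemma cochainsI:
  assumes "\<And>n. f n \<in> extensional (cells C n)"
    and "\<And>n c. c \<in> cells C n \<Longrightarrow> f n c \<in> cells (ner \<tau>) n"
    and "\<And>m n \<phi> c v w. box_mor m n \<phi> \<Longrightarrow> c \<in> cells C n \<Longrightarrow> (v, w) \<in> verts_le m \<Longrightarrow>
      act C m n \<phi> c \<in> cells C m \<Longrightarrow> f m (act C m n \<phi> c) (v, w) = f n c (\<phi> v, \<phi> w)"
    and C: "cubical_set C"
  shows "f \<in> cochains C \<tau>"
proof (rule cubical_homI)
  fix m n \<phi> c assume *: "box_mor m n \<phi>" "c \<in> cells C n"
  then have "act C m n \<phi> c \<in> cells C m" by (rule cubical_setD(1)[OF C])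
  then show "f m (act C m n \<phi> c) = act (ner \<tau>) m n \<phi> (f n c)"
    using * assms(2,3) by (intro verts_le_eqI[OF ner_cellD(4) act_ner_extensional]) auto
qed (use assms in auto)

lemma cochainsD:
  assumes "f \<in> cochains C \<tau>" "c \<in> cells C n"
  shows "(v, w) \<in> verts_le n \<Longrightarrow> f n c (v, w) \<in> carrier \<tau>"
    and "v \<in> verts n \<Longrightarrow> f n c (v, v) = \<one>\<^bsub>\<tau>\<^esub>"
    and "(u, v) \<in> verts_le n \<Longrightarrow> (v, w) \<in> verts_le n \<Longrightarrow> f n c (u, w) = f n c (v, w) \<otimes>\<^bsub>\<tau>\<^esub> f n c (u, v)"
    and "f n c \<in> extensional (verts_le n)"
    and "box_mor m n \<phi> \<Longrightarrow> (x, y) \<in> verts_le m \<Longrightarrow> f m (act C m n \<phi> c) (x, y) = f n c (\<phi> x, \<phi> y)"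
proof -
  note 1 = ner_cellD[OF cubical_homD(1)[OF assms]]
  show "(v, w) \<in> verts_le n \<Longrightarrow> f n c (v, w) \<in> carrier \<tau>"
    and "v \<in> verts n \<Longrightarrow> f n c (v, v) = \<one>\<^bsub>\<tau>\<^esub>"
    and "(u, v) \<in> verts_le n \<Longrightarrow> (v, w) \<in> verts_le n \<Longrightarrow> f n c (u, w) = f n c (v, w) \<otimes>\<^bsub>\<tau>\<^esub> f n c (u, v)"
    and "f n c \<in> extensional (verts_le n)"
    using 1 by blast+
  assume "box_mor m n \<phi>" "(x, y) \<in> verts_le m"
  then show "f m (act C m n \<phi> c) (x, y) = f n c (\<phi> x, \<phi> y)"
    using cubical_homD(2)[OF assms(1) _ assms(2)] by simp
qed

lemma cochains_eqI:
  assumes "f \<in> cochains C \<tau>" "g \<in> cochains C \<tau>"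
    and "\<And>n c v w. c \<in> cells C n \<Longrightarrow> (v, w) \<in> verts_le n \<Longrightarrow> f n c (v, w) = g n c (v, w)"
  shows "f = g"
proof
  fix n
  show "f n = g n"
    using cubical_homD(3)[OF assms(1)] cubical_homD(3)[OF assms(2)]
  proof (rule extensionalityI)
    fix c assume c: "c \<in> cells C n"
    show "f n c = g n c"
      using assms(3)[OF c] by (intro verts_le_eqI[OF cochainsD(4)[OF assms(1) c] cochainsD(4)[OF assms(2) c]])
  qed
qed

section \<open>Edges and vertices of cells; homotopies as functions on 0-cells\<close>

definition edge_value :: "('c, 't) cochain \<Rightarrow> 'c \<Rightarrow> 't" where
  "edge_value f e = f 1 e (const_vertex 1 False, const_vertex 1 True)"

definition vert :: "'c cubical \<Rightarrow> nat \<Rightarrow> 'c \<Rightarrow> (nat \<Rightarrow> bool) \<Rightarrow> 'c" where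
  "vert C n c v = act C 0 n (vertex_map v) c"

lemma vert_mem: "cubical_set C \<Longrightarrow> c \<in> cells C n \<Longrightarrow> v \<in> verts n \<Longrightarrow> vert C n c v \<in> cells C 0"
  unfolding vert_def by (blast intro: cubical_setD(1) box_mor_vertex)

lemma vert_act:
  assumes "cubical_set C" "box_mor m n \<phi>" "c \<in> cells C n" "v \<in> verts m"
  shows "vert C m (act C m n \<phi> c) v = vert C n c (\<phi> v)"
proof -
  have "compose (verts 0) \<phi> (vertex_map v) = vertex_map (\<phi> v)"
    unfolding compose_def by (simp add: vertex_map_def cong: restrict_cong)
  then show ?thesis
    using cubical_setD(3)[OF assms(1) box_mor_vertex[OF assms(4)] assms(2,3)] by (simp add: vert_def)
qed

lemma vert_hom:
  assumes "f \<in> cubical_hom C D" "c \<in> cells C n" "v \<in> verts n"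
  shows "vert D n (f n c) v = f 0 (vert C n c v)"
  using cubical_homD(2)[OF assms(1) box_mor_vertex[OF assms(3)] assms(2)] by (simp add: vert_def)

lemma edge_map_const_vertex:
  assumes "u \<in> verts n" "i < n"
  shows "edge_map n u i (const_vertex 1 b) = u(i := b)"
proof (rule tuples_eqI[where S = UNIV and T = UNIV])
  show "edge_map n u i (const_vertex 1 b) \<in> verts n" by (simp add: edge_map_def tuplesI)
  show "u(i := b) \<in> verts n" using assms by (auto simp: tuples_def PiE_iff extensional_def)
  have "const_vertex 1 b \<in> verts 1" by (rule const_vertex_mem)
  then show "edge_map n u i (const_vertex 1 b) j = (u(i := b)) j" if "j < n" for j
    using that unfolding edge_map_def by (simp del: One_nat_def)
qed

lemma verts_le_update: "u \<in> verts n \<Longrightarrow> i < n \<Longrightarrow> \<not> u i \<Longrightarrow> (u, u(i := True)) \<in> verts_le n"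
  by (rule verts_leI) (auto simp: tuples_def PiE_iff extensional_def)

lemma edge_value_edge_map:
  assumes "f \<in> cochains C \<tau>" "c \<in> cells C n" "u \<in> verts n" "i < n" "\<not> u i"
  shows "edge_value f (act C 1 n (edge_map n u i) c) = f n c (u, u(i := True))"
proof -
  have "u(i := False) = u" using assms(5) by (simp add: fun_eq_iff)
  then show ?thesis
    using cochainsD(5)[OF assms(1,2) box_mor_edge[OF assms(4)] const_vertex_le[of False True 1]]
      edge_map_const_vertex[OF assms(3,4)] by (simp add: edge_value_def)
qed

text \<open>\<open>\<gamma> x\<close> is the value of a homotopy on the edge \<open>x \<otimes> [1]\<close>.\<close>

definition natural_homotopy ::
  "'c cubical \<Rightarrow> ('t, 'm) monoid_scheme \<Rightarrow> ('c, 't) cochain \<Rightarrow> ('c, 't) cochain \<Rightarrow> ('c \<Rightarrow> 't) \<Rightarrow> bool" where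
  "natural_homotopy C \<tau> f g \<gamma> \<longleftrightarrow> (\<forall>x\<in>cells C 0. \<gamma> x \<in> carrier \<tau>) \<and>
     (\<forall>e\<in>cells C 1. \<gamma> (vert C 1 e (const_vertex 1 True)) \<otimes>\<^bsub>\<tau>\<^esub> edge_value f e =
        edge_value g e \<otimes>\<^bsub>\<tau>\<^esub> \<gamma> (vert C 1 e (const_vertex 1 False)))"

text \<open>The squares over the edges of a chain from \<open>v\<close> to \<open>w\<close> are
  pasted side by side.\<close>

lemma natural_homotopy_cell:
  assumes C: "cubical_set C" and "comm_monoid \<tau>" and f: "f \<in> cochains C \<tau>" and g: "g \<in> cochains C \<tau>"
    and \<gamma>: "natural_homotopy C \<tau> f g \<gamma>" and c: "c \<in> cells C n" and vw: "(v, w) \<in> verts_le n"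
  shows "\<gamma> (vert C n c w) \<otimes>\<^bsub>\<tau>\<^esub> f n c (v, w) = g n c (v, w) \<otimes>\<^bsub>\<tau>\<^esub> \<gamma> (vert C n c v)"
proof -
  interpret comm_monoid \<tau> by fact
  have \<gamma>c: "\<gamma> (vert C n c u) \<in> carrier \<tau>" if "u \<in> verts n" for u
    using \<gamma> vert_mem[OF C c that] by (simp add: natural_homotopy_def)
  show ?thesis
    using vw
  proof (induction rule: verts_le_induct)
    case (refl v)
    then show ?case using cochainsD(2)[OF f c refl] cochainsD(2)[OF g c refl] \<gamma>c by simp
  next
    case (edge v u i)
    note edge = edge(1-3) and IH = edge(4)
    let ?u = "u(i := True)" and ?e = "act C 1 n (edge_map n u i) c"
    note u = verts_leD[OF edge(1)]
    have uu: "(u, ?u) \<in> verts_le n" using verts_le_update[OF u(2)] edge by blast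
    note e = box_mor_edge[OF edge(2), of u]
    have eC: "?e \<in> cells C 1" using cubical_setD(1)[OF C e c] .
    have e2: "edge_value f ?e = f n c (u, ?u)" "edge_value g ?e = g n c (u, ?u)"
      using edge_value_edge_map[OF _ c u(2) edge(2,3)] f g by blast+
    have "u(i := False) = u" using edge(3) by (simp add: fun_eq_iff)
    then have "vert C 1 ?e (const_vertex 1 True) = vert C n c ?u"
      "vert C 1 ?e (const_vertex 1 False) = vert C n c u"
      using vert_act[OF C e c] edge_map_const_vertex[OF u(2) edge(2)] by simp_all
    then have sq: "\<gamma> (vert C n c ?u) \<otimes>\<^bsub>\<tau>\<^esub> f n c (u, ?u) = g n c (u, ?u) \<otimes>\<^bsub>\<tau>\<^esub> \<gamma> (vert C n c u)"
      using \<gamma> eC e2 by (auto simp: natural_homotopy_def)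
    note cl = \<gamma>c[OF u(1)] \<gamma>c[OF u(2)] \<gamma>c[OF verts_leD(2)[OF uu]]
      cochainsD(1)[OF f c edge(1)] cochainsD(1)[OF f c uu] cochainsD(1)[OF g c edge(1)] cochainsD(1)[OF g c uu]
    have "\<gamma> (vert C n c ?u) \<otimes>\<^bsub>\<tau>\<^esub> f n c (v, ?u) = (\<gamma> (vert C n c ?u) \<otimes>\<^bsub>\<tau>\<^esub> f n c (u, ?u)) \<otimes>\<^bsub>\<tau>\<^esub> f n c (v, u)"
      using cochainsD(3)[OF f c edge(1) uu] cl by (simp add: m_assoc)
    also have "\<dots> = g n c (u, ?u) \<otimes>\<^bsub>\<tau>\<^esub> (g n c (v, u) \<otimes>\<^bsub>\<tau>\<^esub> \<gamma> (vert C n c v))"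
      unfolding sq using IH cl by (simp add: m_assoc)
    also have "\<dots> = g n c (v, ?u) \<otimes>\<^bsub>\<tau>\<^esub> \<gamma> (vert C n c v)"
      using cochainsD(3)[OF g c edge(1) uu] cl by (simp add: m_assoc)
    finally show ?case .
  qed
qed

subsection \<open>The Day convolution with an interval\<close>

lemma equiv_day: "equiv (day_pre C D n) (day_eq C D n)"
proof (rule equivI)
  show "day_eq C D n \<subseteq> day_pre C D n \<times> day_pre C D n" by (auto simp: day_eq_def)
  show "refl_on (day_pre C D n) (day_eq C D n)" by (auto simp: day_eq_def refl_on_def)
  show "sym (day_eq C D n)" by (auto simp: day_eq_def sym_def intro: equivclp_sym)
  show "trans (day_eq C D n)" unfolding day_eq_def trans_def by (auto intro: equivclp_trans)
qed

definition tensor_fst :: "nat \<Rightarrow> (nat \<Rightarrow> bool) \<Rightarrow> (nat \<Rightarrow> bool)" where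
  "tensor_fst p x = (\<lambda>j\<in>{..<p}. x j)"

definition tensor_snd :: "nat \<Rightarrow> nat \<Rightarrow> (nat \<Rightarrow> bool) \<Rightarrow> (nat \<Rightarrow> bool)" where
  "tensor_snd p q x = (\<lambda>j\<in>{..<q}. x (p + j))"

lemma tensor_fst_mem: "tensor_fst p x \<in> verts p" and tensor_snd_mem: "tensor_snd p q x \<in> verts q"
  by (simp_all add: tensor_fst_def tensor_snd_def tuplesI)

lemma tensor_fst_le: "(x, y) \<in> verts_le (p + q) \<Longrightarrow> (tensor_fst p x, tensor_fst p y) \<in> verts_le p"
  and tensor_snd_le: "(x, y) \<in> verts_le (p + q) \<Longrightarrow> (tensor_snd p q x, tensor_snd p q y) \<in> verts_le q"
proof -
  assume xy: "(x, y) \<in> verts_le (p + q)"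
  show "(tensor_fst p x, tensor_fst p y) \<in> verts_le p"
    by (rule verts_leI[OF tensor_fst_mem tensor_fst_mem]) (use xy in \<open>simp add: tensor_fst_def verts_le_def\<close>)
  show "(tensor_snd p q x, tensor_snd p q y) \<in> verts_le q"
    by (rule verts_leI[OF tensor_snd_mem tensor_snd_mem]) (use xy in \<open>simp add: tensor_snd_def verts_le_def\<close>)
qed

lemma box_tensor_fst:
  assumes "box_mor p p' \<alpha>" "x \<in> verts (p + q)"
  shows "tensor_fst p' (box_tensor p p' \<alpha> q q' \<beta> x) = \<alpha> (tensor_fst p x)"
proof (rule tuples_eqI[where S = UNIV and T = UNIV])
  show "tensor_fst p' (box_tensor p p' \<alpha> q q' \<beta> x) \<in> verts p'" by (rule tensor_fst_mem)
  show "\<alpha> (tensor_fst p x) \<in> verts p'" by (intro box_mor_mem[OF assms(1)] tensor_fst_mem)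
qed (use assms(2) in \<open>simp add: tensor_fst_def box_tensor_def\<close>)

lemma box_tensor_snd:
  assumes "box_mor q q' \<beta>" "x \<in> verts (p + q)"
  shows "tensor_snd p' q' (box_tensor p p' \<alpha> q q' \<beta> x) = \<beta> (tensor_snd p q x)"
proof (rule tuples_eqI[where S = UNIV and T = UNIV])
  show "tensor_snd p' q' (box_tensor p p' \<alpha> q q' \<beta> x) \<in> verts q'" by (rule tensor_snd_mem)
  show "\<beta> (tensor_snd p q x) \<in> verts q'" by (intro box_mor_mem[OF assms(1)] tensor_snd_mem)
qed (use assms(2) in \<open>simp add: tensor_snd_def box_tensor_def\<close>)

text \<open>The action of \<open>tensor\<close> on representatives, before passing to
  classes.\<close>

definition day_push :: "nat \<Rightarrow> ((nat \<Rightarrow> bool) \<Rightarrow> (nat \<Rightarrow> bool)) \<Rightarrow> ('c, 'd) day \<Rightarrow> ('c, 'd) day" where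
  "day_push m \<phi> = (\<lambda>(p, q, c, d, \<theta>). (p, q, c, d, compose (verts m) \<theta> \<phi>))"

lemma day_push_mem: "box_mor m n \<phi> \<Longrightarrow> z \<in> day_pre C D n \<Longrightarrow> day_push m \<phi> z \<in> day_pre C D m"
  by (auto simp: day_pre_def day_push_def intro: box_mor.comp)

lemma day_glueI:
  assumes "box_mor p p' \<alpha>" "box_mor q q' \<beta>" "c \<in> cells C p'" "d \<in> cells D q'" "box_mor n (p + q) \<theta>"
  shows "day_glue C D n (p, q, act C p p' \<alpha> c, act D q q' \<beta> d, \<theta>)
    (p', q', c, d, compose (verts n) (box_tensor p p' \<alpha> q q' \<beta>) \<theta>)"
  using assms unfolding day_glue_def by blast

lemma day_push_glue:
  assumes \<phi>: "box_mor m n \<phi>" and "day_glue C D n x y"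
  shows "day_glue C D m (day_push m \<phi> x) (day_push m \<phi> y)"
proof -
  from assms(2) obtain p p' q q' \<alpha> \<beta> c d \<theta> where *: "box_mor p p' \<alpha>" "box_mor q q' \<beta>" "c \<in> cells C p'" "d \<in> cells D q'"
    "box_mor n (p + q) \<theta>" "x = (p, q, act C p p' \<alpha> c, act D q q' \<beta> d, \<theta>)"
    "y = (p', q', c, d, compose (verts n) (box_tensor p p' \<alpha> q q' \<beta>) \<theta>)"
    unfolding day_glue_def by blast
  have "compose (verts m) (compose (verts n) (box_tensor p p' \<alpha> q q' \<beta>) \<theta>) \<phi> =
      compose (verts m) (box_tensor p p' \<alpha> q q' \<beta>) (compose (verts m) \<theta> \<phi>)"
    using box_mor_mem[OF \<phi>] by (auto simp: compose_def fun_eq_iff)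
  then show ?thesis
    unfolding day_glue_def day_push_def using * box_mor.comp[OF \<phi> *(5)]
    by (intro exI[of _ p] exI[of _ p'] exI[of _ q] exI[of _ q'] exI[of _ \<alpha>] exI[of _ \<beta>] exI[of _ c] exI[of _ d]
        exI[of _ "compose (verts m) \<theta> \<phi>"]) simp
qed

lemma day_push_eq:
  assumes \<phi>: "box_mor m n \<phi>" and "(x, y) \<in> day_eq C D n"
  shows "(day_push m \<phi> x, day_push m \<phi> y) \<in> day_eq C D m"
proof -
  have "equivclp (day_glue C D n) x y" using assms(2) by (simp add: day_eq_def)
  then have "equivclp (day_glue C D m) (day_push m \<phi> x) (day_push m \<phi> y)"
  proof (induction rule: equivclp_induct)
    case (step y z)
    then show ?case using day_push_glue[OF \<phi>]
      by (meson equivclp_into_equivclp)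
  qed simp
  then show ?thesis using assms(2) day_push_mem[OF \<phi>, of x C D] day_push_mem[OF \<phi>, of y C D] by (simp add: day_eq_def)
qed

abbreviation day_class :: "'c cubical \<Rightarrow> 'd cubical \<Rightarrow> nat \<Rightarrow> ('c, 'd) day \<Rightarrow> ('c, 'd) day set" where
  "day_class C D n z \<equiv> day_eq C D n `` {z}"

lemma cells_tensor: "cells (tensor C D) n = day_pre C D n // day_eq C D n"
  by (simp add: tensor_def)

lemma day_class_mem: "z \<in> day_pre C D n \<Longrightarrow> day_class C D n z \<in> cells (tensor C D) n"
  by (simp add: cells_tensor quotientI)

lemma day_class_eqI: "(x, y) \<in> day_eq C D n \<Longrightarrow> day_class C D n x = day_class C D n y"
  by (rule equiv_class_eq[OF equiv_day])

lemma act_tensor: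
  assumes \<phi>: "box_mor m n \<phi>" and z: "z \<in> day_pre C D n"
  shows "act (tensor C D) m n \<phi> (day_class C D n z) = day_class C D m (day_push m \<phi> z)"
proof -
  have "act (tensor C D) m n \<phi> (day_class C D n z) = day_eq C D m `` (day_push m \<phi> ` day_class C D n z)"
  proof -
    have eq: "{(p, q, c, d, compose (verts m) \<theta> \<phi>) |p q c d \<theta>. (p, q, c, d, \<theta>) \<in> A} = day_push m \<phi> ` A"
      for A :: "('a, 'b) day set"
      by (force simp: day_push_def image_iff)
    show ?thesis by (simp only: tensor_def cubical.simps eq)
  qed
  also have "\<dots> = day_class C D m (day_push m \<phi> z)"
  proof
    show "day_eq C D m `` (day_push m \<phi> ` day_class C D n z) \<subseteq> day_class C D m (day_push m \<phi> z)"
    proof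
      fix y assume "y \<in> day_eq C D m `` (day_push m \<phi> ` day_class C D n z)"
      then obtain x where "(z, x) \<in> day_eq C D n" and y: "(day_push m \<phi> x, y) \<in> day_eq C D m" by blast
      then have "(day_push m \<phi> z, day_push m \<phi> x) \<in> day_eq C D m" using day_push_eq[OF \<phi>] by blast
      moreover have "trans (day_eq C D m)" using equiv_day[of C D m] by (rule equivE)
      ultimately show "y \<in> day_class C D m (day_push m \<phi> z)" using y by (auto dest: transD)
    qed
    show "day_class C D m (day_push m \<phi> z) \<subseteq> day_eq C D m `` (day_push m \<phi> ` day_class C D n z)"
      using equiv_class_self[OF equiv_day z] by blast
  qed
  finally show ?thesis .
qed

lemma cells_tensorE:
  assumes "A \<in> cells (tensor C D) n"
  obtains z where "z \<in> day_pre C D n" "A = day_class C D n z"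
  using assms unfolding cells_tensor by (auto elim: quotientE)

text \<open>The test on \<open>d\<close> tells at which end of the cylinder a vertex lies. From end
  0 to end 1 the formula follows \<open>f\<close> first and then climbs at the last vertex, with
  value \<open>\<gamma>\<close>. For \<open>x \<le> y\<close> it never happens that \<open>x\<close>
  is at end 1 and \<open>y\<close> at end 0.\<close>

definition cylinder_homotopy :: "'c cubical \<Rightarrow> ('t, 'm) monoid_scheme \<Rightarrow> ('c, 't) cochain \<Rightarrow> ('c, 't) cochain \<Rightarrow> ('c \<Rightarrow> 't) \<Rightarrow>
    nat \<Rightarrow> ('c, (nat \<Rightarrow> bool) \<Rightarrow> (nat \<Rightarrow> bool)) day \<Rightarrow> (nat \<Rightarrow> bool) \<times> (nat \<Rightarrow> bool) \<Rightarrow> 't" where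
  "cylinder_homotopy C \<tau> f g \<gamma> n = (\<lambda>(p, q, c, d, \<theta>). \<lambda>(x, y)\<in>verts_le n.
     (let x' = tensor_fst p (\<theta> x); y' = tensor_fst p (\<theta> y) in
      if d (tensor_snd p q (\<theta> x)) 0 then g p c (x', y')
      else if d (tensor_snd p q (\<theta> y)) 0 then \<gamma> (vert C p c y') \<otimes>\<^bsub>\<tau>\<^esub> f p c (x', y')
      else f p c (x', y')))"

lemma cells_representable [simp]: "cells (representable k) n = {\<psi>. box_mor n k \<psi>}"
  and act_representable [simp]: "act (representable k) m n \<phi> \<psi> = compose (verts m) \<psi> \<phi>"
  by (simp_all add: representable_def)

lemma cylinder_homotopy_cell:
  assumes C: "cubical_set C" and \<tau>: "comm_monoid \<tau>" and f: "f \<in> cochains C \<tau>" and g: "g \<in> cochains C \<tau>"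
    and \<gamma>: "natural_homotopy C \<tau> f g \<gamma>" and z: "z \<in> day_pre C (representable 1) n"
  shows "cylinder_homotopy C \<tau> f g \<gamma> n z \<in> cells (ner \<tau>) n"
proof -
  interpret comm_monoid \<tau> by fact
  obtain p q c d \<theta> where z': "z = (p, q, c, d, \<theta>)" "c \<in> cells C p" "box_mor q 1 d" "box_mor n (p + q) \<theta>"
    using z by (auto simp: day_pre_def)
  define a where "a x = tensor_fst p (\<theta> x)" for x
  define b where "b x = d (tensor_snd p q (\<theta> x)) 0" for x
  have val: "cylinder_homotopy C \<tau> f g \<gamma> n z (x, y) = (if b x then g p c (a x, a y)
      else if b y then \<gamma> (vert C p c (a y)) \<otimes>\<^bsub>\<tau>\<^esub> f p c (a x, a y) else f p c (a x, a y))"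
    if "(x, y) \<in> verts_le n" for x y
    using that by (simp add: cylinder_homotopy_def z' a_def b_def Let_def)
  have a: "a x \<in> verts p" for x by (simp add: a_def tensor_fst_mem)
  have le: "(a x, a y) \<in> verts_le p" "b x \<Longrightarrow> b y" if "(x, y) \<in> verts_le n" for x y
  proof -
    have th: "(\<theta> x, \<theta> y) \<in> verts_le (p + q)" by (rule box_mor_verts_le[OF z'(4) that])
    then show "(a x, a y) \<in> verts_le p" by (simp add: a_def tensor_fst_le)
    have "(d (tensor_snd p q (\<theta> x)), d (tensor_snd p q (\<theta> y))) \<in> verts_le 1"
      using box_mor_verts_le[OF z'(3) tensor_snd_le[OF th]] .
    then show "b x \<Longrightarrow> b y" by (simp add: b_def verts_le_def)
  qed
  have \<gamma>c: "\<gamma> (vert C p c (a x)) \<in> carrier \<tau>" for x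
    using \<gamma> vert_mem[OF C z'(2) a] by (simp add: natural_homotopy_def)
  note fD = cochainsD[OF f z'(2)] and gD = cochainsD[OF g z'(2)]
  note nat = natural_homotopy_cell[OF C \<tau> f g \<gamma> z'(2)]
  show ?thesis
  proof (rule ner_cellI)
    show "cylinder_homotopy C \<tau> f g \<gamma> n z \<in> extensional (verts_le n)"
      by (simp add: cylinder_homotopy_def z')
    show "cylinder_homotopy C \<tau> f g \<gamma> n z (x, y) \<in> carrier \<tau>" if "(x, y) \<in> verts_le n" for x y
      using le(1)[OF that] fD(1) gD(1) \<gamma>c by (simp add: val[OF that])
    show "cylinder_homotopy C \<tau> f g \<gamma> n z (x, x) = \<one>\<^bsub>\<tau>\<^esub>" if "x \<in> verts n" for x
      using fD(2)[OF a] gD(2)[OF a] \<gamma>c by (simp add: val[OF verts_le_refl[OF that]])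
    fix x y w assume xy: "(x, y) \<in> verts_le n" and yw: "(y, w) \<in> verts_le n"
    note l = le(1)[OF xy] le(1)[OF yw]
    note cl = fD(1)[OF l(1)] fD(1)[OF l(2)] gD(1)[OF l(1)] gD(1)[OF l(2)] \<gamma>c
    consider "b x" "b y" "b w" | "\<not> b x" "b y" "b w" | "\<not> b x" "\<not> b y" "b w" | "\<not> b x" "\<not> b y" "\<not> b w"
      using le(2)[OF xy] le(2)[OF yw] by blast
    then show "cylinder_homotopy C \<tau> f g \<gamma> n z (x, w) =
        cylinder_homotopy C \<tau> f g \<gamma> n z (y, w) \<otimes>\<^bsub>\<tau>\<^esub> cylinder_homotopy C \<tau> f g \<gamma> n z (x, y)"
    proof cases
      \<comment> \<open>The climb happens between \<open>x\<close> and \<open>y\<close>, whereas the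
        formula for \<open>(x, w)\<close> climbs at \<open>w\<close>. Naturality of
        \<open>\<gamma>\<close> moves the climb back from \<open>w\<close> to
        \<open>y\<close>.\<close>
      case 2
      have "\<gamma> (vert C p c (a w)) \<otimes>\<^bsub>\<tau>\<^esub> f p c (a x, a w) =
          (\<gamma> (vert C p c (a w)) \<otimes>\<^bsub>\<tau>\<^esub> f p c (a y, a w)) \<otimes>\<^bsub>\<tau>\<^esub> f p c (a x, a y)"
        using fD(3)[OF l] cl by (simp add: m_assoc)
      also have "\<dots> = g p c (a y, a w) \<otimes>\<^bsub>\<tau>\<^esub> (\<gamma> (vert C p c (a y)) \<otimes>\<^bsub>\<tau>\<^esub> f p c (a x, a y))"
        using nat[OF l(2)] cl by (simp add: m_assoc)
      finally show ?thesis using 2 by (simp add: val[OF xy] val[OF yw] val[OF verts_le_trans[OF xy yw]])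
    qed (use fD(3)[OF l] gD(3)[OF l] cl in
        \<open>simp_all add: val[OF xy] val[OF yw] val[OF verts_le_trans[OF xy yw]] m_assoc\<close>)
  qed
qed

text \<open>The formula uses \<open>\<theta>\<close> only through the two projections of its values,
  and on these \<open>box_tensor\<close> acts by one factor each.\<close>

lemma cylinder_homotopy_glue:
  assumes C: "cubical_set C" and f: "f \<in> cochains C \<tau>" and g: "g \<in> cochains C \<tau>"
    and "day_glue C (representable 1) n z z'"
  shows "cylinder_homotopy C \<tau> f g \<gamma> n z = cylinder_homotopy C \<tau> f g \<gamma> n z'"
proof -
  from assms(4) obtain p p' q q' \<alpha> \<beta> c d \<theta> where *: "box_mor p p' \<alpha>" "box_mor q q' \<beta>" "c \<in> cells C p'"
    "box_mor q' 1 d" "box_mor n (p + q) \<theta>" "z = (p, q, act C p p' \<alpha> c, compose (verts q) d \<beta>, \<theta>)"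
    "z' = (p', q', c, d, compose (verts n) (box_tensor p p' \<alpha> q q' \<beta>) \<theta>)"
    unfolding day_glue_def by auto
  have "cylinder_homotopy C \<tau> f g \<gamma> n z (x, y) = cylinder_homotopy C \<tau> f g \<gamma> n z' (x, y)"
    if xy: "(x, y) \<in> verts_le n" for x y
  proof -
    have th: "\<theta> x \<in> verts (p + q)" "\<theta> y \<in> verts (p + q)"
      using box_mor_mem[OF *(5)] verts_leD[OF xy] by auto
    note a = box_mor_verts_le[OF *(5) xy, THEN tensor_fst_le]
    show ?thesis
      using xy th verts_leD[OF xy]
      by (simp add: cylinder_homotopy_def * Let_def compose_eq box_tensor_fst[OF *(1)] box_tensor_snd[OF *(2)]
          tensor_fst_mem tensor_snd_mem cochainsD(5)[OF f *(3) *(1) a] cochainsD(5)[OF g *(3) *(1) a]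
          vert_act[OF C *(1) *(3)])
  qed
  then show ?thesis
    by (intro verts_le_eqI[of _ n]) (auto simp: cylinder_homotopy_def * Let_def)
qed

lemma cylinder_homotopy_class:
  assumes C: "cubical_set C" and f: "f \<in> cochains C \<tau>" and g: "g \<in> cochains C \<tau>"
    and "(z, z') \<in> day_eq C (representable 1) n"
  shows "cylinder_homotopy C \<tau> f g \<gamma> n z = cylinder_homotopy C \<tau> f g \<gamma> n z'"
proof -
  have "equivclp (day_glue C (representable 1) n) z z'" using assms(4) by (simp add: day_eq_def)
  then show ?thesis
  proof (induction rule: equivclp_induct)
    case (step y z)
    then show ?case using cylinder_homotopy_glue[OF C f g] by metis
  qed simp
qed

text \<open>Together with \<open>natural_if_homotopic\<close>, this replaces cubical functions on a
  Day convolution by a function on 0-cells. All homotopies below are produced and used in that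
  form.\<close>

lemma homotopic_if_natural:
  assumes C: "cubical_set C" and \<tau>: "comm_monoid \<tau>" and f: "f \<in> cochains C \<tau>" and g: "g \<in> cochains C \<tau>"
    and \<gamma>: "natural_homotopy C \<tau> f g \<gamma>"
  shows "cochain_homotopic C \<tau> f g"
proof -
  let ?I = "representable 1" and ?K = "cylinder_homotopy C \<tau> f g \<gamma>"
  \<comment> \<open>The choice of a representative is harmless by
    \<open>cylinder_homotopy_class\<close>.\<close>
  define H where "H n = (\<lambda>A\<in>cells (tensor C ?I) n. ?K n (SOME z. z \<in> A))" for n
  have H: "H n (day_class C ?I n z) = ?K n z" if z: "z \<in> day_pre C ?I n" for n z
  proof -
    have "z \<in> day_class C ?I n z" by (rule equiv_class_self[OF equiv_day z])
    then have "(SOME y. y \<in> day_class C ?I n z) \<in> day_class C ?I n z" by (rule someI)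
    then have "?K n (SOME y. y \<in> day_class C ?I n z) = ?K n z"
      using cylinder_homotopy_class[OF C f g] by (metis Image_singleton_iff)
    then show ?thesis using day_class_mem[OF z] by (simp add: H_def)
  qed
  have "H \<in> cubical_hom (tensor C ?I) (ner \<tau>)"
  proof (rule cubical_homI)
    show "H n \<in> extensional (cells (tensor C ?I) n)" for n by (simp add: H_def)
    show "H n A \<in> cells (ner \<tau>) n" if A: "A \<in> cells (tensor C ?I) n" for n A
      using A by (elim cells_tensorE) (simp only: H cylinder_homotopy_cell[OF C \<tau> f g \<gamma>])
    fix m n \<phi> A assume \<phi>: "box_mor m n \<phi>" and "A \<in> cells (tensor C ?I) n"
    then obtain z where z: "z \<in> day_pre C ?I n" "A = day_class C ?I n z" by (elim cells_tensorE)
    obtain p q c d \<theta> where z': "z = (p, q, c, d, \<theta>)" by (cases z)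
    have "?K m (day_push m \<phi> z) = act (ner \<tau>) m n \<phi> (?K n z)"
    proof (rule verts_le_eqI[OF _ act_ner_extensional])
      show "?K m (day_push m \<phi> z) \<in> extensional (verts_le m)"
        by (simp add: cylinder_homotopy_def day_push_def z')
      fix v w assume vw: "(v, w) \<in> verts_le m"
      then show "?K m (day_push m \<phi> z) (v, w) = act (ner \<tau>) m n \<phi> (?K n z) (v, w)"
        using box_mor_verts_le[OF \<phi> vw] verts_leD[OF vw]
        by (simp add: cylinder_homotopy_def day_push_def z' compose_eq Let_def)
    qed
    then show "H m (act (tensor C ?I) m n \<phi> A) = act (ner \<tau>) m n \<phi> (H n A)"
      using act_tensor[OF \<phi> z(1)] z H day_push_mem[OF \<phi> z(1)] by simp
  qed
  moreover have "cubical_comp C H (cylinder_end C b) = (if b then g else f)" for b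
  proof
    fix n
    show "cubical_comp C H (cylinder_end C b) n = (if b then g else f) n"
    proof (rule extensionalityI)
      show "cubical_comp C H (cylinder_end C b) n \<in> extensional (cells C n)"
        by (simp add: cubical_comp_def)
      show "(if b then g else f) n \<in> extensional (cells C n)"
        using cubical_homD(3)[OF f] cubical_homD(3)[OF g] by simp
      fix c assume c: "c \<in> cells C n"
      let ?z = "(n, 0, c, restrict (coface 0 0 b) (verts 0), restrict (\<lambda>x. x) (verts n))"
      have "box_mor 0 (Suc 0) (restrict (coface 0 0 b) (verts 0))" by (rule box_mor.coface) simp
      then have z: "?z \<in> day_pre C ?I n"
        using c box_mor.ident[of n] by (simp add: day_pre_def)
      have "?K n ?z (v, w) = (if b then g else f) n c (v, w)" if "(v, w) \<in> verts_le n" for v w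
      proof -
        have [simp]: "tensor_fst n x = x" if "x \<in> verts n" for x
          using that by (intro tuples_eqI[where S = UNIV and T = UNIV and n = n]) (simp_all add: tensor_fst_mem, simp add: tensor_fst_def)
        show ?thesis
          using that verts_leD[OF that] tensor_snd_mem[of n 0]
          by (simp add: cylinder_homotopy_def coface_def)
      qed
      moreover have "?K n ?z \<in> extensional (verts_le n)" by (simp add: cylinder_homotopy_def)
      moreover have "(if b then g else f) n c \<in> extensional (verts_le n)"
        using cochainsD(4)[OF f c] cochainsD(4)[OF g c] by simp
      ultimately have "?K n ?z = (if b then g else f) n c" by (intro verts_le_eqI)
      then show "cubical_comp C H (cylinder_end C b) n c = (if b then g else f) n c"
        using c H[OF z] by (simp add: cubical_comp_def cylinder_end_def compose_eq)
    qed
  qed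
  ultimately show ?thesis
    using f g unfolding cochain_homotopic_def by (intro conjI bexI[of _ H]) simp_all
qed

text \<open>\<open>\<gamma> x\<close> is the value of the homotopy on the segment over
  \<open>x\<close>. The equation for an edge \<open>e\<close> compares the two ways around the
  square over \<open>e\<close>.\<close>

lemma natural_if_homotopic:
  assumes C: "cubical_set C" and \<tau>: "comm_monoid \<tau>" and "cochain_homotopic C \<tau> f g"
  obtains \<gamma> where "natural_homotopy C \<tau> f g \<gamma>"
proof -
  interpret comm_monoid \<tau> by fact
  let ?I = "representable 1"
  obtain H where H: "H \<in> cubical_hom (tensor C ?I) (ner \<tau>)"
    and ends: "cubical_comp C H (cylinder_end C False) = f" "cubical_comp C H (cylinder_end C True) = g"
    using assms(3) unfolding cochain_homotopic_def by blast
  let ?id = "\<lambda>n. restrict (\<lambda>x. x) (verts n)" and ?b = "const_vertex 1 False" and ?t = "const_vertex 1 True"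
  let ?pt = "\<lambda>b. restrict (coface 0 0 b) (verts 0)"
  have idm [simp]: "box_mor n n (?id n)" for n by (rule box_mor.ident)
  have pt: "box_mor 0 1 (?pt b)" for b using box_mor.coface[of 0 0 b] by simp
  \<comment> \<open>Representatives of the segment over \<open>x\<close> and, in the next line, of
    the square over \<open>e\<close>; all structure maps are identities.\<close>
  define seg where "seg x = (0::nat, 1::nat, x, ?id 1, ?id 1)" for x :: 'a
  define sq where "sq e = (1::nat, 1::nat, e, ?id 1, ?id 2)" for e :: 'a
  have seg: "seg x \<in> day_pre C ?I 1" if "x \<in> cells C 0" for x
    using that idm[of 1] by (simp add: seg_def day_pre_def del: One_nat_def)
  have sq: "sq e \<in> day_pre C ?I 2" if "e \<in> cells C 1" for e
    using that idm[of 1] idm[of 2] by (simp add: sq_def day_pre_def del: One_nat_def)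
  define \<gamma> where "\<gamma> x = H 1 (day_class C ?I 1 (seg x)) (?b, ?t)" for x
  have \<gamma>c: "\<gamma> x \<in> carrier \<tau>" if "x \<in> cells C 0" for x
    unfolding \<gamma>_def
    by (rule ner_cellD(1)[OF cubical_homD(1)[OF H day_class_mem[OF seg[OF that]]]]) (rule const_vertex_le, simp)
  have "\<gamma> (vert C 1 e ?t) \<otimes>\<^bsub>\<tau>\<^esub> edge_value f e = edge_value g e \<otimes>\<^bsub>\<tau>\<^esub> \<gamma> (vert C 1 e ?b)"
    if e: "e \<in> cells C 1" for e
  proof -
    define Q where "Q = H 2 (day_class C ?I 2 (sq e))"
    \<comment> \<open>The coordinate \<open>a\<close> runs along \<open>e\<close>, the coordinate
      \<open>b\<close> along the interval.\<close>
    define v where "v a b = (\<lambda>i\<in>{..<2::nat}. if i = 0 then a else b)" for a b :: bool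
    have v: "v a b \<in> verts 2" for a b by (simp add: v_def tuplesI)
    have v_le: "(v a b, v a' b') \<in> verts_le 2" if "a \<le> a'" "b \<le> b'" for a b a' b'
      using that by (intro verts_leI v) (auto simp: v_def split: if_splits)
    have Q: "Q \<in> cells (ner \<tau>) 2"
      unfolding Q_def by (rule cubical_homD(1)[OF H day_class_mem[OF sq[OF e]]])
    have restr: "H 1 (day_class C ?I 1 (day_push 1 \<delta> (sq e))) (?b, ?t) = Q (\<delta> ?b, \<delta> ?t)"
      if \<delta>: "box_mor 1 2 \<delta>" for \<delta>
      using cubical_homD(2)[OF H \<delta> day_class_mem[OF sq[OF e]]] const_vertex_le[of False True 1]
      by (simp add: act_tensor[OF \<delta> sq[OF e]] Q_def del: One_nat_def)
    have glueI: "day_class C ?I 1 x = day_class C ?I 1 y"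
      if "day_glue C ?I 1 x y" "x \<in> day_pre C ?I 1" "y \<in> day_pre C ?I 1" for x y
      using that by (intro day_class_eqI) (auto simp: day_eq_def intro: r_into_equivclp)
    have vi: "v a b i = (if i = 0 then a else b)" if "i < 2" for a b i using that by (simp add: v_def)
    have edge0: "edge_map 2 (v False b) 0 (const_vertex 1 a) = v a b" for a b
      using edge_map_const_vertex[OF v, of 0 False b a] by (auto simp: v_def fun_eq_iff)
    have edge1: "edge_map 2 (v a False) 1 (const_vertex 1 b) = v a b" for a b
      using edge_map_const_vertex[OF v, of 1 a False b] by (auto simp: v_def fun_eq_iff)
    \<comment> \<open>The edges along \<open>e\<close> lie in the two ends of the cylinder. Gluing
      along the vertex \<open>b\<close> of the second factor identifies the representative used by
      \<open>cylinder_end\<close> with the restricted square.\<close>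
    have bottom: "edge_value (if b then g else f) e = Q (v False b, v True b)" for b
    proof -
      let ?z = "(1::nat, 0::nat, e, ?pt b, ?id 1)" and ?\<delta> = "edge_map 2 (v False b) 0"
      have \<delta>: "box_mor 1 2 ?\<delta>" by (rule box_mor_edge) simp
      have "?\<delta> x = box_tensor 1 1 (?id 1) 0 1 (?pt b) x" if x: "x \<in> verts 1" for x
      proof (rule tuples_eqI[where S = UNIV and T = UNIV and n = 2])
        show "?\<delta> x \<in> verts 2" using box_mor_mem[OF \<delta> x] .
        show "box_tensor 1 1 (?id 1) 0 1 (?pt b) x \<in> verts 2"
          using x by (simp add: box_tensor_def numeral_2_eq_2 tuplesI)
        have 1: "restrict x {..<Suc 0} \<in> verts (Suc 0)" "(\<lambda>j\<in>{..<0}. x (Suc j)) \<in> verts 0" by (rule tuplesI, simp)+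
        show "?\<delta> x i = box_tensor 1 1 (?id 1) 0 1 (?pt b) x i" if "i < 2" for i
          using x that 1 unfolding numeral_2_eq_2 less_Suc_eq
          by (auto simp: edge_map_def box_tensor_def v_def coface_def numeral_2_eq_2)
      qed
      then have "compose (verts 1) (box_tensor 1 1 (?id 1) 0 1 (?pt b)) (?id 1) = compose (verts 1) (?id 2) ?\<delta>"
        using box_mor_mem[OF \<delta>] by (auto simp: compose_def fun_eq_iff)
      moreover have "compose (verts 0) (?id 1) (?pt b) = ?pt b"
        using box_mor_mem[OF pt] by (auto simp: compose_def fun_eq_iff)
      moreover have "day_glue C ?I 1 (1, 0, act C 1 1 (?id 1) e, act ?I 0 1 (?pt b) (?id 1), ?id 1)
          (1, 1, e, ?id 1, compose (verts 1) (box_tensor 1 1 (?id 1) 0 1 (?pt b)) (?id 1))"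
        using idm[of 1] by (intro day_glueI pt e) (simp_all del: One_nat_def)
      ultimately have "day_glue C ?I 1 ?z (day_push 1 ?\<delta> (sq e))"
        by (simp only: act_representable cubical_setD(2)[OF C e] day_push_def sq_def prod.case)
      moreover have "?z \<in> day_pre C ?I 1" using e idm[of 1] pt[of b] by (simp add: day_pre_def del: One_nat_def)
      ultimately have "day_class C ?I 1 ?z = day_class C ?I 1 (day_push 1 ?\<delta> (sq e))"
        by (intro glueI day_push_mem[OF \<delta> sq[OF e]])
      moreover have "(if b then g else f) 1 e = H 1 (day_class C ?I 1 ?z)"
        unfolding ends[symmetric] using e by (simp add: cubical_comp_def cylinder_end_def compose_eq del: One_nat_def)
      ultimately show ?thesis
        using restr[OF \<delta>] unfolding edge_value_def by (simp only: edge0)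
    qed
    \<comment> \<open>Here the gluing runs along the vertex \<open>a\<close> of the first factor, so
      the side of the square over a vertex of \<open>e\<close> becomes the segment over that
      vertex.\<close>
    have side: "\<gamma> (vert C 1 e (const_vertex 1 a)) = Q (v a False, v a True)" for a
    proof -
      let ?x = "vert C 1 e (const_vertex 1 a)" and ?\<delta> = "edge_map 2 (v a False) 1" and ?a = "vertex_map (const_vertex 1 a)"
      have \<delta>: "box_mor 1 2 ?\<delta>" by (rule box_mor_edge) simp
      have a: "box_mor 0 1 ?a" by (rule box_mor_vertex) (rule const_vertex_mem)
      have "?\<delta> x = box_tensor 0 1 ?a 1 1 (?id 1) x" if x: "x \<in> verts 1" for x
      proof (rule tuples_eqI[where S = UNIV and T = UNIV and n = 2])
        show "?\<delta> x \<in> verts 2" using box_mor_mem[OF \<delta> x] .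
        show "box_tensor 0 1 ?a 1 1 (?id 1) x \<in> verts 2"
          using x by (simp add: box_tensor_def numeral_2_eq_2 tuplesI)
        have 1: "restrict x {..<Suc 0} \<in> verts (Suc 0)" "(\<lambda>j\<in>{..<0}. x j) \<in> verts 0" by (rule tuplesI, simp)+
        show "?\<delta> x i = box_tensor 0 1 ?a 1 1 (?id 1) x i" if "i < 2" for i
          using x that 1 unfolding numeral_2_eq_2 less_Suc_eq
          by (auto simp: edge_map_def box_tensor_def v_def vertex_map_def numeral_2_eq_2 tuplesI)
      qed
      then have "compose (verts 1) (box_tensor 0 1 ?a 1 1 (?id 1)) (?id 1) = compose (verts 1) (?id 2) ?\<delta>"
        using box_mor_mem[OF \<delta>] by (auto simp: compose_def fun_eq_iff)
      moreover have "compose (verts 1) (?id 1) (?id 1) = ?id 1"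
        by (auto simp: compose_def fun_eq_iff)
      moreover have "day_glue C ?I 1 (0, 1, act C 0 1 ?a e, act ?I 1 1 (?id 1) (?id 1), ?id 1)
          (1, 1, e, ?id 1, compose (verts 1) (box_tensor 0 1 ?a 1 1 (?id 1)) (?id 1))"
        using idm[of 1] by (intro day_glueI a e) (simp_all del: One_nat_def)
      ultimately have "day_glue C ?I 1 (seg ?x) (day_push 1 ?\<delta> (sq e))"
        by (simp only: act_representable vert_def day_push_def sq_def seg_def prod.case)
      moreover have "seg ?x \<in> day_pre C ?I 1" by (rule seg, rule vert_mem[OF C e], rule const_vertex_mem)
      ultimately have "day_class C ?I 1 (seg ?x) = day_class C ?I 1 (day_push 1 ?\<delta> (sq e))"
        by (intro glueI day_push_mem[OF \<delta> sq[OF e]])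
      then show ?thesis using restr[OF \<delta>] unfolding \<gamma>_def by (simp only: edge1)
    qed
    \<comment> \<open>Both products equal the value of \<open>Q\<close> on the diagonal pair of
      vertices.\<close>
    have "Q (v True False, v True True) \<otimes>\<^bsub>\<tau>\<^esub> Q (v False False, v True False) =
        Q (v False True, v True True) \<otimes>\<^bsub>\<tau>\<^esub> Q (v False False, v False True)"
      using ner_cellD(3)[OF Q v_le v_le, of False True False False True True]
        ner_cellD(3)[OF Q v_le v_le, of False False False True True True] by simp
    then show ?thesis using bottom[of False] bottom[of True] side by simp
  qed
  then have "natural_homotopy C \<tau> f g \<gamma>" using \<gamma>c by (simp add: natural_homotopy_def)
  then show thesis by (rule that)
qed

subsection \<open>The cohomology monoid\<close>

lemma equiv_cohomologous: "equiv (cochains C \<tau>) (cohomologous C \<tau>)"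
proof (rule equivI)
  show "cohomologous C \<tau> \<subseteq> cochains C \<tau> \<times> cochains C \<tau>" by (auto simp: cohomologous_def)
  show "refl_on (cochains C \<tau>) (cohomologous C \<tau>)" by (auto simp: cohomologous_def refl_on_def)
  show "sym (cohomologous C \<tau>)" by (auto simp: cohomologous_def sym_def intro: equivclp_sym)
  show "trans (cohomologous C \<tau>)" unfolding cohomologous_def trans_def by (auto intro: equivclp_trans)
qed

lemma cohomologous_refl: "f \<in> cochains C \<tau> \<Longrightarrow> (f, f) \<in> cohomologous C \<tau>"
  by (simp add: cohomologous_def)

lemma cohomologous_sym: "(f, g) \<in> cohomologous C \<tau> \<Longrightarrow> (g, f) \<in> cohomologous C \<tau>"
  using equiv_cohomologous by (auto elim!: equivE dest: symD)

lemma cohomologous_trans: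
  "(f, g) \<in> cohomologous C \<tau> \<Longrightarrow> (g, h) \<in> cohomologous C \<tau> \<Longrightarrow> (f, h) \<in> cohomologous C \<tau>"
  using equiv_cohomologous by (auto elim!: equivE dest: transD)

lemma cohomologous_if_homotopic: "cochain_homotopic C \<tau> f g \<Longrightarrow> (f, g) \<in> cohomologous C \<tau>"
  using r_into_equivclp[of "cochain_homotopic C \<tau>" f g] by (simp add: cohomologous_def) (simp add: cochain_homotopic_def)

text \<open>Single homotopies generate the relation, so it suffices to treat them. This serves
  multiplication, pullback, change of coefficients and the extension of cochains alike.\<close>

lemma cohomologous_map:
  assumes F: "\<And>f. f \<in> cochains C \<tau> \<Longrightarrow> F f \<in> cochains D \<sigma>"
    and hom: "\<And>f g. cochain_homotopic C \<tau> f g \<Longrightarrow> (F f, F g) \<in> cohomologous D \<sigma>"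
    and fg: "(f, g) \<in> cohomologous C \<tau>"
  shows "(F f, F g) \<in> cohomologous D \<sigma>"
proof -
  have "equivclp (cochain_homotopic C \<tau>) f g" and f: "f \<in> cochains C \<tau>" using fg by (auto simp: cohomologous_def)
  then show ?thesis
  proof (induction rule: equivclp_induct)
    case base
    then show ?case using F by (simp add: cohomologous_refl)
  next
    case (step y z)
    then show ?case using hom[of y z] hom[of z y] cohomologous_sym cohomologous_trans by blast
  qed
qed

text \<open>The operations on \<open>H1\<close> are defined by images of whole classes of
  representatives; such an image is a single class as soon as its members are equivalent.\<close>

lemma equiv_Image_eq:
  assumes E: "equiv S E" and X: "X \<noteq> {}" "\<And>x. x \<in> X \<Longrightarrow> (y, x) \<in> E"
  shows "E `` X = E `` {y}"
proof -
  have "E `` {x} = E `` {y}" if "x \<in> X" for x using equiv_class_eq[OF E X(2)[OF that]] by simp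
  then show ?thesis using X(1) by blast
qed

lemma carrier_H1: "carrier (H1 C \<tau>) = cochains C \<tau> // cohomologous C \<tau>"
  by (simp add: H1_def)

abbreviation cohomology_class :: "'c cubical \<Rightarrow> ('t, 'm) monoid_scheme \<Rightarrow> ('c, 't) cochain \<Rightarrow> ('c, 't) cochain set" where
  "cohomology_class C \<tau> f \<equiv> cohomologous C \<tau> `` {f}"

lemma class_mem: "f \<in> cochains C \<tau> \<Longrightarrow> cohomology_class C \<tau> f \<in> carrier (H1 C \<tau>)"
  by (simp add: carrier_H1 quotientI)

lemma class_eq: "(f, g) \<in> cohomologous C \<tau> \<Longrightarrow> cohomology_class C \<tau> f = cohomology_class C \<tau> g"
  by (rule equiv_class_eq[OF equiv_cohomologous])

lemma class_eqD: "f \<in> cochains C \<tau> \<Longrightarrow> g \<in> cochains C \<tau> \<Longrightarrow>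
    cohomology_class C \<tau> f = cohomology_class C \<tau> g \<Longrightarrow> (f, g) \<in> cohomologous C \<tau>"
  by (simp add: eq_equiv_class_iff[OF equiv_cohomologous])

lemma carrier_H1E:
  assumes "A \<in> carrier (H1 C \<tau>)"
  obtains f where "f \<in> cochains C \<tau>" "A = cohomology_class C \<tau> f"
  using assms unfolding carrier_H1 by (auto elim: quotientE)

context
  fixes C :: "'c cubical" and \<tau> :: "('t, 'm) monoid_scheme"
  assumes C: "cubical_set C" and \<tau>: "comm_monoid \<tau>"
begin

interpretation comm_monoid \<tau> by (rule \<tau>)

lemma cochain_mult_val [simp]:
  "c \<in> cells C n \<Longrightarrow> e \<in> verts_le n \<Longrightarrow> cochain_mult C \<tau> f g n c e = f n c e \<otimes>\<^bsub>\<tau>\<^esub> g n c e"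
  by (simp add: cochain_mult_def)

lemma cochain_one_val [simp]:
  "c \<in> cells C n \<Longrightarrow> e \<in> verts_le n \<Longrightarrow> cochain_one C \<tau> n c e = \<one>\<^bsub>\<tau>\<^esub>"
  by (simp add: cochain_one_def)

lemma cochain_mult_mem:
  assumes f: "f \<in> cochains C \<tau>" and g: "g \<in> cochains C \<tau>"
  shows "cochain_mult C \<tau> f g \<in> cochains C \<tau>"
proof (rule cochainsI[OF _ _ _ C])
  show "cochain_mult C \<tau> f g n \<in> extensional (cells C n)" for n by (simp add: cochain_mult_def)
  show "cochain_mult C \<tau> f g n c \<in> cells (ner \<tau>) n" if c: "c \<in> cells C n" for n c
  proof (rule ner_cellI)
    show "cochain_mult C \<tau> f g n c \<in> extensional (verts_le n)" using c by (simp add: cochain_mult_def)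
    show "cochain_mult C \<tau> f g n c (v, w) \<in> carrier \<tau>" if "(v, w) \<in> verts_le n" for v w
      using that c cochainsD(1)[OF f c that] cochainsD(1)[OF g c that] by simp
    show "cochain_mult C \<tau> f g n c (v, v) = \<one>\<^bsub>\<tau>\<^esub>" if "v \<in> verts n" for v
      using c verts_le_refl[OF that] cochainsD(2)[OF f c that] cochainsD(2)[OF g c that] by simp
    fix u v w assume uv: "(u, v) \<in> verts_le n" and vw: "(v, w) \<in> verts_le n"
    show "cochain_mult C \<tau> f g n c (u, w) = cochain_mult C \<tau> f g n c (v, w) \<otimes>\<^bsub>\<tau>\<^esub> cochain_mult C \<tau> f g n c (u, v)"
      using c uv vw verts_le_trans[OF uv vw] cochainsD(3)[OF f c uv vw] cochainsD(3)[OF g c uv vw]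
        cochainsD(1)[OF f c uv] cochainsD(1)[OF f c vw] cochainsD(1)[OF g c uv] cochainsD(1)[OF g c vw]
      by (simp add: m_ac)
  qed
  fix m n \<phi> c v w assume *: "box_mor m n \<phi>" "c \<in> cells C n" "(v, w) \<in> verts_le m" "act C m n \<phi> c \<in> cells C m"
  show "cochain_mult C \<tau> f g m (act C m n \<phi> c) (v, w) = cochain_mult C \<tau> f g n c (\<phi> v, \<phi> w)"
    using * box_mor_verts_le[OF *(1,3)] cochainsD(5)[OF f *(2,1,3)] cochainsD(5)[OF g *(2,1,3)] by simp
qed

lemma cochain_one_mem: "cochain_one C \<tau> \<in> cochains C \<tau>"
proof (rule cochainsI[OF _ _ _ C])
  show "cochain_one C \<tau> n \<in> extensional (cells C n)" for n by (simp add: cochain_one_def)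
  show "cochain_one C \<tau> n c \<in> cells (ner \<tau>) n" if "c \<in> cells C n" for n c
  proof (rule ner_cellI)
    show "cochain_one C \<tau> n c \<in> extensional (verts_le n)" using that by (simp add: cochain_one_def)
  qed (use that in \<open>simp_all add: verts_le_refl verts_le_trans[of _ _ n]\<close>)
qed (simp add: box_mor_verts_le)

text \<open>The same \<open>\<gamma>\<close> serves: the common factor \<open>h\<close> commutes
  past it.\<close>

lemma cochain_homotopic_mult:
  assumes "cochain_homotopic C \<tau> f g" and h: "h \<in> cochains C \<tau>"
  shows "cochain_homotopic C \<tau> (cochain_mult C \<tau> f h) (cochain_mult C \<tau> g h)"
proof -
  have fg: "f \<in> cochains C \<tau>" "g \<in> cochains C \<tau>" using assms by (simp_all add: cochain_homotopic_def)
  obtain \<gamma> where \<gamma>: "natural_homotopy C \<tau> f g \<gamma>" by (rule natural_if_homotopic[OF C \<tau> assms(1)])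
  have "\<gamma> (vert C 1 e (const_vertex 1 True)) \<otimes>\<^bsub>\<tau>\<^esub> edge_value (cochain_mult C \<tau> f h) e =
      edge_value (cochain_mult C \<tau> g h) e \<otimes>\<^bsub>\<tau>\<^esub> \<gamma> (vert C 1 e (const_vertex 1 False))" if e: "e \<in> cells C 1" for e
  proof -
    have le: "(const_vertex 1 False, const_vertex 1 True) \<in> verts_le 1" by (rule const_vertex_le) simp
    have "edge_value (cochain_mult C \<tau> k h) e = edge_value k e \<otimes>\<^bsub>\<tau>\<^esub> edge_value h e" for k
      using e le by (simp add: edge_value_def del: One_nat_def)
    moreover have "edge_value f e \<in> carrier \<tau>" "edge_value g e \<in> carrier \<tau>" "edge_value h e \<in> carrier \<tau>"
      unfolding edge_value_def by (intro cochainsD(1)[OF _ e le] fg h)+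
    moreover have "\<gamma> (vert C 1 e (const_vertex 1 b)) \<in> carrier \<tau>" for b
      using \<gamma> vert_mem[OF C e const_vertex_mem] by (simp add: natural_homotopy_def)
    moreover have "\<gamma> (vert C 1 e (const_vertex 1 True)) \<otimes>\<^bsub>\<tau>\<^esub> edge_value f e =
        edge_value g e \<otimes>\<^bsub>\<tau>\<^esub> \<gamma> (vert C 1 e (const_vertex 1 False))"
      using \<gamma> e by (simp add: natural_homotopy_def)
    ultimately show ?thesis by (metis m_assoc m_comm)
  qed
  then have "natural_homotopy C \<tau> (cochain_mult C \<tau> f h) (cochain_mult C \<tau> g h) \<gamma>"
    using \<gamma> by (simp add: natural_homotopy_def)
  then show ?thesis using homotopic_if_natural[OF C \<tau>] cochain_mult_mem fg h by blast
qed

lemma cochain_mult_comm: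
  assumes f: "f \<in> cochains C \<tau>" and g: "g \<in> cochains C \<tau>"
  shows "cochain_mult C \<tau> f g = cochain_mult C \<tau> g f"
  by (rule cochains_eqI[OF cochain_mult_mem[OF f g] cochain_mult_mem[OF g f]])
    (use cochainsD(1)[OF f] cochainsD(1)[OF g] in \<open>simp add: m_comm\<close>)

text \<open>One factor is exchanged at a time, the second one after swapping the factors.\<close>

lemma cohomologous_mult:
  assumes ff: "(f, f') \<in> cohomologous C \<tau>" and gg: "(g, g') \<in> cohomologous C \<tau>"
  shows "(cochain_mult C \<tau> f g, cochain_mult C \<tau> f' g') \<in> cohomologous C \<tau>"
proof -
  have mem: "f \<in> cochains C \<tau>" "f' \<in> cochains C \<tau>" "g \<in> cochains C \<tau>" "g' \<in> cochains C \<tau>"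
    using ff gg by (auto simp: cohomologous_def)
  have mult: "(cochain_mult C \<tau> k h, cochain_mult C \<tau> k' h) \<in> cohomologous C \<tau>"
    if "(k, k') \<in> cohomologous C \<tau>" "h \<in> cochains C \<tau>" for k k' h
    using cochain_mult_mem[OF _ that(2)] cohomologous_if_homotopic[OF cochain_homotopic_mult[OF _ that(2)]] that(1)
    by (rule cohomologous_map)
  show ?thesis
    using mult[OF ff mem(3)] mult[OF gg mem(2)]
      cochain_mult_comm[OF mem(3,2)] cochain_mult_comm[OF mem(4,2)] cohomologous_trans by simp
qed

lemma mult_class:
  assumes f: "f \<in> cochains C \<tau>" and g: "g \<in> cochains C \<tau>"
  shows "cohomology_class C \<tau> f \<otimes>\<^bsub>H1 C \<tau>\<^esub> cohomology_class C \<tau> g = cohomology_class C \<tau> (cochain_mult C \<tau> f g)"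
proof -
  have "cohomologous C \<tau> `` {cochain_mult C \<tau> \<alpha> \<beta> |\<alpha> \<beta>. \<alpha> \<in> cohomology_class C \<tau> f \<and> \<beta> \<in> cohomology_class C \<tau> g} =
      cohomology_class C \<tau> (cochain_mult C \<tau> f g)"
    using cohomologous_refl[OF f] cohomologous_refl[OF g] cohomologous_mult
    by (intro equiv_Image_eq[OF equiv_cohomologous]) blast+
  then show ?thesis by (simp add: H1_def)
qed

lemma one_H1: "\<one>\<^bsub>H1 C \<tau>\<^esub> = cohomology_class C \<tau> (cochain_one C \<tau>)"
  by (simp add: H1_def)

lemma comm_monoid_H1: "comm_monoid (H1 C \<tau>)"
proof (rule comm_monoidI)
  show "\<one>\<^bsub>H1 C \<tau>\<^esub> \<in> carrier (H1 C \<tau>)" by (simp add: one_H1 class_mem cochain_one_mem)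
  fix x y z assume "x \<in> carrier (H1 C \<tau>)" "y \<in> carrier (H1 C \<tau>)" "z \<in> carrier (H1 C \<tau>)"
  then obtain f g h where f: "f \<in> cochains C \<tau>" "x = cohomology_class C \<tau> f"
    and g: "g \<in> cochains C \<tau>" "y = cohomology_class C \<tau> g" and h: "h \<in> cochains C \<tau>" "z = cohomology_class C \<tau> h"
    by (elim carrier_H1E)
  show "x \<otimes>\<^bsub>H1 C \<tau>\<^esub> y \<in> carrier (H1 C \<tau>)" using f g by (simp add: mult_class class_mem cochain_mult_mem)
  show "x \<otimes>\<^bsub>H1 C \<tau>\<^esub> y = y \<otimes>\<^bsub>H1 C \<tau>\<^esub> x" using f g cochain_mult_comm by (simp add: mult_class)
  have "cochain_mult C \<tau> (cochain_mult C \<tau> f g) h = cochain_mult C \<tau> f (cochain_mult C \<tau> g h)"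
  proof (rule cochains_eqI[where \<tau> = \<tau>])
    fix n c v w assume c: "c \<in> cells C n" and vw: "(v, w) \<in> verts_le n"
    then show "cochain_mult C \<tau> (cochain_mult C \<tau> f g) h n c (v, w) = cochain_mult C \<tau> f (cochain_mult C \<tau> g h) n c (v, w)"
      using cochainsD(1)[OF f(1) c vw] cochainsD(1)[OF g(1) c vw] cochainsD(1)[OF h(1) c vw] by (simp add: m_assoc)
  qed (intro cochain_mult_mem f(1) g(1) h(1))+
  then show "x \<otimes>\<^bsub>H1 C \<tau>\<^esub> y \<otimes>\<^bsub>H1 C \<tau>\<^esub> z = x \<otimes>\<^bsub>H1 C \<tau>\<^esub> (y \<otimes>\<^bsub>H1 C \<tau>\<^esub> z)"
    using f g h by (simp add: mult_class cochain_mult_mem)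
  have "cochain_mult C \<tau> (cochain_one C \<tau>) f = f"
  proof (rule cochains_eqI[where \<tau> = \<tau>])
    fix n c v w assume c: "c \<in> cells C n" and vw: "(v, w) \<in> verts_le n"
    then show "cochain_mult C \<tau> (cochain_one C \<tau>) f n c (v, w) = f n c (v, w)"
      using cochainsD(1)[OF f(1) c vw] by simp
  qed (intro cochain_mult_mem cochain_one_mem f(1))+
  then show "\<one>\<^bsub>H1 C \<tau>\<^esub> \<otimes>\<^bsub>H1 C \<tau>\<^esub> x = x" using f by (simp add: one_H1 mult_class cochain_one_mem)
qed

end

subsection \<open>Functoriality of cohomology\<close>

lemma cubical_comp_mem:
  assumes C: "cubical_set C" and f: "f \<in> cubical_hom C D" and g: "g \<in> cubical_hom D E"
  shows "cubical_comp C g f \<in> cubical_hom C E"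
proof (rule cubical_homI)
  show "cubical_comp C g f n \<in> extensional (cells C n)" for n by (simp add: cubical_comp_def)
  show "cubical_comp C g f n c \<in> cells E n" if "c \<in> cells C n" for n c
    using that cubical_homD(1)[OF g cubical_homD(1)[OF f]] by (simp add: cubical_comp_def compose_eq)
  fix m n \<phi> c assume *: "box_mor m n \<phi>" "c \<in> cells C n"
  show "cubical_comp C g f m (act C m n \<phi> c) = act E m n \<phi> (cubical_comp C g f n c)"
    using * cubical_setD(1)[OF C *] cubical_homD(2)[OF f *] cubical_homD(2)[OF g *(1) cubical_homD(1)[OF f *(2)]]
    by (simp add: cubical_comp_def compose_eq)
qed

lemma cubical_comp_val: "c \<in> cells C n \<Longrightarrow> cubical_comp C g f n c = g n (f n c)"
  by (simp add: cubical_comp_def compose_eq)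

text \<open>The function on 0-cells is composed with \<open>f 0\<close>.\<close>

lemma cochain_homotopic_pull:
  assumes C: "cubical_set C" and D: "cubical_set D" and \<tau>: "comm_monoid \<tau>" and f: "f \<in> cubical_hom C D"
    and "cochain_homotopic D \<tau> \<alpha> \<beta>"
  shows "cochain_homotopic C \<tau> (cubical_comp C \<alpha> f) (cubical_comp C \<beta> f)"
proof -
  have ab: "\<alpha> \<in> cochains D \<tau>" "\<beta> \<in> cochains D \<tau>" using assms by (simp_all add: cochain_homotopic_def)
  obtain \<gamma> where \<gamma>: "natural_homotopy D \<tau> \<alpha> \<beta> \<gamma>" by (rule natural_if_homotopic[OF D \<tau> assms(5)])
  have "natural_homotopy C \<tau> (cubical_comp C \<alpha> f) (cubical_comp C \<beta> f) (\<lambda>x. \<gamma> (f 0 x))"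
    using \<gamma> cubical_homD(1)[OF f] vert_hom[OF f _ const_vertex_mem, symmetric]
    by (simp add: natural_homotopy_def edge_value_def cubical_comp_val del: One_nat_def)
  then show ?thesis using homotopic_if_natural[OF C \<tau>] cubical_comp_mem[OF C f] ab by blast
qed

lemma H1_pull_class:
  assumes C: "cubical_set C" and D: "cubical_set D" and \<tau>: "comm_monoid \<tau>" and f: "f \<in> cubical_hom C D"
    and \<alpha>: "\<alpha> \<in> cochains D \<tau>"
  shows "H1_pull C D \<tau> f (cohomology_class D \<tau> \<alpha>) = cohomology_class C \<tau> (cubical_comp C \<alpha> f)"
proof -
  have "(cubical_comp C \<alpha> f, cubical_comp C \<beta> f) \<in> cohomologous C \<tau>" if "(\<alpha>, \<beta>) \<in> cohomologous D \<tau>" for \<beta>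
    using cubical_comp_mem[OF C f] cohomologous_if_homotopic[OF cochain_homotopic_pull[OF C D \<tau> f]] that
    by (rule cohomologous_map)
  then have "cohomologous C \<tau> `` ((\<lambda>\<alpha>. cubical_comp C \<alpha> f) ` cohomology_class D \<tau> \<alpha>) =
      cohomology_class C \<tau> (cubical_comp C \<alpha> f)"
    using cohomologous_refl[OF \<alpha>] by (intro equiv_Image_eq[OF equiv_cohomologous]) auto
  then show ?thesis using class_mem[OF \<alpha>] by (simp add: H1_pull_def)
qed

lemma H1_pull_hom:
  assumes C: "cubical_set C" and D: "cubical_set D" and \<tau>: "comm_monoid \<tau>" and f: "f \<in> cubical_hom C D"
  shows "H1_pull C D \<tau> f \<in> hom (H1 D \<tau>) (H1 C \<tau>)"
proof (rule homI)
  fix A B assume "A \<in> carrier (H1 D \<tau>)" "B \<in> carrier (H1 D \<tau>)"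
  then obtain \<alpha> \<beta> where \<alpha>: "\<alpha> \<in> cochains D \<tau>" "A = cohomology_class D \<tau> \<alpha>"
    and \<beta>: "\<beta> \<in> cochains D \<tau>" "B = cohomology_class D \<tau> \<beta>" by (elim carrier_H1E)
  note pull = H1_pull_class[OF C D \<tau> f] and comp = cubical_comp_mem[OF C f]
  show "H1_pull C D \<tau> f A \<in> carrier (H1 C \<tau>)" using \<alpha> by (simp add: pull comp class_mem)
  have "cubical_comp C (cochain_mult D \<tau> \<alpha> \<beta>) f = cochain_mult C \<tau> (cubical_comp C \<alpha> f) (cubical_comp C \<beta> f)"
    using comp[OF cochain_mult_mem[OF D \<tau> \<alpha>(1) \<beta>(1)]] cochain_mult_mem[OF C \<tau> comp[OF \<alpha>(1)] comp[OF \<beta>(1)]]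
    by (rule cochains_eqI) (simp add: cubical_comp_val cochain_mult_def cubical_homD(1)[OF f])
  then show "H1_pull C D \<tau> f (A \<otimes>\<^bsub>H1 D \<tau>\<^esub> B) = H1_pull C D \<tau> f A \<otimes>\<^bsub>H1 C \<tau>\<^esub> H1_pull C D \<tau> f B"
    using \<alpha> \<beta> by (simp add: pull comp mult_class[OF C \<tau>] mult_class[OF D \<tau>] cochain_mult_mem[OF D \<tau>])
qed

section \<open>Change of coefficients\<close>

definition cochain_push :: "'c cubical \<Rightarrow> ('t \<Rightarrow> 's) \<Rightarrow> ('c, 't) cochain \<Rightarrow> ('c, 's) cochain" where
  "cochain_push C h \<alpha> = (\<lambda>n. \<lambda>c\<in>cells C n. ner_map n h (\<alpha> n c))"

lemma cochain_push_val: "c \<in> cells C n \<Longrightarrow> e \<in> verts_le n \<Longrightarrow> cochain_push C h \<alpha> n c e = h (\<alpha> n c e)"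
  by (simp add: cochain_push_def ner_map_def)

lemma cochain_push_mem:
  assumes C: "cubical_set C" and h: "h \<in> hom \<tau> \<sigma>" "h \<one>\<^bsub>\<tau>\<^esub> = \<one>\<^bsub>\<sigma>\<^esub>" and \<alpha>: "\<alpha> \<in> cochains C \<tau>"
  shows "cochain_push C h \<alpha> \<in> cochains C \<sigma>"
proof (rule cochainsI[OF _ _ _ C])
  show "cochain_push C h \<alpha> n \<in> extensional (cells C n)" for n by (simp add: cochain_push_def)
  show "cochain_push C h \<alpha> n c \<in> cells (ner \<sigma>) n" if c: "c \<in> cells C n" for n c
  proof (rule ner_cellI)
    show "cochain_push C h \<alpha> n c \<in> extensional (verts_le n)" using c by (simp add: cochain_push_def ner_map_def)
    show "cochain_push C h \<alpha> n c (v, w) \<in> carrier \<sigma>" if "(v, w) \<in> verts_le n" for v w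
      using that c hom_in_carrier[OF h(1) cochainsD(1)[OF \<alpha> c that]] by (simp add: cochain_push_val)
    show "cochain_push C h \<alpha> n c (v, v) = \<one>\<^bsub>\<sigma>\<^esub>" if "v \<in> verts n" for v
      using c verts_le_refl[OF that] cochainsD(2)[OF \<alpha> c that] h by (simp add: cochain_push_val)
    fix u v w assume uv: "(u, v) \<in> verts_le n" and vw: "(v, w) \<in> verts_le n"
    show "cochain_push C h \<alpha> n c (u, w) = cochain_push C h \<alpha> n c (v, w) \<otimes>\<^bsub>\<sigma>\<^esub> cochain_push C h \<alpha> n c (u, v)"
      using c uv vw verts_le_trans[OF uv vw] cochainsD(3)[OF \<alpha> c uv vw]
        hom_mult[OF h(1) cochainsD(1)[OF \<alpha> c vw] cochainsD(1)[OF \<alpha> c uv]]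
      by (simp add: cochain_push_val)
  qed
  fix m n \<phi> c v w assume *: "box_mor m n \<phi>" "c \<in> cells C n" "(v, w) \<in> verts_le m" "act C m n \<phi> c \<in> cells C m"
  show "cochain_push C h \<alpha> m (act C m n \<phi> c) (v, w) = cochain_push C h \<alpha> n c (\<phi> v, \<phi> w)"
    using * box_mor_verts_le[OF *(1,3)] cochainsD(5)[OF \<alpha> *(2,1,3)] by (simp add: cochain_push_val)
qed

lemma H1_push_class:
  assumes C: "cubical_set C" and \<tau>: "comm_monoid \<tau>" and \<sigma>: "comm_monoid \<sigma>"
    and h: "h \<in> hom \<tau> \<sigma>" "h \<one>\<^bsub>\<tau>\<^esub> = \<one>\<^bsub>\<sigma>\<^esub>" and \<alpha>: "\<alpha> \<in> cochains C \<tau>"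
  shows "H1_push C \<tau> \<sigma> h (cohomology_class C \<tau> \<alpha>) = cohomology_class C \<sigma> (cochain_push C h \<alpha>)"
proof -
  note mem = cochain_push_mem[OF C h]
  have homotopic: "cochain_homotopic C \<sigma> (cochain_push C h f) (cochain_push C h g)"
    if fg: "cochain_homotopic C \<tau> f g" for f g
  proof -
    have f: "f \<in> cochains C \<tau>" and g: "g \<in> cochains C \<tau>" using fg by (simp_all add: cochain_homotopic_def)
    obtain \<gamma> where \<gamma>: "natural_homotopy C \<tau> f g \<gamma>" by (rule natural_if_homotopic[OF C \<tau> fg])
    have "natural_homotopy C \<sigma> (cochain_push C h f) (cochain_push C h g) (\<lambda>x. h (\<gamma> x))"
      unfolding natural_homotopy_def
    proof (intro conjI ballI)
      show "h (\<gamma> x) \<in> carrier \<sigma>" if "x \<in> cells C 0" for x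
        using \<gamma> that hom_in_carrier[OF h(1)] by (simp add: natural_homotopy_def)
      fix e assume e: "e \<in> cells C 1"
      have le: "(const_vertex 1 False, const_vertex 1 True) \<in> verts_le 1" by (rule const_vertex_le) simp
      have "\<gamma> (vert C 1 e (const_vertex 1 b)) \<in> carrier \<tau>" for b
        using \<gamma> vert_mem[OF C e const_vertex_mem] by (simp add: natural_homotopy_def)
      moreover have "edge_value f e \<in> carrier \<tau>" "edge_value g e \<in> carrier \<tau>"
        unfolding edge_value_def by (intro cochainsD(1)[OF _ e le] f g)+
      moreover have "\<gamma> (vert C 1 e (const_vertex 1 True)) \<otimes>\<^bsub>\<tau>\<^esub> edge_value f e =
          edge_value g e \<otimes>\<^bsub>\<tau>\<^esub> \<gamma> (vert C 1 e (const_vertex 1 False))"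
        using \<gamma> e by (simp add: natural_homotopy_def)
      moreover have "edge_value (cochain_push C h k) e = h (edge_value k e)" for k
        using cochain_push_val[OF e le] by (simp add: edge_value_def)
      ultimately show "h (\<gamma> (vert C 1 e (const_vertex 1 True))) \<otimes>\<^bsub>\<sigma>\<^esub> edge_value (cochain_push C h f) e =
          edge_value (cochain_push C h g) e \<otimes>\<^bsub>\<sigma>\<^esub> h (\<gamma> (vert C 1 e (const_vertex 1 False)))"
        using hom_mult[OF h(1)] by metis
    qed
    then show ?thesis using homotopic_if_natural[OF C \<sigma>] mem f g by blast
  qed
  have "(cochain_push C h \<alpha>, cochain_push C h \<beta>) \<in> cohomologous C \<sigma>" if "(\<alpha>, \<beta>) \<in> cohomologous C \<tau>" for \<beta>
    using mem cohomologous_if_homotopic[OF homotopic] that by (rule cohomologous_map)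
  then have "cohomologous C \<sigma> `` (cochain_push C h ` cohomology_class C \<tau> \<alpha>) =
      cohomology_class C \<sigma> (cochain_push C h \<alpha>)"
    using cohomologous_refl[OF \<alpha>] by (intro equiv_Image_eq[OF equiv_cohomologous]) auto
  then show ?thesis using class_mem[OF \<alpha>] by (simp add: H1_push_def cochain_push_def[abs_def])
qed

text \<open>\<open>Q\<close> is a right inverse of restriction on the level of cochains and a left
  inverse up to homotopy. It provides bijectivity only; the homomorphism property comes from
  \<open>H1_pull_hom\<close>.\<close>

lemma H1_pull_iso:
  assumes C: "cubical_set C" and D: "cubical_set D" and \<tau>: "comm_monoid \<tau>" and f: "f \<in> cubical_hom C D"
    and Q: "\<And>\<alpha>. \<alpha> \<in> cochains C \<tau> \<Longrightarrow> Q \<alpha> \<in> cochains D \<tau>"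
    and Q_f: "\<And>\<alpha>. \<alpha> \<in> cochains C \<tau> \<Longrightarrow> cubical_comp C (Q \<alpha>) f = \<alpha>"
    and f_Q: "\<And>\<beta>. \<beta> \<in> cochains D \<tau> \<Longrightarrow> (\<beta>, Q (cubical_comp C \<beta> f)) \<in> cohomologous D \<tau>"
    and Q_hom: "\<And>\<alpha> \<beta>. cochain_homotopic C \<tau> \<alpha> \<beta> \<Longrightarrow> (Q \<alpha>, Q \<beta>) \<in> cohomologous D \<tau>"
  shows "H1_pull C D \<tau> f \<in> iso (H1 D \<tau>) (H1 C \<tau>)"
proof -
  note pull = H1_pull_class[OF C D \<tau> f] and comp = cubical_comp_mem[OF C f]
  have "inj_on (H1_pull C D \<tau> f) (carrier (H1 D \<tau>))"
  proof (rule inj_onI)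
    fix A B assume "A \<in> carrier (H1 D \<tau>)" "B \<in> carrier (H1 D \<tau>)" and eq: "H1_pull C D \<tau> f A = H1_pull C D \<tau> f B"
    then obtain \<alpha> \<beta> where \<alpha>: "\<alpha> \<in> cochains D \<tau>" "A = cohomology_class D \<tau> \<alpha>"
      and \<beta>: "\<beta> \<in> cochains D \<tau>" "B = cohomology_class D \<tau> \<beta>" by (elim carrier_H1E)
    have "(cubical_comp C \<alpha> f, cubical_comp C \<beta> f) \<in> cohomologous C \<tau>"
      using eq \<alpha> \<beta> by (intro class_eqD comp) (simp_all add: pull)
    then have "(Q (cubical_comp C \<alpha> f), Q (cubical_comp C \<beta> f)) \<in> cohomologous D \<tau>"
      using Q Q_hom by (rule cohomologous_map[rotated 2])
    then have "(\<alpha>, \<beta>) \<in> cohomologous D \<tau>"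
      using f_Q[OF \<alpha>(1)] f_Q[OF \<beta>(1)] cohomologous_sym cohomologous_trans by metis
    then show "A = B" using \<alpha> \<beta> class_eq by metis
  qed
  moreover have "A \<in> H1_pull C D \<tau> f ` carrier (H1 D \<tau>)" if "A \<in> carrier (H1 C \<tau>)" for A
  proof -
    from that obtain \<alpha> where \<alpha>: "\<alpha> \<in> cochains C \<tau>" "A = cohomology_class C \<tau> \<alpha>" by (elim carrier_H1E)
    then have "A = H1_pull C D \<tau> f (cohomology_class D \<tau> (Q \<alpha>))" by (simp add: pull Q Q_f)
    then show ?thesis using class_mem[OF Q[OF \<alpha>(1)]] by blast
  qed
  ultimately show ?thesis
    using H1_pull_hom[OF C D \<tau> f] unfolding iso_def bij_betw_def by (auto simp: hom_def)
qed

subsection \<open>The points of the realization\<close>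

text \<open>The relation generated by the gluing alone. \<open>realization_eq\<close> is the least
  relation above it with weak Hausdorff quotient, which is hard to compute with;
  \<open>realization_eq_glue_eq\<close> identifies the two.\<close>

definition glue_eq ::
  "'c cubical \<Rightarrow> (((nat \<times> 'c) \<times> (nat \<Rightarrow> real)) \<times> ((nat \<times> 'c) \<times> (nat \<Rightarrow> real))) set" where
  "glue_eq C = {(x, y). x \<in> topspace (stop (cells_stream C)) \<and> y \<in> topspace (stop (cells_stream C)) \<and>
     equivclp (\<lambda>x y. (x, y) \<in> realization_glue C) x y}"

definition coordwise :: "(real \<Rightarrow> real) \<Rightarrow> (nat \<times> 'c) \<times> (nat \<Rightarrow> real) \<Rightarrow> (nat \<times> 'c) \<times> (nat \<Rightarrow> real)" where
  "coordwise k = (\<lambda>((n, c), t). ((n, c), cmap k n t))"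

text \<open>The choice in \<open>snap A e\<close> is unique if \<open>spaced A e\<close>.\<close>

definition snap :: "real set \<Rightarrow> real \<Rightarrow> real \<Rightarrow> real" where
  "snap A e t = (if \<exists>a\<in>A. \<bar>t - a\<bar> < e then SOME a. a \<in> A \<and> \<bar>t - a\<bar> < e else t)"

text \<open>0 and 1 belong to \<open>A\<close> so that rounding to \<open>A\<close> fixes the
  endpoints. The factor 4 leaves, in every gap of \<open>A\<close>, room for a level at distance
  \<open>2 * e\<close> from both sides; see \<open>cut\<close>.\<close>

definition spaced :: "real set \<Rightarrow> real \<Rightarrow> bool" where
  "spaced A e \<longleftrightarrow> {0, 1} \<subseteq> A \<and> A \<subseteq> {0..1} \<and> e > 0 \<and> (\<forall>a\<in>A. \<forall>b\<in>A. a \<noteq> b \<longrightarrow> 4 * e \<le> \<bar>a - b\<bar>)"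

text \<open>The points that become glued to \<open>x\<close> once all coordinates close to
  \<open>A\<close> are rounded to \<open>A\<close>. Coordinates far from \<open>A\<close> keep their
  values, but by \<open>glue_eq_update\<close> they can be varied freely.\<close>

definition tube :: "'c cubical \<Rightarrow> real set \<Rightarrow> real \<Rightarrow> (nat \<times> 'c) \<times> (nat \<Rightarrow> real) \<Rightarrow> ((nat \<times> 'c) \<times> (nat \<Rightarrow> real)) set" where
  "tube C A e x = {y \<in> topspace (stop (cells_stream C)). (coordwise (snap A e) y, x) \<in> glue_eq C}"

lemma finite_separation:
  fixes A :: "real set"
  assumes "finite A"
  obtains e where "e > 0" "\<And>a b. a \<in> A \<Longrightarrow> b \<in> A \<Longrightarrow> a \<noteq> b \<Longrightarrow> 4 * e \<le> \<bar>a - b\<bar>"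
proof -
  \<comment> \<open>The 1 keeps the minimum defined when \<open>A\<close> has at most one
    element.\<close>
  define D where "D = insert 1 ((\<lambda>(a, b). \<bar>a - b\<bar>) ` {(a, b) \<in> A \<times> A. a \<noteq> b})"
  have fin: "finite D"
    unfolding D_def using finite_subset[of "{(a, b) \<in> A \<times> A. a \<noteq> b}" "A \<times> A"] assms by auto
  have "0 < Min D" using fin by (subst Min_gr_iff) (auto simp: D_def)
  moreover have "Min D \<le> \<bar>a - b\<bar>" if "a \<in> A" "b \<in> A" "a \<noteq> b" for a b
    using fin that by (intro Min_le) (auto simp: D_def image_iff)
  ultimately show thesis using that[of "Min D / 4"] by simp
qed

lemma spaced_exists:
  assumes "finite A" "{0, 1} \<subseteq> A" "A \<subseteq> {0..1}"
  obtains e where "spaced A e"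
proof -
  obtain e where e: "e > 0" "\<And>a b. a \<in> A \<Longrightarrow> b \<in> A \<Longrightarrow> a \<noteq> b \<Longrightarrow> 4 * e \<le> \<bar>a - b\<bar>"
    by (rule finite_separation[OF assms(1)]) blast
  have "spaced A e" unfolding spaced_def using assms e by blast
  then show thesis by (rule that)
qed

lemma snap_near:
  assumes "spaced A e" "a \<in> A" "\<bar>t - a\<bar> < e"
  shows "snap A e t = a"
proof -
  have "b = a" if "b \<in> A \<and> \<bar>t - b\<bar> < e" for b
  proof (rule ccontr)
    assume "b \<noteq> a"
    then have "4 * e \<le> \<bar>b - a\<bar>" using assms that by (simp add: spaced_def)
    then show False using that assms(3) by linarith
  qed
  then have "(SOME b. b \<in> A \<and> \<bar>t - b\<bar> < e) = a" by (intro some_equality conjI assms(2,3))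
  moreover have "\<exists>a\<in>A. \<bar>t - a\<bar> < e" using assms(2,3) by blast
  ultimately show ?thesis by (simp add: snap_def)
qed

lemma snap_far: "(\<And>a. a \<in> A \<Longrightarrow> e \<le> \<bar>t - a\<bar>) \<Longrightarrow> snap A e t = t"
  unfolding snap_def by (rule if_not_P) (meson leD)

lemma snap_cases:
  assumes "spaced A e"
  obtains (near) a where "a \<in> A" "\<bar>t - a\<bar> < e" "snap A e t = a"
  | (far) "\<And>a. a \<in> A \<Longrightarrow> e \<le> \<bar>t - a\<bar>" "snap A e t = t" "t \<notin> A"
proof (cases "\<exists>a\<in>A. \<bar>t - a\<bar> < e")
  case True
  then show thesis using near snap_near[OF assms] by blast
next
  case False
  then have 1: "\<And>a. a \<in> A \<Longrightarrow> e \<le> \<bar>t - a\<bar>" by (meson not_le)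
  moreover have "t \<notin> A"
  proof
    assume "t \<in> A"
    then have "e \<le> \<bar>t - t\<bar>" by (rule 1)
    then show False using assms by (simp add: spaced_def)
  qed
  ultimately show thesis using far snap_far by blast
qed

lemma snap_fix: "spaced A e \<Longrightarrow> a \<in> A \<Longrightarrow> snap A e a = a"
  by (rule snap_near) (auto simp: spaced_def)

lemma endpoint_fixing_snap:
  assumes "spaced A e"
  shows "endpoint_fixing (snap A e)"
proof -
  have "snap A e t \<in> {0..1}" if "t \<in> {0..1}" for t
    using assms by (cases rule: snap_cases[of A e t]) (use assms that in \<open>auto simp: spaced_def\<close>)
  moreover have "0 \<in> A" "1 \<in> A" using assms by (simp_all add: spaced_def)
  ultimately show ?thesis using snap_fix[OF assms] by (simp add: endpoint_fixing_def Pi_iff)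
qed

lemma mem_cells_stream: "((n, c), t) \<in> topspace (stop (cells_stream C)) \<longleftrightarrow> c \<in> cells C n \<and> t \<in> cube n"
  by (simp add: topspace_cells_stream)

lemma openin_cells_stream:
  "openin (stop (cells_stream C)) U \<longleftrightarrow> U \<subseteq> topspace (stop (cells_stream C)) \<and>
    (\<forall>n. \<forall>c\<in>cells C n. openin (cube_topology n) {t. ((n, c), t) \<in> U})"
  unfolding cells_stream_def stop_coproduct_stream openin_sum_topology by auto

lemma openin_cubeI:
  assumes "S \<subseteq> cube n"
    and "\<And>s. s \<in> S \<Longrightarrow> \<exists>d>0. \<forall>u\<in>cube n. (\<forall>i<n. \<bar>u i - s i\<bar> < d) \<longrightarrow> u \<in> S"
  shows "openin (cube_topology n) S"
proof (subst openin_subopen, rule ballI)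
  fix s assume s: "s \<in> S"
  then obtain d where d: "d > 0" "\<forall>u\<in>cube n. (\<forall>i<n. \<bar>u i - s i\<bar> < d) \<longrightarrow> u \<in> S" using assms(2) by blast
  then show "\<exists>T. openin (cube_topology n) T \<and> s \<in> T \<and> T \<subseteq> S"
    using s assms(1) openin_cube_box[of n s d] by (intro exI[of _ "{u \<in> cube n. \<forall>i<n. \<bar>u i - s i\<bar> < d}"]) auto
qed

context
  fixes C :: "'c cubical"
  assumes C: "cubical_set C"
begin

lemma equiv_glue_eq: "equiv (topspace (stop (cells_stream C))) (glue_eq C)"
proof (rule equivI)
  show "glue_eq C \<subseteq> topspace (stop (cells_stream C)) \<times> topspace (stop (cells_stream C))"
    by (auto simp: glue_eq_def)
  show "refl_on (topspace (stop (cells_stream C))) (glue_eq C)" by (auto simp: glue_eq_def refl_on_def)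
  show "sym (glue_eq C)" unfolding glue_eq_def sym_def using equivclp_sym by fastforce
  show "trans (glue_eq C)" unfolding glue_eq_def trans_def using equivclp_trans by fastforce
qed

lemma glue_eq_refl: "x \<in> topspace (stop (cells_stream C)) \<Longrightarrow> (x, x) \<in> glue_eq C"
  by (simp add: glue_eq_def)

lemma glue_eq_sym: "(x, y) \<in> glue_eq C \<Longrightarrow> (y, x) \<in> glue_eq C"
  using equiv_glue_eq by (auto elim: equivE dest: symD)

lemma glue_eq_trans: "(x, y) \<in> glue_eq C \<Longrightarrow> (y, z) \<in> glue_eq C \<Longrightarrow> (x, z) \<in> glue_eq C"
  using equiv_glue_eq by (auto elim: equivE dest: transD)

lemma glue_eq_mem: "(x, y) \<in> glue_eq C \<Longrightarrow> x \<in> topspace (stop (cells_stream C)) \<and> y \<in> topspace (stop (cells_stream C))"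
  by (auto simp: glue_eq_def)

lemma glue_subset_glue_eq: "realization_glue C \<subseteq> glue_eq C"
  using realization_glue_subset[OF C] by (auto simp: glue_eq_def)

lemma glue_eqI:
  assumes "box_mor m n \<phi>" "c \<in> cells C n" "t \<in> cube m"
  shows "(((m, act C m n \<phi> c), t), ((n, c), cube_map m n \<phi> t)) \<in> glue_eq C"
  by (rule subsetD[OF glue_subset_glue_eq]) (use assms in \<open>unfold realization_glue_def, blast\<close>)

text \<open>Besides functions on points, \<open>F\<close> will be a class or a truth value. Closure
  properties of \<open>glue_eq\<close> then become instances of invariance under the
  generators.\<close>

lemma glue_eq_invariant:
  assumes inv: "\<And>m n \<phi> c t. box_mor m n \<phi> \<Longrightarrow> c \<in> cells C n \<Longrightarrow> t \<in> cube m \<Longrightarrow>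
      F ((m, act C m n \<phi> c), t) = F ((n, c), cube_map m n \<phi> t)"
    and xy: "(x, y) \<in> glue_eq C"
  shows "F x = F y"
proof -
  have glue: "F x = F y" if "(x, y) \<in> realization_glue C" for x y
    using that inv unfolding realization_glue_def by blast
  have "equivclp (\<lambda>x y. (x, y) \<in> realization_glue C) x y" using xy by (simp add: glue_eq_def)
  then show ?thesis
    by (induction rule: equivclp_induct) (use glue in \<open>auto\<close>)
qed

lemma coordwise_mem:
  assumes "endpoint_fixing k" "x \<in> topspace (stop (cells_stream C))"
  shows "coordwise k x \<in> topspace (stop (cells_stream C))"
  using assms cmap_mem by (auto simp: coordwise_def topspace_cells_stream endpoint_fixing_def)

lemma coordwise_glue_eq:
  assumes k: "endpoint_fixing k" and xy: "(x, y) \<in> glue_eq C"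
  shows "(coordwise k x, coordwise k y) \<in> glue_eq C"
proof -
  have k': "k \<in> {0..1} \<rightarrow> {0..1}" using k by (simp add: endpoint_fixing_def)
  \<comment> \<open>Invariance is applied to the class of the image.\<close>
  have "glue_eq C `` {coordwise k x} = glue_eq C `` {coordwise k y}"
  proof (rule glue_eq_invariant[OF _ xy])
    fix m n \<phi> c t assume *: "box_mor m n \<phi>" "c \<in> cells C n" "t \<in> cube m"
    have "(((m, act C m n \<phi> c), cmap k m t), ((n, c), cube_map m n \<phi> (cmap k m t))) \<in> glue_eq C"
      using * k' by (intro glue_eqI cmap_mem)
    then have "(coordwise k ((m, act C m n \<phi> c), t), coordwise k ((n, c), cube_map m n \<phi> t)) \<in> glue_eq C"
      by (simp add: coordwise_def cube_map_cmap[OF *(1) k *(3)])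
    then show "glue_eq C `` {coordwise k ((m, act C m n \<phi> c), t)} = glue_eq C `` {coordwise k ((n, c), cube_map m n \<phi> t)}"
      by (rule equiv_class_eq[OF equiv_glue_eq])
  qed
  then show ?thesis
    using glue_eq_mem[OF xy] coordwise_mem[OF k] by (simp add: eq_equiv_class_iff[OF equiv_glue_eq])
qed

text \<open>A coordinate outside of \<open>A\<close> comes from a degeneracy.\<close>

lemma glue_eq_update:
  assumes A: "{0, 1} \<subseteq> A" and x: "((m, c), t) \<in> topspace (stop (cells_stream C))" "\<And>j. j < m \<Longrightarrow> t j \<in> A"
    and y: "(((n, d), s), ((m, c), t)) \<in> glue_eq C" and i: "i < n" "s i \<notin> A" "r \<in> {0..1}"
  shows "(((n, d), s(i := r)), ((m, c), t)) \<in> glue_eq C"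
proof -
  define x where "x = ((m, c), t)"
  \<comment> \<open>The property carried along the gluing: the representative is glued to
    \<open>x\<close>, and it remains so when any one of its coordinates outside \<open>A\<close> is
    moved. At \<open>x\<close> the second part is vacuous, since all coordinates of \<open>x\<close>
    lie in \<open>A\<close>.\<close>
  define F where "F = (\<lambda>((n, d), s). (((n, d), s), x) \<in> glue_eq C \<and>
     (\<forall>i<n. s i \<notin> A \<longrightarrow> (\<forall>r\<in>{0..1}. (((n, d), s(i := r)), x) \<in> glue_eq C)))"
  have "F x = F ((n, d), s)"
  proof (rule glue_eq_invariant[OF _ glue_eq_sym[OF y[folded x_def]]])
    fix k l \<phi> e u assume *: "box_mor k l \<phi>" "e \<in> cells C l" "u \<in> cube k"
    let ?\<psi> = "cube_map k l \<phi>"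
    have g: "(((k, act C k l \<phi> e), u), x) \<in> glue_eq C \<longleftrightarrow> (((l, e), ?\<psi> u), x) \<in> glue_eq C" if "u \<in> cube k" for u
      using glue_eqI[OF *(1,2) that] glue_eq_trans glue_eq_sym by metis
    show "F ((k, act C k l \<phi> e), u) = F ((l, e), ?\<psi> u)"
    proof
      assume L: "F ((k, act C k l \<phi> e), u)"
      have "(((l, e), (?\<psi> u)(i := r)), x) \<in> glue_eq C" if i: "i < l" "?\<psi> u i \<notin> A" and r: "r \<in> {0..1}" for i r
        using *(1) i(1)
      proof (cases rule: cube_map_update_target)
        case 1
        \<comment> \<open>A constant target coordinate is 0 or 1, hence in \<open>A\<close>: this
          case is contradictory.\<close>
        then show ?thesis using A *(3) i(2) by blast
      next
        \<comment> \<open>In the absence of diagonals, the source coordinate \<open>j\<close> feeds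
          the target coordinate \<open>i\<close> and no other, so moving \<open>j\<close> upstairs
          moves \<open>i\<close> alone.\<close>
        case (2 j)
        then have "(((k, act C k l \<phi> e), u(j := r)), x) \<in> glue_eq C"
          using L i(2) r *(3) by (simp add: F_def)
        then show ?thesis using g[OF cube_update[OF *(3) 2(1) r]] 2(2)[OF *(3) r] by simp
      qed
      then show "F ((l, e), ?\<psi> u)" using L g[OF *(3)] by (simp add: F_def)
    next
      assume R: "F ((l, e), ?\<psi> u)"
      have "(((k, act C k l \<phi> e), u(j := r)), x) \<in> glue_eq C" if j: "j < k" "u j \<notin> A" and r: "r \<in> {0..1}" for j r
        using *(1) j(1)
      proof (cases rule: cube_map_update_source)
        case 1
        then show ?thesis using R g[OF cube_update[OF *(3) j(1) r]] *(3) r by (simp add: F_def)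
      next
        case (2 i)
        then have "(((l, e), (?\<psi> u)(i := r)), x) \<in> glue_eq C" using R j(2) r *(3) by (simp add: F_def)
        then show ?thesis using g[OF cube_update[OF *(3) j(1) r]] 2(2)[OF *(3) r] by simp
      qed
      then show "F ((k, act C k l \<phi> e), u)" using R g[OF *(3)] by (simp add: F_def)
    qed
  qed
  moreover have "F x" using glue_eq_refl[OF x(1)] x(2) by (simp add: F_def x_def)
  ultimately show ?thesis using i by (simp add: F_def x_def)
qed

text \<open>The coordinates outside \<open>A\<close> are moved one after the other; those in
  \<open>A\<close> stay put.\<close>

lemma glue_eq_update_all:
  assumes A: "{0, 1} \<subseteq> A" and x: "((m, c), t) \<in> topspace (stop (cells_stream C))" "\<And>j. j < m \<Longrightarrow> t j \<in> A"
    and y: "(((n, d), s), ((m, c), t)) \<in> glue_eq C" and u: "u \<in> cube n" "\<And>i. i < n \<Longrightarrow> s i \<in> A \<Longrightarrow> u i = s i"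
  shows "(((n, d), u), ((m, c), t)) \<in> glue_eq C"
proof -
  have s: "s \<in> cube n" using glue_eq_mem[OF y] by (simp add: mem_cells_stream)
  \<comment> \<open>The coordinates below \<open>k\<close> are already taken from \<open>u\<close>,
    the others still from \<open>s\<close>.\<close>
  define w where "w k = (\<lambda>i\<in>{..<n}. if i < k then u i else s i)" for k
  have "(((n, d), w k), ((m, c), t)) \<in> glue_eq C" if "k \<le> n" for k
    using that
  proof (induction k)
    case 0
    have "w 0 = s" by (rule tuples_eqI[OF _ s, where S = UNIV]) (auto simp: w_def tuplesI)
    then show ?case using y by simp
  next
    case (Suc k)
    have upd: "w (Suc k) = (w k)(k := u k)" using Suc.prems by (auto simp: w_def fun_eq_iff less_Suc_eq)
    show ?case
    proof (cases "s k \<in> A")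
      case True
      then have "w (Suc k) = w k" using Suc.prems u(2)[of k] by (auto simp: w_def fun_eq_iff less_Suc_eq)
      then show ?thesis using Suc by simp
    next
      case False
      then have "w k k \<notin> A" using Suc.prems by (simp add: w_def)
      then show ?thesis
        unfolding upd using Suc cube_nth[OF u(1), of k] by (intro glue_eq_update[OF A x]) auto
    qed
  qed
  moreover have "w n = u" by (rule tuples_eqI[OF _ u(1), where S = UNIV]) (auto simp: w_def tuplesI)
  ultimately show ?thesis by force
qed

text \<open>Where a coordinate is rounded into \<open>A\<close>, rounding is locally constant. Every
  other coordinate keeps a value outside \<open>A\<close>, and whatever rounding does to its
  neighbours is absorbed by \<open>glue_eq_update_all\<close>.\<close>

lemma openin_tube:
  assumes A: "spaced A e" and x: "x = ((m, c), t)" "x \<in> topspace (stop (cells_stream C))" "\<And>j. j < m \<Longrightarrow> t j \<in> A"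
  shows "openin (stop (cells_stream C)) (tube C A e x)"
  unfolding openin_cells_stream
proof (intro conjI allI ballI)
  show "tube C A e x \<subseteq> topspace (stop (cells_stream C))" by (auto simp: tube_def)
  fix n d assume d: "d \<in> cells C n"
  have A01: "{0, 1} \<subseteq> A" using A by (simp add: spaced_def)
  have mem: "((n, d), s) \<in> tube C A e x \<longleftrightarrow> s \<in> cube n \<and> (((n, d), cmap (snap A e) n s), x) \<in> glue_eq C" for s
    using d by (auto simp: tube_def mem_cells_stream coordwise_def)
  have sn: "snap A e \<in> {0..1} \<rightarrow> {0..1}" using endpoint_fixing_snap[OF A] by (simp add: endpoint_fixing_def)
  show "openin (cube_topology n) {s. ((n, d), s) \<in> tube C A e x}"
  proof (rule openin_cubeI)
    show "{s. ((n, d), s) \<in> tube C A e x} \<subseteq> cube n" using mem by auto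
    fix s assume "s \<in> {s. ((n, d), s) \<in> tube C A e x}"
    then have s: "s \<in> cube n" "(((n, d), cmap (snap A e) n s), x) \<in> glue_eq C" using mem by auto
    have "\<exists>r>0. \<forall>u. \<bar>u - s i\<bar> < r \<longrightarrow> snap A e (s i) \<in> A \<longrightarrow> snap A e u = snap A e (s i)" if "i < n" for i
      using A
    proof (cases rule: snap_cases[of A e "s i"])
      case (near a)
      then show ?thesis
        using snap_near[OF A near(1)] by (intro exI[of _ "e - \<bar>s i - a\<bar>"]) auto
    next
      case far
      then show ?thesis by (intro exI[of _ 1]) auto
    qed
    then obtain r where r: "\<And>i. i < n \<Longrightarrow> r i > 0"
      "\<And>i u. i < n \<Longrightarrow> \<bar>u - s i\<bar> < r i \<Longrightarrow> snap A e (s i) \<in> A \<Longrightarrow> snap A e u = snap A e (s i)" by metis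
    show "\<exists>d'>0. \<forall>u\<in>cube n. (\<forall>i<n. \<bar>u i - s i\<bar> < d') \<longrightarrow> u \<in> {s. ((n, d), s) \<in> tube C A e x}"
    proof (intro exI[of _ "Min (insert 1 (r ` {..<n}))"] conjI ballI impI)
      show "0 < Min (insert 1 (r ` {..<n}))" using r(1) by (subst Min_gr_iff) auto
      fix u assume u: "u \<in> cube n" "\<forall>i<n. \<bar>u i - s i\<bar> < Min (insert 1 (r ` {..<n}))"
      have "\<bar>u i - s i\<bar> < r i" if "i < n" for i
      proof -
        have "Min (insert 1 (r ` {..<n})) \<le> r i" using that by (intro Min_le) auto
        then show ?thesis using u(2) that by force
      qed
      then have "(((n, d), cmap (snap A e) n u), x) \<in> glue_eq C"
        using s(2) x cmap_mem[OF sn u(1)] r(2)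
        by (auto intro!: glue_eq_update_all[OF A01, of m c t n d "cmap (snap A e) n s"])
      then show "u \<in> {s. ((n, d), s) \<in> tube C A e x}" using mem u by simp
    qed
  qed
qed

text \<open>Rounding fixes \<open>x\<close>, all of whose coordinates lie in
  \<open>A\<close>.\<close>

lemma tube_self:
  assumes A: "spaced A e" and x: "x = ((m, c), t)" "x \<in> topspace (stop (cells_stream C))" "\<And>j. j < m \<Longrightarrow> t j \<in> A"
  shows "x \<in> tube C A e x"
proof -
  have t: "t \<in> cube m" using x by (simp add: mem_cells_stream)
  have "cmap (snap A e) m t = t"
    using t by (intro tuples_eqI[OF _ t, of _ "{0..1}"] cmap_mem) 
      (use endpoint_fixing_snap[OF A] x snap_fix[OF A] in \<open>auto simp: endpoint_fixing_def\<close>)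
  then show ?thesis using x glue_eq_refl by (simp add: tube_def coordwise_def)
qed

text \<open>Rounding fixes the endpoints, so it respects the gluing.\<close>

lemma tube_glue_eq:
  assumes A: "spaced A e" and yz: "(y, z) \<in> glue_eq C" and y: "y \<in> tube C A e x"
  shows "z \<in> tube C A e x"
  using coordwise_glue_eq[OF endpoint_fixing_snap[OF A] yz] y glue_eq_mem[OF yz] glue_eq_sym glue_eq_trans
  unfolding tube_def by blast

lemma saturated_quotient:
  assumes "V \<subseteq> topspace (stop (cells_stream C))" "\<And>y z. (y, z) \<in> glue_eq C \<Longrightarrow> y \<in> V \<Longrightarrow> z \<in> V"
  shows "\<Union>(V // glue_eq C) = V"
proof
  show "\<Union>(V // glue_eq C) \<subseteq> V" using assms(2) by (auto elim!: quotientE)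
  show "V \<subseteq> \<Union>(V // glue_eq C)"
  proof
    fix x assume x: "x \<in> V"
    then have "x \<in> glue_eq C `` {x}" using assms(1) glue_eq_refl[of x] by blast
    then show "x \<in> \<Union>(V // glue_eq C)" using x quotientI by fast
  qed
qed

text \<open>The tubes around \<open>x\<close> and \<open>y\<close> for one common set
  \<open>A\<close> separate the two points: a member of both rounds to a representative of
  \<open>x\<close> and of \<open>y\<close>.\<close>

lemma Hausdorff_glue_eq: "Hausdorff_space (quotient_topology (stop (cells_stream C)) (glue_eq C))"
  unfolding Hausdorff_space_def topspace_quotient_topology[OF equiv_glue_eq]
proof (intro allI impI, elim conjE)
  let ?T = "topspace (stop (cells_stream C))"
  fix P Q assume "P \<in> ?T // glue_eq C" "Q \<in> ?T // glue_eq C" and ne: "P \<noteq> Q"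
  then obtain x y where x: "x \<in> ?T" "P = glue_eq C `` {x}" and y: "y \<in> ?T" "Q = glue_eq C `` {y}"
    by (elim quotientE)
  obtain m c t where x': "x = ((m, c), t)" by (metis prod.exhaust)
  obtain n d s where y': "y = ((n, d), s)" by (metis prod.exhaust)
  \<comment> \<open>\<open>A\<close> contains the coordinates of both representatives, so that both
    tubes are open for the same rounding function.\<close>
  define A where "A = {0, 1} \<union> t ` {..<m} \<union> s ` {..<n}"
  have ts: "t \<in> cube m" "s \<in> cube n" using x y by (simp_all add: x' y' mem_cells_stream)
  have "A \<subseteq> {0..1}" using cube_nth[OF ts(1)] cube_nth[OF ts(2)] by (auto simp: A_def)
  then obtain e where A: "spaced A e" by (rule spaced_exists[rotated 2]) (simp_all add: A_def)
  define V where "V z = tube C A e z // glue_eq C" for z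
  have xA: "\<And>j. j < m \<Longrightarrow> t j \<in> A" "\<And>j. j < n \<Longrightarrow> s j \<in> A" by (auto simp: A_def)
  have un: "\<Union>(V z) = tube C A e z" for z
    unfolding V_def
  proof (rule saturated_quotient)
    show "tube C A e z \<subseteq> ?T" by (auto simp: tube_def)
  qed (rule tube_glue_eq[OF A])
  have op: "openin (stop (cells_stream C)) (tube C A e x)" "openin (stop (cells_stream C)) (tube C A e y)"
    using openin_tube[OF A x' x(1) xA(1)] openin_tube[OF A y' y(1) xA(2)] by auto
  have "V z \<subseteq> ?T // glue_eq C" for z unfolding V_def by (auto simp: quotient_def tube_def)
  then have "openin (quotient_topology (stop (cells_stream C)) (glue_eq C)) (V x)"
    "openin (quotient_topology (stop (cells_stream C)) (glue_eq C)) (V y)"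
    using op by (simp_all add: openin_quotient_topology[OF equiv_glue_eq] un)
  moreover have "P \<in> V x" "Q \<in> V y"
    unfolding V_def x y using tube_self[OF A x' x(1) xA(1)] tube_self[OF A y' y(1) xA(2)] by (auto intro: quotientI)
  moreover have "disjnt (V x) (V y)"
    unfolding disjnt_iff
  proof (intro allI notI, elim conjE)
    fix R assume R: "R \<in> V x" "R \<in> V y"
    then obtain z where z: "z \<in> tube C A e x" "R = glue_eq C `` {z}" unfolding V_def by (elim quotientE)
    then have "z \<in> R" using glue_eq_refl by (auto simp: tube_def)
    then have "z \<in> tube C A e y" using R(2) un by blast
    then have "(x, y) \<in> glue_eq C" using z(1) glue_eq_sym glue_eq_trans unfolding tube_def by blast
    then have "P = Q" unfolding x y by (rule equiv_class_eq[OF equiv_glue_eq])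
    then show False using ne by simp
  qed
  ultimately show "\<exists>U V. openin (quotient_topology (stop (cells_stream C)) (glue_eq C)) U \<and>
      openin (quotient_topology (stop (cells_stream C)) (glue_eq C)) V \<and> P \<in> U \<and> Q \<in> V \<and> disjnt U V" by blast
qed

text \<open>The plain quotient is Hausdorff, hence weak Hausdorff, so \<open>glue_eq\<close> is one
  of the relations that are intersected. Conversely, every such relation contains the
  generators.\<close>

lemma realization_eq_glue_eq: "realization_eq C = glue_eq C"
proof
  have "weak_Hausdorff (quotient_topology (stop (cells_stream C)) (glue_eq C))"
    unfolding weak_Hausdorff_def
    using image_compactin[of _ "topspace _"] compactin_imp_closedin[OF Hausdorff_glue_eq]
    by (metis compact_space_def)
  then show "realization_eq C \<subseteq> glue_eq C"
    unfolding realization_eq_def using equiv_glue_eq glue_subset_glue_eq by blast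
  show "glue_eq C \<subseteq> realization_eq C"
  proof
    fix z assume z: "z \<in> glue_eq C"
    obtain x y where xy: "z = (x, y)" by (cases z)
    note E = realization_eq_props(1)[OF C]
    have "realization_eq C `` {x} = realization_eq C `` {y}"
    proof (rule glue_eq_invariant[OF _ z[unfolded xy]])
      fix m n \<phi> c t assume "box_mor m n \<phi>" "c \<in> cells C n" "t \<in> cube m"
      then have "(((m, act C m n \<phi> c), t), ((n, c), cube_map m n \<phi> t)) \<in> realization_eq C"
        using realization_eq_props(2)[OF C] unfolding realization_glue_def by blast
      then show "realization_eq C `` {((m, act C m n \<phi> c), t)} = realization_eq C `` {((n, c), cube_map m n \<phi> t)}"
        by (rule equiv_class_eq[OF E])
    qed
    then show "z \<in> realization_eq C"
      using glue_eq_mem[OF z[unfolded xy]] by (simp add: xy eq_equiv_class_iff[OF E])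
  qed
qed

end

section \<open>Points, open sets and circulation of the realization in terms of cells\<close>

definition point :: "'c cubical \<Rightarrow> nat \<Rightarrow> 'c \<Rightarrow> (nat \<Rightarrow> real) \<Rightarrow> ((nat \<times> 'c) \<times> (nat \<Rightarrow> real)) set" where
  "point C n c t = realization_eq C `` {((n, c), t)}"

text \<open>Descends a family of functions on cells to points by choosing a representative; the
  lemma \<open>point_value\<close> justifies the choice for families that respect the
  gluing.\<close>

definition point_value :: "(nat \<Rightarrow> 'c \<Rightarrow> (nat \<Rightarrow> real) \<Rightarrow> 'v) \<Rightarrow> ((nat \<times> 'c) \<times> (nat \<Rightarrow> real)) set \<Rightarrow> 'v" where
  "point_value F P = (case (SOME z. z \<in> P) of ((n, c), t) \<Rightarrow> F n c t)"

abbreviation points :: "'c cubical \<Rightarrow> ((nat \<times> 'c) \<times> (nat \<Rightarrow> real)) set set" where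
  "points C \<equiv> topspace (stop (realization C))"

context
  fixes C :: "'c cubical"
  assumes C: "cubical_set C"
begin

lemma points_eq: "points C = topspace (stop (cells_stream C)) // realization_eq C"
  by (simp add: realization_def topspace_quotient_topology[OF realization_eq_props(1)[OF C]])

lemma point_mem: "c \<in> cells C n \<Longrightarrow> t \<in> cube n \<Longrightarrow> point C n c t \<in> points C"
  unfolding points_eq point_def by (rule quotientI) (simp add: mem_cells_stream)

lemma pointE:
  assumes "P \<in> points C"
  obtains n c t where "c \<in> cells C n" "t \<in> cube n" "P = point C n c t"
proof -
  from assms[unfolded points_eq] obtain x where x: "x \<in> topspace (stop (cells_stream C))" "P = realization_eq C `` {x}"
    by (rule quotientE)
  obtain n c t where "x = ((n, c), t)" by (metis prod.exhaust)
  then show thesis using that[of c n t] x by (simp add: point_def mem_cells_stream)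
qed

lemma mem_point_iff: "z \<in> point C n c t \<longleftrightarrow> (((n, c), t), z) \<in> glue_eq C"
  by (simp add: point_def realization_eq_glue_eq[OF C])

lemma point_eq_iff:
  assumes "c \<in> cells C n" "t \<in> cube n" "d \<in> cells C m" "s \<in> cube m"
  shows "point C n c t = point C m d s \<longleftrightarrow> (((n, c), t), ((m, d), s)) \<in> glue_eq C"
  using assms
  by (simp add: point_def realization_eq_glue_eq[OF C] eq_equiv_class_iff[OF equiv_glue_eq[OF C]] mem_cells_stream)

lemma point_act:
  assumes "box_mor m n \<phi>" "c \<in> cells C n" "t \<in> cube m"
  shows "point C m (act C m n \<phi> c) t = point C n c (cube_map m n \<phi> t)"
  using glue_eqI[OF C assms] assms cubical_setD(1)[OF C] cube_map_mem by (simp add: point_eq_iff)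

lemma realization_unit_point: "c \<in> cells C n \<Longrightarrow> realization_unit C n c = (\<lambda>t\<in>cube n. point C n c t)"
  by (simp add: realization_unit_def point_def)

lemma openin_realization:
  "openin (stop (realization C)) W \<longleftrightarrow> W \<subseteq> points C \<and>
    (\<forall>n. \<forall>c\<in>cells C n. openin (cube_topology n) {t \<in> cube n. point C n c t \<in> W})"
proof (cases "W \<subseteq> points C")
  case True
  note E = realization_eq_props(1)[OF C]
  have un: "x \<in> \<Union>W \<longleftrightarrow> x \<in> topspace (stop (cells_stream C)) \<and> realization_eq C `` {x} \<in> W" for x
    using True unfolding points_eq by (rule Union_in_quotient[OF E])
  have "{t. ((n, c), t) \<in> \<Union>W} = {t \<in> cube n. point C n c t \<in> W}" if "c \<in> cells C n" for n c
    using that unfolding un mem_cells_stream by (simp add: point_def)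
  moreover have "\<Union>W \<subseteq> topspace (stop (cells_stream C))" using un by blast
  ultimately have "openin (stop (cells_stream C)) (\<Union>W) \<longleftrightarrow>
      (\<forall>n. \<forall>c\<in>cells C n. openin (cube_topology n) {t \<in> cube n. point C n c t \<in> W})"
    unfolding openin_cells_stream by simp
  then show ?thesis
    using True True[unfolded points_eq]
    by (simp add: realization_def openin_quotient_topology[OF E] topspace_quotient_topology[OF E])
qed (use openin_subset in blast)

text \<open>The circulations of the quotient and of the cubes are both transitive closures. A
  transitive relation therefore only has to be checked for one step inside one cell, with the whole
  order interval of the step mapped into \<open>W\<close>.\<close>

lemma realization_circ_induct:
  assumes W: "openin (stop (realization C)) W" and PQ: "(P, Q) \<in> circ (realization C) W"
    and trans: "\<And>x y z. R x y \<Longrightarrow> R y z \<Longrightarrow> R x z"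
    and step: "\<And>n c s u. c \<in> cells C n \<Longrightarrow> (s, u) \<in> cube_le n \<Longrightarrow>
      (\<And>w. w \<in> cube_interval n s u \<Longrightarrow> point C n c w \<in> W) \<Longrightarrow> R (point C n c s) (point C n c u)"
  shows "R P Q"
proof -
  note E = realization_eq_props(1)[OF C]
  have W': "W \<subseteq> points C" using openin_subset[OF W] .
  have oW: "openin (stop (cells_stream C)) (\<Union>W)"
    using W openin_quotient_topology[OF E] by (simp add: realization_def)
  have un: "x \<in> \<Union>W \<longleftrightarrow> x \<in> topspace (stop (cells_stream C)) \<and> realization_eq C `` {x} \<in> W" for x
    using W' unfolding points_eq by (rule Union_in_quotient[OF E])
  have "(P, Q) \<in> {(realization_eq C `` {x}, realization_eq C `` {y}) |x y. (x, y) \<in> circ (cells_stream C) (\<Union>W)}\<^sup>+"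
    using PQ W by (simp add: realization_def quotient_stream_def)
  moreover have base: "R P Q"
    if "(P, Q) \<in> {(realization_eq C `` {x}, realization_eq C `` {y}) |x y. (x, y) \<in> circ (cells_stream C) (\<Union>W)}" for P Q
  proof -
    from that obtain x y where xy: "P = realization_eq C `` {x}" "Q = realization_eq C `` {y}"
      "(x, y) \<in> circ (cells_stream C) (\<Union>W)" by blast
    then obtain n c s u where su: "x = ((n, c), s)" "y = ((n, c), u)" "c \<in> cells C n"
      "(s, u) \<in> circ (directed_cube n) {t. ((n, c), t) \<in> \<Union>W}"
      using oW unfolding cells_stream_def coproduct_stream_def by (auto split: if_splits)
    let ?V = "{t. ((n, c), t) \<in> \<Union>W}"
    have V: "?V = {t \<in> cube n. point C n c t \<in> W}"
      using su(3) unfolding un mem_cells_stream by (simp add: point_def)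
    have oV: "openin (cube_topology n) ?V" using oW su(3) by (simp add: openin_cells_stream)
    then have "(s, u) \<in> (cube_steps n ?V)\<^sup>+"
      using su(4) by (simp add: directed_cube_eq cube_circulation_def)
    then have "R (point C n c s) (point C n c u)"
    proof (induction rule: trancl_induct)
      case (base y)
      then show ?case using step[OF su(3), of s y] unfolding V cube_steps_def by auto
    next
      case (step y z)
      then show ?case using assms(4)[OF su(3), of y z] trans unfolding V cube_steps_def by blast
    qed
    then show ?thesis using xy su by (simp add: point_def)
  qed
  ultimately show ?thesis
  proof (induction rule: trancl_induct)
    case (step y z)
    then show ?case using trans base by blast
  qed blast
qed

lemma point_value:
  assumes inv: "\<And>m n \<phi> c t. box_mor m n \<phi> \<Longrightarrow> c \<in> cells C n \<Longrightarrow> t \<in> cube m \<Longrightarrow>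
      F m (act C m n \<phi> c) t = F n c (cube_map m n \<phi> t)"
    and c: "c \<in> cells C n" "t \<in> cube n"
  shows "point_value F (point C n c t) = F n c t"
proof -
  have self: "((n, c), t) \<in> point C n c t"
    using c glue_eq_refl[OF C] by (simp add: mem_point_iff mem_cells_stream)
  define z where "z = (SOME z. z \<in> point C n c t)"
  have "z \<in> point C n c t" unfolding z_def using self by (rule someI)
  then have "(((n, c), t), z) \<in> glue_eq C" by (simp add: mem_point_iff)
  then have "(\<lambda>((n, c), t). F n c t) ((n, c), t) = (\<lambda>((n, c), t). F n c t) z"
    by (rule glue_eq_invariant[OF C, rotated]) (simp add: inv)
  then show ?thesis by (simp add: point_value_def z_def case_prod_unfold)
qed

end

subsection \<open>Continuation of local potentials along directed paths\<close>

text \<open>Stream maps from the directed interval, stated for functions on the reals whose values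
  outside \<open>{0..1}\<close> are arbitrary. \<open>path_cell_mem\<close> and
  \<open>dipath_stream_map1\<close> translate between the two forms.\<close>

definition dipath :: "'a stream \<Rightarrow> (real \<Rightarrow> 'a) \<Rightarrow> bool" where
  "dipath X g \<longleftrightarrow> (\<forall>t\<in>{0..1}. g t \<in> topspace (stop X)) \<and>
     (\<forall>W. openin (stop X) W \<longrightarrow>
       (\<forall>t\<in>{0..1}. g t \<in> W \<longrightarrow> (\<exists>d>0. \<forall>s\<in>{0..1}. \<bar>s - t\<bar> < d \<longrightarrow> g s \<in> W)) \<and>
       (\<forall>a b. 0 \<le> a \<and> a \<le> b \<and> b \<le> 1 \<and> g ` {a..b} \<subseteq> W \<longrightarrow> (g a, g b) \<in> circ X W))"

text \<open>Directedness is asked in each variable separately. This is enough, because a step from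
  \<open>(x, y)\<close> to \<open>(x', y')\<close> factors through \<open>(x', y)\<close>; see
  \<open>square_cell_mem\<close>.\<close>

definition disquare :: "'a stream \<Rightarrow> (real \<Rightarrow> real \<Rightarrow> 'a) \<Rightarrow> bool" where
  "disquare X G \<longleftrightarrow> (\<forall>t\<in>{0..1}. dipath X (\<lambda>s. G s t)) \<and> (\<forall>s\<in>{0..1}. dipath X (\<lambda>t. G s t)) \<and>
     (\<forall>W. openin (stop X) W \<longrightarrow> (\<forall>a\<in>{0..1}. \<forall>b\<in>{0..1}. G a b \<in> W \<longrightarrow>
       (\<exists>d>0. \<forall>s\<in>{0..1}. \<forall>t\<in>{0..1}. \<bar>s - a\<bar> < d \<and> \<bar>t - b\<bar> < d \<longrightarrow> G s t \<in> W)))"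

lemma dipathD:
  assumes "dipath X g"
  shows "t \<in> {0..1} \<Longrightarrow> g t \<in> topspace (stop X)"
    and "openin (stop X) W \<Longrightarrow> t \<in> {0..1} \<Longrightarrow> g t \<in> W \<Longrightarrow> \<exists>d>0. \<forall>s\<in>{0..1}. \<bar>s - t\<bar> < d \<longrightarrow> g s \<in> W"
    and "openin (stop X) W \<Longrightarrow> 0 \<le> a \<Longrightarrow> a \<le> b \<Longrightarrow> b \<le> 1 \<Longrightarrow> g ` {a..b} \<subseteq> W \<Longrightarrow> (g a, g b) \<in> circ X W"
  using assms unfolding dipath_def by blast+

lemma disquareD:
  assumes "disquare X G"
  shows "t \<in> {0..1} \<Longrightarrow> dipath X (\<lambda>s. G s t)" "s \<in> {0..1} \<Longrightarrow> dipath X (\<lambda>t. G s t)"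
    and "openin (stop X) W \<Longrightarrow> a \<in> {0..1} \<Longrightarrow> b \<in> {0..1} \<Longrightarrow> G a b \<in> W \<Longrightarrow>
       \<exists>d>0. \<forall>s\<in>{0..1}. \<forall>t\<in>{0..1}. \<bar>s - a\<bar> < d \<and> \<bar>t - b\<bar> < d \<longrightarrow> G s t \<in> W"
  using assms unfolding disquare_def by blast+

text \<open>Bisection, with both hypotheses confined to subintervals of the given interval.\<close>

lemma Bolzano_interval [consumes 1, case_names trans local]:
  fixes P :: "real \<Rightarrow> real \<Rightarrow> bool"
  assumes ab: "a \<le> b"
    and trans: "\<And>x y z. P x y \<Longrightarrow> P y z \<Longrightarrow> a \<le> x \<Longrightarrow> x \<le> y \<Longrightarrow> y \<le> z \<Longrightarrow> z \<le> b \<Longrightarrow> P x z"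
    and local: "\<And>t. t \<in> {a..b} \<Longrightarrow> \<exists>d>0. \<forall>x y. a \<le> x \<and> x \<le> t \<and> t \<le> y \<and> y \<le> b \<and> y - x < d \<longrightarrow> P x y"
  shows "P a b"
proof -
  have "a \<le> a \<and> b \<le> b \<longrightarrow> P a b"
  proof (rule Bolzano[where P = "\<lambda>x y. a \<le> x \<and> y \<le> b \<longrightarrow> P x y", OF ab])
    show "a \<le> x \<and> z \<le> b \<longrightarrow> P x z"
      if "a \<le> x \<and> y \<le> b \<longrightarrow> P x y" "a \<le> y \<and> z \<le> b \<longrightarrow> P y z" "x \<le> y" "y \<le> z" for x y z
      using trans[of x y z] that by auto
    fix t assume "a \<le> t" "t \<le> b"
    then obtain d where "d > 0" "\<forall>x y. a \<le> x \<and> x \<le> t \<and> t \<le> y \<and> y \<le> b \<and> y - x < d \<longrightarrow> P x y"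
      using local[of t] by auto
    then show "\<exists>d>0. \<forall>x y. x \<le> t \<and> t \<le> y \<and> y - x < d \<longrightarrow> a \<le> x \<and> y \<le> b \<longrightarrow> P x y" by blast
  qed
  then show ?thesis by simp
qed

text \<open>
  \<open>N p\<close> is a potential on \<open>U p\<close>.  Its increment from \<open>x\<close> to \<open>y\<close> is independent of \<open>p\<close>, up to the
  ambiguity that comes from the lack of cancellation in \<open>\<tau>\<close>.
\<close>

locale local_potential = comm_monoid \<tau> for \<tau> :: "('t, 'm) monoid_scheme" (structure) +
  fixes X :: "'a stream" and U :: "'a \<Rightarrow> 'a set" and N :: "'a \<Rightarrow> 'a \<Rightarrow> 't"
  assumes U_open: "p \<in> topspace (stop X) \<Longrightarrow> openin (stop X) (U p)"
    and U_self: "p \<in> topspace (stop X) \<Longrightarrow> p \<in> U p"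
    and N_closed: "p \<in> topspace (stop X) \<Longrightarrow> x \<in> U p \<Longrightarrow> N p x \<in> carrier \<tau>"
    and N_self: "p \<in> topspace (stop X) \<Longrightarrow> N p p = \<one>"
    and N_step: "p \<in> topspace (stop X) \<Longrightarrow> q \<in> topspace (stop X) \<Longrightarrow> openin (stop X) W \<Longrightarrow>
      W \<subseteq> U p \<Longrightarrow> W \<subseteq> U q \<Longrightarrow> (x, y) \<in> circ X W \<Longrightarrow>
      \<exists>k\<in>carrier \<tau>. N p x \<otimes> k = N p y \<and> N q x \<otimes> k = N q y"
begin

text \<open>The substitute for cancellation: \<open>n\<close> may be cancelled because
  \<open>k\<close> inverts it. Inverses will come from paths that end at the centre of a potential,
  where the potential is \<open>\<one>\<close>.\<close>

lemma inverse_unique: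
  assumes "n \<otimes> k = \<one>" "n \<otimes> v = m" "n \<otimes> w = m" "n \<in> carrier \<tau>" "k \<in> carrier \<tau>" "v \<in> carrier \<tau>" "w \<in> carrier \<tau>"
  shows "v = w"
proof -
  have "v = (n \<otimes> k) \<otimes> v" using assms by simp
  also have "\<dots> = k \<otimes> (n \<otimes> v)" using assms(4-7) by (simp add: m_ac)
  also have "\<dots> = k \<otimes> (n \<otimes> w)" using assms by simp
  also have "\<dots> = (n \<otimes> k) \<otimes> w" using assms(4-7) by (simp add: m_ac)
  finally show ?thesis using assms by simp
qed

text \<open>A primitive along \<open>g\<close>: around each \<open>t\<close> it follows the
  potential centred at \<open>g t\<close>. The condition covers \<open>s < t\<close> too, where
  \<open>N (g t) (g s)\<close> is invertible, so that it also pins down the past of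
  \<open>t\<close>.\<close>

definition lift :: "(real \<Rightarrow> 'a) \<Rightarrow> real \<Rightarrow> real \<Rightarrow> (real \<Rightarrow> 't) \<Rightarrow> bool" where
  "lift g a b L \<longleftrightarrow> (\<forall>t\<in>{a..b}. L t \<in> carrier \<tau>) \<and>
     (\<forall>t\<in>{a..b}. \<exists>d>0. \<forall>s\<in>{a..b}. \<bar>s - t\<bar> < d \<longrightarrow> g s \<in> U (g t) \<and> L s = L t \<otimes> N (g t) (g s))"

text \<open>The total increment of a primitive that starts at \<open>\<one>\<close>. The description
  is definite by \<open>lift_exists\<close> and \<open>lift_unique\<close>.\<close>

definition val :: "(real \<Rightarrow> 'a) \<Rightarrow> real \<Rightarrow> real \<Rightarrow> 't" where
  "val g a b = (THE v. \<exists>L. lift g a b L \<and> L a = \<one> \<and> L b = v)"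

lemma liftD:
  assumes "lift g a b L" "t \<in> {a..b}"
  shows "L t \<in> carrier \<tau>"
    and "\<exists>d>0. \<forall>s\<in>{a..b}. \<bar>s - t\<bar> < d \<longrightarrow> g s \<in> U (g t) \<and> L s = L t \<otimes> N (g t) (g s)"
  using assms unfolding lift_def by blast+

lemma path_step:
  assumes g: "dipath X g" and ab: "0 \<le> a" "a \<le> b" "b \<le> 1"
    and p: "p \<in> topspace (stop X)" "q \<in> topspace (stop X)" "g ` {a..b} \<subseteq> U p" "g ` {a..b} \<subseteq> U q"
  obtains k where "k \<in> carrier \<tau>" "N p (g a) \<otimes> k = N p (g b)" "N q (g a) \<otimes> k = N q (g b)"
proof -
  have W: "openin (stop X) (U p \<inter> U q)" using U_open p by blast
  have "g ` {a..b} \<subseteq> U p \<inter> U q" using p by blast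
  then have "(g a, g b) \<in> circ X (U p \<inter> U q)" by (rule dipathD(3)[OF g W ab])
  then show thesis using N_step[OF p(1,2) W] that by blast
qed

lemma path_near:
  assumes g: "dipath X g" and t: "t \<in> {0..1}"
  obtains d where "d > 0" "\<And>x y. 0 \<le> x \<Longrightarrow> x \<le> t \<Longrightarrow> t \<le> y \<Longrightarrow> y \<le> 1 \<Longrightarrow> y - x < d \<Longrightarrow> g ` {x..y} \<subseteq> U (g t)"
proof -
  note p = dipathD(1)[OF g t]
  obtain d where d: "d > 0" "\<forall>s\<in>{0..1}. \<bar>s - t\<bar> < d \<longrightarrow> g s \<in> U (g t)"
    using dipathD(2)[OF g U_open[OF p] t U_self[OF p]] by blast
  show thesis
  proof (rule that[OF d(1)])
    fix x y :: real assume xy: "0 \<le> x" "x \<le> t" "t \<le> y" "y \<le> 1" "y - x < d"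
    show "g ` {x..y} \<subseteq> U (g t)"
    proof
      fix z assume "z \<in> g ` {x..y}"
      then obtain s where s: "s \<in> {x..y}" "z = g s" by blast
      then have "s \<in> {0..1}" "\<bar>s - t\<bar> < d" using xy by auto
      then show "z \<in> U (g t)" using d(2) s(2) by blast
    qed
  qed
qed

text \<open>A primitive refers to the moving centres \<open>g t\<close>, the claim to the fixed
  centre \<open>p\<close>. The increments supplied by \<open>N_step\<close> are shared by both
  centres, and this lets the comparison pass from one short interval to the next.\<close>

lemma lift_strong:
  assumes g: "dipath X g" and ab: "0 \<le> a" "a \<le> b" "b \<le> 1" and L: "lift g a b L" "L a = \<one>"
    and p: "p \<in> topspace (stop X)" "g ` {a..b} \<subseteq> U p"
  shows "N p (g a) \<otimes> L b = N p (g b)"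
proof -
  have Np: "N p (g t) \<in> carrier \<tau>" if "t \<in> {a..b}" for t
    by (intro N_closed[OF p(1)] subsetD[OF p(2)] imageI that)
  have "N p (g a) \<otimes> L a = N p (g a) \<longrightarrow> N p (g a) \<otimes> L b = N p (g b)"
    using ab(2)
  proof (rule Bolzano_interval[where P = "\<lambda>x y. N p (g a) \<otimes> L x = N p (g x) \<longrightarrow> N p (g a) \<otimes> L y = N p (g y)"])
    fix t assume t: "t \<in> {a..b}"
    then have t01: "t \<in> {0..1}" using ab by auto
    obtain d where d: "d > 0" "\<forall>s\<in>{a..b}. \<bar>s - t\<bar> < d \<longrightarrow> g s \<in> U (g t) \<and> L s = L t \<otimes> N (g t) (g s)"
      using liftD(2)[OF L(1) t] by blast
    show "\<exists>d>0. \<forall>x y. a \<le> x \<and> x \<le> t \<and> t \<le> y \<and> y \<le> b \<and> y - x < d \<longrightarrow>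
        N p (g a) \<otimes> L x = N p (g x) \<longrightarrow> N p (g a) \<otimes> L y = N p (g y)"
    proof (intro exI[of _ d] conjI allI impI d(1))
      fix x y assume xy: "a \<le> x \<and> x \<le> t \<and> t \<le> y \<and> y \<le> b \<and> y - x < d" and *: "N p (g a) \<otimes> L x = N p (g x)"
      have xy': "0 \<le> x" "x \<le> t" "t \<le> y" "y \<le> 1" using xy ab by auto
      have t0: "0 \<le> t" and t1: "t \<le> 1" using t01 by auto
      have near: "g s \<in> U (g t) \<and> L s = L t \<otimes> N (g t) (g s)" if "s \<in> {x..y}" for s
      proof -
        have "s \<in> {a..b}" "\<bar>s - t\<bar> < d" using that xy by auto
        then show ?thesis using d(2) by blast
      qed
      have sub: "g ` {x..t} \<subseteq> U (g t)" "g ` {t..y} \<subseteq> U (g t)" "g ` {x..t} \<subseteq> U p" "g ` {t..y} \<subseteq> U p"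
        using near xy p(2) by auto
      note pt = dipathD(1)[OF g t01]
      obtain k where k: "k \<in> carrier \<tau>" "N p (g x) \<otimes> k = N p (g t)" "N (g t) (g x) \<otimes> k = N (g t) (g t)"
        by (rule path_step[OF g xy'(1,2) t1 p(1) pt sub(3,1)])
      obtain k' where k': "k' \<in> carrier \<tau>" "N p (g t) \<otimes> k' = N p (g y)" "N (g t) (g t) \<otimes> k' = N (g t) (g y)"
        by (rule path_step[OF g t0 xy'(3,4) p(1) pt sub(4,2)])
      have cl: "L a \<in> carrier \<tau>" "L x \<in> carrier \<tau>" "L y \<in> carrier \<tau>" "L t \<in> carrier \<tau>" "N p (g a) \<in> carrier \<tau>"
        "N p (g x) \<in> carrier \<tau>" "N p (g t) \<in> carrier \<tau>"
        using liftD(1)[OF L(1)] Np xy ab by auto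
      have Nx: "N (g t) (g x) \<in> carrier \<tau>" by (rule N_closed[OF pt]) (use near[of x] xy in auto)
      \<comment> \<open>To the left of \<open>t\<close>, \<open>L x\<close> is \<open>L t\<close>
        times \<open>N (g t) (g x)\<close>, and \<open>k\<close> inverts the second factor.\<close>
      have Lt: "L x \<otimes> k = L t"
        using near[of x] xy k(1,3) cl Nx N_self[OF pt] by (auto simp: m_assoc)
      have Ly: "L y = L t \<otimes> k'"
        using near[of y] xy k' N_self[OF pt] by auto
      have "N p (g a) \<otimes> L y = (N p (g a) \<otimes> L x) \<otimes> k \<otimes> k'"
        unfolding Ly Lt[symmetric] using cl k(1) k'(1) by (simp add: m_assoc)
      then show "N p (g a) \<otimes> L y = N p (g y)" using * k(2) k'(2) by simp
    qed
  qed blast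
  then show ?thesis using L(2) Np[of a] ab by simp
qed

text \<open>Equality at \<open>x\<close> passes forward to the centre \<open>t\<close> by cancelling
  the unit \<open>N (g t) (g x)\<close>, and from \<open>t\<close> to \<open>y\<close> by the
  defining equation.\<close>

lemma lift_unique:
  assumes g: "dipath X g" and ab: "0 \<le> a" "a \<le> b" "b \<le> 1" and L: "lift g a b L" "lift g a b L'" "L a = L' a"
  shows "L b = L' b"
proof -
  have "L a = L' a \<longrightarrow> L b = L' b"
    using ab(2)
  proof (rule Bolzano_interval[where P = "\<lambda>x y. L x = L' x \<longrightarrow> L y = L' y"])
    fix t assume t: "t \<in> {a..b}"
    then have t01: "t \<in> {0..1}" using ab by auto
    note pt = dipathD(1)[OF g t01]
    obtain d where d: "d > 0" "\<forall>s\<in>{a..b}. \<bar>s - t\<bar> < d \<longrightarrow> g s \<in> U (g t) \<and> L s = L t \<otimes> N (g t) (g s)"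
      using liftD(2)[OF L(1) t] by blast
    obtain d' where d': "d' > 0" "\<forall>s\<in>{a..b}. \<bar>s - t\<bar> < d' \<longrightarrow> g s \<in> U (g t) \<and> L' s = L' t \<otimes> N (g t) (g s)"
      using liftD(2)[OF L(2) t] by blast
    show "\<exists>d>0. \<forall>x y. a \<le> x \<and> x \<le> t \<and> t \<le> y \<and> y \<le> b \<and> y - x < d \<longrightarrow> L x = L' x \<longrightarrow> L y = L' y"
    proof (intro exI[of _ "min d d'"] conjI allI impI)
      show "0 < min d d'" using d d' by simp
      fix x y assume xy: "a \<le> x \<and> x \<le> t \<and> t \<le> y \<and> y \<le> b \<and> y - x < min d d'" and *: "L x = L' x"
      have near: "g s \<in> U (g t)" "L s = L t \<otimes> N (g t) (g s)" "L' s = L' t \<otimes> N (g t) (g s)" if "s \<in> {x..y}" for s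
      proof -
        have "s \<in> {a..b}" "\<bar>s - t\<bar> < d" "\<bar>s - t\<bar> < d'" using that xy by auto
        then show "g s \<in> U (g t)" "L s = L t \<otimes> N (g t) (g s)" "L' s = L' t \<otimes> N (g t) (g s)"
          using d(2) d'(2) by blast+
      qed
      have sub: "g ` {x..t} \<subseteq> U (g t)" using near(1) xy by auto
      have x0: "0 \<le> x" "x \<le> t" "t \<le> 1" using xy t01 ab by auto
      obtain k where k: "k \<in> carrier \<tau>" "N (g t) (g x) \<otimes> k = N (g t) (g t)" "N (g t) (g x) \<otimes> k = N (g t) (g t)"
        by (rule path_step[OF g x0 pt pt sub sub])
      have Nx: "N (g t) (g x) \<in> carrier \<tau>" by (rule N_closed[OF pt]) (use near(1)[of x] xy in auto)
      have cl: "L t \<in> carrier \<tau>" "L' t \<in> carrier \<tau>" using liftD(1)[OF L(1) t] liftD(1)[OF L(2) t] .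
      have "N (g t) (g x) \<otimes> L t = N (g t) (g x) \<otimes> L' t"
        using near(2,3)[of x] xy * cl Nx by (simp add: m_comm)
      then have "L t = L' t"
        using inverse_unique[of "N (g t) (g x)" k "L t" _ "L' t"] k N_self[OF pt] Nx cl by simp
      then show "L y = L' y" using near(2,3)[of y] xy by simp
    qed
  qed blast
  then show ?thesis using L(3) by simp
qed

lemma lift_cong:
  assumes "lift g a b L" "\<And>t. t \<in> {a..b} \<Longrightarrow> L' t = L t"
  shows "lift g a b L'"
  using assms unfolding lift_def by simp

lemma lift_mult:
  assumes g: "dipath X g" and ab: "0 \<le> a" "b \<le> 1" and L: "lift g a b L" and c: "c \<in> carrier \<tau>"
  shows "lift g a b (\<lambda>t. c \<otimes> L t)"
  unfolding lift_def
proof (intro conjI ballI)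
  show "c \<otimes> L t \<in> carrier \<tau>" if "t \<in> {a..b}" for t using liftD(1)[OF L that] c by simp
  fix t assume t: "t \<in> {a..b}"
  note pt = dipathD(1)[OF g, of t]
  obtain d where d: "d > 0" "\<forall>s\<in>{a..b}. \<bar>s - t\<bar> < d \<longrightarrow> g s \<in> U (g t) \<and> L s = L t \<otimes> N (g t) (g s)"
    using liftD(2)[OF L t] by blast
  show "\<exists>d>0. \<forall>s\<in>{a..b}. \<bar>s - t\<bar> < d \<longrightarrow> g s \<in> U (g t) \<and> c \<otimes> L s = c \<otimes> L t \<otimes> N (g t) (g s)"
  proof (intro exI[of _ d] conjI ballI impI d(1))
    fix s assume "s \<in> {a..b}" "\<bar>s - t\<bar> < d"
    then have s: "g s \<in> U (g t)" "L s = L t \<otimes> N (g t) (g s)" using d(2) by auto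
    show "g s \<in> U (g t)" by fact
    show "c \<otimes> L s = c \<otimes> L t \<otimes> N (g t) (g s)"
      using s N_closed[OF pt s(1)] liftD(1)[OF L t] t ab c by (simp add: m_assoc)
  qed
qed

text \<open>At \<open>t = b\<close> the smaller of the two radii works; elsewhere the interval that
  misses \<open>t\<close> is kept away from it.\<close>

lemma lift_join:
  assumes ab: "a \<le> b" "b \<le> c" and L: "lift g a b L" "lift g b c L"
  shows "lift g a c L"
  unfolding lift_def
proof (intro conjI ballI)
  fix t assume t: "t \<in> {a..c}"
  show "L t \<in> carrier \<tau>" using liftD(1)[OF L(1), of t] liftD(1)[OF L(2), of t] t by (cases "t \<le> b") auto
  have 1: "\<exists>d>0. \<forall>s\<in>{a..b}. \<bar>s - t\<bar> < d \<longrightarrow> g s \<in> U (g t) \<and> L s = L t \<otimes> N (g t) (g s)"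
  proof (cases "t \<le> b")
    case True
    then show ?thesis using liftD(2)[OF L(1), of t] t by auto
  next
    case False
    then show ?thesis by (intro exI[of _ "t - b"]) auto
  qed
  have 2: "\<exists>d>0. \<forall>s\<in>{b..c}. \<bar>s - t\<bar> < d \<longrightarrow> g s \<in> U (g t) \<and> L s = L t \<otimes> N (g t) (g s)"
  proof (cases "b \<le> t")
    case True
    then show ?thesis using liftD(2)[OF L(2), of t] t by auto
  next
    case False
    then show ?thesis by (intro exI[of _ "b - t"]) auto
  qed
  from 1 obtain d where d: "d > 0" "\<forall>s\<in>{a..b}. \<bar>s - t\<bar> < d \<longrightarrow> g s \<in> U (g t) \<and> L s = L t \<otimes> N (g t) (g s)" by blast
  from 2 obtain e where e: "e > 0" "\<forall>s\<in>{b..c}. \<bar>s - t\<bar> < e \<longrightarrow> g s \<in> U (g t) \<and> L s = L t \<otimes> N (g t) (g s)" by blast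
  show "\<exists>d>0. \<forall>s\<in>{a..c}. \<bar>s - t\<bar> < d \<longrightarrow> g s \<in> U (g t) \<and> L s = L t \<otimes> N (g t) (g s)"
  proof (intro exI[of _ "min d e"] conjI ballI impI)
    show "0 < min d e" using d e by simp
    fix s assume s: "s \<in> {a..c}" "\<bar>s - t\<bar> < min d e"
    have "g s \<in> U (g t) \<and> L s = L t \<otimes> N (g t) (g s)"
    proof (cases "s \<le> b")
      case True
      then have "s \<in> {a..b}" "\<bar>s - t\<bar> < d" using s by auto
      then show ?thesis using d(2) by blast
    next
      case False
      then have "s \<in> {b..c}" "\<bar>s - t\<bar> < e" using s by auto
      then show ?thesis using e(2) by blast
    qed
    then show "g s \<in> U (g t)" "L s = L t \<otimes> N (g t) (g s)" by auto
  qed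
qed

lemma lift_concat:
  assumes g: "dipath X g" and ab: "0 \<le> a" "a \<le> b" "b \<le> c" "c \<le> 1"
    and L: "lift g a b L" "L a = \<one>" and L': "lift g b c L'" "L' b = \<one>"
  obtains K where "lift g a c K" "K a = \<one>" "K c = L b \<otimes> L' c"
proof (rule that)
  let ?K = "\<lambda>t. if t \<le> b then L t else L b \<otimes> L' t"
  have Lb: "L b \<in> carrier \<tau>" using liftD(1)[OF L(1)] ab by simp
  show "lift g a c ?K"
  proof (rule lift_join[OF ab(2,3)])
    show "lift g a b ?K" by (rule lift_cong[OF L(1)]) simp
    have "lift g b c (\<lambda>t. L b \<otimes> L' t)" using lift_mult[OF g _ ab(4) L'(1) Lb] ab by simp
    then show "lift g b c ?K" by (rule lift_cong) (use L'(2) Lb in auto)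
  qed
  show "?K a = \<one>" using L(2) ab by simp
  show "?K c = L b \<otimes> L' c" using L'(2) Lb ab by auto
qed

lemma lift_local:
  assumes g: "dipath X g" and ab: "0 \<le> a" "a \<le> t" "t \<le> b" "b \<le> 1" and sub: "g ` {a..b} \<subseteq> U (g t)"
  shows "\<exists>L. lift g a b L \<and> L a = \<one>"
proof -
  have t01: "t \<in> {0..1}" using ab by auto
  note pt = dipathD(1)[OF g t01]
  have sub': "g ` {a..t} \<subseteq> U (g t)" and t1: "t \<le> 1" using sub ab by auto
  \<comment> \<open>\<open>i\<close> inverts \<open>N (g t) (g a)\<close>; multiplying by it makes
    the potential centred at \<open>g t\<close> start from \<open>\<one>\<close> at
    \<open>a\<close>.\<close>
  obtain i where i: "i \<in> carrier \<tau>" "N (g t) (g a) \<otimes> i = N (g t) (g t)" "N (g t) (g a) \<otimes> i = N (g t) (g t)"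
    by (rule path_step[OF g ab(1,2) t1 pt pt sub' sub'])
  have N: "N (g t) (g s) \<in> carrier \<tau>" if "s \<in> {a..b}" for s
    by (intro N_closed[OF pt] subsetD[OF sub] imageI that)
  define L where "L s = i \<otimes> N (g t) (g s)" for s
  have "lift g a b L"
    unfolding lift_def
  proof (intro conjI ballI)
    show "L s \<in> carrier \<tau>" if "s \<in> {a..b}" for s using N[OF that] i by (simp add: L_def)
    fix r assume r: "r \<in> {a..b}"
    then have r01: "r \<in> {0..1}" using ab by auto
    note pr = dipathD(1)[OF g r01]
    obtain d where d: "d > 0"
      "\<And>x y. 0 \<le> x \<Longrightarrow> x \<le> r \<Longrightarrow> r \<le> y \<Longrightarrow> y \<le> 1 \<Longrightarrow> y - x < d \<Longrightarrow> g ` {x..y} \<subseteq> U (g r)"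
      using path_near[OF g r01] by blast
    show "\<exists>d>0. \<forall>s\<in>{a..b}. \<bar>s - r\<bar> < d \<longrightarrow> g s \<in> U (g r) \<and> L s = L r \<otimes> N (g r) (g s)"
    proof (intro exI[of _ d] conjI ballI impI d(1))
      fix s assume s: "s \<in> {a..b}" "\<bar>s - r\<bar> < d"
      have "g s \<in> U (g r) \<and> N (g t) (g s) = N (g t) (g r) \<otimes> N (g r) (g s)"
      proof (cases "r \<le> s")
        case True
        then have 1: "g ` {r..s} \<subseteq> U (g r)" "g ` {r..s} \<subseteq> U (g t)" using d(2)[of r s] s r ab sub by auto
        have "0 \<le> r" "s \<le> 1" using r s ab by auto
        then obtain k where k: "k \<in> carrier \<tau>" "N (g t) (g r) \<otimes> k = N (g t) (g s)" "N (g r) (g r) \<otimes> k = N (g r) (g s)"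
          using path_step[OF g _ True _ pt pr 1(2,1)] by blast
        then show ?thesis using 1 True N_self[OF pr] by auto
      next
        \<comment> \<open>For \<open>s\<close> before \<open>r\<close>, the common increment
          \<open>k\<close> from \<open>s\<close> to \<open>r\<close> is inverse to
          \<open>N (g r) (g s)\<close>, so multiplying by the latter leads back from
          \<open>r\<close> to \<open>s\<close>.\<close>
        case False
        then have 1: "g ` {s..r} \<subseteq> U (g r)" "g ` {s..r} \<subseteq> U (g t)" using d(2)[of s r] s r ab sub by auto
        have "0 \<le> s" "s \<le> r" "r \<le> 1" using r s ab False by auto
        then obtain k where k: "k \<in> carrier \<tau>" "N (g t) (g s) \<otimes> k = N (g t) (g r)" "N (g r) (g s) \<otimes> k = N (g r) (g r)"
          using path_step[OF g _ _ _ pt pr 1(2,1)] by blast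
        have gs: "g s \<in> U (g r)" using 1 False by auto
        have "N (g t) (g r) \<otimes> N (g r) (g s) = N (g t) (g s) \<otimes> (N (g r) (g s) \<otimes> k)"
          unfolding k(2)[symmetric] using N[OF s(1)] N_closed[OF pr gs] k(1) by (simp add: m_ac)
        then show ?thesis using gs k(3) N_self[OF pr] N[OF s(1)] by simp
      qed
      moreover from this have "N (g r) (g s) \<in> carrier \<tau>" using N_closed[OF pr] by blast
      ultimately show "g s \<in> U (g r)" "L s = L r \<otimes> N (g r) (g s)"
        using i(1) N[OF r] by (simp_all add: L_def m_assoc)
    qed
  qed
  moreover have "L a = \<one>" using i N[of a] ab N_self[OF pt] by (simp add: L_def m_comm)
  ultimately show ?thesis by blast
qed

lemma lift_exists:
  assumes g: "dipath X g" and ab: "0 \<le> a" "a \<le> b" "b \<le> 1"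
  shows "\<exists>L. lift g a b L \<and> L a = \<one>"
  using ab(2)
proof (induction rule: Bolzano_interval)
  case (trans x y z)
  then show ?case
    using lift_concat[OF g, of x y z] ab by (metis order_trans)
next
  case (local t)
  then have t01: "t \<in> {0..1}" using ab by auto
  obtain d where d: "d > 0" "\<And>x y. 0 \<le> x \<Longrightarrow> x \<le> t \<Longrightarrow> t \<le> y \<Longrightarrow> y \<le> 1 \<Longrightarrow> y - x < d \<Longrightarrow> g ` {x..y} \<subseteq> U (g t)"
    using path_near[OF g t01] by blast
  show ?case
  proof (intro exI[of _ d] conjI allI impI d(1))
    fix x y assume "a \<le> x \<and> x \<le> t \<and> t \<le> y \<and> y \<le> b \<and> y - x < d"
    then show "\<exists>L. lift g x y L \<and> L x = \<one>"
      using ab d(2)[of x y] by (intro lift_local[OF g, of x t y]) auto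
  qed
qed

lemma val_eqI:
  assumes g: "dipath X g" and ab: "0 \<le> a" "a \<le> b" "b \<le> 1" and L: "lift g a b L" "L a = \<one>"
  shows "val g a b = L b"
  unfolding val_def
proof (rule the_equality)
  show "\<exists>K. lift g a b K \<and> K a = \<one> \<and> K b = L b" using L by blast
  show "v = L b" if "\<exists>K. lift g a b K \<and> K a = \<one> \<and> K b = v" for v
    using that lift_unique[OF g ab _ L(1)] L(2) by auto
qed

lemma val_lift:
  assumes g: "dipath X g" and ab: "0 \<le> a" "a \<le> b" "b \<le> 1"
  obtains L where "lift g a b L" "L a = \<one>" "val g a b = L b"
  using lift_exists[OF assms] val_eqI[OF assms] by blast

lemma val_closed:
  assumes "dipath X g" "0 \<le> a" "a \<le> b" "b \<le> 1"
  shows "val g a b \<in> carrier \<tau>"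
  using val_lift[OF assms] liftD(1) assms(3) by (metis atLeastAtMost_iff order_refl)

lemma val_concat:
  assumes g: "dipath X g" and ab: "0 \<le> a" "a \<le> b" "b \<le> c" "c \<le> 1"
  shows "val g a c = val g a b \<otimes> val g b c"
proof -
  obtain L where L: "lift g a b L" "L a = \<one>" "val g a b = L b" using val_lift[OF g ab(1,2)] ab by auto
  obtain L' where L': "lift g b c L'" "L' b = \<one>" "val g b c = L' c" using val_lift[OF g _ ab(3,4)] ab by auto
  obtain K where "lift g a c K" "K a = \<one>" "K c = L b \<otimes> L' c"
    using lift_concat[OF g ab L(1,2) L'(1,2)] by blast
  then show ?thesis using val_eqI[OF g ab(1) _ ab(4), of K] ab L L' by simp
qed

lemma val_strong:
  assumes g: "dipath X g" and ab: "0 \<le> a" "a \<le> b" "b \<le> 1"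
    and p: "p \<in> topspace (stop X)" "g ` {a..b} \<subseteq> U p"
  shows "N p (g a) \<otimes> val g a b = N p (g b)"
  using val_lift[OF g ab] lift_strong[OF g ab _ _ p] by metis

text \<open>The form in which values get computed. The centre lies on the path, so the value from
  \<open>a\<close> to \<open>t\<close> inverts \<open>N (g t) (g a)\<close>, and the equation for
  \<open>v\<close> has only one solution.\<close>

lemma val_eq_local:
  assumes g: "dipath X g" and ab: "0 \<le> a" "a \<le> t" "t \<le> b" "b \<le> 1" and sub: "g ` {a..b} \<subseteq> U (g t)"
    and v: "v \<in> carrier \<tau>" "N (g t) (g a) \<otimes> v = N (g t) (g b)"
  shows "val g a b = v"
proof -
  have t01: "t \<in> {0..1}" using ab by auto
  note pt = dipathD(1)[OF g t01]
  have "g ` {a..t} \<subseteq> U (g t)" using sub ab by auto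
  then have "N (g t) (g a) \<otimes> val g a t = \<one>" using val_strong[OF g ab(1,2) _ pt] N_self[OF pt] t01 by simp
  moreover have "N (g t) (g a) \<otimes> val g a b = N (g t) (g b)"
    using val_strong[OF g ab(1) _ ab(4) pt sub] ab by simp
  moreover have "N (g t) (g a) \<in> carrier \<tau>" by (intro N_closed[OF pt] subsetD[OF sub] imageI) (use ab in simp)
  moreover have "val g a b \<in> carrier \<tau>" "val g a t \<in> carrier \<tau>" using val_closed[OF g] ab by auto
  ultimately show ?thesis using inverse_unique v by blast
qed

lemma val_const:
  assumes g: "dipath X g" and const: "\<And>t. t \<in> {0..1} \<Longrightarrow> g t = p"
  shows "val g 0 1 = \<one>"
proof (rule val_eq_local[OF g, of 0 0 1])
  have p: "p \<in> topspace (stop X)" using dipathD(1)[OF g, of 0] const[of 0] by simp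
  show "g ` {0..1} \<subseteq> U (g 0)" using const U_self[OF p] by auto
  show "N (g 0) (g 0) \<otimes> \<one> = N (g 0) (g 1)" using const N_self[OF p] by simp
qed auto

section \<open>Compatibility with directed squares\<close>

definition commutes :: "(real \<Rightarrow> real \<Rightarrow> 'a) \<Rightarrow> real \<Rightarrow> real \<Rightarrow> real \<Rightarrow> real \<Rightarrow> bool" where
  "commutes G a a' b b' \<longleftrightarrow> val (\<lambda>s. G s b) a a' \<otimes> val (\<lambda>t. G a' t) b b' = val (\<lambda>t. G a t) b b' \<otimes> val (\<lambda>s. G s b') a a'"

text \<open>In a small square that contains \<open>(a, b)\<close>, both ways around solve the same
  equation for the potential centred at \<open>G a b\<close>, whose coefficient is a unit.\<close>

lemma commutes_local:
  assumes G: "disquare X G" and a: "a \<in> {0..1}" and b: "b \<in> {0..1}"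
  obtains d where "d > 0" "\<And>x x' y y'. 0 \<le> x \<Longrightarrow> x \<le> a \<Longrightarrow> a \<le> x' \<Longrightarrow> x' \<le> 1 \<Longrightarrow> x' - x < d \<Longrightarrow>
    0 \<le> y \<Longrightarrow> y \<le> b \<Longrightarrow> b \<le> y' \<Longrightarrow> y' \<le> 1 \<Longrightarrow> y' - y < d \<Longrightarrow> commutes G x x' y y'"
proof -
  define p where "p = G a b"
  have p: "p \<in> topspace (stop X)" unfolding p_def using dipathD(1)[OF disquareD(1)[OF G b] a] .
  obtain d where d: "d > 0" "\<forall>s\<in>{0..1}. \<forall>t\<in>{0..1}. \<bar>s - a\<bar> < d \<and> \<bar>t - b\<bar> < d \<longrightarrow> G s t \<in> U p"
    using disquareD(3)[OF G U_open[OF p] a b] U_self[OF p] unfolding p_def by blast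
  show thesis
  proof (rule that[OF d(1)])
    fix x x' y y' assume x: "0 \<le> x" "x \<le> a" "a \<le> x'" "x' \<le> 1" "x' - x < d"
      and y: "0 \<le> y" "y \<le> b" "b \<le> y'" "y' \<le> 1" "y' - y < d"
    have near: "G s t \<in> U p" if "x \<le> s" "s \<le> x'" "y \<le> t" "t \<le> y'" for s t
    proof -
      have "s \<in> {0..1}" "t \<in> {0..1}" "\<bar>s - a\<bar> < d" "\<bar>t - b\<bar> < d" using that x y by auto
      then show ?thesis using d(2) by blast
    qed
    have row: "N p (G s t) \<otimes> val (\<lambda>s. G s t) s s' = N p (G s' t)" "val (\<lambda>s. G s t) s s' \<in> carrier \<tau>"
      if "x \<le> s" "s \<le> s'" "s' \<le> x'" "y \<le> t" "t \<le> y'" for s s' t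
    proof -
      have g: "dipath X (\<lambda>s. G s t)" using disquareD(1)[OF G] that y by auto
      show "N p (G s t) \<otimes> val (\<lambda>s. G s t) s s' = N p (G s' t)"
        by (rule val_strong[OF g _ that(2) _ p]) (use that x in \<open>auto intro!: near\<close>)
      show "val (\<lambda>s. G s t) s s' \<in> carrier \<tau>" using val_closed[OF g _ that(2)] that x by auto
    qed
    have col: "N p (G s t) \<otimes> val (\<lambda>t. G s t) t t' = N p (G s t')" "val (\<lambda>t. G s t) t t' \<in> carrier \<tau>"
      if "x \<le> s" "s \<le> x'" "y \<le> t" "t \<le> t'" "t' \<le> y'" for s t t'
    proof -
      have g: "dipath X (\<lambda>t. G s t)" using disquareD(2)[OF G] that x by auto
      show "N p (G s t) \<otimes> val (\<lambda>t. G s t) t t' = N p (G s t')"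
        by (rule val_strong[OF g _ that(4) _ p]) (use that y in \<open>auto intro!: near\<close>)
      show "val (\<lambda>t. G s t) t t' \<in> carrier \<tau>" using val_closed[OF g _ that(4)] that y by auto
    qed
    have Nxy: "N p (G x y) \<in> carrier \<tau>" using N_closed[OF p near] x y by simp
    \<comment> \<open>The row from \<open>x\<close> to \<open>a\<close> followed by the column from
      \<open>y\<close> to \<open>b\<close> ends at the centre, so its value inverts
      \<open>N p (G x y)\<close>.\<close>
    have 1: "N p (G x y) \<otimes> (val (\<lambda>s. G s y) x a \<otimes> val (\<lambda>t. G a t) y b) = \<one>"
      using row[of x a y] col[of a y b] x y Nxy N_self[OF p] by (simp add: m_assoc[symmetric] p_def)
    have 2: "N p (G x y) \<otimes> (val (\<lambda>s. G s y) x x' \<otimes> val (\<lambda>t. G x' t) y y') = N p (G x' y')"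
      using row[of x x' y] col[of x' y y'] x y Nxy by (simp add: m_assoc[symmetric])
    have 3: "N p (G x y) \<otimes> (val (\<lambda>t. G x t) y y' \<otimes> val (\<lambda>s. G s y') x x') = N p (G x' y')"
      using row[of x x' y'] col[of x y y'] x y Nxy by (simp add: m_assoc[symmetric])
    show "commutes G x x' y y'"
      unfolding commutes_def
      using row[of x a y] col[of a y b] row[of x x' y] col[of x' y y'] row[of x x' y'] col[of x y y'] x y Nxy
      by (intro inverse_unique[OF 1 2 3]) simp_all
  qed
qed

lemma commutes_horizontal:
  assumes G: "disquare X G" and "commutes G x y b b'" "commutes G y z b b'"
    and xyz: "0 \<le> x" "x \<le> y" "y \<le> z" "z \<le> 1" and b: "0 \<le> b" "b \<le> b'" "b' \<le> 1"
  shows "commutes G x z b b'"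
proof -
  have row: "val (\<lambda>s. G s t) x z = val (\<lambda>s. G s t) x y \<otimes> val (\<lambda>s. G s t) y z"
    "val (\<lambda>s. G s t) x y \<in> carrier \<tau>" "val (\<lambda>s. G s t) y z \<in> carrier \<tau>" if "t \<in> {b..b'}" for t
  proof -
    have g: "dipath X (\<lambda>s. G s t)" using disquareD(1)[OF G] that b by auto
    show "val (\<lambda>s. G s t) x z = val (\<lambda>s. G s t) x y \<otimes> val (\<lambda>s. G s t) y z"
      "val (\<lambda>s. G s t) x y \<in> carrier \<tau>" "val (\<lambda>s. G s t) y z \<in> carrier \<tau>"
      using val_concat[OF g xyz] val_closed[OF g xyz(1,2)] val_closed[OF g _ xyz(3,4)] xyz by simp_all
  qed
  have col: "val (\<lambda>t. G s t) b b' \<in> carrier \<tau>" if "s \<in> {x..z}" for s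
    by (rule val_closed[OF disquareD(2)[OF G]]) (use that xyz b in auto)
  note r = row[of b] row[of b'] col[of x] col[of y] col[of z]
  have "val (\<lambda>s. G s b) x z \<otimes> val (\<lambda>t. G z t) b b' =
      val (\<lambda>s. G s b) x y \<otimes> (val (\<lambda>s. G s b) y z \<otimes> val (\<lambda>t. G z t) b b')"
    using r xyz b by (simp add: m_assoc)
  also have "\<dots> = val (\<lambda>s. G s b) x y \<otimes> val (\<lambda>t. G y t) b b' \<otimes> val (\<lambda>s. G s b') y z"
    using assms(3) r xyz b by (simp add: commutes_def m_assoc)
  also have "\<dots> = val (\<lambda>t. G x t) b b' \<otimes> val (\<lambda>s. G s b') x z"
    using assms(2) r xyz b by (simp add: commutes_def m_assoc)
  finally show ?thesis by (simp add: commutes_def)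
qed

lemma commutes_flip: "commutes (\<lambda>s t. G t s) b b' a a' \<longleftrightarrow> commutes G a a' b b'"
  unfolding commutes_def by auto

lemma disquare_flip:
  assumes "disquare X G"
  shows "disquare X (\<lambda>s t. G t s)"
  unfolding disquare_def
proof (intro conjI allI ballI impI)
  show "dipath X (\<lambda>s. G t s)" "dipath X (\<lambda>s. G s t)" if "t \<in> {0..1}" for t
    using disquareD(1,2)[OF assms that] by simp_all
  fix W a b assume "openin (stop X) W" "a \<in> {0..1}" "b \<in> {0..1::real}" "G b a \<in> W"
  then obtain d where d: "d > 0" "\<forall>s\<in>{0..1}. \<forall>t\<in>{0..1}. \<bar>s - b\<bar> < d \<and> \<bar>t - a\<bar> < d \<longrightarrow> G s t \<in> W"
    using disquareD(3)[OF assms] by meson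
  show "\<exists>d>0. \<forall>s\<in>{0..1}. \<forall>t\<in>{0..1}. \<bar>s - a\<bar> < d \<and> \<bar>t - b\<bar> < d \<longrightarrow> G t s \<in> W"
    by (intro exI[of _ d] conjI ballI impI d(1)) (simp add: d(2))
qed

lemma commutes_vertical:
  assumes G: "disquare X G" and "commutes G a a' x y" "commutes G a a' y z"
    and "0 \<le> x" "x \<le> y" "y \<le> z" "z \<le> 1" "0 \<le> a" "a \<le> a'" "a' \<le> 1"
  shows "commutes G a a' x z"
  using commutes_horizontal[OF disquare_flip[OF G] commutes_flip[THEN iffD2, OF assms(2)]
      commutes_flip[THEN iffD2, OF assms(3)] assms(4-10)]
  by (rule commutes_flip[THEN iffD1])

text \<open>Bisection in both directions: small squares are pasted to strips of full width, and the
  strips to the whole square.\<close>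

lemma val_square:
  assumes G: "disquare X G"
  shows "val (\<lambda>s. G s 0) 0 1 \<otimes> val (\<lambda>t. G 1 t) 0 1 = val (\<lambda>t. G 0 t) 0 1 \<otimes> val (\<lambda>s. G s 1) 0 1"
proof -
  have "commutes G 0 1 0 1"
    using zero_le_one
  proof (rule Bolzano_interval[where P = "commutes G 0 1"])
    show "commutes G 0 1 x z" if "commutes G 0 1 x y" "commutes G 0 1 y z" "0 \<le> x" "x \<le> y" "y \<le> z" "z \<le> 1" for x y z
      using that by (intro commutes_vertical[OF G that(1,2)]) auto
    fix b :: real assume b: "b \<in> {0..1}"
    \<comment> \<open>Strips around the row \<open>b\<close> with their height left open: pasting
      two strips takes the minimum of their heights.\<close>
    define P where "P a a' \<longleftrightarrow> (\<exists>d>0. \<forall>y y'. 0 \<le> y \<and> y \<le> b \<and> b \<le> y' \<and> y' \<le> 1 \<and> y' - y < d \<longrightarrow> commutes G a a' y y')" for a a'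
    have "P 0 1"
      using zero_le_one
    proof (rule Bolzano_interval[where P = P])
      fix x y z :: real assume "P x y" "P y z" and xyz: "0 \<le> x" "x \<le> y" "y \<le> z" "z \<le> 1"
      then obtain d e where d: "d > 0" "\<forall>u u'. 0 \<le> u \<and> u \<le> b \<and> b \<le> u' \<and> u' \<le> 1 \<and> u' - u < d \<longrightarrow> commutes G x y u u'"
        and e: "e > 0" "\<forall>u u'. 0 \<le> u \<and> u \<le> b \<and> b \<le> u' \<and> u' \<le> 1 \<and> u' - u < e \<longrightarrow> commutes G y z u u'"
        unfolding P_def by blast
      show "P x z"
        unfolding P_def
      proof (intro exI[of _ "min d e"] conjI allI impI)
        show "0 < min d e" using d e by simp
        fix u u' assume u: "0 \<le> u \<and> u \<le> b \<and> b \<le> u' \<and> u' \<le> 1 \<and> u' - u < min d e"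
        show "commutes G x z u u'"
          using u d(2) e(2) xyz by (intro commutes_horizontal[OF G, of x y u u' z]) auto
      qed
    next
      fix a :: real assume a: "a \<in> {0..1}"
      obtain d where d: "d > 0" "\<And>x x' y y'. 0 \<le> x \<Longrightarrow> x \<le> a \<Longrightarrow> a \<le> x' \<Longrightarrow> x' \<le> 1 \<Longrightarrow> x' - x < d \<Longrightarrow>
          0 \<le> y \<Longrightarrow> y \<le> b \<Longrightarrow> b \<le> y' \<Longrightarrow> y' \<le> 1 \<Longrightarrow> y' - y < d \<Longrightarrow> commutes G x x' y y'"
        using commutes_local[OF G a b] by blast
      show "\<exists>d>0. \<forall>x y. 0 \<le> x \<and> x \<le> a \<and> a \<le> y \<and> y \<le> 1 \<and> y - x < d \<longrightarrow> P x y"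
        using d unfolding P_def by blast
    qed
    then show "\<exists>d>0. \<forall>x y. 0 \<le> x \<and> x \<le> b \<and> b \<le> y \<and> y \<le> 1 \<and> y - x < d \<longrightarrow> commutes G 0 1 x y"
      unfolding P_def by blast
  qed
  then show ?thesis by (simp add: commutes_def)
qed

end

subsection \<open>Curves and surfaces in cubes\<close>

definition curve :: "nat \<Rightarrow> (real \<Rightarrow> nat \<Rightarrow> real) \<Rightarrow> bool" where
  "curve n c \<longleftrightarrow> (\<forall>t\<in>{0..1}. c t \<in> cube n) \<and>
     (\<forall>i<n. continuous_on {0..1} (\<lambda>t. c t i) \<and> mono_on {0..1} (\<lambda>t. c t i))"

definition surface :: "nat \<Rightarrow> (real \<Rightarrow> real \<Rightarrow> nat \<Rightarrow> real) \<Rightarrow> bool" where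
  "surface n c \<longleftrightarrow> (\<forall>s\<in>{0..1}. \<forall>t\<in>{0..1}. c s t \<in> cube n) \<and>
     (\<forall>i<n. continuous_on ({0..1} \<times> {0..1}) (\<lambda>(s, t). c s t i) \<and>
       (\<forall>s\<in>{0..1}. mono_on {0..1} (\<lambda>t. c s t i)) \<and> (\<forall>t\<in>{0..1}. mono_on {0..1} (\<lambda>s. c s t i)))"

definition path_cell :: "(real \<Rightarrow> 'a) \<Rightarrow> (nat \<Rightarrow> real) \<Rightarrow> 'a" where
  "path_cell g = (\<lambda>x\<in>cube 1. g (x 0))"

definition square_cell :: "(real \<Rightarrow> real \<Rightarrow> 'a) \<Rightarrow> (nat \<Rightarrow> real) \<Rightarrow> 'a" where
  "square_cell G = (\<lambda>x\<in>cube 2. G (x 0) (x 1))"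

definition pt1 :: "real \<Rightarrow> nat \<Rightarrow> real" where "pt1 t = (\<lambda>_\<in>{..<1}. t)"
definition pt2 :: "real \<Rightarrow> real \<Rightarrow> nat \<Rightarrow> real" where "pt2 s t = (\<lambda>i\<in>{..<2}. if i = 0 then s else t)"

lemma pt1_mem: "t \<in> {0..1} \<Longrightarrow> pt1 t \<in> cube 1" by (simp add: pt1_def tuplesI)
lemma pt2_mem: "s \<in> {0..1} \<Longrightarrow> t \<in> {0..1} \<Longrightarrow> pt2 s t \<in> cube 2" by (simp add: pt2_def tuplesI)
lemma pt1_nth [simp]: "pt1 t 0 = t" by (simp add: pt1_def)
lemma pt2_nth [simp]: "pt2 s t 0 = s" "pt2 s t (Suc 0) = t" by (simp_all add: pt2_def)
lemma pt1_eq: "x \<in> cube 1 \<Longrightarrow> pt1 (x 0) = x"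
  by (rule tuples_eqI[where S = UNIV]) (auto simp: pt1_def tuplesI)
lemma path_cell_val [simp]: "t \<in> {0..1} \<Longrightarrow> path_cell g (pt1 t) = g t"
  unfolding path_cell_def by (simp add: pt1_mem del: One_nat_def)
lemma square_cell_val [simp]: "s \<in> {0..1} \<Longrightarrow> t \<in> {0..1} \<Longrightarrow> square_cell G (pt2 s t) = G s t"
  unfolding square_cell_def by (simp add: pt2_mem)

lemma continuous_map_cube_coord: "i < n \<Longrightarrow> continuous_map (cube_topology n) (top_of_set {0..1}) (\<lambda>x. x i)"
  unfolding cube_topology_def by (rule continuous_map_product_projection) simp

lemma continuous_map_into_cube:
  assumes "\<And>x. x \<in> topspace T \<Longrightarrow> f x \<in> cube n" "\<And>i. i < n \<Longrightarrow> continuous_map T (top_of_set {0..1}) (\<lambda>x. f x i)"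
  shows "continuous_map T (cube_topology n) f"
  unfolding cube_topology_def continuous_map_componentwise
proof (intro conjI ballI)
  show "f ` topspace T \<subseteq> extensional {..<n}" using assms(1) by (auto simp: cube_iff)
qed (use assms(2) in simp)

lemma curve_stream_map:
  assumes "curve n c"
  shows "(\<lambda>x\<in>cube 1. c (x 0)) \<in> stream_maps (directed_cube 1) (directed_cube n)"
proof (rule monotone_stream_map)
  have mem: "c (x 0) \<in> cube n" if "x \<in> cube 1" for x
    using assms cube_nth[OF that, of 0] by (simp add: curve_def)
  show "(\<lambda>x\<in>cube 1. c (x 0)) \<in> cube 1 \<rightarrow>\<^sub>E cube n" using mem by simp
  show "continuous_map (cube_topology 1) (cube_topology n) (\<lambda>x\<in>cube 1. c (x 0))"
  proof (rule continuous_map_into_cube)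
    fix i assume i: "i < n"
    have "continuous_map (top_of_set {0..1}) (top_of_set {0..1}) (\<lambda>t. c t i)"
      using assms i cube_nth by (auto simp: curve_def continuous_map_in_subtopology continuous_map_iff_continuous Pi_iff)
    from continuous_map_compose[OF continuous_map_cube_coord[of 0 1, OF zero_less_one] this]
    show "continuous_map (cube_topology 1) (top_of_set {0..1}) (\<lambda>x. (\<lambda>x\<in>cube 1. c (x 0)) x i)"
      by (rule continuous_map_eq) (auto simp: o_def)
  qed (use mem in auto)
  fix s t assume "(s, t) \<in> cube_le 1"
  then have st: "s \<in> cube 1" "t \<in> cube 1" "s 0 \<le> t 0" by (auto simp: cube_le_def)
  then have "c (s 0) i \<le> c (t 0) i" if "i < n" for i
    using assms that cube_nth[OF st(1), of 0] cube_nth[OF st(2), of 0] by (auto simp: curve_def mono_on_def)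
  then show "((\<lambda>x\<in>cube 1. c (x 0)) s, (\<lambda>x\<in>cube 1. c (x 0)) t) \<in> cube_le n"
    using st mem by (simp add: cube_le_def)
qed

lemma surface_stream_map:
  assumes "surface n c"
  shows "(\<lambda>x\<in>cube 2. c (x 0) (x 1)) \<in> stream_maps (directed_cube 2) (directed_cube n)"
proof (rule monotone_stream_map)
  have x01: "x 0 \<in> {0..1}" "x 1 \<in> {0..1}" if "x \<in> cube 2" for x using cube_nth[OF that] by simp_all
  have mem: "c (x 0) (x 1) \<in> cube n" if "x \<in> cube 2" for x
    using assms x01[OF that] unfolding surface_def by blast
  show "(\<lambda>x\<in>cube 2. c (x 0) (x 1)) \<in> cube 2 \<rightarrow>\<^sub>E cube n" using mem by simp
  show "continuous_map (cube_topology 2) (cube_topology n) (\<lambda>x\<in>cube 2. c (x 0) (x 1))"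
  proof (rule continuous_map_into_cube)
    fix i assume i: "i < n"
    have "(\<lambda>(s, t). c s t i) \<in> {0..1} \<times> {0..1} \<rightarrow> {0..1}"
    proof (clarsimp simp del: atLeastAtMost_iff)
      fix s t :: real assume "s \<in> {0..1}" "t \<in> {0..1}"
      then have "c s t \<in> cube n" using assms unfolding surface_def by blast
      then show "c s t i \<in> {0..1}" using i by (rule cube_nth)
    qed
    moreover have "continuous_on ({0..1} \<times> {0..1}) (\<lambda>(s, t). c s t i)" using assms i unfolding surface_def by blast
    ultimately have "continuous_map (top_of_set ({0..1} \<times> {0..1})) (top_of_set {0..1}) (\<lambda>(s, t). c s t i)"
      by (simp add: continuous_map_in_subtopology continuous_map_iff_continuous image_subset_iff_funcset)
    then have 1: "continuous_map (prod_topology (top_of_set {0..1}) (top_of_set {0..1})) (top_of_set {0..1}) (\<lambda>(s, t). c s t i)"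
      by (simp add: subtopology_Times euclidean_product_topology[symmetric])
    have "continuous_map (cube_topology 2) (prod_topology (top_of_set {0..1}) (top_of_set {0..1})) (\<lambda>x. (x 0, x 1))"
      by (intro continuous_map_pairedI continuous_map_cube_coord) simp_all
    from continuous_map_compose[OF this 1]
    show "continuous_map (cube_topology 2) (top_of_set {0..1}) (\<lambda>x. (\<lambda>x\<in>cube 2. c (x 0) (x 1)) x i)"
      by (rule continuous_map_eq) (auto simp: o_def)
  qed (use mem in auto)
  fix x y assume "(x, y) \<in> cube_le 2"
  then have xy: "x \<in> cube 2" "y \<in> cube 2" "x 0 \<le> y 0" "x 1 \<le> y 1" by (auto simp: cube_le_def)
  have "c (x 0) (x 1) i \<le> c (y 0) (y 1) i" if i: "i < n" for i
  proof -
    have "mono_on {0..1} (\<lambda>s. c s (x 1) i)" "mono_on {0..1} (\<lambda>t. c (y 0) t i)"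
      using assms i x01[OF xy(1)] x01[OF xy(2)] unfolding surface_def by blast+
    then have "c (x 0) (x 1) i \<le> c (y 0) (x 1) i" "c (y 0) (x 1) i \<le> c (y 0) (y 1) i"
      using x01[OF xy(1)] x01[OF xy(2)] xy(3,4) by (blast dest: mono_onD)+
    then show ?thesis by simp
  qed
  then show "((\<lambda>x\<in>cube 2. c (x 0) (x 1)) x, (\<lambda>x\<in>cube 2. c (x 0) (x 1)) y) \<in> cube_le n"
    using xy mem by (simp add: cube_le_def)
qed

subsection \<open>Directed paths and squares as stream maps\<close>

lemma dipath_stream_map1:
  assumes X: "is_stream X" and e: "e \<in> stream_maps (directed_cube 1) X"
  shows "dipath X (\<lambda>t. e (pt1 t))"
  unfolding dipath_def
proof (intro conjI ballI allI impI; (elim conjE)?)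
  note e' = stream_mapsD[OF e]
  show "e (pt1 t) \<in> topspace (stop X)" if "t \<in> {0..1}" for t
    using PiE_mem[OF e'(1), of "pt1 t"] pt1_mem[OF that] by simp
  fix W assume W: "openin (stop X) W"
  define V where "V = {x \<in> cube 1. e x \<in> W}"
  have V: "openin (cube_topology 1) V"
    using openin_continuous_map_preimage[OF e'(2) W] by (simp add: V_def)
  fix t :: real assume t: "t \<in> {0..1}" "e (pt1 t) \<in> W"
  then obtain d where d: "d > 0" "{u \<in> cube 1. \<forall>i<1. \<bar>u i - pt1 t i\<bar> < d} \<subseteq> V"
    using cube_box_neighbourhood[OF V, of "pt1 t"] pt1_mem[OF t(1)] by (auto simp: V_def)
  show "\<exists>d>0. \<forall>s\<in>{0..1}. \<bar>s - t\<bar> < d \<longrightarrow> e (pt1 s) \<in> W"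
  proof (intro exI[of _ d] conjI ballI impI d(1))
    fix s :: real assume "s \<in> {0..1}" "\<bar>s - t\<bar> < d"
    then have "pt1 s \<in> {u \<in> cube 1. \<forall>i<1. \<bar>u i - pt1 t i\<bar> < d}" using pt1_mem[of s] by simp
    then show "e (pt1 s) \<in> W" using d(2) by (auto simp: V_def)
  qed
next
  note e' = stream_mapsD[OF e]
  fix W and a b :: real assume W: "openin (stop X) W" and ab: "0 \<le> a" "a \<le> b" "b \<le> 1" "(\<lambda>t. e (pt1 t)) ` {a..b} \<subseteq> W"
  define V where "V = {x \<in> cube 1. e x \<in> W}"
  have V: "openin (cube_topology 1) V"
    using openin_continuous_map_preimage[OF e'(2) W] by (simp add: V_def)
  have m: "pt1 a \<in> cube 1" "pt1 b \<in> cube 1" using ab by (auto intro!: pt1_mem simp del: One_nat_def)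
  \<comment> \<open>In dimension 1 the order interval is the image of \<open>{a..b}\<close>, so the
    pair of endpoints is a single step of the circulation.\<close>
  have int: "cube_interval 1 (pt1 a) (pt1 b) \<subseteq> V"
  proof
    fix u assume u: "u \<in> cube_interval 1 (pt1 a) (pt1 b)"
    then have "u \<in> cube 1" "u 0 \<in> {a..b}" by (auto simp: cube_interval_def)
    then have "e (pt1 (u 0)) \<in> W" using ab(4) by blast
    then show "u \<in> V" using \<open>u \<in> cube 1\<close> pt1_eq[of u] by (simp add: V_def)
  qed
  have "pt1 a \<in> cube_interval 1 (pt1 a) (pt1 b)" "pt1 b \<in> cube_interval 1 (pt1 a) (pt1 b)"
    using m ab by (auto simp: cube_interval_def)
  then have "(pt1 a, pt1 b) \<in> cube_steps 1 V"
    using int m ab by (auto simp: cube_steps_def cube_le_def)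
  then have "(pt1 a, pt1 b) \<in> circ (directed_cube 1) V"
    using V by (auto simp: directed_cube_eq cube_circulation_def)
  then show "(e (pt1 a), e (pt1 b)) \<in> circ X W" using e'(3)[OF W, of "pt1 a" "pt1 b"] by (simp add: V_def)
qed

lemma dipath_cong:
  assumes g: "dipath X g" and eq: "\<And>t. t \<in> {0..1} \<Longrightarrow> h t = g t"
  shows "dipath X h"
  unfolding dipath_def
proof (intro conjI ballI allI impI; (elim conjE)?)
  show "h t \<in> topspace (stop X)" if "t \<in> {0..1}" for t using dipathD(1)[OF g that] eq[OF that] by simp
  fix W assume W: "openin (stop X) W"
  fix t :: real assume t: "t \<in> {0..1}" "h t \<in> W"
  then obtain d where "d > 0" "\<forall>s\<in>{0..1}. \<bar>s - t\<bar> < d \<longrightarrow> g s \<in> W"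
    using dipathD(2)[OF g W t(1)] eq[OF t(1)] by auto
  then show "\<exists>d>0. \<forall>s\<in>{0..1}. \<bar>s - t\<bar> < d \<longrightarrow> h s \<in> W" using eq by metis
next
  fix W and a b :: real assume W: "openin (stop X) W" and ab: "0 \<le> a" "a \<le> b" "b \<le> 1" "h ` {a..b} \<subseteq> W"
  have "g ` {a..b} = h ` {a..b}" using ab eq by (intro image_cong) auto
  then show "(h a, h b) \<in> circ X W" using dipathD(3)[OF g W ab(1-3)] ab eq[of a] eq[of b] by simp
qed

lemma dipath_curve:
  assumes X: "is_stream X" and e: "e \<in> stream_maps (directed_cube n) X" and c: "curve n c"
  shows "dipath X (\<lambda>t. e (c t))"
proof (rule dipath_cong)
  show "dipath X (\<lambda>t. compose (cube 1) e (\<lambda>x\<in>cube 1. c (x 0)) (pt1 t))"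
    using dipath_stream_map1[OF X stream_maps_compose[OF is_stream_directed_cube curve_stream_map[OF c] e]] by simp
  show "e (c t) = compose (cube 1) e (\<lambda>x\<in>cube 1. c (x 0)) (pt1 t)" if "t \<in> {0..1}" for t
    using pt1_mem[OF that] by (simp add: compose_eq del: One_nat_def)
qed

lemma disquare_surface:
  assumes X: "is_stream X" and e: "e \<in> stream_maps (directed_cube n) X" and c: "surface n c"
  shows "disquare X (\<lambda>s t. e (c s t))"
  unfolding disquare_def
proof (intro conjI ballI allI impI)
  have c': "c s t \<in> cube n" if "s \<in> {0..1}" "t \<in> {0..1}" for s t using c that unfolding surface_def by blast
  have cont: "continuous_on ({0..1} \<times> {0..1}) (\<lambda>(s, t). c s t i)" if "i < n" for i using c that unfolding surface_def by blast
  show "dipath X (\<lambda>s. e (c s t))" if t: "t \<in> {0..1}" for t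
  proof (rule dipath_curve[OF X e])
    have "continuous_on {0..1} (\<lambda>s. c s t i)" if "i < n" for i
    proof -
      have "continuous_on {0..1} (\<lambda>s. case (s, t) of (s, t) \<Rightarrow> c s t i)"
        by (rule continuous_on_compose2[OF cont[OF that]]) (use t in \<open>auto intro!: continuous_intros\<close>)
      then show ?thesis by simp
    qed
    then show "curve n (\<lambda>s. c s t)" using c c' t unfolding curve_def surface_def by simp
  qed
  show "dipath X (\<lambda>t. e (c s t))" if s: "s \<in> {0..1}" for s
  proof (rule dipath_curve[OF X e])
    have "continuous_on {0..1} (\<lambda>t. c s t i)" if "i < n" for i
    proof -
      have "continuous_on {0..1} (\<lambda>t. case (s, t) of (s, t) \<Rightarrow> c s t i)"
        by (rule continuous_on_compose2[OF cont[OF that]]) (use s in \<open>auto intro!: continuous_intros\<close>)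
      then show ?thesis by simp
    qed
    then show "curve n (\<lambda>t. c s t)" using c c' s unfolding curve_def surface_def by simp
  qed
  fix W a b assume W: "openin (stop X) W" and ab: "a \<in> {0..1}" "b \<in> {0..1::real}" "e (c a b) \<in> W"
  let ?h = "compose (cube 2) e (\<lambda>x\<in>cube 2. c (x 0) (x 1))"
  define V where "V = {x \<in> cube 2. ?h x \<in> W}"
  have h: "?h \<in> stream_maps (directed_cube 2) X"
    using stream_maps_compose[OF is_stream_directed_cube surface_stream_map[OF c] e] by simp
  have val: "?h (pt2 s t) = e (c s t)" if "s \<in> {0..1}" "t \<in> {0..1}" for s t
    using pt2_mem[OF that] by (simp add: compose_eq)
  have V: "openin (cube_topology 2) V"
    using openin_continuous_map_preimage[OF stream_mapsD(2)[OF h] W] by (simp add: V_def)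
  have "pt2 a b \<in> V" using pt2_mem[OF ab(1,2)] val[OF ab(1,2)] ab(3) by (simp add: V_def)
  then obtain d where d: "d > 0" "{u \<in> cube 2. \<forall>i<2. \<bar>u i - pt2 a b i\<bar> < d} \<subseteq> V"
    using cube_box_neighbourhood[OF V] by blast
  show "\<exists>d>0. \<forall>s\<in>{0..1}. \<forall>t\<in>{0..1}. \<bar>s - a\<bar> < d \<and> \<bar>t - b\<bar> < d \<longrightarrow> e (c s t) \<in> W"
  proof (intro exI[of _ d] conjI ballI impI d(1))
    fix s t :: real assume st: "s \<in> {0..1}" "t \<in> {0..1}" "\<bar>s - a\<bar> < d \<and> \<bar>t - b\<bar> < d"
    then have "pt2 s t \<in> {u \<in> cube 2. \<forall>i<2. \<bar>u i - pt2 a b i\<bar> < d}"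
      using pt2_mem[OF st(1,2)] by (simp add: numeral_2_eq_2 less_Suc_eq)
    then have "pt2 s t \<in> V" using d(2) by blast
    then show "e (c s t) \<in> W" using val[OF st(1,2)] by (simp add: V_def)
  qed
qed

lemma path_cell_mem:
  assumes X: "is_stream X" and g: "dipath X g"
  shows "path_cell g \<in> stream_maps (directed_cube 1) X"
proof (rule stream_mapsI)
  have x0: "x 0 \<in> {0..1}" if "x \<in> cube 1" for x using cube_nth[OF that, of 0] by simp
  show "path_cell g \<in> topspace (stop (directed_cube 1)) \<rightarrow>\<^sub>E topspace (stop X)"
    using dipathD(1)[OF g] x0 by (simp add: path_cell_def del: One_nat_def)
  have pre: "{x \<in> cube 1. path_cell g x \<in> W} = {x \<in> cube 1. g (x 0) \<in> W}" for W
    by (auto simp: path_cell_def)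
  have op: "openin (cube_topology 1) {x \<in> cube 1. g (x 0) \<in> W}" if W: "openin (stop X) W" for W
  proof (rule openin_cubeI)
    fix x assume x: "x \<in> {x \<in> cube 1. g (x 0) \<in> W}"
    then obtain d where d: "d > 0" "\<forall>s\<in>{0..1}. \<bar>s - x 0\<bar> < d \<longrightarrow> g s \<in> W"
      using dipathD(2)[OF g W x0[of x]] by blast
    show "\<exists>d>0. \<forall>u\<in>cube 1. (\<forall>i<1. \<bar>u i - x i\<bar> < d) \<longrightarrow> u \<in> {x \<in> cube 1. g (x 0) \<in> W}"
      by (intro exI[of _ d] conjI ballI impI d(1)) (use d(2) x0 in simp)
  qed blast
  show "continuous_map (stop (directed_cube 1)) (stop X) (path_cell g)"
    unfolding continuous_map_def using op pre dipathD(1)[OF g] x0 by (simp add: path_cell_def del: One_nat_def)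
  fix W x y assume W: "openin (stop X) W"
    and xy: "(x, y) \<in> circ (directed_cube 1) {x \<in> topspace (stop (directed_cube 1)). path_cell g x \<in> W}"
  let ?V = "{x \<in> cube 1. g (x 0) \<in> W}"
  have step: "(path_cell g x, path_cell g y) \<in> circ X W" if "(x, y) \<in> cube_steps 1 ?V" for x y
  proof -
    have m: "x \<in> cube 1" "y \<in> cube 1" "x 0 \<le> y 0" and int: "cube_interval 1 x y \<subseteq> ?V"
      using that by (auto simp: cube_steps_def cube_le_def)
    have "g ` {x 0..y 0} \<subseteq> W"
    proof
      fix z assume "z \<in> g ` {x 0..y 0}"
      then obtain t where t: "t \<in> {x 0..y 0}" "z = g t" by blast
      have "t \<in> {0..1}" using t x0[OF m(1)] x0[OF m(2)] by auto
      then have "pt1 t \<in> cube_interval 1 x y" using t pt1_mem[of t] by (simp add: cube_interval_def)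
      then show "z \<in> W" using int t by auto
    qed
    then have "(g (x 0), g (y 0)) \<in> circ X W" using dipathD(3)[OF g W _ m(3)] x0[OF m(1)] x0[OF m(2)] by auto
    then show ?thesis using m by (simp add: path_cell_def)
  qed
  have "(x, y) \<in> (cube_steps 1 ?V)\<^sup>+"
    using xy op[OF W] pre by (simp add: directed_cube_eq cube_circulation_def)
  then show "(path_cell g x, path_cell g y) \<in> circ X W"
  proof (induction rule: trancl_induct)
    case (step y z)
    then show ?case using \<open>\<And>y x. (x, y) \<in> cube_steps 1 ?V \<Longrightarrow> _\<close> is_streamD(3)[OF X W] by (meson transD)
  qed (rule step)
qed

lemma square_cell_mem:
  assumes X: "is_stream X" and G: "disquare X G"
  shows "square_cell G \<in> stream_maps (directed_cube 2) X"
proof (rule stream_mapsI)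
  have x01: "x 0 \<in> {0..1}" "x 1 \<in> {0..1}" if "x \<in> cube 2" for x using cube_nth[OF that] by simp_all
  have G': "G s t \<in> topspace (stop X)" if "s \<in> {0..1}" "t \<in> {0..1}" for s t
    using dipathD(1)[OF disquareD(1)[OF G that(2)] that(1)] .
  show "square_cell G \<in> topspace (stop (directed_cube 2)) \<rightarrow>\<^sub>E topspace (stop X)"
    using G' x01 by (simp add: square_cell_def)
  have pre: "{x \<in> cube 2. square_cell G x \<in> W} = {x \<in> cube 2. G (x 0) (x 1) \<in> W}" for W
    by (auto simp: square_cell_def)
  have op: "openin (cube_topology 2) {x \<in> cube 2. G (x 0) (x 1) \<in> W}" if W: "openin (stop X) W" for W
  proof (rule openin_cubeI)
    fix x assume x: "x \<in> {x \<in> cube 2. G (x 0) (x 1) \<in> W}"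
    then obtain d where d: "d > 0"
      "\<forall>s\<in>{0..1}. \<forall>t\<in>{0..1}. \<bar>s - x 0\<bar> < d \<and> \<bar>t - x 1\<bar> < d \<longrightarrow> G s t \<in> W"
      using disquareD(3)[OF G W x01[of x]] by blast
    show "\<exists>d>0. \<forall>u\<in>cube 2. (\<forall>i<2. \<bar>u i - x i\<bar> < d) \<longrightarrow> u \<in> {x \<in> cube 2. G (x 0) (x 1) \<in> W}"
    proof (intro exI[of _ d] conjI ballI impI d(1))
      fix u assume u: "u \<in> cube 2" "\<forall>i<2. \<bar>u i - x i\<bar> < d"
      then have "\<bar>u 0 - x 0\<bar> < d" "\<bar>u 1 - x 1\<bar> < d" by simp_all
      then show "u \<in> {x \<in> cube 2. G (x 0) (x 1) \<in> W}" using d(2) x01[OF u(1)] u(1) by blast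
    qed
  qed blast
  show "continuous_map (stop (directed_cube 2)) (stop X) (square_cell G)"
    unfolding continuous_map_def using op pre G' x01 by (simp add: square_cell_def)
  fix W x y assume W: "openin (stop X) W"
    and xy: "(x, y) \<in> circ (directed_cube 2) {x \<in> topspace (stop (directed_cube 2)). square_cell G x \<in> W}"
  let ?V = "{x \<in> cube 2. G (x 0) (x 1) \<in> W}"
  have step: "(square_cell G x, square_cell G y) \<in> circ X W" if "(x, y) \<in> cube_steps 2 ?V" for x y
  proof -
    have m: "x \<in> cube 2" "y \<in> cube 2" "x 0 \<le> y 0" "x 1 \<le> y 1" and int: "cube_interval 2 x y \<subseteq> ?V"
      using that by (auto simp: cube_steps_def cube_le_def)
    note b = x01[OF m(1)] x01[OF m(2)]
    have W': "G s t \<in> W" if "s \<in> {x 0..y 0}" "t \<in> {x 1..y 1}" for s t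
    proof -
      have "s \<in> {0..1}" "t \<in> {0..1}" using that b by auto
      then have "pt2 s t \<in> cube_interval 2 x y"
        using that pt2_mem[of s t] by (simp add: cube_interval_def numeral_2_eq_2 less_Suc_eq)
      then show ?thesis using int by auto
    qed
    \<comment> \<open>A step of the square is a horizontal step followed by a vertical one, both
      within its order interval.\<close>
    have "(G (x 0) (x 1), G (y 0) (x 1)) \<in> circ X W"
      by (rule dipathD(3)[OF disquareD(1)[OF G b(2)] W]) (use b m W' in auto)
    moreover have "(G (y 0) (x 1), G (y 0) (y 1)) \<in> circ X W"
      by (rule dipathD(3)[OF disquareD(2)[OF G b(3)] W]) (use b m W' in auto)
    ultimately have "(G (x 0) (x 1), G (y 0) (y 1)) \<in> circ X W" using is_streamD(3)[OF X W] by (meson transD)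
    then show ?thesis using m by (simp add: square_cell_def)
  qed
  have "(x, y) \<in> (cube_steps 2 ?V)\<^sup>+"
    using xy op[OF W] pre by (simp add: directed_cube_eq cube_circulation_def)
  then show "(square_cell G x, square_cell G y) \<in> circ X W"
  proof (induction rule: trancl_induct)
    case (step y z)
    then show ?case using \<open>\<And>y x. (x, y) \<in> cube_steps 2 ?V \<Longrightarrow> _\<close> is_streamD(3)[OF X W] by (meson transD)
  qed (rule step)
qed

subsection \<open>Cochains on singular cubical sets\<close>

lemma cells_sing: "cells (sing X) n = stream_maps (directed_cube n) X"
  by (simp add: sing_def)

lemma act_sing: "act (sing X) m n \<phi> e = compose (cube m) e (cube_map m n \<phi>)"
  by (simp add: sing_def)

lemma curve_line:
  assumes "(v, w) \<in> verts_le n"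
  shows "curve n (line n v w)"
  unfolding curve_def
proof (intro conjI ballI allI impI)
  show "line n v w t \<in> cube n" if "t \<in> {0..1}" for t using line_mem[OF that] .
  fix i assume i: "i < n"
  then show "continuous_on {0..1} (\<lambda>t. line n v w t i)" by (simp add: continuous_intros)
  have "of_bool (v i) \<le> (of_bool (w i) :: real)" using verts_leD(3)[OF assms i] by (auto simp: of_bool_def)
  then have "0 \<le> (of_bool (w i) - of_bool (v i) :: real)" by simp
  then have "s * (of_bool (w i) - of_bool (v i)) \<le> t * (of_bool (w i) - of_bool (v i))" if "s \<le> t" for s t :: real
    using that by (rule mult_right_mono[rotated])
  then show "mono_on {0..1} (\<lambda>t. line n v w t i)"
    using i by (auto simp: mono_on_def algebra_simps)
qed

text \<open>A square whose side \<open>a = 0\<close> is collapsed to \<open>u\<close>; its other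
  sides are the lines from \<open>u\<close> to \<open>v\<close>, \<open>v\<close> to
  \<open>w\<close> and \<open>u\<close> to \<open>w\<close>. It turns the square condition on a path
  functional into multiplicativity.\<close>

definition triangle :: "nat \<Rightarrow> (nat \<Rightarrow> bool) \<Rightarrow> (nat \<Rightarrow> bool) \<Rightarrow> (nat \<Rightarrow> bool) \<Rightarrow> real \<Rightarrow> real \<Rightarrow> (nat \<Rightarrow> real)" where
  "triangle n u v w a b = (\<lambda>i\<in>{..<n}. (1 - a) * of_bool (u i) + a * ((1 - b) * of_bool (v i) + b * of_bool (w i)))"

lemma triangle_sides:
  assumes "u \<in> verts n" "v \<in> verts n"
  shows "triangle n u v w a 0 = line n u v a" "triangle n u v w a 1 = line n u w a"
    "triangle n u v w 1 b = line n v w b" "triangle n u v w 0 b = line n u u b"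
  by (auto simp: triangle_def line_def fun_eq_iff algebra_simps)

lemma surface_triangle:
  assumes uv: "(u, v) \<in> verts_le n" and vw: "(v, w) \<in> verts_le n"
  shows "surface n (triangle n u v w)"
  unfolding surface_def
proof (intro conjI ballI allI impI)
  have conv: "(1 - a) * x + a * y \<in> {0..1}" if "a \<in> {0..1}" "x \<in> {0..1}" "y \<in> {0..1}" for a x y :: real
    using convex_bound_le[of x 1 y "1 - a" a] that by auto
  show "triangle n u v w s t \<in> cube n" if "s \<in> {0..1}" "t \<in> {0..1}" for s t
    unfolding triangle_def by (rule tuplesI) (intro conv that; simp)
  fix i assume i: "i < n"
  have le: "of_bool (u i) \<le> (of_bool (v i) :: real)" "of_bool (v i) \<le> (of_bool (w i) :: real)"
    using verts_leD(3)[OF uv i] verts_leD(3)[OF vw i] by (auto simp: of_bool_def)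
  show "continuous_on ({0..1} \<times> {0..1}) (\<lambda>(s, t). triangle n u v w s t i)"
    using i by (auto simp: triangle_def case_prod_unfold intro!: continuous_intros)
  show "mono_on {0..1} (\<lambda>t. triangle n u v w s t i)" if s: "s \<in> {0..1}" for s
  proof (rule mono_onI)
    fix a b :: real assume "a \<le> b"
    then have "0 \<le> s * ((b - a) * (of_bool (w i) - of_bool (v i)))" using s le by simp
    then show "triangle n u v w s a i \<le> triangle n u v w s b i"
      using i by (simp add: triangle_def algebra_simps)
  qed
  show "mono_on {0..1} (\<lambda>s. triangle n u v w s t i)" if t: "t \<in> {0..1}" for t
  proof (rule mono_onI)
    fix a b :: real assume ab: "a \<le> b"
    have "0 \<le> t * (of_bool (w i) - of_bool (v i) :: real)" using le t by simp
    moreover have "(1 - t) * of_bool (v i) + t * of_bool (w i) = of_bool (v i) + t * (of_bool (w i) - of_bool (v i) :: real)"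
      by (simp add: algebra_simps)
    ultimately have "(of_bool (u i) :: real) \<le> (1 - t) * of_bool (v i) + t * of_bool (w i)" using le by linarith
    then have "0 \<le> (b - a) * ((1 - t) * of_bool (v i) + t * of_bool (w i) - (of_bool (u i) :: real))"
      using ab by simp
    then show "triangle n u v w a t i \<le> triangle n u v w b t i"
      using i by (simp add: triangle_def algebra_simps)
  qed
qed

text \<open>The functional \<open>V\<close> is evaluated on straight lines between vertices. Box
  morphisms carry lines to lines (\<open>cube_map_line\<close>), which makes this natural.\<close>

definition path_cochain :: "'a stream \<Rightarrow> ((real \<Rightarrow> 'a) \<Rightarrow> 't) \<Rightarrow> ((nat \<Rightarrow> real) \<Rightarrow> 'a, 't) cochain" where
  "path_cochain X V = (\<lambda>n. \<lambda>e\<in>cells (sing X) n. \<lambda>(v, w)\<in>verts_le n. V (\<lambda>r. e (line n v w r)))"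

lemma path_cochain_val:
  "e \<in> cells (sing X) n \<Longrightarrow> (v, w) \<in> verts_le n \<Longrightarrow> path_cochain X V n e (v, w) = V (\<lambda>r. e (line n v w r))"
  by (simp add: path_cochain_def)

text \<open>Multiplicativity is the square condition for \<open>triangle\<close>, whose collapsed
  side is a constant path.\<close>

lemma path_cochain_mem:
  assumes X: "is_stream X" and \<tau>: "comm_monoid \<tau>"
    and cong: "\<And>g h. dipath X g \<Longrightarrow> (\<And>t. t \<in> {0..1} \<Longrightarrow> h t = g t) \<Longrightarrow> V h = V g"
    and closed: "\<And>g. dipath X g \<Longrightarrow> V g \<in> carrier \<tau>"
    and const: "\<And>g p. dipath X g \<Longrightarrow> (\<And>t. t \<in> {0..1} \<Longrightarrow> g t = p) \<Longrightarrow> V g = \<one>\<^bsub>\<tau>\<^esub>"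
    and square: "\<And>G. disquare X G \<Longrightarrow>
      V (\<lambda>s. G s 0) \<otimes>\<^bsub>\<tau>\<^esub> V (\<lambda>t. G 1 t) = V (\<lambda>t. G 0 t) \<otimes>\<^bsub>\<tau>\<^esub> V (\<lambda>s. G s 1)"
  shows "path_cochain X V \<in> cochains (sing X) \<tau>"
proof (rule cochainsI[OF _ _ _ cubical_set_sing])
  interpret comm_monoid \<tau> by fact
  show "path_cochain X V n \<in> extensional (cells (sing X) n)" for n by (simp add: path_cochain_def)
  have path: "dipath X (\<lambda>r. e (line n v w r))" if "e \<in> cells (sing X) n" "(v, w) \<in> verts_le n" for e n v w
    using dipath_curve[OF X _ curve_line[OF that(2)]] that(1) by (simp add: cells_sing)
  show "path_cochain X V n e \<in> cells (ner \<tau>) n" if e: "e \<in> cells (sing X) n" for n e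
  proof (rule ner_cellI)
    show "path_cochain X V n e \<in> extensional (verts_le n)" using e by (simp add: path_cochain_def)
    show "path_cochain X V n e (v, w) \<in> carrier \<tau>" if "(v, w) \<in> verts_le n" for v w
      using closed[OF path[OF e that]] by (simp add: path_cochain_val[OF e that])
    have refl: "V (\<lambda>r. e (line n v v r)) = \<one>\<^bsub>\<tau>\<^esub>" if "v \<in> verts n" for v
    proof (rule const[OF path[OF e verts_le_refl[OF that]]])
      have "line n v v t = line n v v 0" for t by (auto simp: line_def fun_eq_iff algebra_simps)
      then show "e (line n v v t) = e (line n v v 0)" for t by metis
    qed
    then show "path_cochain X V n e (v, v) = \<one>\<^bsub>\<tau>\<^esub>" if "v \<in> verts n" for v
      using that by (simp add: path_cochain_val[OF e verts_le_refl[OF that]])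
    fix u v w assume uv: "(u, v) \<in> verts_le n" and vw: "(v, w) \<in> verts_le n"
    note uw = verts_le_trans[OF uv vw] and u = verts_leD(1,2)[OF uv]
    have "disquare X (\<lambda>s t. e (triangle n u v w s t))"
      using disquare_surface[OF X _ surface_triangle[OF uv vw]] e by (simp add: cells_sing)
    from square[OF this]
    have "V (\<lambda>r. e (line n u v r)) \<otimes>\<^bsub>\<tau>\<^esub> V (\<lambda>r. e (line n v w r)) = \<one>\<^bsub>\<tau>\<^esub> \<otimes>\<^bsub>\<tau>\<^esub> V (\<lambda>r. e (line n u w r))"
      by (simp add: triangle_sides[OF u] refl[OF u(1)])
    then show "path_cochain X V n e (u, w) = path_cochain X V n e (v, w) \<otimes>\<^bsub>\<tau>\<^esub> path_cochain X V n e (u, v)"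
      using closed[OF path[OF e uv]] closed[OF path[OF e vw]] closed[OF path[OF e uw]]
      by (simp add: path_cochain_val[OF e uv] path_cochain_val[OF e vw] path_cochain_val[OF e uw] m_comm)
  qed
  fix m n \<phi> e v w
  assume \<phi>: "box_mor m n \<phi>" and e: "e \<in> cells (sing X) n" and vw: "(v, w) \<in> verts_le m"
    and ae: "act (sing X) m n \<phi> e \<in> cells (sing X) m"
  note vw' = box_mor_verts_le[OF \<phi> vw]
  have "V (\<lambda>r. act (sing X) m n \<phi> e (line m v w r)) = V (\<lambda>r. e (line n (\<phi> v) (\<phi> w) r))"
    by (rule cong[OF path[OF e vw']])
      (use cube_map_line[OF \<phi> verts_leD(1,2)[OF vw]] in \<open>simp add: act_sing compose_eq line_mem\<close>)
  then show "path_cochain X V m (act (sing X) m n \<phi> e) (v, w) = path_cochain X V n e (\<phi> v, \<phi> w)"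
    by (simp add: path_cochain_val[OF ae vw] path_cochain_val[OF e vw'])
qed

context local_potential
begin

lemma val_cong:
  assumes "\<And>t. t \<in> {a..b} \<Longrightarrow> h t = g t"
  shows "val h a b = val g a b"
proof -
  have "lift h a b L \<longleftrightarrow> lift g a b L" for L
    unfolding lift_def using assms by simp
  then show ?thesis by (simp add: val_def)
qed

lemma val_path_cochain:
  assumes "is_stream X"
  shows "path_cochain X (\<lambda>g. val g 0 1) \<in> cochains (sing X) \<tau>"
proof (rule path_cochain_mem[OF assms comm_monoid_axioms])
  show "val h 0 1 = val g 0 1" if "\<And>t. t \<in> {0..1} \<Longrightarrow> h t = g t" for g h by (rule val_cong[OF that])
  show "val g 0 1 \<in> carrier \<tau>" if "dipath X g" for g by (rule val_closed[OF that]) simp_all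
qed (rule val_const, assumption+, rule val_square)

end

section \<open>Evaluation of a singular cochain on directed paths\<close>

definition path_value :: "((nat \<Rightarrow> real) \<Rightarrow> 'a, 't) cochain \<Rightarrow> (real \<Rightarrow> 'a) \<Rightarrow> 't" where
  "path_value \<beta> g = edge_value \<beta> (path_cell g)"

lemma path_value_cong:
  assumes "\<And>t. t \<in> {0..1} \<Longrightarrow> h t = g t"
  shows "path_value \<beta> h = path_value \<beta> g"
proof -
  have "path_cell h = path_cell g"
    unfolding path_cell_def using assms cube_nth[of _ 1 0] by (intro restrict_ext) simp
  then show ?thesis by (simp add: path_value_def)
qed

lemma act_sing_edge:
  assumes "u \<in> verts n" "i < n" "\<not> u i"
  shows "act (sing X) 1 n (edge_map n u i) e = path_cell (\<lambda>r. e (line n u (u(i := True)) r))"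
proof -
  have "cube_map 1 n (edge_map n u i) x = line n u (u(i := True)) (x 0)" if x: "x \<in> cube 1" for x
  proof -
    have x0: "x 0 \<in> {0..1}" using cube_nth[OF x, of 0] by simp
    have "x = line 1 (const_vertex 1 False) (const_vertex 1 True) (x 0)"
      by (rule tuples_eqI[OF x line_mem[OF x0]]) simp
    then have "cube_map 1 n (edge_map n u i) x =
        line n (edge_map n u i (const_vertex 1 False)) (edge_map n u i (const_vertex 1 True)) (x 0)"
      using cube_map_line[OF box_mor_edge[OF assms(2)] const_vertex_mem const_vertex_mem x0] by metis
    moreover have "u(i := False) = u" using assms(3) by (simp add: fun_eq_iff)
    ultimately show ?thesis by (simp only: edge_map_const_vertex[OF assms(1,2)])
  qed
  then show ?thesis unfolding act_sing compose_def path_cell_def by (intro restrict_ext) simp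
qed

context
  fixes X :: "'a stream" and \<tau> :: "('t, 'm) monoid_scheme" and \<beta> :: "((nat \<Rightarrow> real) \<Rightarrow> 'a, 't) cochain"
  assumes X: "is_stream X" and \<tau>: "comm_monoid \<tau>" and \<beta>: "\<beta> \<in> cochains (sing X) \<tau>"
begin

interpretation comm_monoid \<tau> by (rule \<tau>)

lemma path_value_closed:
  assumes "dipath X g"
  shows "path_value \<beta> g \<in> carrier \<tau>"
proof -
  have "path_cell g \<in> cells (sing X) 1" using path_cell_mem[OF X assms] by (simp add: cells_sing)
  then show ?thesis
    unfolding path_value_def edge_value_def by (rule cochainsD(1)[OF \<beta>]) (rule const_vertex_le, simp)
qed

lemma cochain_edge:
  assumes e: "e \<in> cells (sing X) n" and u: "u \<in> verts n" "i < n" "\<not> u i"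
  shows "\<beta> n e (u, u(i := True)) = path_value \<beta> (\<lambda>r. e (line n u (u(i := True)) r))"
  using edge_value_edge_map[OF \<beta> e u] by (simp only: act_sing_edge[OF u] path_value_def)

text \<open>Both sides are the value of the cochain on the diagonal pair of vertices of
  \<open>square_cell G\<close>.\<close>

lemma path_value_square:
  assumes G: "disquare X G"
  shows "path_value \<beta> (\<lambda>s. G s 0) \<otimes>\<^bsub>\<tau>\<^esub> path_value \<beta> (\<lambda>t. G 1 t) =
    path_value \<beta> (\<lambda>t. G 0 t) \<otimes>\<^bsub>\<tau>\<^esub> path_value \<beta> (\<lambda>s. G s 1)"
proof -
  have e: "square_cell G \<in> cells (sing X) 2" using square_cell_mem[OF X G] by (simp add: cells_sing)
  define v where "v a b = (\<lambda>i\<in>{..<2::nat}. if i = 0 then a else b)" for a b :: bool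
  have v: "v a b \<in> verts 2" for a b by (simp add: v_def tuplesI)
  have v_le: "(v a b, v a' b') \<in> verts_le 2" if "a \<le> a'" "b \<le> b'" for a b a' b'
    using that by (intro verts_leI v) (auto simp: v_def split: if_splits)
  have upd: "(v False b)(0 := True) = v True b" "(v a False)(Suc 0 := True) = v a True" for a b
    by (auto simp: v_def fun_eq_iff)
  have line: "line 2 (v a b) (v a' b') r = pt2 ((1 - r) * of_bool a + r * of_bool a') ((1 - r) * of_bool b + r * of_bool b')"
    for a b a' b' r by (auto simp: line_def v_def pt2_def fun_eq_iff)
  have 1: "\<beta> 2 (square_cell G) (v False b, v True b) = path_value \<beta> (\<lambda>s. G s (of_bool b))" for b
  proof -
    have "\<beta> 2 (square_cell G) (v False b, v True b) = path_value \<beta> (\<lambda>r. square_cell G (line 2 (v False b) (v True b) r))"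
      by (rule cochain_edge[OF e v, of 0 False b, unfolded upd]) (simp_all add: v_def)
    also have "\<dots> = path_value \<beta> (\<lambda>s. G s (of_bool b))"
    proof (rule path_value_cong)
      fix t :: real assume t: "t \<in> {0..1}"
      have "line 2 (v False b) (v True b) t = pt2 t (of_bool b)" by (simp add: line algebra_simps)
      then show "square_cell G (line 2 (v False b) (v True b) t) = G t (of_bool b)" using t by simp
    qed
    finally show ?thesis .
  qed
  have 2: "\<beta> 2 (square_cell G) (v a False, v a True) = path_value \<beta> (\<lambda>t. G (of_bool a) t)" for a
  proof -
    have "\<beta> 2 (square_cell G) (v a False, v a True) = path_value \<beta> (\<lambda>r. square_cell G (line 2 (v a False) (v a True) r))"
      by (rule cochain_edge[OF e v, of "Suc 0" a False, unfolded upd]) (simp_all add: v_def)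
    also have "\<dots> = path_value \<beta> (\<lambda>t. G (of_bool a) t)"
    proof (rule path_value_cong)
      fix t :: real assume t: "t \<in> {0..1}"
      have "line 2 (v a False) (v a True) t = pt2 (of_bool a) t" by (simp add: line algebra_simps)
      then show "square_cell G (line 2 (v a False) (v a True) t) = G (of_bool a) t" using t by simp
    qed
    finally show ?thesis .
  qed
  have "\<beta> 2 (square_cell G) (v True False, v True True) \<otimes>\<^bsub>\<tau>\<^esub> \<beta> 2 (square_cell G) (v False False, v True False) =
      \<beta> 2 (square_cell G) (v False True, v True True) \<otimes>\<^bsub>\<tau>\<^esub> \<beta> 2 (square_cell G) (v False False, v False True)"
    using cochainsD(3)[OF \<beta> e v_le v_le, of False True False False True True]
      cochainsD(3)[OF \<beta> e v_le v_le, of False False False True True True] by simp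
  moreover have "path_value \<beta> (\<lambda>s. G s t) \<in> carrier \<tau>" "path_value \<beta> (\<lambda>s. G t s) \<in> carrier \<tau>" if "t \<in> {0..1}" for t
    using path_value_closed disquareD(1,2)[OF G that] by blast+
  ultimately show ?thesis
    using 1[of False] 1[of True] 2[of False] 2[of True] by (simp add: m_comm)
qed

text \<open>A constant path is a degenerate 1-cell, so its value is that of a 0-cell on a pair of
  equal vertices.\<close>

lemma path_value_const:
  assumes p: "p \<in> topspace (stop X)" and g: "\<And>t. t \<in> {0..1} \<Longrightarrow> g t = p"
  shows "path_value \<beta> g = \<one>\<^bsub>\<tau>\<^esub>"
proof -
  have "dipath X (\<lambda>t. p)" 
    unfolding dipath_def
  proof (intro conjI ballI allI impI; (elim conjE)?)
    fix W and a b :: real assume W: "openin (stop X) W" and ab: "a \<le> b" "(\<lambda>t. p) ` {a..b} \<subseteq> W"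
    then have "p \<in> W" by (simp add: image_constant_conv)
    then show "(p, p) \<in> circ X W" using is_streamD(2)[OF X W] by (simp add: refl_on_def)
  qed (use p in \<open>auto intro!: exI[of _ 1]\<close>)
  then have c1: "path_cell (\<lambda>t. p) \<in> cells (sing X) 1" using path_cell_mem[OF X] by (simp add: cells_sing)
  define c0 where "c0 = act (sing X) 0 1 (vertex_map (const_vertex 1 False)) (path_cell (\<lambda>t. p))"
  have c0: "c0 \<in> cells (sing X) 0"
    unfolding c0_def by (rule cubical_setD(1)[OF cubical_set_sing box_mor_vertex[OF const_vertex_mem] c1])
  have \<phi>: "box_mor 1 0 (restrict (codegeneracy 0 0) (verts (Suc 0)))" (is "box_mor 1 0 ?\<phi>")
    using box_mor.codegeneracy[of 0 0] by simp
  have "act (sing X) 1 0 ?\<phi> c0 = path_cell (\<lambda>t. p)"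
    using cube_map_mem[OF \<phi>] cube_map_mem[OF box_mor_vertex[OF const_vertex_mem[of 1 False]]]
    by (auto simp: act_sing c0_def path_cell_def compose_def fun_eq_iff simp del: One_nat_def)
  moreover have "\<beta> 1 (act (sing X) 1 0 ?\<phi> c0) (const_vertex 1 False, const_vertex 1 True) =
      \<beta> 0 c0 (?\<phi> (const_vertex 1 False), ?\<phi> (const_vertex 1 True))"
    by (rule cochainsD(5)[OF \<beta> c0 \<phi>]) (rule const_vertex_le, simp)
  \<comment> \<open>Both vertices of the edge go to the only vertex of the 0-cube.\<close>
  moreover have "?\<phi> (const_vertex 1 b) = const_vertex 0 True" for b
    using box_mor_mem[OF \<phi> const_vertex_mem[of 1 b]] verts_0[of True] by blast
  ultimately have "path_value \<beta> (\<lambda>t. p) = \<one>\<^bsub>\<tau>\<^esub>"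
    using cochainsD(2)[OF \<beta> c0 const_vertex_mem[of 0 True]] by (simp add: path_value_def edge_value_def)
  moreover have "path_value \<beta> g = path_value \<beta> (\<lambda>t. p)" by (rule path_value_cong) (rule g)
  ultimately show ?thesis by simp
qed

text \<open>A singular cochain is thus determined by its values on paths, and it agrees with
  \<open>path_cochain\<close> of \<open>path_value\<close>. For an edge this is restriction to a
  face; for a longer pair, \<open>triangle\<close> replaces two sides by the line across.\<close>

lemma path_value_line:
  assumes e: "e \<in> cells (sing X) n" and vw: "(v, w) \<in> verts_le n"
  shows "\<beta> n e (v, w) = path_value \<beta> (\<lambda>r. e (line n v w r))"
  using vw
proof (induction rule: verts_le_induct)
  case (refl v)
  have "line n v v t = line n v v 0" for t by (auto simp: line_def fun_eq_iff algebra_simps)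
  moreover have "e (line n v v 0) \<in> topspace (stop X)"
    using stream_mapsD(1)[of e "directed_cube n" X] e line_mem[of 0 n v v] by (auto simp: cells_sing)
  ultimately have "path_value \<beta> (\<lambda>r. e (line n v v r)) = \<one>\<^bsub>\<tau>\<^esub>"
    by (intro path_value_const[of "e (line n v v 0)"]) metis+
  then show ?case using cochainsD(2)[OF \<beta> e refl] by simp
next
  case (edge v u i)
  let ?w = "u(i := True)"
  note u = verts_leD(1,2)[OF edge(1)]
  note uw = verts_le_update[OF u(2) edge(2,3)]
  have e': "e \<in> stream_maps (directed_cube n) X" using e by (simp add: cells_sing)
  have path: "path_value \<beta> (\<lambda>r. e (line n x y r)) \<in> carrier \<tau>" if "(x, y) \<in> verts_le n" for x y
    by (rule path_value_closed[OF dipath_curve[OF X e' curve_line[OF that]]])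
  have "line n v v t = line n v v 0" for t by (auto simp: line_def fun_eq_iff algebra_simps)
  moreover have "e (line n v v 0) \<in> topspace (stop X)"
    using stream_mapsD(1)[OF e'] line_mem[of 0 n v v] by auto
  ultimately have one: "path_value \<beta> (\<lambda>r. e (line n v v r)) = \<one>\<^bsub>\<tau>\<^esub>"
    by (intro path_value_const[of "e (line n v v 0)"]) metis+
  have "disquare X (\<lambda>s t. e (triangle n v u ?w s t))"
    by (rule disquare_surface[OF X e' surface_triangle[OF edge(1) uw]])
  from path_value_square[OF this]
  have "path_value \<beta> (\<lambda>r. e (line n v u r)) \<otimes>\<^bsub>\<tau>\<^esub> path_value \<beta> (\<lambda>r. e (line n u ?w r)) = path_value \<beta> (\<lambda>r. e (line n v ?w r))"
    using path[OF verts_le_trans[OF edge(1) uw]] by (simp add: triangle_sides[OF u] one)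
  moreover have "\<beta> n e (v, ?w) = path_value \<beta> (\<lambda>r. e (line n u ?w r)) \<otimes>\<^bsub>\<tau>\<^esub> path_value \<beta> (\<lambda>r. e (line n v u r))"
    unfolding cochainsD(3)[OF \<beta> e edge(1) uw] edge.IH cochain_edge[OF e u(2) edge(2,3)] by (rule refl)
  ultimately show ?case using m_comm[OF path[OF edge(1)] path[OF uw]] by (simp only:)
qed

text \<open>Cochains are multiplicative on vertices of one cell, not on subdivided paths. The
  subdivision has to be realized as two sides of a singular square.\<close>

lemma path_value_concat:
  assumes g: "dipath X g" and ab: "0 \<le> a" "a \<le> b" "b \<le> c" "c \<le> 1"
  shows "path_value \<beta> (\<lambda>r. g (a + r * (c - a))) =
    path_value \<beta> (\<lambda>r. g (a + r * (b - a))) \<otimes>\<^bsub>\<tau>\<^esub> path_value \<beta> (\<lambda>r. g (b + r * (c - b)))"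
proof -
  \<comment> \<open>The sides of this square run from \<open>a\<close> to \<open>b\<close> at
    \<open>t = 0\<close>, from \<open>a\<close> to \<open>c\<close> at \<open>t = 1\<close> and from
    \<open>b\<close> to \<open>c\<close> at \<open>s = 1\<close>; the side \<open>s = 0\<close> is
    constant.\<close>
  define h where "h s t = a + s * (b - a + t * (c - b))" for s t :: real
  have h_le: "h s t \<le> h s' t'" if "0 \<le> s" "s \<le> s'" "0 \<le> t" "t \<le> t'" for s t s' t'
  proof -
    have "t * (c - b) \<le> t' * (c - b)" "0 \<le> t * (c - b)" using that ab by (simp_all add: mult_right_mono)
    then have "s * (b - a + t * (c - b)) \<le> s' * (b - a + t' * (c - b))"
      using that ab by (intro mult_mono) auto
    then show ?thesis by (simp add: h_def)
  qed
  have h01: "h s t \<in> {0..1}" if "s \<in> {0..1}" "t \<in> {0..1}" for s t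
    using h_le[of 0 s 0 t] h_le[of s 1 t 1] that ab by (auto simp: h_def)
  have surf: "surface 1 (\<lambda>s t. pt1 (h s t))"
    unfolding surface_def
  proof (intro conjI ballI allI impI)
    show "pt1 (h s t) \<in> cube 1" if "s \<in> {0..1}" "t \<in> {0..1}" for s t by (rule pt1_mem[OF h01[OF that]])
    fix i :: nat assume "i < 1"
    then have i: "i = 0" by simp
    show "continuous_on ({0..1} \<times> {0..1}) (\<lambda>(s, t). pt1 (h s t) i)"
      by (auto simp: i h_def case_prod_unfold intro!: continuous_intros)
    show "mono_on {0..1} (\<lambda>t. pt1 (h s t) i)" if "s \<in> {0..1}" for s using that h_le by (auto simp: i intro!: mono_onI)
    show "mono_on {0..1} (\<lambda>s. pt1 (h s t) i)" if "t \<in> {0..1}" for t using that h_le by (auto simp: i intro!: mono_onI)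
  qed
  have G: "disquare X (\<lambda>s t. path_cell g (pt1 (h s t)))"
    by (rule disquare_surface[OF X path_cell_mem[OF X g] surf])
  have val: "path_cell g (pt1 (h s t)) = g (h s t)" if "s \<in> {0..1}" "t \<in> {0..1}" for s t
    by (rule path_cell_val[OF h01[OF that]])
  have rows: "path_value \<beta> (\<lambda>s. path_cell g (pt1 (h s t))) = path_value \<beta> (\<lambda>s. g (h s t))"
    "path_value \<beta> (\<lambda>s. path_cell g (pt1 (h t s))) = path_value \<beta> (\<lambda>s. g (h t s))" if "t \<in> {0..1}" for t
    by (rule path_value_cong, rule val; simp add: that[simplified])+
  have "path_value \<beta> (\<lambda>t. g (h 0 t)) = \<one>\<^bsub>\<tau>\<^esub>"
    by (rule path_value_const[of "g a"]) (use dipathD(1)[OF g, of a] ab in \<open>auto simp: h_def\<close>)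
  moreover have "path_value \<beta> (\<lambda>s. g (h s t)) \<in> carrier \<tau>" if "t \<in> {0..1}" for t
    using path_value_closed[OF disquareD(1)[OF G that]] rows(1)[OF that] by simp
  ultimately have "path_value \<beta> (\<lambda>s. g (h s 1)) = path_value \<beta> (\<lambda>s. g (h s 0)) \<otimes>\<^bsub>\<tau>\<^esub> path_value \<beta> (\<lambda>t. g (h 1 t))"
    using path_value_square[OF G] rows(1)[of 0] rows(1)[of 1] rows(2)[of 0] rows(2)[of 1] by simp
  moreover have "h s 1 = a + s * (c - a)" "h s 0 = a + s * (b - a)" "h 1 s = b + s * (c - b)" for s
    by (simp_all add: h_def algebra_simps)
  ultimately show ?thesis by simp
qed

end

subsection \<open>The local potential of a cochain on the realization\<close>

definition rep :: "((nat \<times> 'c) \<times> (nat \<Rightarrow> real)) set \<Rightarrow> (nat \<times> 'c) \<times> (nat \<Rightarrow> real)" where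
  "rep P = (SOME z. z \<in> P)"

text \<open>1/2 is a member so that \<open>radius\<close> also controls the gap between 1/2 and the
  next larger member.\<close>

definition grid :: "((nat \<times> 'c) \<times> (nat \<Rightarrow> real)) set \<Rightarrow> real set" where
  "grid P = (case rep P of ((m, c), t) \<Rightarrow> {0, 1 / 2, 1} \<union> t ` {..<m})"

definition radius :: "((nat \<times> 'c) \<times> (nat \<Rightarrow> real)) set \<Rightarrow> real" where
  "radius P = (SOME e. spaced (grid P) e)"

text \<open>The gap of the grid above 1/2 has width at least \<open>4 * radius P\<close>, so this
  level keeps distance \<open>2 * radius P\<close> from the grid. Rounding moves a coordinate by
  less than \<open>radius P\<close>, hence never across it.\<close>

definition cut :: "((nat \<times> 'c) \<times> (nat \<Rightarrow> real)) set \<Rightarrow> real" where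
  "cut P = 1 / 2 + 2 * radius P"

text \<open>The neighbourhood of \<open>P\<close> on which its potential is used. Asking for all
  representatives avoids a choice; by \<open>tube_glue_eq\<close>, one representative decides
  (\<open>mem_star_iff\<close>).\<close>

definition star :: "'c cubical \<Rightarrow> ((nat \<times> 'c) \<times> (nat \<Rightarrow> real)) set \<Rightarrow> ((nat \<times> 'c) \<times> (nat \<Rightarrow> real)) set set" where
  "star C P = {Q \<in> points C. \<forall>y\<in>Q. y \<in> tube C (grid P) (radius P) (rep P)}"

text \<open>The two vertices differ in the coordinates that lie in \<open>{1/2<..r}\<close>.\<close>

definition mass :: "('c, 't) cochain \<Rightarrow> real \<Rightarrow> ((nat \<times> 'c) \<times> (nat \<Rightarrow> real)) set \<Rightarrow> 't" where
  "mass \<alpha> r = point_value (\<lambda>n d s. \<alpha> n d (above r n s, above (1 / 2) n s))"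

text \<open>Carries a homotopy on \<open>C\<close>, a function on 0-cells, to the points of the
  realization.\<close>

definition half_vertex :: "'c cubical \<Rightarrow> ((nat \<times> 'c) \<times> (nat \<Rightarrow> real)) set \<Rightarrow> 'c" where
  "half_vertex C = point_value (\<lambda>n d s. vert C n d (above (1 / 2) n s))"

context
  fixes C :: "'c cubical"
  assumes C: "cubical_set C"
begin

lemma rep_cases:
  assumes P: "P \<in> points C"
  obtains m c t where "rep P = ((m, c), t)" "c \<in> cells C m" "t \<in> cube m" "P = point C m c t"
    "grid P = {0, 1 / 2, 1} \<union> t ` {..<m}" "\<And>j. j < m \<Longrightarrow> t j \<in> grid P" "spaced (grid P) (radius P)"
proof -
  obtain n d s where d: "d \<in> cells C n" "s \<in> cube n" "P = point C n d s" using pointE[OF C P] by blast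
  have "((n, d), s) \<in> P" using d glue_eq_refl[OF C] by (simp add: mem_point_iff[OF C] mem_cells_stream)
  then have "rep P \<in> P" unfolding rep_def by (rule someI)
  obtain m c t where r: "rep P = ((m, c), t)" by (metis prod.exhaust)
  have g: "(((n, d), s), ((m, c), t)) \<in> glue_eq C"
  proof -
    have "((m, c), t) \<in> P" using \<open>rep P \<in> P\<close> by (simp add: r)
    then show ?thesis using d(3) by (simp add: mem_point_iff[OF C])
  qed
  then have m: "c \<in> cells C m" "t \<in> cube m" using glue_eq_mem[OF C g] by (simp_all add: mem_cells_stream)
  have "P = point C m c t" using d m g by (simp add: point_eq_iff[OF C])
  moreover have A: "grid P = {0, 1 / 2, 1} \<union> t ` {..<m}" by (simp add: grid_def r)
  moreover have "spaced (grid P) (radius P)"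
  proof -
    have "grid P \<subseteq> {0..1}" using cube_nth[OF m(2)] by (auto simp: A)
    then obtain e where "spaced (grid P) e" by (rule spaced_exists[rotated 2]) (simp_all add: A)
    then show ?thesis unfolding radius_def by (rule someI)
  qed
  ultimately show thesis using that r m by auto
qed

lemma cut_props:
  assumes "P \<in> points C"
  shows "radius P > 0" "1 / 2 < cut P" "cut P + 2 * radius P \<le> 1"
    and "\<And>a. a \<in> grid P \<Longrightarrow> a \<le> 1 / 2 \<or> cut P + 2 * radius P \<le> a"
proof -
  obtain t and m :: nat where r: "grid P = {0, 1 / 2, 1} \<union> t ` {..<m}" "spaced (grid P) (radius P)"
    by (rule rep_cases[OF assms]) (rule that; assumption)
  show e: "radius P > 0" using r(2) by (simp add: spaced_def)
  then show "1 / 2 < cut P" by (simp add: cut_def)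
  have gap: "a = 1 / 2 \<or> 4 * radius P \<le> \<bar>a - 1 / 2\<bar>" if "a \<in> grid P" for a
    using r that by (auto simp: spaced_def)
  show *: "a \<le> 1 / 2 \<or> cut P + 2 * radius P \<le> a" if "a \<in> grid P" for a
    using gap[OF that] by (auto simp: cut_def)
  show "cut P + 2 * radius P \<le> 1" using *[of 1] r(1) by auto
qed

lemma mem_star_iff:
  assumes P: "P \<in> points C" and d: "d \<in> cells C n" "s \<in> cube n"
  shows "point C n d s \<in> star C P \<longleftrightarrow> (((n, d), cmap (snap (grid P) (radius P)) n s), rep P) \<in> glue_eq C"
proof -
  obtain m c t where r: "rep P = ((m, c), t)" "spaced (grid P) (radius P)" by (rule rep_cases[OF P]) (rule that; assumption)
  have "((n, d), s) \<in> point C n d s" using d glue_eq_refl[OF C] by (simp add: mem_point_iff[OF C] mem_cells_stream)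
  moreover have "y \<in> tube C (grid P) (radius P) (rep P)"
    if "((n, d), s) \<in> tube C (grid P) (radius P) (rep P)" "y \<in> point C n d s" for y
    using that(2) by (intro tube_glue_eq[OF C r(2) _ that(1)]) (simp add: mem_point_iff[OF C])
  ultimately have "(\<forall>y\<in>point C n d s. y \<in> tube C (grid P) (radius P) (rep P)) \<longleftrightarrow> ((n, d), s) \<in> tube C (grid P) (radius P) (rep P)"
    by blast
  then show ?thesis
    using point_mem[OF C d] d by (simp add: star_def tube_def coordwise_def mem_cells_stream)
qed

lemma star_open:
  assumes P: "P \<in> points C"
  shows "openin (stop (realization C)) (star C P)"
  unfolding openin_realization[OF C]
proof (intro conjI allI ballI)
  show "star C P \<subseteq> points C" by (auto simp: star_def)
  fix n d assume d: "d \<in> cells C n"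
  obtain m c t where r: "rep P = ((m, c), t)" "c \<in> cells C m" "t \<in> cube m" "\<And>j. j < m \<Longrightarrow> t j \<in> grid P"
    "spaced (grid P) (radius P)" by (rule rep_cases[OF P]) (rule that; assumption)
  have "openin (stop (cells_stream C)) (tube C (grid P) (radius P) (rep P))"
    using r by (intro openin_tube[OF C r(5) r(1)]) (simp_all add: mem_cells_stream)
  then have "openin (cube_topology n) {s. ((n, d), s) \<in> tube C (grid P) (radius P) (rep P)}"
    using d by (simp add: openin_cells_stream)
  moreover have "{s. ((n, d), s) \<in> tube C (grid P) (radius P) (rep P)} = {s \<in> cube n. point C n d s \<in> star C P}"
    using d by (auto simp: mem_star_iff[OF P d] tube_def coordwise_def mem_cells_stream)
  ultimately show "openin (cube_topology n) {s \<in> cube n. point C n d s \<in> star C P}" by simp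
qed

lemma star_self:
  assumes P: "P \<in> points C"
  shows "P \<in> star C P"
proof -
  obtain m c t where r: "rep P = ((m, c), t)" "c \<in> cells C m" "t \<in> cube m" "P = point C m c t"
    "\<And>j. j < m \<Longrightarrow> t j \<in> grid P" "spaced (grid P) (radius P)" by (rule rep_cases[OF P]) (rule that; assumption)
  have "cmap (snap (grid P) (radius P)) m t = t"
    using endpoint_fixing_snap[OF r(6)] r(3,5) snap_fix[OF r(6)]
    by (intro tuples_eqI[OF cmap_mem r(3)]) (auto simp: endpoint_fixing_def)
  then have "point C m c t \<in> star C P"
    using glue_eq_refl[OF C, of "((m, c), t)"] mem_star_iff[OF P r(2,3)] r(1-3) by (simp add: mem_cells_stream)
  then show ?thesis using r(4) by simp
qed

context
  fixes \<tau> :: "('t, 'm) monoid_scheme"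
  assumes \<tau>: "comm_monoid \<tau>"
begin

interpretation comm_monoid \<tau> by (rule \<tau>)

lemma mass_point:
  assumes \<alpha>: "\<alpha> \<in> cochains C \<tau>" and r: "1 / 2 \<le> r" "r < 1" and d: "d \<in> cells C n" "s \<in> cube n"
  shows "mass \<alpha> r (point C n d s) = \<alpha> n d (above r n s, above (1 / 2) n s)"
  unfolding mass_def
proof (rule point_value[OF C _ d])
  fix m n \<phi> c t assume *: "box_mor m n \<phi>" "c \<in> cells C n" "t \<in> cube m"
  show "\<alpha> m (act C m n \<phi> c) (above r m t, above (1 / 2) m t) =
      \<alpha> n c (above r n (cube_map m n \<phi> t), above (1 / 2) n (cube_map m n \<phi> t))"
    using cochainsD(5)[OF \<alpha> *(2,1) above_le[OF r(1)]] above_cube_map[OF *(1) _ _ *(3)] r by simp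
qed

lemma mass_glue_eq:
  assumes \<alpha>: "\<alpha> \<in> cochains C \<tau>" and r: "1 / 2 \<le> r" "r < 1" and g: "(((n, d), s), ((m, c), t)) \<in> glue_eq C"
  shows "\<alpha> n d (above r n s, above (1 / 2) n s) = \<alpha> m c (above r m t, above (1 / 2) m t)"
proof -
  have "d \<in> cells C n" "s \<in> cube n" "c \<in> cells C m" "t \<in> cube m"
    using glue_eq_mem[OF C g] by (simp_all add: mem_cells_stream)
  then show ?thesis using mass_point[OF \<alpha> r] g point_eq_iff[OF C] by metis
qed

lemma mass_closed:
  assumes \<alpha>: "\<alpha> \<in> cochains C \<tau>" and r: "1 / 2 \<le> r" "r < 1" and Q: "Q \<in> points C"
  shows "mass \<alpha> r Q \<in> carrier \<tau>"
  using pointE[OF C Q] mass_point[OF \<alpha> r] cochainsD(1)[OF \<alpha> _ above_le[OF r(1)]] by metis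

text \<open>No coordinate of the chosen representative lies above 1/2 and at or below the cut, so
  the two vertices in the mass agree.\<close>

lemma mass_self:
  assumes \<alpha>: "\<alpha> \<in> cochains C \<tau>" and P: "P \<in> points C"
  shows "mass \<alpha> (cut P) P = \<one>\<^bsub>\<tau>\<^esub>"
proof -
  obtain m c t where r: "c \<in> cells C m" "t \<in> cube m" "P = point C m c t" "\<And>j. j < m \<Longrightarrow> t j \<in> grid P"
    by (rule rep_cases[OF P]) (rule that; assumption)
  note cut = cut_props[OF P]
  have "above (cut P) m t = above (1 / 2) m t"
  proof (rule tuples_eqI[OF above_mem above_mem])
    fix j assume j: "j < m"
    have "cut P < t j \<longleftrightarrow> 1 / 2 < t j" using cut(4)[OF r(4)[OF j]] cut(1,2) by linarith
    then show "above (cut P) m t j = above (1 / 2) m t j" using j by simp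
  qed
  moreover have "mass \<alpha> (cut P) P = \<alpha> m c (above (cut P) m t, above (1 / 2) m t)"
    using mass_point[OF \<alpha>, of "cut P" c m t] r cut by simp
  ultimately show ?thesis using cochainsD(2)[OF \<alpha> r(1) above_mem] by simp
qed

text \<open>A coordinate that moves across the gap between two points of the grid comes from a degeneracy.\<close>

lemma no_crossing:
  assumes \<alpha>: "\<alpha> \<in> cochains C \<tau>" and P: "P \<in> points C" and d: "d \<in> cells C n" and su: "(s, u) \<in> cube_le n"
    and int: "\<And>w. w \<in> cube_interval n s u \<Longrightarrow> point C n d w \<in> star C P"
  shows "\<alpha> n d (above (cut P) n s, above (cut P) n u) = \<one>\<^bsub>\<tau>\<^esub>"
proof -
  obtain m c t where r: "rep P = ((m, c), t)" "c \<in> cells C m" "t \<in> cube m" "P = point C m c t"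
    "grid P = {0, 1 / 2, 1} \<union> t ` {..<m}" "\<And>j. j < m \<Longrightarrow> t j \<in> grid P" "spaced (grid P) (radius P)"
    by (rule rep_cases[OF P]) (rule that; assumption)
  note cut = cut_props[OF P]
  let ?snap = "snap (grid P) (radius P)"
  have su': "s \<in> cube n" "u \<in> cube n" "\<And>i. i < n \<Longrightarrow> s i \<le> u i" using su by (auto simp: cube_le_def)
  define I where "I i \<longleftrightarrow> s i \<le> cut P \<and> cut P < u i" for i
  \<comment> \<open>A point between \<open>s\<close> and \<open>u\<close> at which every crossing
    coordinate sits exactly on the cut, far from the grid. It lies in the star, so its rounding
    represents \<open>P\<close>.\<close>
  define w where "w = (\<lambda>i\<in>{..<n}. if I i then cut P else u i)"
  \<comment> \<open>Coordinates of the rounding that lie outside the grid may be moved. Crossing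
    ones are put on the cut, the others to 0 or 1 according to their side.\<close>
  define z where "z = (\<lambda>i\<in>{..<n}. if ?snap (w i) \<in> grid P then ?snap (w i) else if I i then cut P else of_bool (cut P < u i))"
  have cut01: "cut P \<in> {0..1}" using cut by auto
  have w: "w \<in> cube n" unfolding w_def by (rule tuplesI) (use cut01 cube_nth[OF su'(2)] in auto)
  have "w \<in> cube_interval n s u" using w su'(3) by (auto simp: cube_interval_def w_def I_def)
  then have g: "(((n, d), cmap ?snap n w), ((m, c), t)) \<in> glue_eq C"
    using int mem_star_iff[OF P d w] r(1) by simp
  have "grid P \<subseteq> {0..1}" using r(7) by (simp add: spaced_def)
  then have z: "z \<in> cube n" unfolding z_def by (intro tuplesI) (use cut01 in auto)
  have "(((n, d), z), ((m, c), t)) \<in> glue_eq C"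
    by (rule glue_eq_update_all[OF C _ _ r(6) g z]) (use r(2,3,5) in \<open>auto simp: mem_cells_stream z_def\<close>)
  \<comment> \<open>\<open>z\<close> is another representative of \<open>P\<close>, and the mass of
    \<open>P\<close> does not depend on the representative.\<close>
  then have "\<alpha> n d (above (cut P) n z, above (1 / 2) n z) = \<alpha> m c (above (cut P) m t, above (1 / 2) m t)"
    using mass_glue_eq[OF \<alpha> _ _ ] cut by simp
  also have "\<dots> = \<one>\<^bsub>\<tau>\<^esub>" using mass_self[OF \<alpha> P] mass_point[OF \<alpha> _ _ r(2,3), of "cut P"] r(4) cut by simp
  finally have one: "\<alpha> n d (above (cut P) n z, above (1 / 2) n z) = \<one>\<^bsub>\<tau>\<^esub>" .
  \<comment> \<open>A crossing coordinate lies above 1/2 but not above the cut. The mass computed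
    from \<open>z\<close> is therefore the weight of exactly the crossing coordinates.\<close>
  have zi: "(cut P < z i \<longleftrightarrow> cut P < s i) \<and> (1 / 2 < z i \<longleftrightarrow> cut P < u i)" if i: "i < n" for i
  proof (cases "I i")
    case True
    have "?snap (cut P) = cut P" using cut(1) by (intro snap_far) (use cut(4) in \<open>force simp: cut_def\<close>)
    moreover have "cut P \<notin> grid P" using cut(1,2) cut(4)[of "cut P"] by auto
    ultimately have "z i = cut P" using i True by (simp add: z_def w_def)
    then show ?thesis using True cut by (auto simp: I_def)
  next
    case False
    then have side: "cut P < s i \<longleftrightarrow> cut P < u i" using su'(3)[OF i] by (auto simp: I_def)
    have wi: "w i = u i" using i False by (simp add: w_def)
    show ?thesis
      using r(7)
    proof (cases rule: snap_cases[of "grid P" "radius P" "u i"])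
      case (near a)
      then have "z i = a" using i by (simp add: z_def wi)
      moreover have "cut P < a \<longleftrightarrow> cut P < u i" "1 / 2 < a \<longleftrightarrow> cut P < u i"
        using cut(4)[OF near(1)] near(2) cut(1) by (auto simp: cut_def abs_less_iff)
      ultimately show ?thesis using side by simp
    next
      case far
      then have "z i = of_bool (cut P < u i)" using i False by (simp add: z_def wi)
      then show ?thesis using side cut by (auto simp: of_bool_def)
    qed
  qed
  have "above (cut P) n z = above (cut P) n s" "above (1 / 2) n z = above (cut P) n u"
    using zi by (auto simp: above_def fun_eq_iff)
  then show ?thesis using one by simp
qed

text \<open>There are two ways from \<open>above (cut P) n s\<close> to
  \<open>above (1 / 2) n u\<close>: one through \<open>above (1 / 2) n s\<close>, the other through
  \<open>above (cut P) n u\<close>. The first leg of the latter is trivial by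
  \<open>no_crossing\<close>. The resulting increment does not mention \<open>P\<close>.\<close>

lemma mass_step:
  assumes \<alpha>: "\<alpha> \<in> cochains C \<tau>" and P: "P \<in> points C" and d: "d \<in> cells C n" and su: "(s, u) \<in> cube_le n"
    and int: "\<And>w. w \<in> cube_interval n s u \<Longrightarrow> point C n d w \<in> star C P"
  shows "mass \<alpha> (cut P) (point C n d s) \<otimes>\<^bsub>\<tau>\<^esub> \<alpha> n d (above (1 / 2) n s, above (1 / 2) n u) =
    mass \<alpha> (cut P) (point C n d u)"
proof -
  have s: "s \<in> cube n" "u \<in> cube n" using su by (auto simp: cube_le_def)
  note cut = cut_props[OF P]
  have cut': "1 / 2 \<le> cut P" "cut P < 1" using cut by auto
  note A = above_mono[OF su, of "1 / 2"] and B = above_mono[OF su, of "cut P"]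
    and D = above_le[OF cut'(1), of n s] and E = above_le[OF cut'(1), of n u]
  have "mass \<alpha> (cut P) (point C n d s) \<otimes>\<^bsub>\<tau>\<^esub> \<alpha> n d (above (1 / 2) n s, above (1 / 2) n u) =
      \<alpha> n d (above (cut P) n s, above (1 / 2) n u)"
    using cochainsD(3)[OF \<alpha> d D A] cochainsD(1)[OF \<alpha> d D] cochainsD(1)[OF \<alpha> d A]
    by (simp add: mass_point[OF \<alpha> cut' d s(1)] m_comm)
  also have "\<dots> = \<alpha> n d (above (cut P) n u, above (1 / 2) n u)"
    using cochainsD(3)[OF \<alpha> d B E] no_crossing[OF \<alpha> P d su int] cochainsD(1)[OF \<alpha> d E] by simp
  finally show ?thesis by (simp add: mass_point[OF \<alpha> cut' d s(2)])
qed

text \<open>One \<open>k\<close> works for all centres at once, because the increments of single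
  steps do not depend on the centre and increments of chains are their products.\<close>

lemma mass_circ:
  assumes \<alpha>: "\<alpha> \<in> cochains C \<tau>" and W: "openin (stop (realization C)) W" and xy: "(x, y) \<in> circ (realization C) W"
  shows "\<exists>k\<in>carrier \<tau>. \<forall>P\<in>points C. W \<subseteq> star C P \<longrightarrow> mass \<alpha> (cut P) x \<otimes>\<^bsub>\<tau>\<^esub> k = mass \<alpha> (cut P) y"
proof -
  have closed: "mass \<alpha> (cut P) Q \<in> carrier \<tau>" if "P \<in> points C" "Q \<in> points C" for P Q
    using mass_closed[OF \<alpha> _ _ that(2), of "cut P"] cut_props[OF that(1)] by simp
  \<comment> \<open>Membership of \<open>x\<close> is carried along so that its mass lies in the
    carrier when increments are composed.\<close>
  have "x \<in> points C \<and> (\<exists>k\<in>carrier \<tau>. \<forall>P\<in>points C. W \<subseteq> star C P \<longrightarrow> mass \<alpha> (cut P) x \<otimes>\<^bsub>\<tau>\<^esub> k = mass \<alpha> (cut P) y)"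
  proof (rule realization_circ_induct[OF C W xy, where R = "\<lambda>x y. x \<in> points C \<and>
      (\<exists>k\<in>carrier \<tau>. \<forall>P\<in>points C. W \<subseteq> star C P \<longrightarrow> mass \<alpha> (cut P) x \<otimes>\<^bsub>\<tau>\<^esub> k = mass \<alpha> (cut P) y)"])
    fix x y z
    assume "x \<in> points C \<and> (\<exists>k\<in>carrier \<tau>. \<forall>P\<in>points C. W \<subseteq> star C P \<longrightarrow> mass \<alpha> (cut P) x \<otimes>\<^bsub>\<tau>\<^esub> k = mass \<alpha> (cut P) y)"
      "y \<in> points C \<and> (\<exists>k\<in>carrier \<tau>. \<forall>P\<in>points C. W \<subseteq> star C P \<longrightarrow> mass \<alpha> (cut P) y \<otimes>\<^bsub>\<tau>\<^esub> k = mass \<alpha> (cut P) z)"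
    then obtain k l where x: "x \<in> points C"
      and k: "k \<in> carrier \<tau>" "\<And>P. P \<in> points C \<Longrightarrow> W \<subseteq> star C P \<Longrightarrow> mass \<alpha> (cut P) x \<otimes>\<^bsub>\<tau>\<^esub> k = mass \<alpha> (cut P) y"
      and l: "l \<in> carrier \<tau>" "\<And>P. P \<in> points C \<Longrightarrow> W \<subseteq> star C P \<Longrightarrow> mass \<alpha> (cut P) y \<otimes>\<^bsub>\<tau>\<^esub> l = mass \<alpha> (cut P) z"
      by blast
    have "mass \<alpha> (cut P) x \<otimes>\<^bsub>\<tau>\<^esub> (k \<otimes>\<^bsub>\<tau>\<^esub> l) = mass \<alpha> (cut P) z" if P: "P \<in> points C" "W \<subseteq> star C P" for P
      using k(1) l(1) closed[OF P(1) x] k(2)[OF P] l(2)[OF P] by (simp add: m_assoc[symmetric])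
    then show "x \<in> points C \<and> (\<exists>k\<in>carrier \<tau>. \<forall>P\<in>points C. W \<subseteq> star C P \<longrightarrow> mass \<alpha> (cut P) x \<otimes>\<^bsub>\<tau>\<^esub> k = mass \<alpha> (cut P) z)"
      using x k(1) l(1) by (intro conjI bexI[of _ "k \<otimes>\<^bsub>\<tau>\<^esub> l"]) auto
  next
    fix n d s u assume d: "d \<in> cells C n" and su: "(s, u) \<in> cube_le n"
      and int: "\<And>w. w \<in> cube_interval n s u \<Longrightarrow> point C n d w \<in> W"
    have s: "s \<in> cube n" using su by (simp add: cube_le_def)
    show "point C n d s \<in> points C \<and> (\<exists>k\<in>carrier \<tau>. \<forall>P\<in>points C. W \<subseteq> star C P \<longrightarrow>
        mass \<alpha> (cut P) (point C n d s) \<otimes>\<^bsub>\<tau>\<^esub> k = mass \<alpha> (cut P) (point C n d u))"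
    proof (intro conjI bexI[of _ "\<alpha> n d (above (1 / 2) n s, above (1 / 2) n u)"] ballI impI)
      show "mass \<alpha> (cut P) (point C n d s) \<otimes>\<^bsub>\<tau>\<^esub> \<alpha> n d (above (1 / 2) n s, above (1 / 2) n u) =
          mass \<alpha> (cut P) (point C n d u)" if "P \<in> points C" "W \<subseteq> star C P" for P
        using int that(2) by (intro mass_step[OF \<alpha> that(1) d su]) blast
    qed (use point_mem[OF C d s] cochainsD(1)[OF \<alpha> d above_mono[OF su]] in auto)
  qed
  then show ?thesis by blast
qed

lemma local_potential_mass:
  assumes \<alpha>: "\<alpha> \<in> cochains C \<tau>"
  shows "local_potential \<tau> (realization C) (star C) (\<lambda>P. mass \<alpha> (cut P))"
proof (rule local_potential.intro[OF \<tau>], unfold_locales)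
  fix p x assume p: "p \<in> points C" 
  show "openin (stop (realization C)) (star C p)" by (rule star_open[OF p])
  show "p \<in> star C p" by (rule star_self[OF p])
  show "mass \<alpha> (cut p) x \<in> carrier \<tau>" if "x \<in> star C p"
    using mass_closed[OF \<alpha>, of "cut p" x] cut_props[OF p] that by (simp add: star_def)
  show "mass \<alpha> (cut p) p = \<one>\<^bsub>\<tau>\<^esub>" by (rule mass_self[OF \<alpha> p])
next
  fix p q W x y assume p: "p \<in> points C" "q \<in> points C" and W: "openin (stop (realization C)) W"
    and sub: "W \<subseteq> star C p" "W \<subseteq> star C q" and xy: "(x, y) \<in> circ (realization C) W"
  obtain k where k: "k \<in> carrier \<tau>"
    "\<forall>P\<in>points C. W \<subseteq> star C P \<longrightarrow> mass \<alpha> (cut P) x \<otimes>\<^bsub>\<tau>\<^esub> k = mass \<alpha> (cut P) y"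
    using mass_circ[OF \<alpha> W xy] by (rule bexE)
  show "\<exists>k\<in>carrier \<tau>. mass \<alpha> (cut p) x \<otimes>\<^bsub>\<tau>\<^esub> k = mass \<alpha> (cut p) y \<and> mass \<alpha> (cut q) x \<otimes>\<^bsub>\<tau>\<^esub> k = mass \<alpha> (cut q) y"
    using k(2) p sub by (intro bexI[OF _ k(1)] conjI) simp_all
qed

end

end

subsection \<open>Extending cochains along the unit\<close>

lemma path_value_path_cochain:
  assumes X: "is_stream X" and g: "dipath X g"
    and cong: "\<And>h. (\<And>t. t \<in> {0..1} \<Longrightarrow> h t = g t) \<Longrightarrow> V h = V g"
  shows "path_value (path_cochain X V) g = V g"
proof -
  have "line 1 (const_vertex 1 False) (const_vertex 1 True) r = pt1 r" for r
    by (auto simp: line_def pt1_def fun_eq_iff)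
  moreover have "path_cell g \<in> cells (sing X) 1" using path_cell_mem[OF X g] by (simp add: cells_sing)
  moreover have "(const_vertex 1 False, const_vertex 1 True) \<in> verts_le 1" by (rule const_vertex_le) simp
  ultimately have "path_value (path_cochain X V) g = V (\<lambda>r. path_cell g (pt1 r))"
    unfolding path_value_def edge_value_def by (simp only: path_cochain_val)
  also have "\<dots> = V g" by (rule cong) simp
  finally show ?thesis .
qed

text \<open>\<open>\<lambda>_. undefined\<close> is the only member of \<open>cube 0\<close>, the
  extensional functions on the empty set.\<close>

definition eval0 :: "((nat \<Rightarrow> real) \<Rightarrow> 'a) \<Rightarrow> 'a" where
  "eval0 x = x (\<lambda>_. undefined)"

lemma eval0_vert:
  "eval0 (vert (sing X) 1 e (const_vertex 1 b)) = e (pt1 (of_bool b))"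
proof -
  let ?o = "(\<lambda>_. undefined) :: nat \<Rightarrow> real" and ?v = "vertex_map (const_vertex 1 b)"
  have o: "?o \<in> cube 0" by (simp add: tuples_def)
  have v: "box_mor 0 1 ?v" by (rule box_mor_vertex) (rule const_vertex_mem)
  have "?o = line 0 (const_vertex 0 True) (const_vertex 0 True) 0"
    by (auto simp: line_def fun_eq_iff)
  then have "cube_map 0 1 ?v ?o = line 1 (?v (const_vertex 0 True)) (?v (const_vertex 0 True)) 0"
    using cube_map_line[OF v const_vertex_mem const_vertex_mem, of 0] by simp
  also have "?v (const_vertex 0 True) = const_vertex 1 b"
    using const_vertex_mem[of 0 True] by (simp add: vertex_map_def)
  also have "line 1 (const_vertex 1 b) (const_vertex 1 b) 0 = pt1 (of_bool b)"
    by (auto simp: line_def pt1_def fun_eq_iff)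
  finally show ?thesis using o by (simp add: eval0_def vert_def act_sing compose_eq)
qed

text \<open>Restates the edge equation for points and directed paths, the 0-cells and 1-cells of the
  singular cubical set.\<close>

lemma natural_homotopy_singI:
  assumes X: "is_stream X"
    and closed: "\<And>x. x \<in> topspace (stop X) \<Longrightarrow> \<Gamma> x \<in> carrier \<tau>"
    and nat: "\<And>g. dipath X g \<Longrightarrow> \<Gamma> (g 1) \<otimes>\<^bsub>\<tau>\<^esub> path_value \<alpha> g = path_value \<beta> g \<otimes>\<^bsub>\<tau>\<^esub> \<Gamma> (g 0)"
  shows "natural_homotopy (sing X) \<tau> \<alpha> \<beta> (\<lambda>x. \<Gamma> (eval0 x))"
  unfolding natural_homotopy_def
proof (intro conjI ballI)
  fix x assume "x \<in> cells (sing X) 0"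
  then have "x \<in> stream_maps (directed_cube 0) X" by (simp add: cells_sing)
  from PiE_mem[OF stream_mapsD(1)[OF this], of "\<lambda>_. undefined"] show "\<Gamma> (eval0 x) \<in> carrier \<tau>"
    unfolding eval0_def by (intro closed) (simp add: tuples_def)
next
  fix e assume "e \<in> cells (sing X) 1"
  then have e: "e \<in> stream_maps (directed_cube 1) X" by (simp add: cells_sing)
  have "path_cell (\<lambda>t. e (pt1 t)) = e"
  proof (rule extensionalityI[where A = "cube 1"])
    show "e \<in> extensional (cube 1)" using stream_mapsD(1)[OF e] by (simp add: PiE_iff)
  qed (simp_all add: path_cell_def pt1_eq del: One_nat_def)
  then have "edge_value f e = path_value f (\<lambda>t. e (pt1 t))" for f :: "((nat \<Rightarrow> real) \<Rightarrow> 'a, 'b) cochain"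
    by (simp add: path_value_def)
  then show "\<Gamma> (eval0 (vert (sing X) 1 e (const_vertex 1 True))) \<otimes>\<^bsub>\<tau>\<^esub> edge_value \<alpha> e =
      edge_value \<beta> e \<otimes>\<^bsub>\<tau>\<^esub> \<Gamma> (eval0 (vert (sing X) 1 e (const_vertex 1 False)))"
    using nat[OF dipath_stream_map1[OF X e]] by (simp add: eval0_vert del: One_nat_def)
qed

lemma dipath_subinterval:
  assumes X: "is_stream X" and g: "dipath X g" and ab: "0 \<le> a" "a \<le> b" "b \<le> 1"
  shows "dipath X (\<lambda>r. g (a + r * (b - a)))"
proof (rule dipath_cong)
  have r01: "a + r * (b - a) \<in> {a..b}" if "r \<in> {0..1}" for r
    using mult_left_le_one_le[of "b - a" r] that ab by auto
  show "dipath X (\<lambda>r. path_cell g (pt1 (a + r * (b - a))))"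
  proof (rule dipath_curve[OF X path_cell_mem[OF X g]])
    show "curve 1 (\<lambda>r. pt1 (a + r * (b - a)))"
      unfolding curve_def
    proof (intro conjI ballI allI impI)
      show "pt1 (a + t * (b - a)) \<in> cube 1" if "t \<in> {0..1}" for t using r01[OF that] ab by (intro pt1_mem) auto
      fix i :: nat assume "i < 1"
      then show "continuous_on {0..1} (\<lambda>t. pt1 (a + t * (b - a)) i)" "mono_on {0..1} (\<lambda>t. pt1 (a + t * (b - a)) i)"
        using ab by (auto intro!: continuous_intros mono_onI mult_right_mono)
    qed
  qed
  show "g (a + r * (b - a)) = path_cell g (pt1 (a + r * (b - a)))" if "r \<in> {0..1}" for r
    using r01[OF that] ab by simp
qed

definition extend_cochain ::
  "'c cubical \<Rightarrow> ('t, 'm) monoid_scheme \<Rightarrow> ('c, 't) cochain \<Rightarrow>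
    ((nat \<Rightarrow> real) \<Rightarrow> ((nat \<times> 'c) \<times> (nat \<Rightarrow> real)) set, 't) cochain" where
  "extend_cochain C \<tau> \<alpha> = path_cochain (realization C)
     (\<lambda>g. local_potential.val \<tau> (star C) (\<lambda>P. mass \<alpha> (cut P)) g 0 1)"

context
  fixes C :: "'c cubical" and \<tau> :: "('t, 'm) monoid_scheme"
  assumes C: "cubical_set C" and \<tau>: "comm_monoid \<tau>"
begin

interpretation comm_monoid \<tau> by (rule \<tau>)

abbreviation "tval \<alpha> \<equiv> local_potential.val \<tau> (star C) (\<lambda>P. mass \<alpha> (cut P))"

lemmas potential = local_potential_mass[OF C \<tau>]
lemmas X = is_stream_realization[OF C]

lemma extend_cochain_mem: "\<alpha> \<in> cochains C \<tau> \<Longrightarrow> extend_cochain C \<tau> \<alpha> \<in> cochains (sing (realization C)) \<tau>"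
  unfolding extend_cochain_def by (rule local_potential.val_path_cochain[OF potential X])

lemma path_value_extend:
  assumes "\<alpha> \<in> cochains C \<tau>" "dipath (realization C) g"
  shows "path_value (extend_cochain C \<tau> \<alpha>) g = tval \<alpha> g 0 1"
  unfolding extend_cochain_def
  by (rule path_value_path_cochain[OF X assms(2)]) (rule local_potential.val_cong[OF potential[OF assms(1)]])

text \<open>Within one cell, \<open>mass_step\<close> gives the increment over each short piece of
  the curve. The pieces multiply up, so only the positions of the two ends relative to 1/2
  remain.\<close>

lemma val_curve:
  assumes \<alpha>: "\<alpha> \<in> cochains C \<tau>" and d: "d \<in> cells C n" and c: "curve n c"
  shows "tval \<alpha> (\<lambda>t. realization_unit C n d (c t)) 0 1 = \<alpha> n d (above (1 / 2) n (c 0), above (1 / 2) n (c 1))"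
proof -
  interpret local_potential \<tau> "realization C" "star C" "\<lambda>P. mass \<alpha> (cut P)" by (rule potential[OF \<alpha>])
  define g where "g t = realization_unit C n d (c t)" for t
  have c01: "c t \<in> cube n" if "t \<in> {0..1}" for t using c that by (simp add: curve_def)
  have g: "g t = point C n d (c t)" if "t \<in> {0..1}" for t
    using c01[OF that] by (simp add: g_def realization_unit_point[OF C d])
  have path: "dipath (realization C) g"
    unfolding g_def using dipath_curve[OF X realization_unit_stream_map[OF C d] c] .
  have le: "(c s, c t) \<in> cube_le n" if "s \<in> {0..1}" "t \<in> {0..1}" "s \<le> t" for s t
    using c that c01 by (auto simp: curve_def cube_le_def mono_on_def)
  have "val g 0 1 = \<alpha> n d (above (1 / 2) n (c 0), above (1 / 2) n (c 1))"
    using zero_le_one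
  proof (rule Bolzano_interval[where P = "\<lambda>a b. val g a b = \<alpha> n d (above (1 / 2) n (c a), above (1 / 2) n (c b))"])
    fix x y z :: real
    assume *: "val g x y = \<alpha> n d (above (1 / 2) n (c x), above (1 / 2) n (c y))"
      "val g y z = \<alpha> n d (above (1 / 2) n (c y), above (1 / 2) n (c z))" and xyz: "0 \<le> x" "x \<le> y" "y \<le> z" "z \<le> 1"
    have "(c x, c y) \<in> cube_le n" "(c y, c z) \<in> cube_le n" using le xyz by auto
    note A = this[THEN above_mono, of "1 / 2"]
    show "val g x z = \<alpha> n d (above (1 / 2) n (c x), above (1 / 2) n (c z))"
      using val_concat[OF path xyz] cochainsD(3)[OF \<alpha> d A] cochainsD(1)[OF \<alpha> d A(1)] cochainsD(1)[OF \<alpha> d A(2)] *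
      by (simp add: m_comm)
  next
    fix t :: real assume t: "t \<in> {0..1}"
    have P: "g t \<in> points C" using dipathD(1)[OF path t] .
    define V where "V = {s \<in> cube n. point C n d s \<in> star C (g t)}"
    have "openin (cube_topology n) V"
      using star_open[OF C P] d unfolding openin_realization[OF C] V_def by blast
    moreover have "c t \<in> V" using star_self[OF C P] c01[OF t] g[OF t] by (simp add: V_def)
    ultimately obtain e where e: "e > 0" "{u \<in> cube n. \<forall>i<n. \<bar>u i - c t i\<bar> < e} \<subseteq> V"
      using cube_box_neighbourhood by blast
    have "\<exists>r>0. \<forall>s\<in>{0..1}. \<bar>s - t\<bar> < r \<longrightarrow> \<bar>c s i - c t i\<bar> < e" if "i < n" for i
    proof -
      have "continuous_on {0..1} (\<lambda>t. c t i)" using c that by (simp add: curve_def)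
      then show ?thesis using t e(1) unfolding continuous_on_iff dist_real_def by blast
    qed
    then obtain r where r: "\<And>i. i < n \<Longrightarrow> r i > 0"
      "\<And>i s. i < n \<Longrightarrow> s \<in> {0..1} \<Longrightarrow> \<bar>s - t\<bar> < r i \<Longrightarrow> \<bar>c s i - c t i\<bar> < e" by metis
    define \<delta> where "\<delta> = Min (insert 1 (r ` {..<n}))"
    have \<delta>: "\<delta> > 0" unfolding \<delta>_def using r(1) by (subst Min_gr_iff) auto
    have \<delta>r: "\<delta> \<le> r i" if "i < n" for i unfolding \<delta>_def using that by (intro Min_le) auto
    show "\<exists>d'>0. \<forall>x y. 0 \<le> x \<and> x \<le> t \<and> t \<le> y \<and> y \<le> 1 \<and> y - x < d' \<longrightarrow>
        val g x y = \<alpha> n d (above (1 / 2) n (c x), above (1 / 2) n (c y))"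
    proof (intro exI[of _ \<delta>] conjI allI impI \<delta>)
      fix x y assume xy: "0 \<le> x \<and> x \<le> t \<and> t \<le> y \<and> y \<le> 1 \<and> y - x < \<delta>"
      have x01: "x \<in> {0..1}" "y \<in> {0..1}" using xy by auto
      have near: "\<bar>c s i - c t i\<bar> < e" if "s \<in> {x..y}" "i < n" for s i
      proof (rule r(2)[OF that(2)])
        show "s \<in> {0..1}" using that xy by auto
        show "\<bar>s - t\<bar> < r i" using that xy \<delta>r[OF that(2)] by auto
      qed
      \<comment> \<open>By monotonicity the order interval between \<open>c x\<close> and
        \<open>c y\<close> is squeezed into the box around \<open>c t\<close>.\<close>
      have box: "w \<in> V" if "w \<in> cube_interval n (c x) (c y)" for w
      proof -
        have "\<bar>w i - c t i\<bar> < e" if i: "i < n" for i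
        proof -
          have "c x i \<le> w i" "w i \<le> c y i" using that \<open>w \<in> cube_interval n (c x) (c y)\<close> by (auto simp: cube_interval_def)
          then show ?thesis using near[of x i] near[of y i] i xy by (auto simp: abs_less_iff)
        qed
        then have "w \<in> {u \<in> cube n. \<forall>i<n. \<bar>u i - c t i\<bar> < e}" using that by (simp add: cube_interval_def)
        then show ?thesis using e(2) by blast
      qed
      have "g ` {x..y} \<subseteq> star C (g t)"
      proof
        fix z assume "z \<in> g ` {x..y}"
        then obtain s where s: "s \<in> {x..y}" "z = g s" by blast
        then have s01: "s \<in> {0..1}" using xy by auto
        have "c s \<in> {u \<in> cube n. \<forall>i<n. \<bar>u i - c t i\<bar> < e}" using c01[OF s01] near[OF s(1)] by simp
        then have "c s \<in> V" using e(2) by blast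
        then show "z \<in> star C (g t)" using s g[OF s01] by (simp add: V_def)
      qed
      moreover have xyle: "(c x, c y) \<in> cube_le n" using le x01 xy by auto
      moreover have "mass \<alpha> (cut (g t)) (g x) \<otimes>\<^bsub>\<tau>\<^esub> \<alpha> n d (above (1 / 2) n (c x), above (1 / 2) n (c y)) = mass \<alpha> (cut (g t)) (g y)"
        unfolding g[OF x01(1)] g[OF x01(2)]
        by (rule mass_step[OF C \<tau> \<alpha> P d xyle]) (use box in \<open>simp add: V_def\<close>)
      ultimately show "val g x y = \<alpha> n d (above (1 / 2) n (c x), above (1 / 2) n (c y))"
        using xy cochainsD(1)[OF \<alpha> d above_mono[OF xyle]] by (intro val_eq_local[OF path, of x t y]) auto
    qed
  qed
  then show ?thesis unfolding g_def .
qed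

text \<open>Vertices have coordinates 0 and 1, so cutting at 1/2 returns the vertices
  themselves.\<close>

lemma extend_unit:
  assumes \<alpha>: "\<alpha> \<in> cochains C \<tau>"
  shows "cubical_comp C (extend_cochain C \<tau> \<alpha>) (realization_unit C) = \<alpha>"
proof (rule cochains_eqI[OF cubical_comp_mem[OF C realization_unit_hom[OF C] extend_cochain_mem[OF \<alpha>]] \<alpha>])
  fix n d v w assume d: "d \<in> cells C n" and vw: "(v, w) \<in> verts_le n"
  have e: "realization_unit C n d \<in> cells (sing (realization C)) n"
    by (rule cubical_homD(1)[OF realization_unit_hom[OF C] d])
  have "above (1 / 2) n (line n v w 0) = v" "above (1 / 2) n (line n v w 1) = w"
    using verts_leD(1,2)[OF vw] by (auto intro!: tuples_eqI[OF above_mem] simp: of_bool_def split: if_splits)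
  then show "cubical_comp C (extend_cochain C \<tau> \<alpha>) (realization_unit C) n d (v, w) = \<alpha> n d (v, w)"
    using val_curve[OF \<alpha> d curve_line[OF vw]]
    by (simp add: cubical_comp_val[OF d] extend_cochain_def path_cochain_val[OF e vw])
qed

lemma half_vertex_point:
  assumes d: "d \<in> cells C n" "s \<in> cube n"
  shows "half_vertex C (point C n d s) = vert C n d (above (1 / 2) n s)"
  unfolding half_vertex_def
proof (rule point_value[OF C _ d])
  fix m n \<phi> c t assume *: "box_mor m n \<phi>" "c \<in> cells C n" "t \<in> cube m"
  show "vert C m (act C m n \<phi> c) (above (1 / 2) m t) = vert C n c (above (1 / 2) n (cube_map m n \<phi> t))"
    using vert_act[OF C *(1,2) above_mem] above_cube_map[OF *(1) _ _ *(3), of "1 / 2"] by simp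
qed

text \<open>The function \<open>\<gamma>\<close> is transported to points by
  \<open>half_vertex\<close>. For a step inside a cell, both increments are values on vertices of
  that cell, and \<open>natural_homotopy_cell\<close> applies.\<close>

lemma extend_homotopic:
  assumes "cochain_homotopic C \<tau> \<alpha> \<beta>"
  shows "cochain_homotopic (sing (realization C)) \<tau> (extend_cochain C \<tau> \<alpha>) (extend_cochain C \<tau> \<beta>)"
proof -
  have \<alpha>: "\<alpha> \<in> cochains C \<tau>" and \<beta>: "\<beta> \<in> cochains C \<tau>" using assms by (simp_all add: cochain_homotopic_def)
  obtain \<gamma> where \<gamma>: "natural_homotopy C \<tau> \<alpha> \<beta> \<gamma>" by (rule natural_if_homotopic[OF C \<tau> assms])
  define \<Gamma> where "\<Gamma> Q = \<gamma> (half_vertex C Q)" for Q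
  have \<Gamma>p: "\<Gamma> (point C n d s) = \<gamma> (vert C n d (above (1 / 2) n s))" if "d \<in> cells C n" "s \<in> cube n" for n d s
    using half_vertex_point[OF that] by (simp add: \<Gamma>_def)
  have \<Gamma>: "\<Gamma> Q \<in> carrier \<tau>" if Q: "Q \<in> points C" for Q
  proof -
    obtain n d s where d: "d \<in> cells C n" "s \<in> cube n" "Q = point C n d s" using pointE[OF C Q] by blast
    then show ?thesis
      using \<gamma> vert_mem[OF C d(1) above_mem] by (simp add: \<Gamma>p natural_homotopy_def)
  qed
  interpret A: local_potential \<tau> "realization C" "star C" "\<lambda>P. mass \<alpha> (cut P)" by (rule potential[OF \<alpha>])
  interpret B: local_potential \<tau> "realization C" "star C" "\<lambda>P. mass \<beta> (cut P)" by (rule potential[OF \<beta>])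
  have nat: "\<Gamma> (g 1) \<otimes>\<^bsub>\<tau>\<^esub> tval \<alpha> g 0 1 = tval \<beta> g 0 1 \<otimes>\<^bsub>\<tau>\<^esub> \<Gamma> (g 0)" if g: "dipath (realization C) g" for g
    using zero_le_one
  proof (rule Bolzano_interval[where P = "\<lambda>a b. \<Gamma> (g b) \<otimes>\<^bsub>\<tau>\<^esub> tval \<alpha> g a b = tval \<beta> g a b \<otimes>\<^bsub>\<tau>\<^esub> \<Gamma> (g a)"])
    fix x y z :: real
    assume *: "\<Gamma> (g y) \<otimes>\<^bsub>\<tau>\<^esub> tval \<alpha> g x y = tval \<beta> g x y \<otimes>\<^bsub>\<tau>\<^esub> \<Gamma> (g x)"
      "\<Gamma> (g z) \<otimes>\<^bsub>\<tau>\<^esub> tval \<alpha> g y z = tval \<beta> g y z \<otimes>\<^bsub>\<tau>\<^esub> \<Gamma> (g y)" and xyz: "0 \<le> x" "x \<le> y" "y \<le> z" "z \<le> 1"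
    have cl: "\<Gamma> (g x) \<in> carrier \<tau>" "\<Gamma> (g y) \<in> carrier \<tau>" "\<Gamma> (g z) \<in> carrier \<tau>"
      using \<Gamma> dipathD(1)[OF g] xyz by auto
    have y: "y \<le> 1" "0 \<le> y" using xyz by auto
    have cl': "tval \<alpha> g x y \<in> carrier \<tau>" "tval \<alpha> g y z \<in> carrier \<tau>" "tval \<beta> g x y \<in> carrier \<tau>" "tval \<beta> g y z \<in> carrier \<tau>"
      using A.val_closed[OF g xyz(1,2) y(1)] A.val_closed[OF g y(2) xyz(3,4)]
        B.val_closed[OF g xyz(1,2) y(1)] B.val_closed[OF g y(2) xyz(3,4)] by auto
    have "\<Gamma> (g z) \<otimes>\<^bsub>\<tau>\<^esub> tval \<alpha> g x z = \<Gamma> (g z) \<otimes>\<^bsub>\<tau>\<^esub> tval \<alpha> g y z \<otimes>\<^bsub>\<tau>\<^esub> tval \<alpha> g x y"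
      unfolding A.val_concat[OF g xyz] using cl cl' by (simp add: m_ac)
    also have "\<dots> = tval \<beta> g y z \<otimes>\<^bsub>\<tau>\<^esub> (\<Gamma> (g y) \<otimes>\<^bsub>\<tau>\<^esub> tval \<alpha> g x y)"
      unfolding *(2) using cl cl' by (simp add: m_assoc)
    also have "\<dots> = tval \<beta> g x z \<otimes>\<^bsub>\<tau>\<^esub> \<Gamma> (g x)"
      unfolding *(1) B.val_concat[OF g xyz] using cl cl' by (simp add: m_ac)
    finally show "\<Gamma> (g z) \<otimes>\<^bsub>\<tau>\<^esub> tval \<alpha> g x z = tval \<beta> g x z \<otimes>\<^bsub>\<tau>\<^esub> \<Gamma> (g x)" .
  next
    fix t :: real assume t: "t \<in> {0..1}"
    have P: "g t \<in> points C" using dipathD(1)[OF g t] .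
    note W = star_open[OF C P]
    obtain \<delta> where \<delta>: "\<delta> > 0"
      "\<And>x y. 0 \<le> x \<Longrightarrow> x \<le> t \<Longrightarrow> t \<le> y \<Longrightarrow> y \<le> 1 \<Longrightarrow> y - x < \<delta> \<Longrightarrow> g ` {x..y} \<subseteq> star C (g t)"
      using A.path_near[OF g t] by blast
    define N where "N \<zeta> = mass \<zeta> (cut (g t))" for \<zeta> :: "('c, 't) cochain"
    have Nc: "N \<zeta> Q \<in> carrier \<tau>" if "\<zeta> \<in> cochains C \<tau>" "Q \<in> points C" for \<zeta> Q
      using mass_closed[OF C \<tau> that(1) _ _ that(2), of "cut (g t)"] cut_props[OF C P] by (simp add: N_def)
    \<comment> \<open>\<open>k\<close> and \<open>l\<close> are increments of the two masses that
      satisfy naturality. Such pairs compose, as the induction over the steps of the circulation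
      demands.\<close>
    define R where "R x y \<longleftrightarrow> x \<in> points C \<and> y \<in> points C \<and> (\<exists>k\<in>carrier \<tau>. \<exists>l\<in>carrier \<tau>.
      N \<alpha> x \<otimes>\<^bsub>\<tau>\<^esub> k = N \<alpha> y \<and> N \<beta> x \<otimes>\<^bsub>\<tau>\<^esub> l = N \<beta> y \<and> \<Gamma> y \<otimes>\<^bsub>\<tau>\<^esub> k = l \<otimes>\<^bsub>\<tau>\<^esub> \<Gamma> x)" for x y
    have R: "R x y" if xy: "(x, y) \<in> circ (realization C) (star C (g t))" for x y
    proof (rule realization_circ_induct[OF C W xy])
      fix x y z assume xy: "R x y" and yz: "R y z"
      from xy obtain k l where k: "k \<in> carrier \<tau>" "l \<in> carrier \<tau>" "x \<in> points C" "y \<in> points C"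
        "N \<alpha> x \<otimes>\<^bsub>\<tau>\<^esub> k = N \<alpha> y" "N \<beta> x \<otimes>\<^bsub>\<tau>\<^esub> l = N \<beta> y" "\<Gamma> y \<otimes>\<^bsub>\<tau>\<^esub> k = l \<otimes>\<^bsub>\<tau>\<^esub> \<Gamma> x" unfolding R_def by blast
      from yz obtain k' l' where k': "k' \<in> carrier \<tau>" "l' \<in> carrier \<tau>" "z \<in> points C"
        "N \<alpha> y \<otimes>\<^bsub>\<tau>\<^esub> k' = N \<alpha> z" "N \<beta> y \<otimes>\<^bsub>\<tau>\<^esub> l' = N \<beta> z" "\<Gamma> z \<otimes>\<^bsub>\<tau>\<^esub> k' = l' \<otimes>\<^bsub>\<tau>\<^esub> \<Gamma> y" unfolding R_def by blast
      note cl = k(1,2) k'(1,2) \<Gamma>[OF k(3)] \<Gamma>[OF k(4)] \<Gamma>[OF k'(3)] Nc[OF \<alpha> k(3)] Nc[OF \<beta> k(3)]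
      have "N \<alpha> x \<otimes>\<^bsub>\<tau>\<^esub> (k \<otimes>\<^bsub>\<tau>\<^esub> k') = N \<alpha> z" using k'(4) k(5) cl by (simp add: m_assoc[symmetric])
      moreover have "N \<beta> x \<otimes>\<^bsub>\<tau>\<^esub> (l \<otimes>\<^bsub>\<tau>\<^esub> l') = N \<beta> z" using k'(5) k(6) cl by (simp add: m_assoc[symmetric])
      moreover have "\<Gamma> z \<otimes>\<^bsub>\<tau>\<^esub> (k \<otimes>\<^bsub>\<tau>\<^esub> k') = (l \<otimes>\<^bsub>\<tau>\<^esub> l') \<otimes>\<^bsub>\<tau>\<^esub> \<Gamma> x"
      proof -
        have "\<Gamma> z \<otimes>\<^bsub>\<tau>\<^esub> (k \<otimes>\<^bsub>\<tau>\<^esub> k') = (\<Gamma> z \<otimes>\<^bsub>\<tau>\<^esub> k') \<otimes>\<^bsub>\<tau>\<^esub> k" using cl by (simp add: m_ac)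
        also have "\<dots> = l' \<otimes>\<^bsub>\<tau>\<^esub> (\<Gamma> y \<otimes>\<^bsub>\<tau>\<^esub> k)" unfolding k'(6) using cl by (simp add: m_assoc)
        also have "\<dots> = (l \<otimes>\<^bsub>\<tau>\<^esub> l') \<otimes>\<^bsub>\<tau>\<^esub> \<Gamma> x" unfolding k(7) using cl by (simp add: m_ac)
        finally show ?thesis .
      qed
      ultimately show "R x z"
        unfolding R_def using k(3) k'(3) cl
        by (intro conjI bexI[of _ "k \<otimes>\<^bsub>\<tau>\<^esub> k'"] bexI[of _ "l \<otimes>\<^bsub>\<tau>\<^esub> l'"]) simp_all
    next
      fix n d s u assume d: "d \<in> cells C n" and su: "(s, u) \<in> cube_le n"
        and int: "\<And>w. w \<in> cube_interval n s u \<Longrightarrow> point C n d w \<in> star C (g t)"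
      have s: "s \<in> cube n" "u \<in> cube n" using su by (auto simp: cube_le_def)
      note le = above_mono[OF su, of "1 / 2"]
      show "R (point C n d s) (point C n d u)"
        unfolding R_def
        using point_mem[OF C d s(1)] point_mem[OF C d s(2)] mass_step[OF C \<tau> \<alpha> P d su int] mass_step[OF C \<tau> \<beta> P d su int]
          natural_homotopy_cell[OF C \<tau> \<alpha> \<beta> \<gamma> d le] cochainsD(1)[OF \<alpha> d le] cochainsD(1)[OF \<beta> d le]
        by (intro conjI bexI[of _ "\<alpha> n d (above (1 / 2) n s, above (1 / 2) n u)"]
            bexI[of _ "\<beta> n d (above (1 / 2) n s, above (1 / 2) n u)"]) (simp_all add: N_def \<Gamma>p d s)
    qed
    show "\<exists>d>0. \<forall>x y. 0 \<le> x \<and> x \<le> t \<and> t \<le> y \<and> y \<le> 1 \<and> y - x < d \<longrightarrow>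
        \<Gamma> (g y) \<otimes>\<^bsub>\<tau>\<^esub> tval \<alpha> g x y = tval \<beta> g x y \<otimes>\<^bsub>\<tau>\<^esub> \<Gamma> (g x)"
    proof (intro exI[of _ \<delta>] conjI allI impI \<delta>(1))
      fix x y assume xy: "0 \<le> x \<and> x \<le> t \<and> t \<le> y \<and> y \<le> 1 \<and> y - x < \<delta>"
      then have xy': "0 \<le> x" "x \<le> t" "t \<le> y" "y \<le> 1" "x \<le> y" by auto
      have sub: "g ` {x..y} \<subseteq> star C (g t)" using \<delta>(2) xy by blast
      \<comment> \<open>The piece of \<open>g\<close> may run through many cells; the circulation of
        the star replaces it by a chain of steps, each in a single cell.\<close>
      have "R (g x) (g y)" by (rule R[OF dipathD(3)[OF g W xy'(1,5,4) sub]])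
      then obtain k l where k: "k \<in> carrier \<tau>" "l \<in> carrier \<tau>"
        "N \<alpha> (g x) \<otimes>\<^bsub>\<tau>\<^esub> k = N \<alpha> (g y)" "N \<beta> (g x) \<otimes>\<^bsub>\<tau>\<^esub> l = N \<beta> (g y)" "\<Gamma> (g y) \<otimes>\<^bsub>\<tau>\<^esub> k = l \<otimes>\<^bsub>\<tau>\<^esub> \<Gamma> (g x)"
        unfolding R_def by blast
      have "tval \<alpha> g x y = k" by (rule A.val_eq_local[OF g xy'(1-4) sub k(1) k(3)[unfolded N_def]])
      moreover have "tval \<beta> g x y = l" by (rule B.val_eq_local[OF g xy'(1-4) sub k(2) k(4)[unfolded N_def]])
      ultimately show "\<Gamma> (g y) \<otimes>\<^bsub>\<tau>\<^esub> tval \<alpha> g x y = tval \<beta> g x y \<otimes>\<^bsub>\<tau>\<^esub> \<Gamma> (g x)" using k(5) by simp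
    qed
  qed
  have "natural_homotopy (sing (realization C)) \<tau> (extend_cochain C \<tau> \<alpha>) (extend_cochain C \<tau> \<beta>) (\<lambda>x. \<Gamma> (eval0 x))"
    by (rule natural_homotopy_singI[OF X \<Gamma>]) (simp_all add: path_value_extend[OF \<alpha>] path_value_extend[OF \<beta>] nat)
  then show ?thesis
    by (rule homotopic_if_natural[OF cubical_set_sing \<tau> extend_cochain_mem[OF \<alpha>] extend_cochain_mem[OF \<beta>]])
qed

end

subsection \<open>Natural self-maps of the realization\<close>

text \<open>The directed self-maps of the unit interval that fix both ends. In contrast to
  \<open>snap\<close>, they induce stream maps of the realization.\<close>

definition reparam :: "(real \<Rightarrow> real) \<Rightarrow> bool" where
  "reparam k \<longleftrightarrow> endpoint_fixing k \<and> continuous_on {0..1} k \<and> mono_on {0..1} k"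

definition self_map :: "'c cubical \<Rightarrow> (real \<Rightarrow> real) \<Rightarrow>
    ((nat \<times> 'c) \<times> (nat \<Rightarrow> real)) set \<Rightarrow> ((nat \<times> 'c) \<times> (nat \<Rightarrow> real)) set" where
  "self_map C k = (\<lambda>P\<in>points C. point_value (\<lambda>n d s. point C n d (cmap k n s)) P)"

definition blend :: "(real \<Rightarrow> real) \<Rightarrow> (real \<Rightarrow> real) \<Rightarrow> real \<Rightarrow> real \<Rightarrow> real" where
  "blend k l r = (\<lambda>t. (1 - r) * k t + r * l t)"

definition threshold :: "real \<Rightarrow> real \<Rightarrow> real \<Rightarrow> real" where
  "threshold r k t = max 0 (min 1 (k * (t - r)))"

lemma blend_ends: "blend k l 0 = k" "blend k l 1 = l"
  by (simp_all add: blend_def fun_eq_iff)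

lemma reparamD:
  assumes "reparam k"
  shows "endpoint_fixing k" "k \<in> {0..1} \<rightarrow> {0..1}" "continuous_on {0..1} k" "mono_on {0..1} k"
  using assms by (simp_all add: reparam_def endpoint_fixing_def)

lemma reparam_id: "reparam (\<lambda>t. t)"
  by (simp add: reparam_def endpoint_fixing_def mono_on_def)

lemma reparam_blend:
  assumes k: "reparam k" and l: "reparam l" and r: "r \<in> {0..1}"
  shows "reparam (blend k l r)"
  unfolding reparam_def
proof (intro conjI)
  have "blend k l r t \<in> {0..1}" if t: "t \<in> {0..1}" for t
  proof -
    have "k t \<in> {0..1}" "l t \<in> {0..1}" using reparamD(2)[OF k] reparamD(2)[OF l] t by blast+
    then show ?thesis using convex_bound_le[of "k t" 1 "l t" "1 - r" r] r by (auto simp: blend_def)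
  qed
  then show "endpoint_fixing (blend k l r)"
    using reparamD(1)[OF k] reparamD(1)[OF l] by (simp add: endpoint_fixing_def blend_def)
  show "continuous_on {0..1} (blend k l r)"
    unfolding blend_def by (intro continuous_intros reparamD(3) k l)
  show "mono_on {0..1} (blend k l r)"
  proof (rule mono_onI)
    fix a b :: real assume ab: "a \<in> {0..1}" "b \<in> {0..1}" "a \<le> b"
    have "k a \<le> k b" "l a \<le> l b" using mono_onD[OF reparamD(4)[OF k] ab] mono_onD[OF reparamD(4)[OF l] ab] .
    then show "blend k l r a \<le> blend k l r b"
      unfolding blend_def using r by (intro add_mono mult_left_mono) auto
  qed
qed

text \<open>The ramp starts at \<open>r\<close> and has slope \<open>k\<close>; the second bound on
  \<open>k\<close> lets it reach 1 no later than at 1.\<close>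

lemma reparam_threshold:
  assumes r: "0 \<le> r" and k: "0 \<le> k" "1 \<le> k * (1 - r)"
  shows "reparam (threshold r k)"
proof -
  have "0 \<le> k * r" using r k by simp
  then show ?thesis
    unfolding reparam_def endpoint_fixing_def threshold_def
    using k by (auto intro!: continuous_intros mono_onI max.mono min.mono mult_left_mono)
qed

lemma threshold_antimono: "0 \<le> k \<Longrightarrow> r \<le> r' \<Longrightarrow> threshold r' k t \<le> threshold r k t"
  unfolding threshold_def by (intro max.mono min.mono mult_left_mono order_refl) auto

lemma threshold_le: "2 \<le> k \<Longrightarrow> threshold (1 / 2) 2 t \<le> threshold (1 / 2) k t"
proof (cases "t \<le> 1 / 2")
  case True
  then have "2 * (t - 1 / 2) \<le> 0" by simp
  then show ?thesis by (simp add: threshold_def)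
next
  assume "2 \<le> k"
  case False
  then have "2 * (t - 1 / 2) \<le> k * (t - 1 / 2)" using \<open>2 \<le> k\<close> by (intro mult_right_mono) auto
  then show ?thesis unfolding threshold_def by (intro max.mono min.mono) auto
qed

text \<open>At \<open>t = r\<close> the ramp is still 0, in accordance with the strict inequality in
  \<open>above\<close>.\<close>

lemma threshold_eventually: "\<forall>\<^sub>F k in at_top. threshold r k t = of_bool (r < t)"
proof (cases "r < t")
  case True
  have "\<forall>\<^sub>F k in at_top. 1 / (t - r) \<le> k" by (rule eventually_ge_at_top)
  then show ?thesis
    by (rule eventually_mono) (use True in \<open>simp add: threshold_def field_simps\<close>)
next
  case False
  have "\<forall>\<^sub>F k in at_top. (0::real) \<le> k" by (rule eventually_ge_at_top)
  then show ?thesis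
  proof (rule eventually_mono)
    fix k :: real assume "0 \<le> k"
    then have "k * (t - r) \<le> 0" using False by (simp add: mult_nonneg_nonpos)
    then show "threshold r k t = of_bool (r < t)" using False by (simp add: threshold_def)
  qed
qed

lemma threshold_cmap_eventually:
  fixes n :: nat
  shows "\<forall>\<^sub>F k in at_top. \<forall>i<n. threshold r k (s i) = of_bool (r < s i)"
proof -
  have "\<forall>\<^sub>F k in at_top. \<forall>i\<in>{..<n}. threshold r k (s i) = of_bool (r < s i)"
    by (intro eventually_ball_finite ballI threshold_eventually) simp
  then show ?thesis by (simp only: Ball_def lessThan_iff)
qed

section \<open>Maps induced on singular cubical sets, and homotopies between self-maps\<close>

lemma sing_map_hom:
  assumes X: "is_stream X" and h: "h \<in> stream_maps X Y"
  shows "sing_map X h \<in> cubical_hom (sing X) (sing Y)"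
proof (rule cubical_homI)
  show "sing_map X h n \<in> extensional (cells (sing X) n)" for n by (simp add: sing_map_def)
  show "sing_map X h n e \<in> cells (sing Y) n" if "e \<in> cells (sing X) n" for n e
    using stream_maps_compose[OF is_stream_directed_cube _ h, of e n] that by (simp add: sing_map_def cells_sing)
  fix m n \<phi> e assume \<phi>: "box_mor m n \<phi>" and e: "e \<in> cells (sing X) n"
  show "sing_map X h m (act (sing X) m n \<phi> e) = act (sing Y) m n \<phi> (sing_map X h n e)"
    using e cubical_setD(1)[OF cubical_set_sing \<phi> e] cube_map_mem[OF \<phi>]
    by (auto simp: sing_map_def act_sing compose_def fun_eq_iff)
qed

lemma sing_map_val: "e \<in> cells (sing X) n \<Longrightarrow> sing_map X h n e = compose (cube n) h e"
  by (simp add: sing_map_def)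

lemma path_value_sing_map:
  assumes X: "is_stream X" and g: "dipath X g"
  shows "path_value (cubical_comp (sing X) \<beta> (sing_map X h)) g = path_value \<beta> (\<lambda>t. h (g t))"
proof -
  have c: "path_cell g \<in> cells (sing X) 1" using path_cell_mem[OF X g] by (simp add: cells_sing)
  have "compose (cube 1) h (path_cell g) = path_cell (\<lambda>t. h (g t))"
    unfolding compose_def path_cell_def by (intro restrict_ext) simp
  then show ?thesis
    by (simp only: path_value_def edge_value_def cubical_comp_val[OF c] sing_map_val[OF c])
qed

context
  fixes C :: "'c cubical"
  assumes C: "cubical_set C"
begin

lemma self_map_point:
  assumes k: "endpoint_fixing k" and d: "d \<in> cells C n" "s \<in> cube n"
  shows "self_map C k (point C n d s) = point C n d (cmap k n s)"
proof -
  have "point_value (\<lambda>n d s. point C n d (cmap k n s)) (point C n d s) = point C n d (cmap k n s)"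
  proof (rule point_value[OF C _ d])
    fix m n \<phi> c t assume *: "box_mor m n \<phi>" "c \<in> cells C n" "t \<in> cube m"
    have "cmap k m t \<in> cube m" using k *(3) by (intro cmap_mem) (simp_all add: endpoint_fixing_def)
    then show "point C m (act C m n \<phi> c) (cmap k m t) = point C n c (cmap k n (cube_map m n \<phi> t))"
      using point_act[OF C *(1,2)] cube_map_cmap[OF *(1) k *(3)] by simp
  qed
  then show ?thesis using point_mem[OF C d] by (simp add: self_map_def)
qed

text \<open>The order \<open>k t \<le> l t\<close> makes the interpolation increase with its
  parameter; only comparable reparametrizations are joined by directed paths.\<close>

lemma curve_cmap_blend:
  assumes k: "reparam k" and l: "reparam l" and kl: "\<And>t. t \<in> {0..1} \<Longrightarrow> k t \<le> l t" and s: "s \<in> cube n"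
  shows "curve n (\<lambda>r. cmap (blend k l r) n s)"
  unfolding curve_def
proof (intro conjI ballI allI impI)
  show "cmap (blend k l r) n s \<in> cube n" if "r \<in> {0..1}" for r
    using cmap_mem[OF reparamD(2)[OF reparam_blend[OF k l that]] s] .
  fix i assume i: "i < n"
  show "continuous_on {0..1} (\<lambda>r. cmap (blend k l r) n s i)" using i by (simp add: blend_def continuous_intros)
  have "0 \<le> l (s i) - k (s i)" using kl cube_nth[OF s i] by simp
  then have "a * (l (s i) - k (s i)) \<le> b * (l (s i) - k (s i))" if "a \<le> b" for a b
    using that by (intro mult_right_mono)
  then show "mono_on {0..1} (\<lambda>r. cmap (blend k l r) n s i)"
    using i by (intro mono_onI) (simp add: blend_def algebra_simps)
qed

text \<open>Obtained from the universal property of the realization, applied to the structure maps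
  precomposed with \<open>cmap k\<close>.\<close>

lemma self_map_stream_map:
  assumes k: "reparam k"
  shows "self_map C k \<in> stream_maps (realization C) (realization C)"
proof -
  note k' = reparamD[OF k]
  define f where "f n = restrict (cmap k n) (cube n)" for n
  have f: "f n \<in> stream_maps (directed_cube n) (directed_cube n)" for n
  proof (rule monotone_stream_map)
    show "f n \<in> cube n \<rightarrow>\<^sub>E cube n" using cmap_mem[OF k'(2)] by (simp add: f_def)
    show "continuous_map (cube_topology n) (cube_topology n) (f n)"
    proof (rule continuous_map_into_cube)
      fix i assume i: "i < n"
      have "continuous_map (top_of_set {0..1}) (top_of_set {0..1}) k"
        using k'(2,3) by (auto simp: continuous_map_in_subtopology continuous_map_iff_continuous)
      from continuous_map_compose[OF continuous_map_cube_coord[OF i] this]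
      show "continuous_map (cube_topology n) (top_of_set {0..1}) (\<lambda>x. f n x i)"
        by (rule continuous_map_eq) (use i in \<open>simp add: f_def\<close>)
    qed (use cmap_mem[OF k'(2)] in \<open>simp add: f_def\<close>)
    fix s t assume st: "(s, t) \<in> cube_le n"
    then have "s \<in> cube n" "t \<in> cube n" by (auto simp: cube_le_def)
    moreover from this have "k (s i) \<le> k (t i)" if "i < n" for i
      using mono_onD[OF k'(4) cube_nth cube_nth] that st by (auto simp: cube_le_def)
    ultimately show "(f n s, f n t) \<in> cube_le n" using cmap_mem[OF k'(2)] by (simp add: cube_le_def f_def)
  qed
  define G where "G n d = compose (cube n) (realization_unit C n d) (f n)" for n d
  have Gv: "G n d = (\<lambda>t\<in>cube n. point C n d (cmap k n t))" if "d \<in> cells C n" for n d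
    unfolding G_def compose_def realization_unit_point[OF C that]
    by (intro restrict_ext) (simp add: f_def cmap_mem[OF k'(2)])
  have "\<exists>!h. h \<in> stream_maps (realization C) (realization C) \<and>
      (\<forall>n. \<forall>c\<in>cells C n. compose (cube n) h (realization_unit C n c) = G n c)"
  proof (rule realization_universal[OF C is_stream_realization[OF C] weak_Hausdorff_realization[OF C]])
    show "G n c \<in> stream_maps (directed_cube n) (realization C)" if "c \<in> cells C n" for n c
      using stream_maps_compose[OF is_stream_directed_cube f realization_unit_stream_map[OF C that]] by (simp add: G_def)
    fix m n \<phi> c assume *: "box_mor m n \<phi>" "c \<in> cells C n"
    show "G m (act C m n \<phi> c) = compose (cube m) (G n c) (cube_map m n \<phi>)"
      unfolding Gv[OF *(2)] Gv[OF cubical_setD(1)[OF C *]] compose_def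
      using point_act[OF C *] cube_map_cmap[OF *(1) k'(1)] cmap_mem[OF k'(2)] cube_map_mem[OF *(1)]
      by (intro restrict_ext) simp
  qed
  then obtain h where h: "h \<in> stream_maps (realization C) (realization C)"
    "\<And>n c. c \<in> cells C n \<Longrightarrow> compose (cube n) h (realization_unit C n c) = G n c" by blast
  have "self_map C k = h"
  proof (rule extensionalityI[where A = "points C"])
    show "self_map C k \<in> extensional (points C)" by (simp add: self_map_def)
    show "h \<in> extensional (points C)" using stream_mapsD(1)[OF h(1)] by (simp add: PiE_iff)
    fix P assume "P \<in> points C"
    then obtain n d s where d: "d \<in> cells C n" "s \<in> cube n" "P = point C n d s" using pointE[OF C] by blast
    have "compose (cube n) h (realization_unit C n d) s = G n d s" using h(2)[OF d(1)] by simp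
    then show "self_map C k P = h P"
      using d by (simp add: compose_eq realization_unit_point[OF C d(1)] Gv[OF d(1)] self_map_point[OF k'(1)])
  qed
  then show ?thesis using h(1) by simp
qed

lemma dipath_self_map:
  assumes k: "reparam k" and g: "dipath (realization C) g"
  shows "dipath (realization C) (\<lambda>t. self_map C k (g t))"
proof (rule dipath_cong)
  note X = is_stream_realization[OF C]
  show "dipath (realization C) (\<lambda>t. compose (cube 1) (self_map C k) (path_cell g) (pt1 t))"
    using dipath_stream_map1[OF X stream_maps_compose[OF is_stream_directed_cube path_cell_mem[OF X g] self_map_stream_map[OF k]]]
    by simp
  show "self_map C k (g t) = compose (cube 1) (self_map C k) (path_cell g) (pt1 t)" if "t \<in> {0..1}" for t
    using that pt1_mem[OF that] by (simp add: compose_eq del: One_nat_def)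
qed

lemma dipath_blend:
  assumes k: "reparam k" and l: "reparam l" and kl: "\<And>t. t \<in> {0..1} \<Longrightarrow> k t \<le> l t" and P: "P \<in> points C"
  shows "dipath (realization C) (\<lambda>r. self_map C (blend k l r) P)"
proof -
  obtain n d s where d: "d \<in> cells C n" "s \<in> cube n" "P = point C n d s" using pointE[OF C P] by blast
  note c = curve_cmap_blend[OF k l kl d(2)]
  show ?thesis
  proof (rule dipath_cong)
    show "dipath (realization C) (\<lambda>r. realization_unit C n d (cmap (blend k l r) n s))"
      by (rule dipath_curve[OF is_stream_realization[OF C] realization_unit_stream_map[OF C d(1)] c])
    show "self_map C (blend k l r) P = realization_unit C n d (cmap (blend k l r) n s)" if "r \<in> {0..1}" for r
      using d that self_map_point[OF reparamD(1)[OF reparam_blend[OF k l that]] d(1,2)] c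
      by (simp add: realization_unit_point[OF C d(1)] curve_def)
  qed
qed

text \<open>Joint continuity is the delicate point, as the realization is a quotient. The variables
  are separated: for a compact interval \<open>J\<close> of parameters, the set \<open>V\<close> of
  points that all of \<open>J\<close> sends into \<open>W\<close> is shown to be open cell by
  cell.\<close>

lemma disquare_blend:
  assumes k: "reparam k" and l: "reparam l" and kl: "\<And>t. t \<in> {0..1} \<Longrightarrow> k t \<le> l t" and g: "dipath (realization C) g"
  shows "disquare (realization C) (\<lambda>r t. self_map C (blend k l r) (g t))"
  unfolding disquare_def
proof (intro conjI ballI allI impI)
  note X = is_stream_realization[OF C]
  show "dipath (realization C) (\<lambda>r. self_map C (blend k l r) (g t))" if "t \<in> {0..1}" for t
    by (rule dipath_blend[OF k l kl dipathD(1)[OF g that]])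
  show "dipath (realization C) (\<lambda>t. self_map C (blend k l r) (g t))" if "r \<in> {0..1}" for r
    by (rule dipath_self_map[OF reparam_blend[OF k l that] g])
  fix W a b assume W: "openin (stop (realization C)) W" and a: "a \<in> {0..1}" and b: "b \<in> {0..1::real}"
    and ab: "self_map C (blend k l a) (g b) \<in> W"
  have Pb: "g b \<in> points C" using dipathD(1)[OF g b] .
  obtain e where e: "e > 0" "\<forall>r\<in>{0..1}. \<bar>r - a\<bar> < e \<longrightarrow> self_map C (blend k l r) (g b) \<in> W"
    using dipathD(2)[OF dipath_blend[OF k l kl Pb] W a ab] by blast
  \<comment> \<open>A closed neighbourhood of \<open>a\<close> on which the path through
    \<open>g b\<close> stays in \<open>W\<close>. The radius is halved so that the closed interval
    remains inside the open one.\<close>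
  define J where "J = {0..1} \<inter> {a - e / 2..a + e / 2}"
  have J: "J \<subseteq> {0..1}" "compact J" unfolding J_def by auto
  define V where "V = {Q \<in> points C. \<forall>r\<in>J. self_map C (blend k l r) Q \<in> W}"
  have "openin (stop (realization C)) V"
    unfolding openin_realization[OF C]
  proof (intro conjI allI ballI)
    show "V \<subseteq> points C" by (auto simp: V_def)
    fix n d assume d: "d \<in> cells C n"
    define S where "S = {t \<in> cube n. point C n d t \<in> W}"
    have S: "openin (cube_topology n) S" using W d unfolding openin_realization[OF C] S_def by blast
    let ?T = "prod_topology (top_of_set J) (cube_topology n)"
    define f where "f = (\<lambda>(r, s). cmap (blend k l r) n s)"
    have bl: "blend k l r \<in> {0..1} \<rightarrow> {0..1}" if "r \<in> J" for r
      using reparamD(2)[OF reparam_blend[OF k l]] J that by blast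
    have fm: "f z \<in> cube n" if "z \<in> topspace ?T" for z
      using that cmap_mem[OF bl] by (auto simp: f_def)
    have "continuous_map ?T (cube_topology n) f"
    proof (rule continuous_map_into_cube[OF fm])
      fix i assume i: "i < n"
      have c: "continuous_map ?T euclideanreal (\<lambda>z. h (snd z i))" if "reparam h" for h
      proof -
        have "continuous_map (top_of_set {0..1}) euclideanreal h"
          using reparamD(3)[OF that] by (simp add: continuous_map_iff_continuous)
        from continuous_map_compose[OF continuous_map_compose[OF continuous_map_snd continuous_map_cube_coord[OF i]] this]
        show ?thesis by (simp add: o_def)
      qed
      have c': "continuous_map ?T euclideanreal fst"
        using continuous_map_compose[OF continuous_map_fst, of "top_of_set J" euclideanreal "\<lambda>x. x"]
        by (simp add: o_def continuous_map_iff_continuous)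
      have "continuous_map ?T euclideanreal (\<lambda>z. (1 - fst z) * k (snd z i) + fst z * l (snd z i))"
        by (intro continuous_map_add continuous_map_real_mult continuous_map_diff c[OF k] c[OF l] c') simp
      then have "continuous_map ?T euclideanreal (\<lambda>z. f z i)"
        by (rule continuous_map_eq) (use i in \<open>auto simp: f_def blend_def\<close>)
      then show "continuous_map ?T (top_of_set {0..1}) (\<lambda>z. f z i)"
        using cube_nth[OF fm i] by (auto simp: continuous_map_in_subtopology)
    qed simp
    \<comment> \<open>The complement of \<open>V\<close> in a cell is the projection of this closed
      set along the compact factor \<open>J\<close>, and such a projection is a closed map.\<close>
    then have cl: "closedin ?T {z \<in> topspace ?T. f z \<in> cube n - S}"
      by (rule closedin_continuous_map_preimage) (use S in \<open>simp add: closedin_def Diff_Diff_Int Int_absorb1 openin_subset[THEN order_trans] double_diff\<close>)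
    have "compact_space (top_of_set J)" by (intro compact_space_subtopology) (simp add: J(2))
    then have "closed_map ?T (cube_topology n) snd" by (rule closed_map_snd)
    then have "closedin (cube_topology n) (snd ` {z \<in> topspace ?T. f z \<in> cube n - S})"
      by (rule closed_map_def[THEN meta_eq_to_obj_eq, THEN iffD1, rule_format, OF _ cl])
    then have "openin (cube_topology n) (cube n - snd ` {z \<in> topspace ?T. f z \<in> cube n - S})"
      by (rule openin_diff[OF openin_cube])
    moreover have "cube n - snd ` {z \<in> topspace ?T. f z \<in> cube n - S} = {t \<in> cube n. point C n d t \<in> V}"
    proof (rule Set.set_eqI)
      fix t
      show "t \<in> cube n - snd ` {z \<in> topspace ?T. f z \<in> cube n - S} \<longleftrightarrow> t \<in> {t \<in> cube n. point C n d t \<in> V}"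
      proof (cases "t \<in> cube n")
        case True
        have "t \<in> snd ` {z \<in> topspace ?T. f z \<in> cube n - S} \<longleftrightarrow> (\<exists>r\<in>J. cmap (blend k l r) n t \<notin> S)"
        proof
          assume "t \<in> snd ` {z \<in> topspace ?T. f z \<in> cube n - S}"
          then obtain r where "(r, t) \<in> topspace ?T" "f (r, t) \<in> cube n - S" by (metis (no_types, lifting) imageE mem_Collect_eq prod.collapse)
          then show "\<exists>r\<in>J. cmap (blend k l r) n t \<notin> S" by (intro bexI[of _ r]) (simp_all add: f_def)
        next
          assume "\<exists>r\<in>J. cmap (blend k l r) n t \<notin> S"
          then obtain r where r: "r \<in> J" "cmap (blend k l r) n t \<notin> S" ..
          show "t \<in> snd ` {z \<in> topspace ?T. f z \<in> cube n - S}"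
          proof (rule image_eqI[of _ _ "(r, t)"])
            show "(r, t) \<in> {z \<in> topspace ?T. f z \<in> cube n - S}"
              using r True cmap_mem[OF bl[OF r(1)] True] by (simp add: f_def)
          qed simp
        qed
        also have "\<dots> \<longleftrightarrow> (\<exists>r\<in>J. self_map C (blend k l r) (point C n d t) \<notin> W)"
        proof (rule bex_cong[OF refl])
          fix r assume r: "r \<in> J"
          then have "endpoint_fixing (blend k l r)" using reparamD(1)[OF reparam_blend[OF k l]] J(1) by blast
          from self_map_point[OF this d True]
          show "cmap (blend k l r) n t \<notin> S \<longleftrightarrow> self_map C (blend k l r) (point C n d t) \<notin> W"
            using cmap_mem[OF bl[OF r] True] by (simp only: S_def mem_Collect_eq simp_thms)
        qed
        finally have "t \<notin> snd ` {z \<in> topspace ?T. f z \<in> cube n - S}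
            \<longleftrightarrow> (\<forall>r\<in>J. self_map C (blend k l r) (point C n d t) \<in> W)" by (simp only: bex_simps(8) ball_simps not_not)
        then show ?thesis using True point_mem[OF C d True] by (simp only: V_def mem_Collect_eq Diff_iff simp_thms)
      qed (simp only: mem_Collect_eq Diff_iff simp_thms)
    qed
    ultimately show "openin (cube_topology n) {t \<in> cube n. point C n d t \<in> V}" by simp
  qed
  moreover have "g b \<in> V"
  proof -
    have "self_map C (blend k l r) (g b) \<in> W" if "r \<in> J" for r
    proof -
      have "r \<in> {0..1}" "\<bar>r - a\<bar> < e" using that e(1) by (auto simp: J_def abs_less_iff)
      then show ?thesis using e(2) by blast
    qed
    then show ?thesis using Pb by (simp add: V_def)
  qed
  ultimately obtain \<delta> where \<delta>: "\<delta> > 0" "\<forall>s\<in>{0..1}. \<bar>s - b\<bar> < \<delta> \<longrightarrow> g s \<in> V"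
    using dipathD(2)[OF g _ b] by blast
  show "\<exists>d>0. \<forall>s\<in>{0..1}. \<forall>t\<in>{0..1}. \<bar>s - a\<bar> < d \<and> \<bar>t - b\<bar> < d \<longrightarrow> self_map C (blend k l s) (g t) \<in> W"
  proof (intro exI[of _ "min \<delta> (e / 2)"] conjI ballI impI)
    show "0 < min \<delta> (e / 2)" using \<delta> e by simp
    fix s t :: real assume st: "s \<in> {0..1}" "t \<in> {0..1}" "\<bar>s - a\<bar> < min \<delta> (e / 2) \<and> \<bar>t - b\<bar> < min \<delta> (e / 2)"
    then have "g t \<in> V" using \<delta>(2) by simp
    moreover have "s \<in> J"
    proof -
      have "\<bar>s - a\<bar> < e / 2" using st(3) by simp
      then have "a - e / 2 \<le> s" "s \<le> a + e / 2" unfolding abs_less_iff by linarith+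
      then show ?thesis using st(1) unfolding J_def by simp
    qed
    ultimately show "self_map C (blend k l s) (g t) \<in> W" by (simp add: V_def)
  qed
qed

end

subsection \<open>Cochains on the realization are determined by their restriction\<close>

context
  fixes C :: "'c cubical" and \<tau> :: "('t, 'm) monoid_scheme"
    and \<beta> :: "((nat \<Rightarrow> real) \<Rightarrow> ((nat \<times> 'c) \<times> (nat \<Rightarrow> real)) set, 't) cochain"
  assumes C: "cubical_set C" and \<tau>: "comm_monoid \<tau>" and \<beta>: "\<beta> \<in> cochains (sing (realization C)) \<tau>"
begin

interpretation comm_monoid \<tau> by (rule \<tau>)

lemmas RX = is_stream_realization[OF C]

definition trace :: "(real \<Rightarrow> real) \<Rightarrow> (real \<Rightarrow> real) \<Rightarrow> ((nat \<times> 'c) \<times> (nat \<Rightarrow> real)) set \<Rightarrow> 't" where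
  "trace k l P = path_value \<beta> (\<lambda>r. self_map C (blend k l r) P)"

lemma trace_closed:
  assumes "reparam k" "reparam l" "\<And>t. t \<in> {0..1} \<Longrightarrow> k t \<le> l t" "P \<in> points C"
  shows "trace k l P \<in> carrier \<tau>"
  unfolding trace_def by (rule path_value_closed[OF RX \<tau> \<beta> dipath_blend[OF C assms]])

lemma trace_natural:
  assumes k: "reparam k" and l: "reparam l" and kl: "\<And>t. t \<in> {0..1} \<Longrightarrow> k t \<le> l t" and g: "dipath (realization C) g"
  shows "trace k l (g 0) \<otimes>\<^bsub>\<tau>\<^esub> path_value \<beta> (\<lambda>t. self_map C l (g t)) =
    path_value \<beta> (\<lambda>t. self_map C k (g t)) \<otimes>\<^bsub>\<tau>\<^esub> trace k l (g 1)"
  using path_value_square[OF RX \<tau> \<beta> disquare_blend[OF C k l kl g]] by (simp add: trace_def blend_ends)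

lemma self_map_id: "P \<in> points C \<Longrightarrow> self_map C (\<lambda>t. t) P = P"
proof -
  assume "P \<in> points C"
  then obtain n d s where d: "d \<in> cells C n" "s \<in> cube n" "P = point C n d s" using pointE[OF C] by blast
  have "cmap (\<lambda>t. t) n s = s" by (rule tuples_eqI[OF _ d(2), of _ "{0..1}"]) (use d(2) in \<open>auto intro!: cmap_mem\<close>)
  then show ?thesis using d by (simp add: self_map_point[OF C reparamD(1)[OF reparam_id]])
qed

abbreviation "restricted \<equiv> cubical_comp C \<beta> (realization_unit C)"

lemma restricted_mem: "restricted \<in> cochains C \<tau>"
  by (rule cubical_comp_mem[OF C realization_unit_hom[OF C] \<beta>])

lemma path_value_cell_line:
  assumes d: "d \<in> cells C n" and vw: "(v, w) \<in> verts_le n"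
  shows "path_value \<beta> (\<lambda>r. point C n d (line n v w r)) = restricted n d (v, w)"
proof -
  have "path_value \<beta> (\<lambda>r. point C n d (line n v w r)) = path_value \<beta> (\<lambda>r. realization_unit C n d (line n v w r))"
    by (rule path_value_cong) (simp add: realization_unit_point[OF C d] line_mem)
  also have "\<dots> = restricted n d (v, w)"
    using path_value_line[OF RX \<tau> \<beta> cubical_homD(1)[OF realization_unit_hom[OF C] d] vw]
    by (simp add: cubical_comp_val[OF d])
  finally show ?thesis .
qed

text \<open>A point has finitely many coordinates in its representative, so for large
  \<open>k\<close> both thresholds act on it as step functions. The trace is then a straight line
  between two vertices of the cell, and its value is the mass.\<close>

lemma trace_threshold_eventually:
  assumes P: "P \<in> points C" and r: "1 / 2 \<le> r" "r < 1"
  shows "\<forall>\<^sub>F k in at_top. trace (threshold r k) (threshold (1 / 2) k) P = mass restricted r P"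
proof -
  obtain n d s where d: "d \<in> cells C n" "s \<in> cube n" "P = point C n d s" using pointE[OF C P] by blast
  have "\<forall>\<^sub>F k in at_top. (0::real) \<le> k" "\<forall>\<^sub>F k in at_top. 1 / (1 - r) \<le> k" "\<forall>\<^sub>F k in at_top. (2::real) \<le> k"
    by (rule eventually_ge_at_top)+
  with threshold_cmap_eventually[of n r s] threshold_cmap_eventually[of n "1 / 2" s] show ?thesis
  proof eventually_elim
    case (elim k)
    have "1 \<le> k * (1 - r)" using elim(4) r by (simp add: field_simps)
    then have rk: "reparam (threshold r k)" "reparam (threshold (1 / 2) k)"
      using elim(3,5) r by (auto intro!: reparam_threshold)
    have "path_value \<beta> (\<lambda>t. self_map C (blend (threshold r k) (threshold (1 / 2) k) t) P) =
        path_value \<beta> (\<lambda>t. point C n d (line n (above r n s) (above (1 / 2) n s) t))"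
    proof (rule path_value_cong)
      fix t :: real assume t: "t \<in> {0..1}"
      have "cmap (blend (threshold r k) (threshold (1 / 2) k) t) n s = line n (above r n s) (above (1 / 2) n s) t"
        using elim(1,2) by (auto simp: cmap_def line_def fun_eq_iff blend_def above_def)
      then show "self_map C (blend (threshold r k) (threshold (1 / 2) k) t) P = point C n d (line n (above r n s) (above (1 / 2) n s) t)"
        using d self_map_point[OF C reparamD(1)[OF reparam_blend[OF rk t]] d(1,2)] by simp
    qed
    then show ?case
      using path_value_cell_line[OF d(1) above_le[OF r(1)]] d(3)
      by (simp add: trace_def mass_point[OF C \<tau> restricted_mem r d(1,2)])
  qed
qed

text \<open>If the slope \<open>k\<close> is at least \<open>1 / radius P\<close>, the ramp lies
  inside the gap of the grid. Rounding is then invisible to the map, and a point of the star rounds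
  to a representative of \<open>P\<close>.\<close>

lemma threshold_star_constant:
  assumes P: "P \<in> points C" and k: "1 / radius P \<le> k" and Q: "Q \<in> star C P"
  shows "self_map C (threshold (cut P) k) Q = self_map C (threshold (cut P) k) P"
proof -
  note cut = cut_props[OF C P]
  have k0: "0 \<le> k" using k cut(1) by (meson order_trans zero_le_divide_1_iff less_imp_le)
  have kr: "1 \<le> k * radius P" using k cut(1) by (simp add: field_simps)
  have "k * radius P \<le> k * (1 - cut P)" using k0 cut by (intro mult_left_mono) auto
  then have rk: "endpoint_fixing (threshold (cut P) k)"
    using kr k0 cut by (intro reparamD(1) reparam_threshold) auto
  obtain m c t where r: "rep P = ((m, c), t)" "c \<in> cells C m" "t \<in> cube m" "P = point C m c t" "spaced (grid P) (radius P)"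
    by (rule rep_cases[OF C P]) (rule that; assumption)
  have "Q \<in> points C" using Q by (simp add: star_def)
  then obtain n d s where d: "d \<in> cells C n" "s \<in> cube n" "Q = point C n d s" using pointE[OF C] by blast
  let ?snap = "snap (grid P) (radius P)"
  have sn: "cmap ?snap n s \<in> cube n"
    using endpoint_fixing_snap[OF r(5)] d(2) by (intro cmap_mem) (simp_all add: endpoint_fixing_def)
  have "(((n, d), cmap ?snap n s), ((m, c), t)) \<in> glue_eq C"
    using Q d r(1) mem_star_iff[OF C P d(1,2)] by simp
  then have "point C n d (cmap ?snap n s) = P"
    using d r sn by (simp add: point_eq_iff[OF C])
  moreover have "cmap (threshold (cut P) k) n (cmap ?snap n s) = cmap (threshold (cut P) k) n s"
  proof -
    have "threshold (cut P) k (?snap x) = threshold (cut P) k x" for x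
      using r(5)
    proof (cases rule: snap_cases[of "grid P" "radius P" x])
      case (near a)
      show ?thesis
        using cut(4)[OF near(1)]
      proof
        assume "a \<le> 1 / 2"
        then have "a - cut P \<le> 0" "x - cut P \<le> 0" using near(2) cut(1,2) by (auto simp: cut_def abs_less_iff)
        then have "k * (a - cut P) \<le> 0" "k * (x - cut P) \<le> 0" using k0 by (simp_all add: mult_nonneg_nonpos)
        then show ?thesis by (simp add: near(3) threshold_def)
      next
        assume "cut P + 2 * radius P \<le> a"
        then have "radius P \<le> a - cut P" "radius P \<le> x - cut P" using near(2) cut(1) by (auto simp: abs_less_iff)
        then have "k * radius P \<le> k * (a - cut P)" "k * radius P \<le> k * (x - cut P)" using k0 by (simp_all add: mult_left_mono)
        then show ?thesis using kr by (simp add: near(3) threshold_def)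
      qed
    qed simp
    then show ?thesis by (simp add: cmap_def fun_eq_iff)
  qed
  ultimately show ?thesis
    using self_map_point[OF C rk d(1,2)] self_map_point[OF C rk d(1) sn] d(3) by metis
qed

text \<open>On a piece of the path within a star, the threshold at the cut is compared with the
  threshold at 1/2. The first collapses the piece, and the traces at its ends are masses; naturality
  becomes the equation that characterizes \<open>val\<close>.\<close>

lemma path_value_threshold_eventually:
  assumes g: "dipath (realization C) g"
  shows "\<forall>\<^sub>F k in at_top. path_value \<beta> (\<lambda>t. self_map C (threshold (1 / 2) k) (g t)) =
    tval C \<tau> restricted g 0 1"
proof -
  interpret local_potential \<tau> "realization C" "star C" "\<lambda>P. mass restricted (cut P)"
    by (rule local_potential_mass[OF C \<tau> restricted_mem])
  \<comment> \<open>The value on the part of the pushed path over \<open>{a..b}\<close>, rescaled to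
    the unit interval. How large \<open>k\<close> must be depends on the part; joining two parts
    joins the two conditions.\<close>
  define F where "F k a b = path_value \<beta> (\<lambda>t. self_map C (threshold (1 / 2) k) (g (a + t * (b - a))))" for k a b
  have reparam: "reparam (threshold (1 / 2) k)" if "2 \<le> k" for k using that by (intro reparam_threshold) auto
  have F: "F k a b \<in> carrier \<tau>" if "2 \<le> k" "0 \<le> a" "a \<le> b" "b \<le> 1" for k a b
    unfolding F_def
    by (rule path_value_closed[OF RX \<tau> \<beta> dipath_self_map[OF C reparam[OF that(1)] dipath_subinterval[OF RX g that(2-4)]]])
  have "\<forall>\<^sub>F k in at_top. F k 0 1 = val g 0 1"
    using zero_le_one
  proof (rule Bolzano_interval[where P = "\<lambda>a b. \<forall>\<^sub>F k in at_top. F k a b = val g a b"])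
    fix x y z :: real
    assume 1: "\<forall>\<^sub>F k in at_top. F k x y = val g x y" and 2: "\<forall>\<^sub>F k in at_top. F k y z = val g y z"
      and xyz: "0 \<le> x" "x \<le> y" "y \<le> z" "z \<le> 1"
    have 3: "\<forall>\<^sub>F k in at_top. (2::real) \<le> k" by (rule eventually_ge_at_top)
    show "\<forall>\<^sub>F k in at_top. F k x z = val g x z"
      using 1 2 3
    proof eventually_elim
      case (elim k)
      then show ?case
        using path_value_concat[OF RX \<tau> \<beta> dipath_self_map[OF C reparam[OF elim(3)] g] xyz] val_concat[OF g xyz]
        by (simp add: F_def)
    qed
  next
    fix t :: real assume t: "t \<in> {0..1}"
    define P where "P = g t"
    have P: "P \<in> points C" unfolding P_def using dipathD(1)[OF g t] .
    note cut = cut_props[OF C P]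
    obtain \<delta> where \<delta>: "\<delta> > 0"
      "\<And>x y. 0 \<le> x \<Longrightarrow> x \<le> t \<Longrightarrow> t \<le> y \<Longrightarrow> y \<le> 1 \<Longrightarrow> y - x < \<delta> \<Longrightarrow> g ` {x..y} \<subseteq> star C P"
      using path_near[OF g t] unfolding P_def by blast
    have "\<forall>\<^sub>F k in at_top. F k x y = val g x y" if xy: "0 \<le> x" "x \<le> t" "t \<le> y" "y \<le> 1" "y - x < \<delta>" for x y
    proof -
      have sub: "g ` {x..y} \<subseteq> star C P" by (rule \<delta>(2)[OF xy])
      have gx: "g x \<in> points C" "g y \<in> points C" using dipathD(1)[OF g] xy by auto
      have c: "1 / 2 \<le> cut P" "cut P < 1" using cut by auto
      have ev: "\<forall>\<^sub>F k in at_top. (2::real) \<le> k" "\<forall>\<^sub>F k in at_top. 1 / radius P \<le> k" "\<forall>\<^sub>F k in at_top. 1 / (1 - cut P) \<le> k"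
        by (rule eventually_ge_at_top)+
      from ev trace_threshold_eventually[OF gx(1) c] trace_threshold_eventually[OF gx(2) c] show ?thesis
      proof eventually_elim
        case (elim k)
        have "1 \<le> k * (1 - cut P)" using elim(3) c by (simp add: field_simps)
        then have rk: "reparam (threshold (cut P) k)" using elim(1) c by (intro reparam_threshold) auto
        have mono: "threshold (cut P) k s \<le> threshold (1 / 2) k s" for s
          using elim(1) c by (intro threshold_antimono) auto
        define h where "h r = g (x + r * (y - x))" for r
        have h: "dipath (realization C) h"
          unfolding h_def using dipath_subinterval[OF RX g] xy by simp
        have h_end: "h 0 = g x" "h 1 = g y" by (simp_all add: h_def)
        \<comment> \<open>The collapsed piece contributes \<open>\<one>\<close> to
          \<open>trace_natural\<close>, which leaves the two traces and
          \<open>F k x y\<close>.\<close>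
        have const: "path_value \<beta> (\<lambda>r. self_map C (threshold (cut P) k) (h r)) = \<one>\<^bsub>\<tau>\<^esub>"
        proof (rule path_value_const[OF RX \<tau> \<beta>])
          show "self_map C (threshold (cut P) k) P \<in> topspace (stop (realization C))"
            using PiE_mem[OF stream_mapsD(1)[OF self_map_stream_map[OF C rk]] P] .
          fix r :: real assume "r \<in> {0..1}"
          then have "x + r * (y - x) \<in> {x..y}" using mult_left_le_one_le[of "y - x" r] xy by auto
          then have "h r \<in> star C P" using sub unfolding h_def by blast
          then show "self_map C (threshold (cut P) k) (h r) = self_map C (threshold (cut P) k) P"
            by (rule threshold_star_constant[OF P elim(2)])
        qed
        have "mass restricted (cut P) (g x) \<otimes>\<^bsub>\<tau>\<^esub> F k x y = mass restricted (cut P) (g y)"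
          using trace_natural[OF rk reparam[OF elim(1)] mono h] mass_closed[OF C \<tau> restricted_mem c gx(2)]
          by (simp add: const elim(4,5) h_end F_def h_def[symmetric])
        then show "F k x y = val g x y"
          using F[OF elim(1)] xy sub by (intro val_eq_local[OF g, of x t y, symmetric]) (auto simp: P_def)
      qed
    qed
    then show "\<exists>d>0. \<forall>x y. 0 \<le> x \<and> x \<le> t \<and> t \<le> y \<and> y \<le> 1 \<and> y - x < d \<longrightarrow> (\<forall>\<^sub>F k in at_top. F k x y = val g x y)"
      using \<delta>(1) by blast
  qed
  then show ?thesis by (simp add: F_def)
qed

text \<open>For large \<open>k\<close> the upper threshold acts on the coordinates of
  \<open>P\<close> as a step function, and from then on the trace no longer changes.\<close>

lemma trace_limit:
  assumes P: "P \<in> points C"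
  obtains v where "v \<in> carrier \<tau>" "\<forall>\<^sub>F k in at_top. trace (threshold (1 / 2) 2) (threshold (1 / 2) k) P = v"
proof -
  obtain n d s where d: "d \<in> cells C n" "s \<in> cube n" "P = point C n d s" using pointE[OF C P] by blast
  define v where "v = path_value \<beta> (\<lambda>r. point C n d (\<lambda>i\<in>{..<n}. (1 - r) * threshold (1 / 2) 2 (s i) + r * of_bool (1 / 2 < s i)))"
  have r2: "reparam (threshold (1 / 2) 2)" by (intro reparam_threshold) auto
  have "\<forall>\<^sub>F k in at_top. (2::real) \<le> k" by (rule eventually_ge_at_top)
  with threshold_cmap_eventually[of n "1 / 2" s]
  have ev: "\<forall>\<^sub>F k in at_top. trace (threshold (1 / 2) 2) (threshold (1 / 2) k) P = v \<and>
      trace (threshold (1 / 2) 2) (threshold (1 / 2) k) P \<in> carrier \<tau>"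
  proof eventually_elim
    case (elim k)
    have rk: "reparam (threshold (1 / 2) k)" using elim(2) by (intro reparam_threshold) auto
    have "path_value \<beta> (\<lambda>r. self_map C (blend (threshold (1 / 2) 2) (threshold (1 / 2) k) r) P) = v"
      unfolding v_def
    proof (rule path_value_cong)
      fix t :: real assume t: "t \<in> {0..1}"
      have "cmap (blend (threshold (1 / 2) 2) (threshold (1 / 2) k) t) n s =
          (\<lambda>i\<in>{..<n}. (1 - t) * threshold (1 / 2) 2 (s i) + t * of_bool (1 / 2 < s i))"
        using elim(1) by (auto simp: cmap_def fun_eq_iff blend_def)
      then show "self_map C (blend (threshold (1 / 2) 2) (threshold (1 / 2) k) t) P =
          point C n d (\<lambda>i\<in>{..<n}. (1 - t) * threshold (1 / 2) 2 (s i) + t * of_bool (1 / 2 < s i))"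
        using d self_map_point[OF C reparamD(1)[OF reparam_blend[OF r2 rk t]] d(1,2)] by simp
    qed
    then show ?case
      using trace_closed[OF r2 rk threshold_le[OF elim(2)] P] by (simp add: trace_def)
  qed
  \<comment> \<open>\<open>v\<close> is defined by a path not yet known to be directed, but it
    coincides with a trace for some \<open>k\<close>.\<close>
  then have "v \<in> carrier \<tau>" using eventually_happens[OF ev] by auto
  moreover have "\<forall>\<^sub>F k in at_top. trace (threshold (1 / 2) 2) (threshold (1 / 2) k) P = v"
    using ev by (rule eventually_mono) simp
  ultimately show thesis by (rule that)
qed

text \<open>For \<open>k > 2\<close> the threshold at 1/2 lies neither above nor below the identity,
  so no single directed interpolation joins them. \<open>threshold (1 / 2) 2\<close> lies below
  both, and its pullback \<open>\<beta>'\<close> is the middle of a zigzag of two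
  homotopies.\<close>

lemma extend_restricted: "(\<beta>, extend_cochain C \<tau> restricted) \<in> cohomologous (sing (realization C)) \<tau>"
proof -
  define M where "M = self_map C (threshold (1 / 2) 2)"
  define \<beta>' where "\<beta>' = cubical_comp (sing (realization C)) \<beta> (sing_map (realization C) M)"
  have r2: "reparam (threshold (1 / 2) 2)" by (intro reparam_threshold) auto
  have M: "M \<in> stream_maps (realization C) (realization C)" unfolding M_def by (rule self_map_stream_map[OF C r2])
  have \<beta>': "\<beta>' \<in> cochains (sing (realization C)) \<tau>"
    unfolding \<beta>'_def by (rule cubical_comp_mem[OF cubical_set_sing sing_map_hom[OF RX M] \<beta>])
  have ext: "extend_cochain C \<tau> restricted \<in> cochains (sing (realization C)) \<tau>"
    by (rule extend_cochain_mem[OF C \<tau> restricted_mem])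
  have le_id: "threshold (1 / 2) 2 t \<le> t" if "t \<in> {0..1}" for t using that by (auto simp: threshold_def)
  have "natural_homotopy (sing (realization C)) \<tau> \<beta>' \<beta> (\<lambda>x. trace (threshold (1 / 2) 2) (\<lambda>t. t) (eval0 x))"
  proof (rule natural_homotopy_singI[OF RX])
    show "trace (threshold (1 / 2) 2) (\<lambda>t. t) x \<in> carrier \<tau>" if "x \<in> points C" for x
      by (rule trace_closed[OF r2 reparam_id le_id that])
    fix g assume g: "dipath (realization C) g"
    have "path_value \<beta> (\<lambda>t. self_map C (\<lambda>t. t) (g t)) = path_value \<beta> g"
      by (rule path_value_cong) (simp add: self_map_id dipathD(1)[OF g])
    moreover have "path_value \<beta>' g = path_value \<beta> (\<lambda>t. M (g t))"
      unfolding \<beta>'_def by (rule path_value_sing_map[OF RX g])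
    ultimately show "trace (threshold (1 / 2) 2) (\<lambda>t. t) (g 1) \<otimes>\<^bsub>\<tau>\<^esub> path_value \<beta>' g =
        path_value \<beta> g \<otimes>\<^bsub>\<tau>\<^esub> trace (threshold (1 / 2) 2) (\<lambda>t. t) (g 0)"
      using trace_natural[OF r2 reparam_id le_id g] path_value_closed[OF RX \<tau> \<beta> g]
        path_value_closed[OF RX \<tau> \<beta>' g] trace_closed[OF r2 reparam_id le_id dipathD(1)[OF g]]
      by (simp add: M_def m_comm)
  qed
  then have 1: "cochain_homotopic (sing (realization C)) \<tau> \<beta>' \<beta>"
    by (rule homotopic_if_natural[OF cubical_set_sing \<tau> \<beta>' \<beta>])
  have "\<forall>P. \<exists>v. P \<in> points C \<longrightarrow> v \<in> carrier \<tau> \<and>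
      (\<forall>\<^sub>F k in at_top. trace (threshold (1 / 2) 2) (threshold (1 / 2) k) P = v)"
    using trace_limit by metis
  then obtain \<Gamma> where \<Gamma>: "\<And>P. P \<in> points C \<Longrightarrow> \<Gamma> P \<in> carrier \<tau>"
    "\<And>P. P \<in> points C \<Longrightarrow> \<forall>\<^sub>F k in at_top. trace (threshold (1 / 2) 2) (threshold (1 / 2) k) P = \<Gamma> P"
    by metis
  have "natural_homotopy (sing (realization C)) \<tau> \<beta>' (extend_cochain C \<tau> restricted) (\<lambda>x. \<Gamma> (eval0 x))"
  proof (rule natural_homotopy_singI[OF RX \<Gamma>(1)])
    fix g assume g: "dipath (realization C) g"
    have p: "g 0 \<in> points C" "g 1 \<in> points C" using dipathD(1)[OF g] by auto
    have v: "path_value \<beta>' g = path_value \<beta> (\<lambda>t. M (g t))"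
      unfolding \<beta>'_def by (rule path_value_sing_map[OF RX g])
    have "\<forall>\<^sub>F k in at_top. (2::real) \<le> k" by (rule eventually_ge_at_top)
    with \<Gamma>(2)[OF p(1)] \<Gamma>(2)[OF p(2)] path_value_threshold_eventually[OF g]
    \<comment> \<open>For a given path, some \<open>k\<close> is large enough for both ends and for
      the path itself. The resulting equation no longer contains \<open>k\<close>.\<close>
    have "\<forall>\<^sub>F k in (at_top :: real filter). \<Gamma> (g 1) \<otimes>\<^bsub>\<tau>\<^esub> path_value \<beta>' g =
        path_value (extend_cochain C \<tau> restricted) g \<otimes>\<^bsub>\<tau>\<^esub> \<Gamma> (g 0)"
    proof eventually_elim
      case (elim k)
      have rk: "reparam (threshold (1 / 2) k)" using elim(4) by (intro reparam_threshold) auto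
      show ?case
        using trace_natural[OF r2 rk threshold_le[OF elim(4)] g] elim(1-3) \<Gamma>(1)[OF p(1)] \<Gamma>(1)[OF p(2)]
          path_value_closed[OF RX \<tau> \<beta>' g] path_value_closed[OF RX \<tau> ext g]
        by (simp add: path_value_extend[OF C \<tau> restricted_mem g] v M_def m_comm)
    qed
    then show "\<Gamma> (g 1) \<otimes>\<^bsub>\<tau>\<^esub> path_value \<beta>' g = path_value (extend_cochain C \<tau> restricted) g \<otimes>\<^bsub>\<tau>\<^esub> \<Gamma> (g 0)"
      by (auto dest: eventually_happens)
  qed
  then have 2: "cochain_homotopic (sing (realization C)) \<tau> \<beta>' (extend_cochain C \<tau> restricted)"
    by (rule homotopic_if_natural[OF cubical_set_sing \<tau> \<beta>' ext])
  show ?thesis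
    using cohomologous_if_homotopic[OF 1] cohomologous_if_homotopic[OF 2] cohomologous_sym cohomologous_trans by blast
qed

end

lemma H1_unit_iso:
  assumes C: "cubical_set C" and \<tau>: "comm_monoid \<tau>"
  shows "H1_pull C (sing (realization C)) \<tau> (realization_unit C) \<in> iso (H1_sing (realization C) \<tau>) (H1 C \<tau>)"
  unfolding H1_sing_def
proof (rule H1_pull_iso[OF C cubical_set_sing \<tau> realization_unit_hom[OF C], where Q = "extend_cochain C \<tau>"])
qed (simp_all add: extend_cochain_mem[OF C \<tau>] extend_unit[OF C \<tau>] extend_restricted[OF C \<tau>]
    cohomologous_if_homotopic[OF extend_homotopic[OF C \<tau>]])

text \<open>Both sides pull back along the same cubical function, by naturality of the unit
  (\<open>realization_map_props\<close>).\<close>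

lemma H1_unit_natural:
  assumes C: "cubical_set C" and D: "cubical_set D" and \<tau>: "comm_monoid \<tau>" and f: "f \<in> cubical_hom C D"
    and A: "A \<in> carrier (H1_sing (realization D) \<tau>)"
  shows "H1_pull C (sing (realization C)) \<tau> (realization_unit C)
      (H1_pull (sing (realization C)) (sing (realization D)) \<tau>
        (sing_map (realization C) (realization_map C D f)) A) =
    H1_pull C D \<tau> f (H1_pull D (sing (realization D)) \<tau> (realization_unit D) A)"
proof -
  note S = cubical_set_sing
  note map = realization_map_props[OF C D f]
  note sm = sing_map_hom[OF is_stream_realization[OF C] map(1)]
  note uC = realization_unit_hom[OF C] and uD = realization_unit_hom[OF D]
  obtain \<alpha> where \<alpha>: "\<alpha> \<in> cochains (sing (realization D)) \<tau>" "A = cohomology_class (sing (realization D)) \<tau> \<alpha>"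
    using A unfolding H1_sing_def by (elim carrier_H1E)
  note l1 = cubical_comp_mem[OF S sm \<alpha>(1)] and r1 = cubical_comp_mem[OF D uD \<alpha>(1)]
  have "cubical_comp C (cubical_comp (sing (realization C)) \<alpha> (sing_map (realization C) (realization_map C D f))) (realization_unit C) =
      cubical_comp C (cubical_comp D \<alpha> (realization_unit D)) f"
  proof (rule cochains_eqI[OF cubical_comp_mem[OF C uC l1] cubical_comp_mem[OF C f r1]])
    fix n c v w assume c: "c \<in> cells C n"
    note u = cubical_homD(1)[OF uC c]
    show "cubical_comp C (cubical_comp (sing (realization C)) \<alpha> (sing_map (realization C) (realization_map C D f))) (realization_unit C) n c (v, w) =
        cubical_comp C (cubical_comp D \<alpha> (realization_unit D)) f n c (v, w)"
      by (simp add: cubical_comp_val[OF c] cubical_comp_val[OF u] cubical_comp_val[OF cubical_homD(1)[OF f c]] sing_map_val[OF u] map(2)[OF c])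
  qed
  then show ?thesis
    by (simp add: \<alpha>(2) H1_pull_class[OF S S \<tau> sm \<alpha>(1)] H1_pull_class[OF C S \<tau> uC l1]
        H1_pull_class[OF D S \<tau> uD \<alpha>(1)] H1_pull_class[OF C D \<tau> f r1])
qed

text \<open>Precomposition with \<open>f\<close> and postcomposition with \<open>h\<close> commute
  already on cochains.\<close>

lemma H1_pull_push:
  assumes C: "cubical_set C" and D: "cubical_set D" and \<tau>: "comm_monoid \<tau>" and \<sigma>: "comm_monoid \<sigma>"
    and h: "h \<in> hom \<tau> \<sigma>" "h \<one>\<^bsub>\<tau>\<^esub> = \<one>\<^bsub>\<sigma>\<^esub>" and f: "f \<in> cubical_hom C D" and A: "A \<in> carrier (H1 D \<tau>)"
  shows "H1_pull C D \<sigma> f (H1_push D \<tau> \<sigma> h A) = H1_push C \<tau> \<sigma> h (H1_pull C D \<tau> f A)"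
proof -
  obtain \<alpha> where \<alpha>: "\<alpha> \<in> cochains D \<tau>" "A = cohomology_class D \<tau> \<alpha>" using A by (elim carrier_H1E)
  note l = cochain_push_mem[OF D h \<alpha>(1)] and r = cubical_comp_mem[OF C f \<alpha>(1)]
  have "cubical_comp C (cochain_push D h \<alpha>) f = cochain_push C h (cubical_comp C \<alpha> f)"
  proof (rule cochains_eqI[OF cubical_comp_mem[OF C f l] cochain_push_mem[OF C h r]])
    fix n c v w assume c: "c \<in> cells C n" and vw: "(v, w) \<in> verts_le n"
    show "cubical_comp C (cochain_push D h \<alpha>) f n c (v, w) = cochain_push C h (cubical_comp C \<alpha> f) n c (v, w)"
      by (simp add: cubical_comp_val[OF c] cochain_push_val[OF c vw] cochain_push_val[OF cubical_homD(1)[OF f c] vw])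
  qed
  then show ?thesis
    by (simp add: \<alpha>(2) H1_push_class[OF D \<tau> \<sigma> h \<alpha>(1)] H1_pull_class[OF C D \<sigma> f l]
        H1_pull_class[OF C D \<tau> f \<alpha>(1)] H1_push_class[OF C \<tau> \<sigma> h r])
qed

theorem proposition4p25:
  fixes C :: "'c cubical" and \<tau> :: "('t, 'm) monoid_scheme"
  assumes C: "cubical_set C" and \<tau>: "comm_monoid \<tau>"
  shows
    "comm_monoid (H1_sing (realization C) \<tau>) \<and> comm_monoid (H1 C \<tau>) \<and>
     H1_pull C (sing (realization C)) \<tau> (realization_unit C) \<in> iso (H1_sing (realization C) \<tau>) (H1 C \<tau>) \<and>
     (\<forall>(D :: 'd cubical) f. cubical_set D \<and> f \<in> cubical_hom C D \<longrightarrow>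
        (\<forall>A \<in> carrier (H1_sing (realization D) \<tau>).
           H1_pull C (sing (realization C)) \<tau> (realization_unit C)
             (H1_pull (sing (realization C)) (sing (realization D)) \<tau>
                (sing_map (realization C) (realization_map C D f)) A) =
           H1_pull C D \<tau> f (H1_pull D (sing (realization D)) \<tau> (realization_unit D) A))) \<and>
     (\<forall>(\<sigma> :: ('s, 'k) monoid_scheme) h. comm_monoid \<sigma> \<and> h \<in> hom \<tau> \<sigma> \<and> h \<one>\<^bsub>\<tau>\<^esub> = \<one>\<^bsub>\<sigma>\<^esub> \<longrightarrow>
        (\<forall>A \<in> carrier (H1_sing (realization C) \<tau>).
           H1_pull C (sing (realization C)) \<sigma> (realization_unit C)
             (H1_push (sing (realization C)) \<tau> \<sigma> h A) =
           H1_push C \<tau> \<sigma> h (H1_pull C (sing (realization C)) \<tau> (realization_unit C) A)))"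
proof (intro conjI allI impI ballI; (elim conjE)?)
  show "comm_monoid (H1_sing (realization C) \<tau>)"
    unfolding H1_sing_def by (rule comm_monoid_H1[OF cubical_set_sing \<tau>])
  show "comm_monoid (H1 C \<tau>)" by (rule comm_monoid_H1[OF C \<tau>])
  show "H1_pull C (sing (realization C)) \<tau> (realization_unit C) \<in> iso (H1_sing (realization C) \<tau>) (H1 C \<tau>)"
    by (rule H1_unit_iso[OF C \<tau>])
next
  fix D :: "'d cubical" and f A
  assume "cubical_set D" "f \<in> cubical_hom C D" "A \<in> carrier (H1_sing (realization D) \<tau>)"
  then show "H1_pull C (sing (realization C)) \<tau> (realization_unit C)
      (H1_pull (sing (realization C)) (sing (realization D)) \<tau>
        (sing_map (realization C) (realization_map C D f)) A) =
    H1_pull C D \<tau> f (H1_pull D (sing (realization D)) \<tau> (realization_unit D) A)"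
    by (intro H1_unit_natural[OF C _ \<tau>])
next
  fix \<sigma> :: "('s, 'k) monoid_scheme" and h A
  assume "comm_monoid \<sigma>" "h \<in> hom \<tau> \<sigma>" "h \<one>\<^bsub>\<tau>\<^esub> = \<one>\<^bsub>\<sigma>\<^esub>"
    "A \<in> carrier (H1_sing (realization C) \<tau>)"
  then show "H1_pull C (sing (realization C)) \<sigma> (realization_unit C)
      (H1_push (sing (realization C)) \<tau> \<sigma> h A) =
    H1_push C \<tau> \<sigma> h (H1_pull C (sing (realization C)) \<tau> (realization_unit C) A)"
    unfolding H1_sing_def
    by (intro H1_pull_push[OF C cubical_set_sing \<tau> _ _ _ realization_unit_hom[OF C]])
qed

end
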